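(* Let $N\ge3$ and let $V:\mathbb{R}^N\to\mathbb{R}$ satisfy: $V=V_1+V_2$ and $W(x):=V(x)|x|=W_1(x)+W_2(x)$, with $V_1\in L^{N/2}(\mathbb{R}^N)$, $W_1\in L^{N}(\mathbb{R}^N)$, $V_2,W_2\in L^\infty(\mathbb{R}^N)$, $|V_2(x)|+|W_2(x)|\to 0$ as $|x|\to\infty$, and $$\inf\Big\{\int_{\mathbb{R}^N}(|\nabla\varphi|^2+V\varphi^2)\,dx:\ \varphi\in H^1(\mathbb{R}^N),\ \int_{\mathbb{R}^N}\varphi^2\,dx=1\Big\}<0.$$ Then there exists $\rho^*>0$ such that, if $0<\rho<\rho^*$, the problem $$-\Delta U+V(x)U=\lambda U+|U|^{2^*-2}U\ \text{ in }\mathbb{R}^N,\qquad \int_{\mathbb{R}^N}U^2\,dx=\rho^2,$$ has a solution $(U,\lambda)\in H^1(\mathbb{R}^N)\times\mathbb{R}$ such that $U$ is a local minimizer of $E$ on $\mathcal{M}_\rho$, with $E(U)<0$ and $\lambda<0$, and $U$ can be chosen to be strictly positive almost everywhere in $\mathbb{R}^N$. Moreover, for a possibly smaller threshold $\rho^*>0$, such local minimizer is a normalized ground state.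
   Context: $2^*:=\frac{2N}{N-2}$. The energy $E:H^1(\mathbb{R}^N)\to\mathbb{R}$ is $$E(U)=\frac12\int_{\mathbb{R}^N}|\nabla U|^2dx+\frac12\int_{\mathbb{R}^N}V(x)U^2dx-\frac1{2^*}\int_{\mathbb{R}^N}|U|^{2^*}dx,$$ and $\mathcal{M}_\rho=\{U\in H^1(\mathbb{R}^N):\int_{\mathbb{R}^N}U^2\,dx=\rho^2\}$. Solutions are understood in the weak sense; they correspond to critical points of $E$ constrained to $\mathcal{M}_\rho$, with $\lambda$ the Lagrange multiplier. A normalized ground state is a critical point $U_0$ of $E$ constrained to $\mathcal{M}_\rho$ such that $E(U_0)=\inf\{E(U):U\in\mathcal{M}_\rho,\ \nabla_{\mathcal{M}_\rho}E(U)=0\}$. *)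

theory Defs
  imports "HOL-Analysis.Analysis"
begin

text \<open>
  Elements of Lebesgue and Sobolev spaces are represented by functions rather than by classes of
  almost everywhere equal functions. All integrals are taken over \<^term>\<open>lebesgue\<close>, the completed
  measure, so that representatives need only be Lebesgue measurable.
\<close>

definition Lp :: "real \<Rightarrow> (real^'n::finite \<Rightarrow> real) set" where
  "Lp p = {f \<in> borel_measurable lebesgue. integrable lebesgue (\<lambda>x. \<bar>f x\<bar> powr p)}"

definition Linf :: "(real^'n::finite \<Rightarrow> real) set" where
  "Linf = {f \<in> borel_measurable lebesgue. \<exists>C. AE x in lebesgue. \<bar>f x\<bar> \<le> C}"

definition L2_vec :: "(real^'n::finite \<Rightarrow> real^'n) set" where
  "L2_vec = {g \<in> borel_measurable lebesgue. integrable lebesgue (\<lambda>x. (norm (g x))\<^sup>2)}"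

definition partial :: "'n::finite \<Rightarrow> (real^'n \<Rightarrow> real) \<Rightarrow> real^'n \<Rightarrow> real" where
  "partial i f x = frechet_derivative f (at x) (axis i 1)"

primrec Ck :: "nat \<Rightarrow> (real^'n::finite \<Rightarrow> real) \<Rightarrow> bool" where
  "Ck 0 f \<longleftrightarrow> continuous_on UNIV f"
| "Ck (Suc k) f \<longleftrightarrow> (\<forall>x. f differentiable (at x)) \<and> (\<forall>i. Ck k (partial i f))"

definition test_fun :: "(real^'n::finite \<Rightarrow> real) set" where
  "test_fun = {\<phi>. (\<forall>k. Ck k \<phi>) \<and> compact (closure {x. \<phi> x \<noteq> 0})}"

definition has_weak_grad :: "(real^'n::finite \<Rightarrow> real) \<Rightarrow> (real^'n \<Rightarrow> real^'n) \<Rightarrow> bool" where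
  "has_weak_grad u g \<longleftrightarrow> g \<in> L2_vec \<and>
     (\<forall>\<phi>\<in>test_fun. \<forall>i.
        (\<integral>x. u x * partial i \<phi> x \<partial>lebesgue) = - (\<integral>x. g x $ i * \<phi> x \<partial>lebesgue))"

definition H1 :: "(real^'n::finite \<Rightarrow> real) set" where
  "H1 = {u. u \<in> Lp 2 \<and> (\<exists>g. has_weak_grad u g)}"

text \<open>For \<^prop>\<open>u \<in> H1\<close> the weak gradient is determined up to a null set; one is chosen.\<close>

definition weak_grad :: "(real^'n::finite \<Rightarrow> real) \<Rightarrow> real^'n \<Rightarrow> real^'n" where
  "weak_grad u = (SOME g. has_weak_grad u g)"

definition H1_norm :: "(real^'n::finite \<Rightarrow> real) \<Rightarrow> real" where
  "H1_norm u = sqrt ((\<integral>x. (norm (weak_grad u x))\<^sup>2 \<partial>lebesgue) + (\<integral>x. (u x)\<^sup>2 \<partial>lebesgue))"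

text \<open>The critical Sobolev exponent, with the dimension given by the index type.\<close>

definition crit_exp :: "'n::finite itself \<Rightarrow> real" where
  "crit_exp _ = 2 * real CARD('n) / (real CARD('n) - 2)"

definition energy :: "(real^'n::finite \<Rightarrow> real) \<Rightarrow> (real^'n \<Rightarrow> real) \<Rightarrow> real" where
  "energy V U =
     1/2 * (\<integral>x. (norm (weak_grad U x))\<^sup>2 \<partial>lebesgue)
   + 1/2 * (\<integral>x. V x * (U x)\<^sup>2 \<partial>lebesgue)
   - 1 / crit_exp TYPE('n) * (\<integral>x. \<bar>U x\<bar> powr crit_exp TYPE('n) \<partial>lebesgue)"

definition mass_sphere :: "real \<Rightarrow> (real^'n::finite \<Rightarrow> real) set" where
  "mass_sphere \<rho> = {U \<in> H1. (\<integral>x. (U x)\<^sup>2 \<partial>lebesgue) = \<rho>\<^sup>2}"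

definition weak_solution ::
    "(real^'n::finite \<Rightarrow> real) \<Rightarrow> (real^'n \<Rightarrow> real) \<Rightarrow> real \<Rightarrow> bool" where
  "weak_solution V U \<mu> \<longleftrightarrow> U \<in> H1 \<and>
     (\<forall>\<phi>\<in>H1.
        (\<integral>x. weak_grad U x \<bullet> weak_grad \<phi> x \<partial>lebesgue) + (\<integral>x. V x * U x * \<phi> x \<partial>lebesgue)
      = \<mu> * (\<integral>x. U x * \<phi> x \<partial>lebesgue)
        + (\<integral>x. \<bar>U x\<bar> powr (crit_exp TYPE('n) - 2) * U x * \<phi> x \<partial>lebesgue))"

definition local_minimizer ::
    "(real^'n::finite \<Rightarrow> real) \<Rightarrow> real \<Rightarrow> (real^'n \<Rightarrow> real) \<Rightarrow> bool" where
  "local_minimizer V \<rho> U \<longleftrightarrow> U \<in> mass_sphere \<rho> \<and>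
     (\<exists>\<delta>>0. \<forall>W\<in>mass_sphere \<rho>. H1_norm (\<lambda>x. W x - U x) < \<delta> \<longrightarrow> energy V U \<le> energy V W)"

text \<open>Frechet differentiability on \<^const>\<open>H1\<close>; the values of \<open>L\<close> outside \<^const>\<open>H1\<close> are irrelevant.\<close>

definition has_H1_derivative ::
    "((real^'n::finite \<Rightarrow> real) \<Rightarrow> real) \<Rightarrow> ((real^'n \<Rightarrow> real) \<Rightarrow> real) \<Rightarrow> (real^'n \<Rightarrow> real) \<Rightarrow> bool"
  where
  "has_H1_derivative F L u \<longleftrightarrow>
     (\<forall>v\<in>H1. \<forall>w\<in>H1. \<forall>a b. L (\<lambda>x. a * v x + b * w x) = a * L v + b * L w) \<and>
     (\<exists>C. \<forall>v\<in>H1. \<bar>L v\<bar> \<le> C * H1_norm v) \<and>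
     (\<forall>\<epsilon>>0. \<exists>\<delta>>0. \<forall>h\<in>H1. H1_norm h < \<delta> \<longrightarrow>
        \<bar>F (\<lambda>x. u x + h x) - F u - L h\<bar> \<le> \<epsilon> * H1_norm h)"

text \<open>
  The constrained gradient at \<open>U\<close> vanishes iff the derivative of the energy vanishes on the tangent
  space of the constraint, i.e. on the elements of \<^const>\<open>H1\<close> that are \<open>L\<^sup>2\<close>-orthogonal to \<open>U\<close>.
\<close>

definition constrained_critical ::
    "(real^'n::finite \<Rightarrow> real) \<Rightarrow> real \<Rightarrow> (real^'n \<Rightarrow> real) \<Rightarrow> bool" where
  "constrained_critical V \<rho> U \<longleftrightarrow> U \<in> mass_sphere \<rho> \<and>
     (\<exists>L. has_H1_derivative (energy V) L U \<and>
          (\<forall>v\<in>H1. (\<integral>x. U x * v x \<partial>lebesgue) = 0 \<longrightarrow> L v = 0))"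

text \<open>The infimum is taken in the extended reals, so that it has its usual meaning for any set.\<close>

definition normalized_ground_state ::
    "(real^'n::finite \<Rightarrow> real) \<Rightarrow> real \<Rightarrow> (real^'n \<Rightarrow> real) \<Rightarrow> bool" where
  "normalized_ground_state V \<rho> U \<longleftrightarrow> constrained_critical V \<rho> U \<and>
     ereal (energy V U) = (INF W\<in>{W. constrained_critical V \<rho> W}. ereal (energy V W))"

end

theory Submission
  imports Defs "HOL-Library.Diagonal_Subsequence"
begin

text \<open>
  Compactness enters only through quadratic forms: \<open>V\<close>, \<open>(V |x|)\<^sup>2\<close> and \<open>|U|\<^bsup>2*-2\<^esup>\<close> are form-compact relative
  to \<open>H\<^sup>1\<close>. On a ball \<open>|\<nabla>U| \<le> r\<close> with \<open>r\<close> small the Dirichlet part plus the critical term is uniformly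
  convex, so midpoints of a minimizing sequence on the mass sphere show that it is Cauchy; negative energy
  forces \<open>|\<nabla>U| < r\<close>, so the minimizer is interior, and \<open>|U|\<close> is positive by a logarithmic gradient estimate.
  For a critical point \<open>W\<close> of negative energy, \<open>\<lambda> < 0\<close> and form-compactness give
  \<open>E(W\<^sub>t) \<ge> E(W) - C(t - 1)\<^sup>2\<close> for \<open>W\<^sub>t(x) = t\<^bsup>N/2\<^esup> W(t x)\<close>, \<open>t > 1\<close>; dividing by \<open>t - 1\<close> yields half of the
  Pohozaev identity, which bounds \<open>|\<nabla>W|\<close> by a multiple of \<open>\<rho>\<close> and places \<open>W\<close> in the ball.
\<close>

section \<open>Square integrable functions\<close>

text \<open>The obstacle is the critical exponent \<open>p\<close>: the embedding of H1 into L^p is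
  not compact, so a minimizing sequence may concentrate. The weight |U|^(p-2) is form-compact only
  for a fixed U; uniformity along a sequence has to come from small gradients. Hence the
  minimization is confined to a ball, and the sequence is shown to be Cauchy without naming a weak
  limit. For the ground state the difficulty is a critical point W with large gradient. The test
  direction of the Pohozaev identity, x . grad W + (N/2) W, need not lie in H1, so finite dilations
  replace it. Dilation keeps the mass, so the first-order term of the energy equals -\<lambda>/2
  times the squared L2 distance of the dilate from W. Together with the gradient term it absorbs the
  potential and the critical remainder up to a local L2 norm, which is O(t - 1). Comparing for t > 1
  suffices, because only an upper bound of the critical integral by the gradient is wanted. The
  product V(x) |x| appears because W(t x) - W(x) is |x| times a function of L2 norm at most (t - 1)
  |grad W|.\<close>

definition sq_int :: "'a measure \<Rightarrow> ('a \<Rightarrow> 'b::euclidean_space) \<Rightarrow> bool" where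
  "sq_int M f \<longleftrightarrow> f \<in> borel_measurable M \<and> integrable M (\<lambda>x. (norm (f x))\<^sup>2)"

definition nrm2 :: "'a measure \<Rightarrow> ('a \<Rightarrow> 'b::euclidean_space) \<Rightarrow> real" where
  "nrm2 M f = sqrt (\<integral>x. (norm (f x))\<^sup>2 \<partial>M)"

lemma nrm2_power2: "(nrm2 M f)\<^sup>2 = (\<integral>x. (norm (f x))\<^sup>2 \<partial>M)"
  unfolding nrm2_def by (simp add: Bochner_Integration.integral_nonneg)

lemma nrm2_nonneg [simp]: "0 \<le> nrm2 M f"
  unfolding nrm2_def by (simp add: Bochner_Integration.integral_nonneg)

lemma sq_int_measurable [measurable_dest]: "sq_int M f \<Longrightarrow> f \<in> borel_measurable M"
  by (simp add: sq_int_def)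

lemma sq_int_integrable: "sq_int M f \<Longrightarrow> integrable M (\<lambda>x. (norm (f x))\<^sup>2)"
  by (simp add: sq_int_def)

lemma sq_int_real: "sq_int M f \<Longrightarrow> integrable M (\<lambda>x. (f x :: real)\<^sup>2)"
  by (simp add: sq_int_def)

lemma sq_int_bound:
  assumes "sq_int M f" and "g \<in> borel_measurable M"
    and "AE x in M. norm (g x) \<le> C * norm (f x)"
  shows "sq_int M g"
proof -
  have "integrable M (\<lambda>x. C\<^sup>2 * (norm (f x))\<^sup>2)"
    using assms(1) by (simp add: sq_int_def)
  then have "integrable M (\<lambda>x. (norm (g x))\<^sup>2)"
  proof (rule Bochner_Integration.integrable_bound)
    show "(\<lambda>x. (norm (g x))\<^sup>2) \<in> borel_measurable M"
      using assms(2) by measurable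
    show "AE x in M. norm ((norm (g x))\<^sup>2) \<le> norm (C\<^sup>2 * (norm (f x))\<^sup>2)"
      using assms(3) 
    proof eventually_elim
      case (elim x)
      then have "(norm (g x))\<^sup>2 \<le> (C * norm (f x))\<^sup>2"
        by (intro power_mono) auto
      then show ?case by (simp add: power_mult_distrib)
    qed
  qed
  then show ?thesis using assms(2) by (simp add: sq_int_def)
qed

lemma sq_int_zero [simp]: "sq_int M (\<lambda>x. 0)"
  by (simp add: sq_int_def)

lemma norm_add_sq_le: "(norm (a + b))\<^sup>2 \<le> 2 * (norm a)\<^sup>2 + 2 * (norm (b::'a::real_inner))\<^sup>2"
proof -
  have "(norm (a + b))\<^sup>2 + (norm (a - b))\<^sup>2 = 2 * (norm a)\<^sup>2 + 2 * (norm b)\<^sup>2"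
    by (simp add: power2_norm_eq_inner algebra_simps inner_commute)
  then show ?thesis using zero_le_power2[of "norm (a - b)"] by linarith
qed

lemma sq_int_add [intro]:
  assumes "sq_int M f" "sq_int M g" shows "sq_int M (\<lambda>x. f x + g x)"
proof -
  have [measurable]: "f \<in> borel_measurable M" "g \<in> borel_measurable M"
    using assms by (auto simp: sq_int_def)
  have "integrable M (\<lambda>x. 2 * (norm (f x))\<^sup>2 + 2 * (norm (g x))\<^sup>2)"
    using assms by (simp add: sq_int_def)
  then have "integrable M (\<lambda>x. (norm (f x + g x))\<^sup>2)"
    by (rule Bochner_Integration.integrable_bound) (auto simp: norm_add_sq_le)
  then show ?thesis by (simp add: sq_int_def)
qed

lemma sq_int_scaleR [intro]: "sq_int M f \<Longrightarrow> sq_int M (\<lambda>x. c *\<^sub>R f x)"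
  by (rule sq_int_bound[where C="\<bar>c\<bar>"]) auto

lemma sq_int_cmult [intro]: "sq_int M f \<Longrightarrow> sq_int M (\<lambda>x. c * (f x :: real))"
  using sq_int_scaleR[of M f c] by simp

lemma sq_int_uminus [intro]: "sq_int M f \<Longrightarrow> sq_int M (\<lambda>x. - f x)"
  using sq_int_scaleR[of M f "-1"] by simp

lemma sq_int_diff [intro]: "sq_int M f \<Longrightarrow> sq_int M g \<Longrightarrow> sq_int M (\<lambda>x. f x - g x)"
  using sq_int_add[of M f "\<lambda>x. - g x"] by auto

lemma sq_int_abs: "sq_int M f \<Longrightarrow> sq_int M (\<lambda>x. \<bar>f x :: real\<bar>)"
  by (rule sq_int_bound[where C=1]) auto

lemma measurable_vec_nth [measurable (raw)]: 
  "f \<in> borel_measurable M \<Longrightarrow> (\<lambda>x. (f x :: real^'n::finite) $ i) \<in> borel_measurable M"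
  by (simp add: cart_eq_inner_axis)

lemma sq_int_component: "sq_int M (f :: 'a \<Rightarrow> real^'n::finite) \<Longrightarrow> sq_int M (\<lambda>x. f x $ i)"
  by (rule sq_int_bound[where C=1 and f=f]) (auto simp: component_le_norm_cart)

lemma sq_int_integrable_mult:
  assumes "sq_int M f" "sq_int M g"
  shows "integrable M (\<lambda>x. norm (f x) * norm (g x))"
proof -
  have [measurable]: "f \<in> borel_measurable M" "g \<in> borel_measurable M"
    using assms by (auto simp: sq_int_def)
  have "integrable M (\<lambda>x. (norm (f x))\<^sup>2 + (norm (g x))\<^sup>2)"
    using assms by (simp add: sq_int_def)
  then show ?thesis
  proof (rule Bochner_Integration.integrable_bound, goal_cases)
    case 2
    have "norm (norm (f x) * norm (g x)) \<le> norm ((norm (f x))\<^sup>2 + (norm (g x))\<^sup>2)" for x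
      using sum_squares_bound[of "norm (f x)" "norm (g x)"] mult_nonneg_nonneg[of "norm (f x)" "norm (g x)", OF norm_ge_zero norm_ge_zero]
      unfolding real_norm_def mult.assoc by linarith
    then show ?case by auto
  qed simp
qed

lemma sq_int_inner: 
  assumes "sq_int M f" "sq_int M g"
  shows "integrable M (\<lambda>x. f x \<bullet> g x)"
proof -
  have [measurable]: "f \<in> borel_measurable M" "g \<in> borel_measurable M"
    using assms by (auto simp: sq_int_def)
  show ?thesis
    by (rule Bochner_Integration.integrable_bound[OF sq_int_integrable_mult[OF assms]])
       (auto simp: Cauchy_Schwarz_ineq2)
qed

lemma sq_int_mult: 
  assumes "sq_int M f" "sq_int M (g :: 'a \<Rightarrow> real)"
  shows "integrable M (\<lambda>x. f x * g x)"
  using sq_int_inner[OF assms] by (simp add: mult.commute)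

lemma integral_norm_mult_le:
  assumes "sq_int M f" "sq_int M g"
  shows "(\<integral>x. norm (f x) * norm (g x) \<partial>M) \<le> nrm2 M f * nrm2 M g"
proof -
  have [measurable]: "f \<in> borel_measurable M" "g \<in> borel_measurable M"
    using assms by (auto simp: sq_int_def)
  have "(\<integral>\<^sup>+x. ennreal (norm (f x)) * ennreal (norm (g x)) \<partial>M)\<^sup>2 
      \<le> (\<integral>\<^sup>+x. (ennreal (norm (f x)))\<^sup>2 \<partial>M) * (\<integral>\<^sup>+x. (ennreal (norm (g x)))\<^sup>2 \<partial>M)"
    by (rule Cauchy_Schwarz_nn_integral) auto
  then have "(\<integral>\<^sup>+x. ennreal (norm (f x) * norm (g x)) \<partial>M)\<^sup>2 
      \<le> (\<integral>\<^sup>+x. ennreal ((norm (f x))\<^sup>2) \<partial>M) * (\<integral>\<^sup>+x. ennreal ((norm (g x))\<^sup>2) \<partial>M)"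
    by (simp add: ennreal_mult ennreal_power)
  also have "(\<integral>\<^sup>+x. ennreal (norm (f x) * norm (g x)) \<partial>M) = ennreal (\<integral>x. norm (f x) * norm (g x) \<partial>M)"
    using sq_int_integrable_mult[OF assms] by (intro nn_integral_eq_integral) auto
  also have "(\<integral>\<^sup>+x. ennreal ((norm (f x))\<^sup>2) \<partial>M) = ennreal ((nrm2 M f)\<^sup>2)"
    unfolding nrm2_power2 using assms by (intro nn_integral_eq_integral) (auto simp: sq_int_def)
  also have "(\<integral>\<^sup>+x. ennreal ((norm (g x))\<^sup>2) \<partial>M) = ennreal ((nrm2 M g)\<^sup>2)"
    unfolding nrm2_power2 using assms by (intro nn_integral_eq_integral) (auto simp: sq_int_def)
  finally have "(\<integral>x. norm (f x) * norm (g x) \<partial>M)\<^sup>2 \<le> (nrm2 M f * nrm2 M g)\<^sup>2"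
    by (simp add: ennreal_power Bochner_Integration.integral_nonneg power_mult_distrib flip: ennreal_mult)
  then show ?thesis by (rule power2_le_imp_le) simp
qed

lemma integral_inner_le:
  assumes "sq_int M f" "sq_int M g"
  shows "\<bar>\<integral>x. f x \<bullet> g x \<partial>M\<bar> \<le> nrm2 M f * nrm2 M g"
proof -
  have "\<bar>\<integral>x. f x \<bullet> g x \<partial>M\<bar> \<le> (\<integral>x. \<bar>f x \<bullet> g x\<bar> \<partial>M)"
    using integral_norm_bound[of M "\<lambda>x. f x \<bullet> g x"] by simp
  also have "\<dots> \<le> (\<integral>x. norm (f x) * norm (g x) \<partial>M)"
    using sq_int_inner[OF assms] sq_int_integrable_mult[OF assms]
    by (intro integral_mono) (auto simp: Cauchy_Schwarz_ineq2)
  also have "\<dots> \<le> nrm2 M f * nrm2 M g" by (rule integral_norm_mult_le[OF assms])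
  finally show ?thesis .
qed

lemma integral_mult_le:
  assumes "sq_int M f" "sq_int M (g :: 'a \<Rightarrow> real)"
  shows "\<bar>\<integral>x. f x * g x \<partial>M\<bar> \<le> nrm2 M f * nrm2 M g"
  using integral_inner_le[OF assms] by (simp add: mult.commute)

lemma nrm2_add_power2:
  assumes "sq_int M f" "sq_int M g"
  shows "(nrm2 M (\<lambda>x. f x + g x))\<^sup>2 = (nrm2 M f)\<^sup>2 + 2 * (\<integral>x. f x \<bullet> g x \<partial>M) + (nrm2 M g)\<^sup>2"
proof -
  have "(\<integral>x. (norm (f x + g x))\<^sup>2 \<partial>M) 
      = (\<integral>x. (norm (f x))\<^sup>2 + 2 * (f x \<bullet> g x) + (norm (g x))\<^sup>2 \<partial>M)"
    by (rule Bochner_Integration.integral_cong) 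
       (auto simp: power2_norm_eq_inner algebra_simps inner_commute)
  also have "\<dots> = (\<integral>x. (norm (f x))\<^sup>2 \<partial>M) + 2 * (\<integral>x. f x \<bullet> g x \<partial>M) + (\<integral>x. (norm (g x))\<^sup>2 \<partial>M)"
    using sq_int_integrable[OF assms(1)] sq_int_integrable[OF assms(2)] sq_int_inner[OF assms] by simp
  finally show ?thesis by (simp add: nrm2_power2)
qed

lemma nrm2_scaleR: "nrm2 M (\<lambda>x. c *\<^sub>R f x) = \<bar>c\<bar> * nrm2 M f"
  by (simp add: nrm2_def power_mult_distrib real_sqrt_mult)

lemma nrm2_cmult: "nrm2 M (\<lambda>x. c * (f x::real)) = \<bar>c\<bar> * nrm2 M f"
  using nrm2_scaleR[of M c f] by simp

lemma nrm2_uminus: "nrm2 M (\<lambda>x. - f x) = nrm2 M f"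
  by (simp add: nrm2_def)

lemma nrm2_minus_commute: "nrm2 M (\<lambda>x. f x - g x) = nrm2 M (\<lambda>x. g x - f x)"
  by (simp add: nrm2_def norm_minus_commute)

lemma nrm2_triangle:
  assumes "sq_int M f" "sq_int M g"
  shows "nrm2 M (\<lambda>x. f x + g x) \<le> nrm2 M f + nrm2 M g"
proof (rule power2_le_imp_le)
  show "(nrm2 M (\<lambda>x. f x + g x))\<^sup>2 \<le> (nrm2 M f + nrm2 M g)\<^sup>2"
    using integral_inner_le[OF assms] nrm2_add_power2[OF assms] by (simp add: power2_sum)
qed simp

lemma nrm2_triangle_diff:
  assumes "sq_int M f" "sq_int M g"
  shows "nrm2 M (\<lambda>x. f x - g x) \<le> nrm2 M f + nrm2 M g"
  using nrm2_triangle[OF assms(1) sq_int_uminus[OF assms(2)]] by (simp add: nrm2_uminus)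

lemma nrm2_diff_le:
  assumes "sq_int M f" "sq_int M g"
  shows "\<bar>nrm2 M f - nrm2 M g\<bar> \<le> nrm2 M (\<lambda>x. f x - g x)"
proof -
  have "nrm2 M f \<le> nrm2 M (\<lambda>x. f x - g x) + nrm2 M g"
    using nrm2_triangle[OF sq_int_diff[OF assms] assms(2)] by simp
  moreover have "nrm2 M g \<le> nrm2 M (\<lambda>x. f x - g x) + nrm2 M f"
    using nrm2_triangle[OF sq_int_diff[OF assms(2,1)] assms(1)] nrm2_minus_commute[of M f g] by simp
  ultimately show ?thesis by linarith
qed

lemma nrm2_mono:
  assumes "sq_int M g" "AE x in M. norm (f x) \<le> norm (g x)"
  shows "nrm2 M f \<le> nrm2 M g"
  unfolding nrm2_def 
proof (rule real_sqrt_le_mono, cases "integrable M (\<lambda>x. (norm (f x))\<^sup>2)")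
  case True
  then show "(\<integral>x. (norm (f x))\<^sup>2 \<partial>M) \<le> (\<integral>x. (norm (g x))\<^sup>2 \<partial>M)"
    using assms by (intro integral_mono_AE) (auto simp: sq_int_def elim!: eventually_mono intro: power_mono)
next
  \<comment> \<open>The Bochner integral of a non-integrable function is 0, so the inequality holds
    by default.\<close>
  case False
  then show "(\<integral>x. (norm (f x))\<^sup>2 \<partial>M) \<le> (\<integral>x. (norm (g x))\<^sup>2 \<partial>M)"
    by (simp add: not_integrable_integral_eq Bochner_Integration.integral_nonneg)
qed

lemma nrm2_cong_AE:
  assumes "f \<in> borel_measurable M" "g \<in> borel_measurable M" "AE x in M. f x = g x"
  shows "nrm2 M f = nrm2 M g"
proof -
  have "(\<integral>x. (norm (f x))\<^sup>2 \<partial>M) = (\<integral>x. (norm (g x))\<^sup>2 \<partial>M)"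
    using assms by (intro integral_cong_AE) auto
  then show ?thesis by (simp add: nrm2_def)
qed

lemma sq_int_cong_AE:
  assumes "sq_int M f" "g \<in> borel_measurable M" "AE x in M. f x = g x"
  shows "sq_int M g"
  by (rule sq_int_bound[OF assms(1,2), where C=1]) (use assms(3) in \<open>auto elim!: eventually_mono\<close>)

lemma nrm2_zero_imp_AE:
  assumes "sq_int M f" "nrm2 M f = 0"
  shows "AE x in M. f x = 0"
proof -
  have "(\<integral>x. (norm (f x))\<^sup>2 \<partial>M) = 0" using assms(2) nrm2_power2[of M f] by simp
  then have "AE x in M. (norm (f x))\<^sup>2 = 0"
    using integral_nonneg_eq_0_iff_AE[OF sq_int_integrable[OF assms(1)]] by auto
  then show ?thesis by auto
qed

lemma nn_integral_sq_int:
  "sq_int M f \<Longrightarrow> (\<integral>\<^sup>+x. ennreal ((norm (f x))\<^sup>2) \<partial>M) = ennreal ((nrm2 M f)\<^sup>2)"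
  unfolding nrm2_power2 by (intro nn_integral_eq_integral) (auto simp: sq_int_def)

lemma nn_integral_bound_integrable:
  fixes f :: "'a \<Rightarrow> real"
  assumes "f \<in> borel_measurable M" "\<And>x. 0 \<le> f x" "(\<integral>\<^sup>+x. ennreal (f x) \<partial>M) \<le> ennreal C" "0 \<le> C"
  shows "integrable M f" "(\<integral>x. f x \<partial>M) \<le> C"
proof -
  show "integrable M f"
    by (rule integrableI_bounded)
       (use assms in \<open>auto simp: top_unique intro: le_less_trans[OF assms(3)]\<close>)
  then have "ennreal (\<integral>x. f x \<partial>M) \<le> ennreal C"
    using assms by (subst (asm) nn_integral_eq_integral) auto
  then show "(\<integral>x. f x \<partial>M) \<le> C" using assms(4) by simp
qed

lemma nn_integral_sq_le_imp:
  assumes "f \<in> borel_measurable M" "(\<integral>\<^sup>+x. ennreal ((norm (f x))\<^sup>2) \<partial>M) \<le> ennreal (C\<^sup>2)" "0 \<le> C"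
  shows "sq_int M f" "nrm2 M f \<le> C"
proof -
  note * = nn_integral_bound_integrable[where f="\<lambda>x. (norm (f x))\<^sup>2", OF _ _ assms(2)]
  show "sq_int M f" using assms *(1) by (auto simp: sq_int_def)
  have "(nrm2 M f)\<^sup>2 \<le> C\<^sup>2" unfolding nrm2_power2 using assms * by auto
  then show "nrm2 M f \<le> C" using assms(3) by (rule power2_le_imp_le)
qed

text \<open>Carries an inequality from smooth approximations to their almost everywhere limit. The
  bounds \<open>c k\<close> may vary with \<open>k\<close>, so the limit inherits the sharp constant
  \<open>C\<close> instead of a supremum.\<close>

lemma nn_integral_Fatou:
  fixes f :: "nat \<Rightarrow> 'a \<Rightarrow> real"
  assumes "\<And>k. f k \<in> borel_measurable M" "g \<in> borel_measurable M"
    and "AE x in M. (\<lambda>k. f k x) \<longlonglongrightarrow> g x"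
    and "\<And>k. (\<integral>\<^sup>+x. ennreal (f k x) \<partial>M) \<le> ennreal (c k)" "c \<longlonglongrightarrow> C"
  shows "(\<integral>\<^sup>+x. ennreal (g x) \<partial>M) \<le> ennreal C"
proof -
  have "(\<integral>\<^sup>+x. ennreal (g x) \<partial>M) = (\<integral>\<^sup>+x. liminf (\<lambda>k. ennreal (f k x)) \<partial>M)"
  proof (rule nn_integral_cong_AE)
    show "AE x in M. ennreal (g x) = liminf (\<lambda>k. ennreal (f k x))"
      using assms(3)
    proof eventually_elim
      case (elim x)
      then have "(\<lambda>k. ennreal (f k x)) \<longlonglongrightarrow> ennreal (g x)" by (intro tendsto_intros) auto
      then show ?case using lim_imp_Liminf[of sequentially "\<lambda>k. ennreal (f k x)" "ennreal (g x)"] by simp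
    qed
  qed
  also have "\<dots> \<le> liminf (\<lambda>k. \<integral>\<^sup>+x. ennreal (f k x) \<partial>M)"
    using assms(1) by (intro nn_integral_liminf) auto
  also have "\<dots> \<le> liminf (\<lambda>k. ennreal (c k))"
    using assms(4) by (intro Liminf_mono) auto
  also have "\<dots> = ennreal C"
    using assms(5) by (intro lim_imp_Liminf tendsto_intros) auto
  finally show ?thesis .
qed

lemma nrm2_AE_subseq:
  assumes "\<And>k. sq_int M (f k)" "sq_int M g" "(\<lambda>k. nrm2 M (\<lambda>x. f k x - g x)) \<longlonglongrightarrow> 0"
  shows "\<exists>r::nat\<Rightarrow>nat. strict_mono r \<and> (AE x in M. (\<lambda>k. f (r k) x) \<longlonglongrightarrow> g x)"
proof -
  have "(\<lambda>k. (nrm2 M (\<lambda>x. f k x - g x))\<^sup>2) \<longlonglongrightarrow> 0\<^sup>2"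
    by (intro tendsto_intros assms)
  then have "(\<lambda>k. \<integral>x. norm ((norm (f k x - g x))\<^sup>2) \<partial>M) \<longlonglongrightarrow> 0"
    by (simp add: nrm2_power2)
  moreover have "integrable M (\<lambda>x. (norm (f k x - g x))\<^sup>2)" for k
    using assms by (intro sq_int_integrable sq_int_diff) auto
  ultimately obtain r :: "nat \<Rightarrow> nat" where "strict_mono r" 
    and *: "AE x in M. (\<lambda>k. (norm (f (r k) x - g x))\<^sup>2) \<longlonglongrightarrow> 0"
    using tendsto_L1_AE_subseq[of M "\<lambda>k x. (norm (f k x - g x))\<^sup>2"] by auto
  have "AE x in M. (\<lambda>k. f (r k) x) \<longlonglongrightarrow> g x"
    using *
  proof eventually_elim
    case (elim x)
    then have "(\<lambda>k. sqrt ((norm (f (r k) x - g x))\<^sup>2)) \<longlonglongrightarrow> sqrt 0"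
      by (rule tendsto_real_sqrt)
    then show ?case by (simp add: LIM_zero_iff tendsto_norm_zero_iff)
  qed
  then show ?thesis using \<open>strict_mono r\<close> by auto
qed

lemma nrm2_tendsto:
  assumes "\<And>k. sq_int M (f k)" "sq_int M g" "(\<lambda>k. nrm2 M (\<lambda>x. f k x - g x)) \<longlonglongrightarrow> 0"
  shows "(\<lambda>k. nrm2 M (f k)) \<longlonglongrightarrow> nrm2 M g"
proof -
  have "(\<lambda>k. nrm2 M (f k) - nrm2 M g) \<longlonglongrightarrow> 0"
    by (rule Lim_null_comparison[OF _ assms(3)]) (use nrm2_diff_le[OF assms(1,2)] in auto)
  then show ?thesis by (simp add: LIM_zero_iff)
qed

lemma integral_inner_tendsto:
  assumes "\<And>k. sq_int M (f k)" "sq_int M g" "(\<lambda>k. nrm2 M (\<lambda>x. f k x - g x)) \<longlonglongrightarrow> 0" "sq_int M h"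
  shows "(\<lambda>k. \<integral>x. f k x \<bullet> h x \<partial>M) \<longlonglongrightarrow> (\<integral>x. g x \<bullet> h x \<partial>M)"
proof -
  have "(\<lambda>k. (\<integral>x. f k x \<bullet> h x \<partial>M) - (\<integral>x. g x \<bullet> h x \<partial>M)) \<longlonglongrightarrow> 0"
  proof (rule Lim_null_comparison)
    show "\<forall>\<^sub>F k in sequentially. norm ((\<integral>x. f k x \<bullet> h x \<partial>M) - (\<integral>x. g x \<bullet> h x \<partial>M)) 
        \<le> nrm2 M (\<lambda>x. f k x - g x) * nrm2 M h"
    proof (intro always_eventually allI)
      fix k
      have "(\<integral>x. f k x \<bullet> h x \<partial>M) - (\<integral>x. g x \<bullet> h x \<partial>M) = (\<integral>x. (f k x - g x) \<bullet> h x \<partial>M)"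
        using sq_int_inner[OF assms(1,4)] sq_int_inner[OF assms(2,4)] 
        by (simp add: inner_diff_left)
      then show "norm ((\<integral>x. f k x \<bullet> h x \<partial>M) - (\<integral>x. g x \<bullet> h x \<partial>M)) 
        \<le> nrm2 M (\<lambda>x. f k x - g x) * nrm2 M h"
        using integral_inner_le[OF sq_int_diff[OF assms(1,2)] assms(4)] by simp
    qed
    show "(\<lambda>k. nrm2 M (\<lambda>x. f k x - g x) * nrm2 M h) \<longlonglongrightarrow> 0"
      using tendsto_mult[OF assms(3) tendsto_const] by simp
  qed
  then show ?thesis by (simp add: LIM_zero_iff)
qed

lemma nrm2_dominated:
  assumes "\<And>k. f k \<in> borel_measurable M" "g \<in> borel_measurable M" "sq_int M w"
    and "AE x in M. (\<lambda>k. f k x) \<longlonglongrightarrow> g x"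
    and "\<And>k. AE x in M. norm (f k x) \<le> norm (w x)"
  shows "\<And>k. sq_int M (f k)" "sq_int M g" "(\<lambda>k. nrm2 M (\<lambda>x. f k x - g x)) \<longlonglongrightarrow> 0"
proof -
  show s: "sq_int M (f k)" for k
    by (rule sq_int_bound[OF assms(3,1), where C=1]) (use assms(5) in auto)
  have "AE x in M. \<forall>k. norm (f k x) \<le> norm (w x)"
    using assms(5) by (simp add: AE_all_countable)
  then have g: "AE x in M. norm (g x) \<le> norm (w x)"
    using assms(4) 
  proof eventually_elim
    case (elim x)
    show ?case by (rule Lim_bounded[OF tendsto_norm[OF elim(2)]]) (use elim in auto)
  qed
  then show g': "sq_int M g"
    by (intro sq_int_bound[OF assms(3,2), where C=1]) auto
  have "(\<lambda>k. \<integral>x. (norm (f k x - g x))\<^sup>2 \<partial>M) \<longlonglongrightarrow> (\<integral>x. 0 \<partial>M)"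
  proof (rule integral_dominated_convergence)
    show "integrable M (\<lambda>x. 4 * (norm (w x))\<^sup>2)" using assms(3) by (simp add: sq_int_def)
    show "(\<lambda>x. (norm (f k x - g x))\<^sup>2) \<in> borel_measurable M" for k using assms(1,2) by measurable
    show "AE x in M. (\<lambda>k. (norm (f k x - g x))\<^sup>2) \<longlonglongrightarrow> 0"
      using assms(4)
    proof eventually_elim
      case (elim x)
      then have "(\<lambda>k. (norm (f k x - g x))\<^sup>2) \<longlonglongrightarrow> (norm (g x - g x))\<^sup>2" by (intro tendsto_intros)
      then show ?case by simp
    qed
    show "AE x in M. norm ((norm (f k x - g x))\<^sup>2) \<le> 4 * (norm (w x))\<^sup>2" for k
      using g assms(5)[of k]
    proof eventually_elim
      case (elim x)
      have "norm (f k x - g x) \<le> 2 * norm (w x)"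
        using norm_triangle_ineq4[of "f k x" "g x"] elim by linarith
      then have "(norm (f k x - g x))\<^sup>2 \<le> (2 * norm (w x))\<^sup>2" by (intro power_mono) auto
      then show ?case by (simp add: power_mult_distrib)
    qed
  qed auto
  then have "(\<lambda>k. sqrt (\<integral>x. (norm (f k x - g x))\<^sup>2 \<partial>M)) \<longlonglongrightarrow> sqrt 0"
    by (intro tendsto_real_sqrt) simp
  then show "(\<lambda>k. nrm2 M (\<lambda>x. f k x - g x)) \<longlonglongrightarrow> 0" by (simp add: nrm2_def)
qed

text \<open>Riesz-Fischer. Along a subsequence with steps of norm below 4^-k the series of 4^k
  |step|^2 has integral at most the sum of 4^-k, so almost everywhere the steps are O(2^-k) and the
  subsequence converges pointwise. Fatou then bounds the distance to the limit.\<close>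

lemma sq_int_complete:
  fixes f :: "nat \<Rightarrow> 'a \<Rightarrow> 'b::euclidean_space"
  assumes f: "\<And>k. sq_int M (f k)"
    and Cauchy: "\<And>e. 0 < e \<Longrightarrow> \<exists>N. \<forall>m\<ge>N. \<forall>n\<ge>N. nrm2 M (\<lambda>x. f m x - f n x) < e"
  shows "\<exists>g. sq_int M g \<and> (\<lambda>k. nrm2 M (\<lambda>x. f k x - g x)) \<longlonglongrightarrow> 0"
proof -
  have [measurable]: "f k \<in> borel_measurable M" for k using f by (simp add: sq_int_def)
  have "\<exists>r::nat\<Rightarrow>nat. \<forall>k. (\<forall>m\<ge>r k. \<forall>n\<ge>r k. nrm2 M (\<lambda>x. f m x - f n x) < (1/4)^k) \<and> r k < r (Suc k)"
  proof (rule dependent_nat_choice)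
    show "\<exists>x. \<forall>m\<ge>x. \<forall>n\<ge>x. nrm2 M (\<lambda>x. f m x - f n x) < (1 / 4) ^ 0" using Cauchy[of 1] by simp
    fix x k
    obtain N where "\<forall>m\<ge>N. \<forall>n\<ge>N. nrm2 M (\<lambda>x. f m x - f n x) < (1 / 4) ^ Suc k"
      using Cauchy[of "(1/4)^Suc k"] by auto
    then show "\<exists>y. (\<forall>m\<ge>y. \<forall>n\<ge>y. nrm2 M (\<lambda>x. f m x - f n x) < (1 / 4) ^ Suc k) \<and> x < y"
      by (intro exI[of _ "max N (Suc x)"]) auto
  qed
  then obtain r where r: "\<And>k m n. m \<ge> r k \<Longrightarrow> n \<ge> r k \<Longrightarrow> nrm2 M (\<lambda>x. f m x - f n x) < (1/4)^k"
    and r_Suc: "\<And>k. r k < r (Suc k)" by blast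
  define d where "d k x = norm (f (r (Suc k)) x - f (r k) x)" for k x
  have [measurable]: "d k \<in> borel_measurable M" for k unfolding d_def by measurable
  have "(\<integral>\<^sup>+x. (\<Sum>k. ennreal (4^k * (d k x)\<^sup>2)) \<partial>M) = (\<Sum>k. \<integral>\<^sup>+x. ennreal (4^k * (d k x)\<^sup>2) \<partial>M)"
    by (rule nn_integral_suminf) simp
  also have "\<dots> \<le> (\<Sum>k. ennreal ((1/4)^k))"
  proof (rule suminf_le)
    fix k
    have "(\<integral>\<^sup>+x. ennreal (4^k * (d k x)\<^sup>2) \<partial>M) = 4^k * (\<integral>\<^sup>+x. ennreal ((norm (f (r (Suc k)) x - f (r k) x))\<^sup>2) \<partial>M)"
      by (simp add: nn_integral_cmult d_def ennreal_mult flip: ennreal_power)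
    also have "\<dots> = 4^k * ennreal ((nrm2 M (\<lambda>x. f (r (Suc k)) x - f (r k) x))\<^sup>2)"
      by (subst nn_integral_sq_int) (auto intro: f)
    also have "\<dots> = ennreal (4^k * (nrm2 M (\<lambda>x. f (r (Suc k)) x - f (r k) x))\<^sup>2)"
      by (simp add: ennreal_mult flip: ennreal_power)
    also have "\<dots> \<le> ennreal (4^k * ((1/4)^k)\<^sup>2)"
      using r[of k "r (Suc k)" "r k"] r_Suc[of k]
      by (intro ennreal_leI mult_left_mono power_mono) auto
    also have "(4::real)^k * ((1/4)^k)\<^sup>2 = (1/4)^k"
      by (simp add: power2_eq_square power_one_over)
    finally show "(\<integral>\<^sup>+x. ennreal (4^k * (d k x)\<^sup>2) \<partial>M) \<le> ennreal ((1/4)^k)" .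
  qed auto
  also have "\<dots> = ennreal (\<Sum>k. (1/4)^k)"
    by (intro suminf_ennreal2) (auto intro: summable_geometric)
  finally have "(\<integral>\<^sup>+x. (\<Sum>k. ennreal (4^k * (d k x)\<^sup>2)) \<partial>M) \<noteq> \<infinity>"
    by (auto simp: top_unique)
  then have "AE x in M. (\<Sum>k. ennreal (4^k * (d k x)\<^sup>2)) \<noteq> \<infinity>"
    by (intro nn_integral_PInf_AE) auto
  then have conv: "AE x in M. convergent (\<lambda>k. f (r k) x)"
  proof eventually_elim
    case (elim x)
    then have s: "summable (\<lambda>k. 4^k * (d k x)\<^sup>2)"
      by (intro summable_suminf_not_top) auto
    then have "Bseq (\<lambda>k. 4^k * (d k x)\<^sup>2)"
      by (intro convergent_imp_Bseq) (use summable_LIMSEQ_zero convergentI in blast)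
    then obtain B where B: "B > 0" "\<And>k. 4^k * (d k x)\<^sup>2 \<le> B"
      unfolding Bseq_def by auto
    have le: "d k x \<le> sqrt B * (1/2)^k" for k
    proof -
      have "(4::real)^k = (2^k)\<^sup>2" by (simp add: power2_eq_square flip: power_mult_distrib)
      then have "(2^k * d k x)\<^sup>2 \<le> B" using B(2)[of k] by (simp add: power_mult_distrib)
      then have "2^k * d k x \<le> sqrt B" by (rule real_le_rsqrt)
      then show ?thesis by (simp add: field_simps power_one_over)
    qed
    have "summable (\<lambda>k. f (r (Suc k)) x - f (r k) x)"
    proof (rule summable_comparison_test')
      show "summable (\<lambda>k. sqrt B * (1/2)^k)" by (intro summable_mult summable_geometric) simp
      show "norm (f (r (Suc k)) x - f (r k) x) \<le> sqrt B * (1/2)^k" if "k \<ge> 0" for k 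
        using le[of k] by (simp add: d_def)
    qed
    then have "convergent (\<lambda>n. \<Sum>k<n. f (r (Suc k)) x - f (r k) x)"
      by (simp add: summable_iff_convergent)
    then have "convergent (\<lambda>n. f (r n) x - f (r 0) x)"
      by (simp add: sum_lessThan_telescope[of "\<lambda>k. f (r k) x"])
    then have "convergent (\<lambda>n. (f (r n) x - f (r 0) x) + f (r 0) x)"
      by (intro convergent_add convergent_const)
    then show ?case by simp
  qed
  define g where "g x = lim (\<lambda>k. f (r k) x)" for x
  have g[measurable]: "g \<in> borel_measurable M" unfolding g_def by (rule borel_measurable_lim_metric) simp
  have lim: "AE x in M. (\<lambda>k. f (r k) x) \<longlonglongrightarrow> g x"
    using conv unfolding g_def by (simp add: convergent_LIMSEQ_iff)
  have le: "sq_int M (\<lambda>x. f m x - g x) \<and> nrm2 M (\<lambda>x. f m x - g x) \<le> (1/4)^k" if m: "m \<ge> r k" for m k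
  proof -
    have mono: "r k \<le> r (k + j)" for j
      by (induction j) (auto intro: order_trans less_imp_le[OF r_Suc])
    have "(\<integral>\<^sup>+x. ennreal ((norm (f m x - g x))\<^sup>2) \<partial>M) \<le> ennreal (((1/4)^k)\<^sup>2)"
    proof (rule nn_integral_Fatou[where c="\<lambda>_. ((1/4)^k)\<^sup>2" and f="\<lambda>j x. (norm (f m x - f (r (k + j)) x))\<^sup>2"])
      show "AE x in M. (\<lambda>j. (norm (f m x - f (r (k + j)) x))\<^sup>2) \<longlonglongrightarrow> (norm (f m x - g x))\<^sup>2"
        using lim
      proof eventually_elim
        case (elim x)
        then have "(\<lambda>j. f (r (j + k)) x) \<longlonglongrightarrow> g x" by (rule LIMSEQ_ignore_initial_segment)
        then show ?case by (intro tendsto_intros) (simp add: add.commute)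
      qed
      show "(\<integral>\<^sup>+ x. ennreal ((norm (f m x - f (r (k + j)) x))\<^sup>2) \<partial>M) \<le> ennreal (((1 / 4) ^ k)\<^sup>2)" for j
        using r[OF m mono, of j] by (subst nn_integral_sq_int) (auto intro!: f ennreal_leI power_mono less_imp_le)
    qed auto
    from nn_integral_sq_le_imp[OF _ this] show ?thesis by auto
  qed
  have gs: "sq_int M g"
    using sq_int_diff[OF f conjunct1[OF le[of 0 "r 0"]], of "r 0"] by simp
  have "(\<lambda>k. nrm2 M (\<lambda>x. f k x - g x)) \<longlonglongrightarrow> 0"
  proof (rule LIMSEQ_I)
    fix e :: real assume "0 < e"
    then obtain k where "(1/4)^k < e" using real_arch_pow_inv[of e "1/4"] by auto
    then show "\<exists>no. \<forall>n\<ge>no. norm (nrm2 M (\<lambda>x. f n x - g x) - 0) < e"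
      using le by (intro exI[of _ "r k"]) (auto intro: le_less_trans)
  qed
  then show ?thesis using gs by auto
qed

text \<open>Hoelder's inequality with exponents 1/\<theta> and 1/(1-\<theta>), written for powers of
  two integrable functions. It is the weighted inequality of arithmetic and geometric means applied
  to \<open>f\<close> and \<open>g\<close> divided by their integrals.\<close>

lemma Hoelder_interpolation:
  fixes f g :: "'a \<Rightarrow> real"
  assumes f: "integrable M f" "\<And>x. 0 \<le> f x" and g: "integrable M g" "\<And>x. 0 \<le> g x"
    and \<theta>: "0 < \<theta>" "\<theta> < 1"
  shows "integrable M (\<lambda>x. f x powr \<theta> * g x powr (1 - \<theta>))"
    and "(\<integral>x. f x powr \<theta> * g x powr (1 - \<theta>) \<partial>M) \<le> (\<integral>x. f x \<partial>M) powr \<theta> * (\<integral>x. g x \<partial>M) powr (1 - \<theta>)"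
proof -
  have [measurable]: "f \<in> borel_measurable M" "g \<in> borel_measurable M" using f g by auto
  have young: "a powr \<theta> * b powr (1 - \<theta>) \<le> \<theta> * a + (1 - \<theta>) * b" if "0 \<le> a" "0 \<le> b" for a b
  proof (cases "a = 0 \<or> b = 0")
    case True then show ?thesis using that \<theta> by auto
  next
    case False then show ?thesis using that \<theta> by (intro Youngs_inequality_0) auto
  qed
  show int: "integrable M (\<lambda>x. f x powr \<theta> * g x powr (1 - \<theta>))"
  proof (rule Bochner_Integration.integrable_bound)
    show "integrable M (\<lambda>x. \<theta> * f x + (1 - \<theta>) * g x)" using f g by auto
    show "AE x in M. norm (f x powr \<theta> * g x powr (1 - \<theta>)) \<le> norm (\<theta> * f x + (1 - \<theta>) * g x)"
      using young[OF f(2) g(2)] \<theta> f(2) g(2) by (intro AE_I2) (auto simp: abs_mult)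
  qed simp
  define A where "A = (\<integral>x. f x \<partial>M)"
  define B where "B = (\<integral>x. g x \<partial>M)"
  have AB: "0 \<le> A" "0 \<le> B" unfolding A_def B_def using f g by auto
  have "(\<integral>x. f x powr \<theta> * g x powr (1 - \<theta>) \<partial>M) \<le> A powr \<theta> * B powr (1 - \<theta>)"
  \<comment> \<open>The normalization divides by both integrals. If one of them is 0, its function
    vanishes almost everywhere and so does the product.\<close>
  proof (cases "A = 0 \<or> B = 0")
    case True
    then have "(AE x in M. f x = 0) \<or> (AE x in M. g x = 0)"
      using integral_nonneg_eq_0_iff_AE[OF f(1)] integral_nonneg_eq_0_iff_AE[OF g(1)] f g
      by (auto simp: A_def B_def)
    then have "AE x in M. f x powr \<theta> * g x powr (1 - \<theta>) = 0"
      by auto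
    then have "(\<integral>x. f x powr \<theta> * g x powr (1 - \<theta>) \<partial>M) = 0"
      by (rule integral_eq_zero_AE)
    then show ?thesis using AB by simp
  next
    case False
    then have AB: "0 < A" "0 < B" using AB by auto
    have "(\<integral>x. (f x powr \<theta> * g x powr (1 - \<theta>)) / (A powr \<theta> * B powr (1 - \<theta>)) \<partial>M)
       \<le> (\<integral>x. \<theta> * (f x / A) + (1 - \<theta>) * (g x / B) \<partial>M)"
    proof (rule integral_mono)
      show "f x powr \<theta> * g x powr (1 - \<theta>) / (A powr \<theta> * B powr (1 - \<theta>)) \<le> \<theta> * (f x / A) + (1 - \<theta>) * (g x / B)" for x
        using young[of "f x / A" "g x / B"] f(2)[of x] g(2)[of x] AB by (simp add: powr_divide)
    qed (use f g int in auto)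
    also have "\<dots> = \<theta> * (A / A) + (1 - \<theta>) * (B / B)"
      using f g unfolding A_def B_def by simp
    also have "\<dots> = 1" using AB by simp
    finally show ?thesis using AB by (simp add: field_simps)
  qed
  then show "(\<integral>x. f x powr \<theta> * g x powr (1 - \<theta>) \<partial>M) \<le> (\<integral>x. f x \<partial>M) powr \<theta> * (\<integral>x. g x \<partial>M) powr (1 - \<theta>)"
    by (simp add: A_def B_def)
qed

section \<open>Affine changes of variables for Lebesgue measure\<close>

context
  fixes t :: "'a::euclidean_space" and c :: real
  assumes c: "c \<noteq> 0"
begin

lemma lebesgue_affine_eq:
  "lebesgue = density (distr lebesgue lebesgue (\<lambda>x::'a. t + c *\<^sub>R x)) (\<lambda>_. ennreal (\<bar>c\<bar> ^ DIM('a)))"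
  using lebesgue_affine_euclidean[of "\<lambda>_::'a. c" t] c 
  unfolding scaleR_scaleR[symmetric] scaleR_sum_right[symmetric] euclidean_representation prod_constant by simp

lemma measurable_lebesgue_affine [measurable]: "(\<lambda>x::'a. t + c *\<^sub>R x) \<in> lebesgue \<rightarrow>\<^sub>M lebesgue"
  using lebesgue_affine_measurable[of "\<lambda>_::'a. c" t] c
  unfolding scaleR_scaleR[symmetric] scaleR_sum_right[symmetric] euclidean_representation by simp

lemma nn_integral_lebesgue_affine:
  assumes [measurable]: "f \<in> borel_measurable lebesgue"
  shows "(\<integral>\<^sup>+x. f x \<partial>lebesgue) = ennreal (\<bar>c\<bar> ^ DIM('a)) * (\<integral>\<^sup>+x. f (t + c *\<^sub>R x) \<partial>lebesgue)"
  by (subst lebesgue_affine_eq)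
     (simp add: nn_integral_density nn_integral_distr nn_integral_cmult)

lemma integrable_lebesgue_affine:
  fixes f :: "'a \<Rightarrow> 'b::{banach, second_countable_topology}"
  assumes f: "integrable lebesgue f"
  shows "integrable lebesgue (\<lambda>x. f (t + c *\<^sub>R x))"
    and "(\<integral>x. f (t + c *\<^sub>R x) \<partial>lebesgue) = (\<integral>x. f x \<partial>lebesgue) /\<^sub>R (\<bar>c\<bar> ^ DIM('a))"
proof -
  have [measurable]: "f \<in> borel_measurable lebesgue" using f by auto
  have f': "integrable (density (distr lebesgue lebesgue (\<lambda>x::'a. t + c *\<^sub>R x)) (\<lambda>_. ennreal (\<bar>c\<bar> ^ DIM('a)))) f"
    using f lebesgue_affine_eq by simp
  then have "integrable (distr lebesgue lebesgue (\<lambda>x::'a. t + c *\<^sub>R x)) (\<lambda>x. (\<bar>c\<bar> ^ DIM('a)) *\<^sub>R f x)"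
    by (subst (asm) integrable_density) (auto)
  from integrable_scaleR_right[OF this, of "inverse (\<bar>c\<bar> ^ DIM('a))"]
  have "integrable (distr lebesgue lebesgue (\<lambda>x::'a. t + c *\<^sub>R x)) f"
    using c by simp
  then show "integrable lebesgue (\<lambda>x. f (t + c *\<^sub>R x))"
    by (subst (asm) integrable_distr_eq) auto
  have "(\<integral>x. f x \<partial>lebesgue) = (\<integral>x. (\<bar>c\<bar> ^ DIM('a)) *\<^sub>R f x \<partial>distr lebesgue lebesgue (\<lambda>x::'a. t + c *\<^sub>R x))"
    by (subst lebesgue_affine_eq, subst integral_density) auto
  also have "\<dots> = (\<integral>x. (\<bar>c\<bar> ^ DIM('a)) *\<^sub>R f (t + c *\<^sub>R x) \<partial>lebesgue)"
    by (subst integral_distr) auto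
  finally show "(\<integral>x. f (t + c *\<^sub>R x) \<partial>lebesgue) = (\<integral>x. f x \<partial>lebesgue) /\<^sub>R (\<bar>c\<bar> ^ DIM('a))"
    using c by simp
qed

lemma AE_lebesgue_affine:
  assumes "AE x in lebesgue. P (x::'a)"
  shows "AE x in lebesgue. P (t + c *\<^sub>R x)"
proof -
  obtain N where N: "N \<in> null_sets lebesgue" "{x. \<not> P x} \<subseteq> N"
    using assms by (auto simp: eventually_ae_filter)
  have [measurable]: "N \<in> sets lebesgue" using N by auto
  have "(\<integral>\<^sup>+x. indicator N x \<partial>lebesgue) = ennreal (\<bar>c\<bar> ^ DIM('a)) * (\<integral>\<^sup>+x. indicator N (t + c *\<^sub>R x) \<partial>lebesgue)"
    by (rule nn_integral_lebesgue_affine) simp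
  moreover have "(\<integral>\<^sup>+x. indicator N x \<partial>lebesgue) = 0" using N(1) by (subst nn_integral_indicator) auto
  ultimately have "(\<integral>\<^sup>+x. indicator N (t + c *\<^sub>R x) \<partial>lebesgue) = 0" using c by simp
  then have "AE x in lebesgue. (indicator N (t + c *\<^sub>R x)::ennreal) = 0" 
    by (subst (asm) nn_integral_0_iff_AE) auto
  then show ?thesis
    by eventually_elim (use N(2) in \<open>auto simp: indicator_def split: if_splits\<close>)
qed

lemma sq_int_affine:
  fixes f :: "'a \<Rightarrow> 'b::euclidean_space"
  assumes "sq_int lebesgue f"
  shows "sq_int lebesgue (\<lambda>x. f (t + c *\<^sub>R x))"
    and "nrm2 lebesgue (\<lambda>x. f (t + c *\<^sub>R x)) = nrm2 lebesgue f / sqrt (\<bar>c\<bar> ^ DIM('a))"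
proof -
  have [measurable]: "f \<in> borel_measurable lebesgue" using assms by (simp add: sq_int_def)
  note * = integrable_lebesgue_affine[OF sq_int_integrable[OF assms]]
  show "sq_int lebesgue (\<lambda>x. f (t + c *\<^sub>R x))" using *(1) by (simp add: sq_int_def)
  show "nrm2 lebesgue (\<lambda>x. f (t + c *\<^sub>R x)) = nrm2 lebesgue f / sqrt (\<bar>c\<bar> ^ DIM('a))"
    using *(2) by (simp add: nrm2_def real_sqrt_divide divide_inverse mult.commute real_sqrt_mult real_sqrt_inverse)
qed

end

section \<open>Density of continuous functions and continuity of translations in L2\<close>

lemma sq_int_translate:
  fixes f :: "'a::euclidean_space \<Rightarrow> 'b::euclidean_space"
  assumes "sq_int lebesgue f"
  shows "sq_int lebesgue (\<lambda>x. f (x + z))" "nrm2 lebesgue (\<lambda>x. f (x + z)) = nrm2 lebesgue f"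
  using sq_int_affine[OF _ assms, of 1 z] by (auto simp: add.commute)

lemma sets_lebesgue_ball [measurable]: "cball a r \<in> sets lebesgue" "ball a r \<in> sets lebesgue"
  by (auto intro: fmeasurableD)

lemma integrable_indicator_cball [simp]: "integrable lebesgue (indicat_real (cball a r))"
  by (intro integrable_real_indicator) 
     (use lmeasurable_cball[of a r] in \<open>auto simp: fmeasurable_def simp del: emeasure_completion\<close>)

lemma sq_int_bounded_support:
  fixes f :: "'a::euclidean_space \<Rightarrow> 'b::euclidean_space"
  assumes [measurable]: "f \<in> borel_measurable lebesgue" 
    and "\<And>x. norm (f x) \<le> B * indicator (cball 0 R) x"
  shows "sq_int lebesgue f"
proof -
  have "sq_int lebesgue (\<lambda>x::'a. indicator (cball 0 R) x :: real)"
    unfolding sq_int_def by (simp add: power2_eq_square flip: indicator_inter_arith)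
  then show ?thesis
    by (rule sq_int_bound[OF _ assms(1), where C="B"]) (use assms(2) in auto)
qed

text \<open>Truncating values and support changes \<open>f\<close> little in L2. Continuous
  functions converge to \<open>f\<close> off a negligible set; applying the same truncations to them
  provides a common square integrable majorant, so dominated convergence gives an L2 approximation
  of the truncated \<open>f\<close>.\<close>

lemma L2_dense_continuous:
  fixes f :: "'a::euclidean_space \<Rightarrow> real"
  assumes f: "sq_int lebesgue f" and e: "0 < e"
  shows "\<exists>h R. continuous_on UNIV h \<and> (\<forall>x. R \<le> norm x \<longrightarrow> h x = 0) \<and> sq_int lebesgue h
           \<and> nrm2 lebesgue (\<lambda>x. f x - h x) < e"
proof -
  have fm[measurable]: "f \<in> borel_measurable lebesgue" using f by (simp add: sq_int_def)
  define cut where "cut R x = max 0 (min 1 (R + 1 - norm x))" for R :: real and x :: 'a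
  define clip where "clip R y = max (-R) (min R y)" for R y :: real
  have cut_cont: "continuous_on UNIV (cut R)" for R 
    unfolding cut_def by (intro continuous_intros)
  then have [measurable]: "cut R \<in> borel_measurable lebesgue" for R
    using borel_measurable_continuous_onI measurable_completion by (metis measurable_lborel2)
  define fR where "fR k x = clip (real k) (f x) * cut (real k) x" for k x
  have fRm[measurable]: "fR k \<in> borel_measurable lebesgue" for k
    unfolding fR_def clip_def by measurable
  have cut01: "0 \<le> cut R x" "cut R x \<le> 1" for R x by (auto simp: cut_def)
  have "(\<lambda>k. nrm2 lebesgue (\<lambda>x. fR k x - f x)) \<longlonglongrightarrow> 0"
  proof (rule nrm2_dominated(3)[OF fRm fm f])
    show "AE x in lebesgue. (\<lambda>k. fR k x) \<longlonglongrightarrow> f x"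
    proof (intro AE_I2 tendsto_eventually)
      fix x
      obtain N where N: "real N \<ge> max (norm x) \<bar>f x\<bar>" using real_arch_simple by blast
      have "fR k x = f x" if "k \<ge> N" for k
      proof -
        have "real k \<ge> real N" using that by simp
        then show ?thesis using N unfolding fR_def clip_def cut_def by auto
      qed
      then show "\<forall>\<^sub>F k in sequentially. fR k x = f x" using eventually_sequentially by blast
    qed
    show "AE x in lebesgue. norm (fR k x) \<le> norm (f x)" for k
    proof (rule AE_I2)
      fix x
      have "\<bar>clip (real k) (f x)\<bar> * \<bar>cut (real k) x\<bar> \<le> \<bar>f x\<bar> * 1"
        using cut01[of "real k" x] by (intro mult_mono) (auto simp: clip_def)
      then show "norm (fR k x) \<le> norm (f x)" by (simp add: fR_def abs_mult)
    qed
  qed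
  then have "\<forall>\<^sub>F k in sequentially. nrm2 lebesgue (\<lambda>x. fR k x - f x) < e/2"
    using e by (intro order_tendstoD(2)) auto
  then obtain k where k: "nrm2 lebesgue (\<lambda>x. fR k x - f x) < e/2"
    using eventually_happens'[OF sequentially_bot] by blast
  obtain N g where N: "negligible N" and g: "\<And>n. continuous_on UNIV (g n)" 
     and lim: "\<And>x. x \<notin> N \<Longrightarrow> (\<lambda>n. g n x) \<longlonglongrightarrow> f x"
    using lebesgue_measurable_imp_measurable_on[OF fm, of UNIV] by (auto simp: measurable_on_def)
  define h where "h n x = clip (real k) (g n x) * cut (real k) x" for n x
  have hc: "continuous_on UNIV (h n)" for n
    unfolding h_def clip_def cut_def by (intro continuous_intros g)
  then have hm: "h n \<in> borel_measurable lebesgue" for n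
    using borel_measurable_continuous_onI measurable_completion by (metis measurable_lborel2)
  define w where "w x = real k * indicat_real (cball 0 (real k + 1)) (x::'a)" for x
  have w: "sq_int lebesgue w"
    by (rule sq_int_bounded_support[where B="real k" and R="real k + 1"]) (auto simp: w_def[abs_def])
  have hw: "norm (h n x) \<le> norm (w x)" for n x
  proof -
    have "\<bar>clip (real k) (g n x)\<bar> * \<bar>cut (real k) x\<bar> \<le> real k * indicator (cball 0 (real k + 1)) x"
      by (rule mult_mono) (auto simp: clip_def cut_def indicator_def)
    then show ?thesis by (simp add: w_def h_def abs_mult)
  qed
  have hlim: "AE x in lebesgue. (\<lambda>n. h n x) \<longlonglongrightarrow> fR k x"
  proof -
    have "AE x in lebesgue. x \<notin> N" using N by (simp add: AE_not_in negligible_iff_null_sets)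
    then show ?thesis
    proof eventually_elim
      case (elim x)
      show ?case unfolding h_def fR_def clip_def by (intro tendsto_intros lim elim)
    qed
  qed
  note dom = nrm2_dominated[OF hm fRm w hlim AE_I2[OF hw]]
  have "\<forall>\<^sub>F n in sequentially. nrm2 lebesgue (\<lambda>x. h n x - fR k x) < e/2"
    using e dom(3) by (intro order_tendstoD(2)) auto
  then obtain n where n: "nrm2 lebesgue (\<lambda>x. h n x - fR k x) < e/2"
    using eventually_happens'[OF sequentially_bot] by blast
  have "nrm2 lebesgue (\<lambda>x. (f x - fR k x) + (fR k x - h n x)) \<le> nrm2 lebesgue (\<lambda>x. f x - fR k x) + nrm2 lebesgue (\<lambda>x. fR k x - h n x)"
    using f dom by (intro nrm2_triangle sq_int_diff) auto
  also have "\<dots> < e" using k n nrm2_minus_commute[of lebesgue f "fR k"] nrm2_minus_commute[of lebesgue "fR k" "h n"] by simp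
  finally have "nrm2 lebesgue (\<lambda>x. f x - h n x) < e" by simp
  moreover have "h n x = 0" if "real k + 1 \<le> norm x" for x
    using that by (simp add: h_def cut_def)
  ultimately show ?thesis using hc dom(1) by blast
qed

lemma L2_translation_continuous:
  fixes f :: "'a::euclidean_space \<Rightarrow> real"
  assumes f: "sq_int lebesgue f" and e: "0 < e"
  shows "\<exists>d>0. \<forall>z. norm z < d \<longrightarrow> nrm2 lebesgue (\<lambda>x. f (x + z) - f x) < e"
proof -
  obtain h R where h: "continuous_on UNIV h" "\<And>x. R \<le> norm x \<Longrightarrow> h x = 0" "sq_int lebesgue h"
     and fh: "nrm2 lebesgue (\<lambda>x. f x - h x) < e/3"
    using L2_dense_continuous[OF f, of "e/3"] e by auto
  define I where "I = nrm2 lebesgue (\<lambda>x::'a. indicat_real (cball 0 (\<bar>R\<bar> + 1)) x)"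
  have I: "sq_int lebesgue (\<lambda>x::'a. indicat_real (cball 0 (\<bar>R\<bar> + 1)) x)"
    by (rule sq_int_bounded_support[where B=1 and R="\<bar>R\<bar> + 1"]) auto
  \<comment> \<open>A pointwise error \<open>e'\<close> on the ball of radius |R| + 1 costs
    \<open>e' * I\<close> in L2; the summand 1 keeps the denominator positive.\<close>
  define e' where "e' = e / (3 * (I + 1))"
  have I0: "0 \<le> I" by (simp add: I_def)
  have e': "0 < e'" using e I0 by (simp add: e'_def)
  have "uniformly_continuous_on (cball 0 (\<bar>R\<bar> + 2)) h"
    by (intro compact_uniformly_continuous continuous_on_subset[OF h(1)]) auto
  then obtain d where d: "d > 0" "\<And>x y. x \<in> cball 0 (\<bar>R\<bar> + 2) \<Longrightarrow> y \<in> cball 0 (\<bar>R\<bar> + 2) \<Longrightarrow> dist x y < d \<Longrightarrow> dist (h x) (h y) < e'"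
    using e' unfolding uniformly_continuous_on_def by metis
  show ?thesis
  proof (intro exI[of _ "min d 1"] conjI allI impI)
    show "0 < min d 1" using d by simp
    fix z :: 'a assume z: "norm z < min d 1"
    have "norm (h (x + z) - h x) \<le> norm (e' * indicat_real (cball 0 (\<bar>R\<bar> + 1)) x)" for x
    proof (cases "norm x \<le> \<bar>R\<bar> + 1")
      case True
      then have "norm (x + z) \<le> \<bar>R\<bar> + 2" using norm_triangle_ineq[of x z] z by auto
      then have "dist (h (x + z)) (h x) < e'" using True z by (intro d(2)) (auto simp: dist_norm mem_cball_0 simp del: mem_cball)
      then show ?thesis using True e' by (simp add: dist_norm)
    next
      case False
      have "norm (x + z) \<ge> norm x - norm z" by (rule norm_diff_ineq)
      then have "h (x + z) = 0" "h x = 0" using False z by (auto intro!: h(2))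
      then show ?thesis by simp
    qed
    then have "nrm2 lebesgue (\<lambda>x. h (x + z) - h x) \<le> nrm2 lebesgue (\<lambda>x::'a. e' * indicat_real (cball 0 (\<bar>R\<bar> + 1)) x)"
      by (intro nrm2_mono sq_int_cmult I AE_I2)
    also have "\<dots> = e' * I" using e' by (simp add: nrm2_cmult I_def)
    also have "\<dots> < e / 3" using I0 e by (simp add: e'_def field_simps)
    finally have hz: "nrm2 lebesgue (\<lambda>x. h (x + z) - h x) < e / 3" .
    have fh': "nrm2 lebesgue (\<lambda>x. f (x + z) - h (x + z)) = nrm2 lebesgue (\<lambda>x. f x - h x)"
      by (rule sq_int_translate(2)) (intro sq_int_diff f h)
    have s1: "sq_int lebesgue (\<lambda>x. f (x + z) - h (x + z))" by (rule sq_int_translate(1)[of "\<lambda>x. f x - h x"]) (intro sq_int_diff f h)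
    have s2: "sq_int lebesgue (\<lambda>x. h (x + z) - h x)" by (intro sq_int_diff sq_int_translate(1) h)
    have s3: "sq_int lebesgue (\<lambda>x. h x - f x)" by (intro sq_int_diff f h)
    have "nrm2 lebesgue (\<lambda>x. f (x + z) - f x) = nrm2 lebesgue (\<lambda>x. (f (x + z) - h (x + z)) + ((h (x + z) - h x) + (h x - f x)))"
      by simp
    also have "\<dots> \<le> nrm2 lebesgue (\<lambda>x. f (x + z) - h (x + z)) + nrm2 lebesgue (\<lambda>x. (h (x + z) - h x) + (h x - f x))"
      by (intro nrm2_triangle s1 sq_int_add s2 s3)
    also have "\<dots> \<le> nrm2 lebesgue (\<lambda>x. f (x + z) - h (x + z)) + (nrm2 lebesgue (\<lambda>x. h (x + z) - h x) + nrm2 lebesgue (\<lambda>x. h x - f x))"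
      using nrm2_triangle[OF s2 s3] by simp
    also have "\<dots> < e" using fh' fh hz nrm2_minus_commute[of lebesgue h f] by simp
    finally show "nrm2 lebesgue (\<lambda>x. f (x + z) - f x) < e" .
  qed
qed

section \<open>Test functions and mollification\<close>

lemma partial_eq: "(f has_derivative f') (at x) \<Longrightarrow> partial i f x = f' (axis i 1)"
  unfolding partial_def using frechet_derivative_at by metis

lemma has_derivative_frechet: "f differentiable (at x) \<Longrightarrow> (f has_derivative frechet_derivative f (at x)) (at x)"
  by (simp add: frechet_derivative_works)

lemma has_derivative_partial:
  fixes f :: "real^'n::finite \<Rightarrow> real"
  assumes "f differentiable (at x)"
  shows "(f has_derivative (\<lambda>h. (\<chi> i. partial i f x) \<bullet> h)) (at x)"
proof -
  let ?D = "frechet_derivative f (at x)"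
  have D: "(f has_derivative ?D) (at x)" using assms by (rule has_derivative_frechet)
  then interpret bounded_linear ?D by (rule has_derivative_bounded_linear)
  have "?D h = (\<chi> i. partial i f x) \<bullet> h" for h
  proof -
    have "?D h = ?D (\<Sum>i\<in>UNIV. (h $ i) *\<^sub>R axis i 1)"
      using basis_expansion[of h] by (simp add: scalar_mult_eq_scaleR)
    also have "\<dots> = (\<Sum>i\<in>UNIV. h $ i * ?D (axis i 1))" by (simp add: sum scaleR)
    finally show ?thesis by (simp add: inner_vec_def partial_def mult.commute)
  qed
  then show ?thesis using D by (metis (no_types, lifting) ext)
qed

lemma gradient_line_derivative:
  assumes "\<And>x. (f has_derivative (\<lambda>h. G x \<bullet> h)) (at x)"
  shows "((\<lambda>t. f (z + t *\<^sub>R h)) has_real_derivative G (z + t *\<^sub>R h) \<bullet> h) (at t)"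
proof (rule has_derivative_imp_has_field_derivative)
  show "((\<lambda>t. f (z + t *\<^sub>R h)) has_derivative (\<lambda>s. G (z + t *\<^sub>R h) \<bullet> (s *\<^sub>R h))) (at t)"
    by (rule has_derivative_compose[of "\<lambda>t. z + t *\<^sub>R h" "\<lambda>s. s *\<^sub>R h" t UNIV f, OF _ assms]) 
       (auto intro!: derivative_eq_intros)
qed simp

lemma Ck_const [simp]: "Ck k (\<lambda>x. c)"
proof (induction k arbitrary: c)
  case (Suc k)
  have "partial i (\<lambda>x::real^'a. c) = (\<lambda>x. 0)" for i
    by (rule ext, subst partial_eq[OF has_derivative_const]) auto
  then show ?case using Suc by simp
qed simp

lemma Ck_Suc_imp_Ck: "Ck (Suc k) f \<Longrightarrow> Ck k f"
proof (induction k arbitrary: f)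
  case 0
  then show ?case by (auto intro!: continuous_at_imp_continuous_on differentiable_imp_continuous_within)
next
  case (Suc k)
  then show ?case by auto
qed

lemma Ck_add: "Ck k f \<Longrightarrow> Ck k g \<Longrightarrow> Ck k (\<lambda>x. f x + g x)"
proof (induction k arbitrary: f g)
  case (Suc k)
  have "partial i (\<lambda>x. f x + g x) = (\<lambda>x. partial i f x + partial i g x)" for i
    using Suc.prems by (intro ext, subst partial_eq[OF has_derivative_add[OF has_derivative_frechet has_derivative_frechet]]) (auto simp: partial_def)
  with Suc show ?case by auto
qed (auto intro: continuous_on_add)

lemma Ck_mult: "Ck k f \<Longrightarrow> Ck k g \<Longrightarrow> Ck k (\<lambda>x. f x * g x)"
proof (induction k arbitrary: f g)
  case (Suc k)
  have "partial i (\<lambda>x. f x * g x) = (\<lambda>x. f x * partial i g x + partial i f x * g x)" for i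
    using Suc.prems by (intro ext, subst partial_eq[OF has_derivative_mult[OF has_derivative_frechet has_derivative_frechet]]) (auto simp: partial_def)
  moreover have "Ck k f" "Ck k g" using Suc.prems Ck_Suc_imp_Ck by blast+
  ultimately show ?case using Suc by (auto intro!: Ck_add Suc.IH)
qed (auto intro: continuous_on_mult)

lemma Ck_cmult: "Ck k f \<Longrightarrow> Ck k (\<lambda>x. c * f x)"
  by (intro Ck_mult Ck_const)

lemma Ck_affine: "Ck k f \<Longrightarrow> Ck k (\<lambda>x. f (a + c *\<^sub>R x))"
proof (induction k arbitrary: f)
  case 0
  then show ?case by (auto intro!: continuous_intros elim: continuous_on_compose2)
next
  case (Suc k)
  have D: "((\<lambda>x. f (a + c *\<^sub>R x)) has_derivative (\<lambda>h. frechet_derivative f (at (a + c *\<^sub>R x)) (c *\<^sub>R h))) (at x)" for x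
  proof (rule has_derivative_compose[of "\<lambda>x. a + c *\<^sub>R x" "\<lambda>h. c *\<^sub>R h" x UNIV f])
    show "((\<lambda>x. a + c *\<^sub>R x) has_derivative (\<lambda>h. c *\<^sub>R h)) (at x)" by (auto intro!: derivative_eq_intros)
  qed (use Suc.prems has_derivative_frechet in auto)
  have "partial i (\<lambda>x. f (a + c *\<^sub>R x)) = (\<lambda>x. c * partial i f (a + c *\<^sub>R x))" for i
  proof
    fix x
    have "bounded_linear (frechet_derivative f (at (a + c *\<^sub>R x)))"
      using Suc.prems by (intro has_derivative_bounded_linear[OF has_derivative_frechet]) simp
    then show "partial i (\<lambda>x. f (a + c *\<^sub>R x)) x = c * partial i f (a + c *\<^sub>R x)"
      by (simp add: partial_eq[OF D] linear_cmul bounded_linear.linear) (simp add: partial_def)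
  qed
  then show ?case using Suc differentiableI[OF D] by (auto intro!: Ck_cmult)
qed

lemma Ck_component: "Ck k (\<lambda>x::real^'n::finite. x $ i)"
proof (cases k)
  case 0
  then show ?thesis by (auto intro!: continuous_intros)
next
  case (Suc m)
  have D: "((\<lambda>x::real^'n. x $ i) has_derivative (\<lambda>h. h $ i)) (at x)" for x
    by (auto intro!: derivative_eq_intros bounded_linear_imp_has_derivative bounded_linear_vec_nth)
  have "partial j (\<lambda>x::real^'n. x $ i) = (\<lambda>x. axis j 1 $ i)" for j
    by (rule ext) (simp add: partial_eq[OF D])
  then show ?thesis using differentiableI[OF D] Suc by auto
qed

definition expinv :: "nat \<Rightarrow> real \<Rightarrow> real" where
  "expinv k t = (if 0 < t then exp (- (1 / t)) / t ^ k else 0)"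

lemma expinv_at_0: "(expinv k \<longlongrightarrow> 0) (at 0)"
proof (rule filterlim_split_at)
  show "(expinv k \<longlongrightarrow> 0) (at_left 0)"
    by (rule tendsto_eventually) (auto simp: expinv_def eventually_at_filter)
  have "((\<lambda>x::real. (inverse x) ^ k / exp (inverse x)) \<longlongrightarrow> 0) (at_right 0)"
    by (rule filterlim_compose[OF tendsto_power_div_exp_0 filterlim_inverse_at_top_right])
  then show "(expinv k \<longlongrightarrow> 0) (at_right 0)"
  proof (rule filterlim_cong[THEN iffD1, rotated -1])
    show "\<forall>\<^sub>F x in at_right 0. inverse x ^ k / exp (inverse x) = expinv k x"
      unfolding eventually_at_filter by (auto simp: expinv_def exp_minus field_simps intro!: always_eventually)
  qed auto
qed

text \<open>The powers of 1/t in \<open>expinv\<close> make the family closed under differentiation,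
  so smoothness follows by induction over the order with \<open>k\<close> arbitrary.\<close>

lemma expinv_DERIV: "(expinv k has_real_derivative expinv (k + 2) t - real k * expinv (k + 1) t) (at t)"
proof (cases "t = 0")
  case True
  \<comment> \<open>At 0 the difference quotient of \<open>expinv k\<close> is
    \<open>expinv (k + 1)\<close>, which tends to 0.\<close>
  have "((\<lambda>h. (expinv k (0 + h) - expinv k 0) / h) \<longlongrightarrow> 0) (at 0)"
  proof (rule filterlim_cong[THEN iffD1, rotated -1])
    show "(expinv (k + 1) \<longlongrightarrow> 0) (at 0)" by (rule expinv_at_0)
    show "\<forall>\<^sub>F h in at 0. expinv (k + 1) h = (expinv k (0 + h) - expinv k 0) / h"
      unfolding eventually_at_filter by (auto simp: expinv_def intro!: always_eventually)
  qed auto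
  then show ?thesis using True by (simp add: DERIV_def expinv_def)
next
  case False
  show ?thesis
  proof (cases "0 < t")
    case True
    have "((\<lambda>t. exp (- (1 / t)) / t ^ k) has_real_derivative expinv (k + 2) t - real k * expinv (k + 1) t) (at t)"
      using True by (auto intro!: derivative_eq_intros simp: expinv_def field_simps power2_eq_square)
         (cases k; simp add: field_simps)
    then show ?thesis
    proof (rule DERIV_cong_ev[OF refl _ refl, THEN iffD1, rotated])
      have "\<forall>\<^sub>F x in nhds t. 0 < x" using True by (intro order_tendstoD(1)[of "\<lambda>x. x" t]) (auto simp: filterlim_ident)
      then show "\<forall>\<^sub>F x in nhds t. exp (- (1 / x)) / x ^ k = expinv k x"
        by eventually_elim (simp add: expinv_def)
    qed
  next
    case F: False
    with False have t: "t < 0" by simp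
    have "((\<lambda>t. 0) has_real_derivative 0) (at t)" by simp
    then have "(expinv k has_real_derivative 0) (at t)"
    proof (rule DERIV_cong_ev[OF refl _ refl, THEN iffD1, rotated])
      have "\<forall>\<^sub>F x in nhds t. x < 0" using t by (intro order_tendstoD(2)[of "\<lambda>x. x" t]) (auto simp: filterlim_ident)
      then show "\<forall>\<^sub>F x in nhds t. 0 = expinv k x"
        by eventually_elim (simp add: expinv_def)
    qed
    then show ?thesis using t by (simp add: expinv_def)
  qed
qed

definition bump :: "real^'n::finite \<Rightarrow> real" where
  "bump x = expinv 0 (1 - x \<bullet> x)"

lemma Ck_expinv: "Ck m (\<lambda>x::real^'n::finite. expinv k (1 - x \<bullet> x))"
proof (induction m arbitrary: k)
  case 0
  have "continuous_on UNIV (expinv k)"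
    using expinv_DERIV DERIV_continuous_on by (metis DERIV_isCont continuous_at_imp_continuous_on)
  then have "continuous_on UNIV (\<lambda>x::real^'n. expinv k (1 - x \<bullet> x))"
    by (rule continuous_on_compose2) (auto intro!: continuous_intros)
  then show ?case by simp
next
  case (Suc m)
  have D: "((\<lambda>x::real^'n. expinv k (1 - x \<bullet> x)) has_derivative 
     (\<lambda>h. (expinv (k + 2) (1 - x \<bullet> x) - real k * expinv (k + 1) (1 - x \<bullet> x)) * (- 2 * (x \<bullet> h)))) (at x)" for x
    by (rule has_derivative_eq_rhs, rule has_derivative_compose[of "\<lambda>x. 1 - x \<bullet> x" "\<lambda>h. - 2 * (x \<bullet> h)" x UNIV "expinv k", 
          OF _ expinv_DERIV[unfolded has_field_derivative_def]])
       (auto intro!: derivative_eq_intros simp: inner_commute)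
  have "partial i (\<lambda>x::real^'n. expinv k (1 - x \<bullet> x)) = 
      (\<lambda>x. (expinv (k + 2) (1 - x \<bullet> x) + (- real k) * expinv (k + 1) (1 - x \<bullet> x)) * (- 2 * (x $ i)))" for i
    by (rule ext) (simp add: partial_eq[OF D] inner_axis)
  moreover have "Ck m (\<lambda>x::real^'n. (expinv (k + 2) (1 - x \<bullet> x) + (- real k) * expinv (k + 1) (1 - x \<bullet> x)) * (- 2 * (x $ i)))" for i
    by (intro Ck_mult[OF Ck_add Ck_cmult] Suc Ck_cmult Ck_component)
  moreover have "(\<lambda>x::real^'n. expinv k (1 - x \<bullet> x)) differentiable (at x)" for x
    using D unfolding differentiable_def by blast
  ultimately show ?case by simp
qed

lemma test_funI:
  assumes "\<And>k. Ck k \<phi>" "\<And>x. R < norm x \<Longrightarrow> \<phi> x = 0"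
  shows "\<phi> \<in> test_fun"
proof -
  have "bounded {x. \<phi> x \<noteq> 0}"
    unfolding bounded_iff using assms(2) by (intro exI[of _ R]) (auto simp: not_less[symmetric])
  then show ?thesis using assms(1) by (simp add: test_fun_def compact_closure)
qed

lemma test_funD:
  fixes \<phi> :: "real^'n::finite \<Rightarrow> real"
  assumes "\<phi> \<in> test_fun"
  shows "Ck k \<phi>" "\<phi> differentiable (at x)" "continuous_on UNIV \<phi>" 
    and "\<exists>R>0. \<forall>x. R < norm x \<longrightarrow> \<phi> x = 0"
proof -
  have *: "Ck (Suc 0) \<phi>" "Ck 0 \<phi>" "bounded {x. \<phi> x \<noteq> 0}" and "Ck k \<phi>" 
    using assms by (simp_all add: test_fun_def compact_closure del: Ck.simps)
  show "Ck k \<phi>" by fact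
  show "\<phi> differentiable (at x)" "continuous_on UNIV \<phi>" using * by auto
  obtain R where R: "R > 0" "\<forall>x\<in>{x. \<phi> x \<noteq> 0}. norm x \<le> R" using *(3) unfolding bounded_pos by blast
  show "\<exists>R>0. \<forall>x. R < norm x \<longrightarrow> \<phi> x = 0" 
  proof (intro exI[of _ R] conjI allI impI R(1))
    fix x :: "real^'n" assume "R < norm x"
    then show "\<phi> x = 0" using R(2) by (meson mem_Collect_eq not_le)
  qed
qed

lemma bump_test_fun: "bump \<in> test_fun"
proof (rule test_funI[where R=1])
  show "Ck k (bump :: real^'n \<Rightarrow> real)" for k using Ck_expinv[of k 0] by (simp add: bump_def[abs_def])
  fix x :: "real^'n" assume "1 < norm x"
  then have "1 < (norm x)\<^sup>2" by (simp add: one_less_power)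
  then show "bump x = 0" by (simp add: bump_def expinv_def power2_norm_eq_inner)
qed

lemma bump_nonneg: "0 \<le> bump x" by (simp add: bump_def expinv_def)

lemma bump_pos: "norm x < 1 \<Longrightarrow> 0 < bump x"
  using power_strict_mono[of "norm x" 1 2] by (simp add: bump_def expinv_def power2_norm_eq_inner)

lemma bump_zero: "1 \<le> norm x \<Longrightarrow> bump x = 0"
  using power_mono[of 1 "norm x" 2] by (simp add: bump_def expinv_def power2_norm_eq_inner)

lemma test_fun_affine:
  fixes \<phi> :: "real^'n::finite \<Rightarrow> real"
  assumes "\<phi> \<in> test_fun" "c \<noteq> 0" shows "(\<lambda>x. \<phi> (a + c *\<^sub>R x)) \<in> test_fun"
proof -
  obtain R where R: "R > 0" "\<And>x. R < norm x \<Longrightarrow> \<phi> x = 0" using test_funD(4)[OF assms(1)] by auto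
  show ?thesis
  proof (rule test_funI[where R="(R + norm a) / \<bar>c\<bar>"])
    fix x :: "real^'n" assume "(R + norm a) / \<bar>c\<bar> < norm x"
    then have "R + norm a < norm (c *\<^sub>R x)" using assms(2) by (simp add: field_simps)
    then have "R < norm (a + c *\<^sub>R x)" using norm_diff_ineq[of "c *\<^sub>R x" a] by (simp add: add.commute)
    then show "\<phi> (a + c *\<^sub>R x) = 0" by (rule R)
  qed (intro Ck_affine test_funD assms)
qed

lemma test_fun_mult:
  assumes "\<phi> \<in> test_fun" "\<psi> \<in> test_fun" shows "(\<lambda>x. \<phi> x * \<psi> x) \<in> test_fun"
proof -
  obtain R where R: "R > 0" "\<And>x. R < norm x \<Longrightarrow> \<phi> x = 0" using test_funD(4)[OF assms(1)] by auto
  show ?thesis 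
  proof (rule test_funI[where R=R])
    show "Ck k (\<lambda>x. \<phi> x * \<psi> x)" for k by (intro Ck_mult test_funD(1) assms)
    show "R < norm x \<Longrightarrow> \<phi> x * \<psi> x = 0" for x by (simp add: R(2))
  qed
qed

lemma test_fun_cmult:
  assumes "\<phi> \<in> test_fun" shows "(\<lambda>x. c * \<phi> x) \<in> test_fun"
proof -
  obtain R where R: "R > 0" "\<And>x. R < norm x \<Longrightarrow> \<phi> x = 0" using test_funD(4)[OF assms(1)] by auto
  show ?thesis 
  proof (rule test_funI[where R=R])
    show "Ck k (\<lambda>x. c * \<phi> x)" for k by (intro Ck_cmult test_funD(1) assms)
    show "R < norm x \<Longrightarrow> c * \<phi> x = 0" for x by (simp add: R(2))
  qed
qed

lemma has_derivative_zero_outside: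
  fixes f :: "real^'n::finite \<Rightarrow> real"
  assumes "\<And>x. R < norm x \<Longrightarrow> f x = 0" "(f has_derivative f') (at x)" "R < norm x"
  shows "f' = (\<lambda>h. 0)"
proof -
  have "((\<lambda>x. 0) has_derivative f') (at x)"
    by (rule has_derivative_transform_within_open[OF assms(2), of "{x. R < norm x}"])
       (use assms in \<open>auto intro!: open_Collect_less continuous_intros\<close>)
  moreover have "((\<lambda>x. 0) has_derivative (\<lambda>h. 0)) (at x)" by simp
  ultimately show ?thesis using has_derivative_unique by blast
qed

lemma test_fun_partial:
  fixes \<phi> :: "real^'n::finite \<Rightarrow> real"
  assumes "\<phi> \<in> test_fun" shows "partial i \<phi> \<in> test_fun"
proof -
  obtain R where R: "R > 0" "\<And>x. R < norm x \<Longrightarrow> \<phi> x = 0" using test_funD(4)[OF assms] by auto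
  show ?thesis
  proof (rule test_funI[where R=R])
    show "Ck k (partial i \<phi>)" for k using test_funD(1)[OF assms, of "Suc k"] by simp
    fix x :: "real^'n" assume "R < norm x"
    then show "partial i \<phi> x = 0"
      using has_derivative_zero_outside[OF R(2) has_derivative_frechet[OF test_funD(2)[OF assms]]]
      by (auto simp: partial_def)
  qed
qed

lemma continuous_borel_lebesgue: 
  fixes f :: "'a::euclidean_space \<Rightarrow> 'b::euclidean_space"
  shows "continuous_on UNIV f \<Longrightarrow> f \<in> borel_measurable lebesgue"
  using borel_measurable_continuous_onI measurable_completion by (metis measurable_lborel2)

lemma continuous_support_bounded:
  fixes f :: "'a::euclidean_space \<Rightarrow> 'b::euclidean_space"
  assumes "continuous_on UNIV f" "\<And>x. R < norm x \<Longrightarrow> f x = 0"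
  shows "\<exists>B>0. \<forall>x. norm (f x) \<le> B * indicator (cball 0 R) x"
proof -
  have "compact (f ` cball 0 R)" by (intro compact_continuous_image continuous_on_subset[OF assms(1)]) auto
  then obtain B where B: "B > 0" "\<And>x. x \<in> cball 0 R \<Longrightarrow> norm (f x) \<le> B"
    using compact_imp_bounded bounded_pos by (metis imageI)
  show ?thesis using B assms(2) by (intro exI[of _ B]) (auto simp: indicator_def not_le)
qed

lemma test_fun_bound:
  assumes "\<phi> \<in> test_fun" shows "\<exists>B R. B > 0 \<and> R > 0 \<and> (\<forall>x. \<bar>\<phi> x\<bar> \<le> B * indicator (cball 0 R) x)"
proof -
  obtain R where R: "R > 0" "\<And>x. R < norm x \<Longrightarrow> \<phi> x = 0" using test_funD(4)[OF assms] by auto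
  then show ?thesis using continuous_support_bounded[OF test_funD(3)[OF assms], of R] by auto
qed

lemma test_fun_sq_int: "\<phi> \<in> test_fun \<Longrightarrow> sq_int lebesgue \<phi>"
  using test_fun_bound[of \<phi>] by (auto intro!: sq_int_bounded_support[of \<phi>] continuous_borel_lebesgue test_funD)

lemma test_fun_integrable:
  assumes "\<phi> \<in> test_fun" shows "integrable lebesgue \<phi>"
proof -
  obtain B R where B: "\<And>x. \<bar>\<phi> x\<bar> \<le> B * indicator (cball 0 R) x" "B > 0" using test_fun_bound[OF assms] by auto
  have [measurable]: "\<phi> \<in> borel_measurable lebesgue" by (intro continuous_borel_lebesgue test_funD assms)
  show ?thesis
    by (rule Bochner_Integration.integrable_bound[of _ "\<lambda>x. B * indicator (cball 0 R) x"]) (use B in auto)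
qed

lemma test_fun_Lipschitz:
  assumes "\<phi> \<in> test_fun" shows "\<exists>L>0. \<forall>x y. \<bar>\<phi> x - \<phi> y\<bar> \<le> L * norm (x - y)"
proof -
  define G where "G x = (\<chi> i. partial i \<phi> x)" for x
  have G: "(\<phi> has_derivative (\<lambda>h. G x \<bullet> h)) (at x)" for x
    unfolding G_def by (intro has_derivative_partial test_funD assms)
  have "\<exists>B. \<forall>x. \<bar>partial i \<phi> x\<bar> \<le> B" for i
  proof -
    obtain B R where B: "\<And>x. \<bar>partial i \<phi> x\<bar> \<le> B * indicator (cball 0 R) x" "B > 0" using test_fun_bound[OF test_fun_partial[OF assms]] by blast
    have "\<bar>partial i \<phi> x\<bar> \<le> B" for x 
      by (rule order_trans[OF B(1)]) (use B(2) in \<open>auto simp: indicator_def\<close>)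
    then show ?thesis by blast
  qed
  then obtain B where B: "\<And>i x. \<bar>partial i \<phi> x\<bar> \<le> B i" by metis
  define L where "L = (\<Sum>i\<in>UNIV. \<bar>B i\<bar>) + 1"
  have L: "0 < L" unfolding L_def by (intro add_nonneg_pos sum_nonneg) auto
  have "norm (G x) \<le> L" for x
  proof -
    have "norm (G x) \<le> (\<Sum>i\<in>UNIV. \<bar>G x $ i\<bar>)" by (rule norm_le_l1_cart)
    also have "\<dots> \<le> (\<Sum>i\<in>UNIV. \<bar>B i\<bar>)" by (rule sum_mono) (use B in \<open>auto simp: G_def intro: order_trans[OF _ abs_ge_self]\<close>)
    finally show ?thesis by (simp add: L_def)
  qed
  then have on: "onorm (\<lambda>h. G x \<bullet> h) \<le> L" for x
    using L by (intro onorm_le) (auto intro!: order_trans[OF Cauchy_Schwarz_ineq2] mult_right_mono)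
  have "norm (\<phi> x - \<phi> y) \<le> L * norm (x - y)" for x y
    by (rule differentiable_bound[of UNIV \<phi> "\<lambda>x h. G x \<bullet> h"]) (use G on in auto)
  then show ?thesis using L by auto
qed

section \<open>Convolution of a square integrable function with a test function\<close>

definition conv :: "(real^'n::finite \<Rightarrow> real) \<Rightarrow> (real^'n \<Rightarrow> real) \<Rightarrow> real^'n \<Rightarrow> real" where
  "conv u \<phi> x = (\<integral>y. u y * \<phi> (x - y) \<partial>lebesgue)"

lemma test_fun_reflect: "\<phi> \<in> test_fun \<Longrightarrow> (\<lambda>y. \<phi> (x - y)) \<in> test_fun"
  using test_fun_affine[of \<phi> "-1" x] by simp

lemma conv_integrable:
  assumes "sq_int lebesgue u" "\<phi> \<in> test_fun"
  shows "integrable lebesgue (\<lambda>y. u y * \<phi> (x - y))"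
  by (intro sq_int_mult assms test_fun_sq_int test_fun_reflect)

lemma test_fun_Taylor:
  fixes \<phi> :: "real^'n::finite \<Rightarrow> real"
  assumes "\<phi> \<in> test_fun"
  shows "\<exists>L R. L > 0 \<and> R > 0 \<and> (\<forall>z h. norm h \<le> 1 \<longrightarrow> 
     \<bar>\<phi> (z + h) - \<phi> z - (\<chi> i. partial i \<phi> z) \<bullet> h\<bar> \<le> L * (norm h)\<^sup>2 * indicator (cball 0 R) z)"
proof -
  define G where "G x = (\<chi> i. partial i \<phi> x)" for x
  have G: "(\<phi> has_derivative (\<lambda>h. G x \<bullet> h)) (at x)" for x
    unfolding G_def by (intro has_derivative_partial test_funD assms)
  have "\<exists>L>0. \<forall>x y. \<bar>partial i \<phi> x - partial i \<phi> y\<bar> \<le> L * norm (x - y)" for i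
    by (intro test_fun_Lipschitz test_fun_partial assms)
  then obtain L where L: "\<And>i. L i > 0" "\<And>i x y. \<bar>partial i \<phi> x - partial i \<phi> y\<bar> \<le> L i * norm (x - y)" by metis
  define K where "K = (\<Sum>i\<in>UNIV. L i) + 1"
  have K: "0 < K" unfolding K_def using L by (intro add_nonneg_pos sum_nonneg) (auto intro: less_imp_le)
  have GL: "norm (G x - G y) \<le> K * norm (x - y)" for x y
  proof -
    have "norm (G x - G y) \<le> (\<Sum>i\<in>UNIV. \<bar>(G x - G y) $ i\<bar>)" by (rule norm_le_l1_cart)
    also have "\<dots> \<le> (\<Sum>i\<in>UNIV. L i * norm (x - y))" by (rule sum_mono) (use L in \<open>auto simp: G_def\<close>)
    also have "\<dots> \<le> K * norm (x - y)" by (simp add: K_def algebra_simps flip: sum_distrib_right)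
    finally show ?thesis .
  qed
  obtain R where R: "R > 0" "\<And>x. R < norm x \<Longrightarrow> \<phi> x = 0" using test_funD(4)[OF assms] by auto
  have GR: "G x = 0" if "R < norm x" for x 
    using has_derivative_zero_outside[OF R(2) has_derivative_frechet[OF test_funD(2)[OF assms]] that]
    by (simp add: G_def vec_eq_iff partial_def)
  have "\<bar>\<phi> (z + h) - \<phi> z - G z \<bullet> h\<bar> \<le> K * (norm h)\<^sup>2 * indicator (cball 0 (R + 1)) z" if h: "norm h \<le> 1" for z h
  proof (cases "norm z \<le> R + 1")
    case True
    define f where "f t = \<phi> (z + t *\<^sub>R h)" for t :: real
    have D: "(f has_real_derivative G (z + t *\<^sub>R h) \<bullet> h) (at t)" for t
      unfolding f_def by (rule gradient_line_derivative[OF G])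
    obtain t where t: "0 < t" "t < 1" "f 1 - f 0 = (1 - 0) * (G (z + t *\<^sub>R h) \<bullet> h)"
      using MVT2[of 0 1 f "\<lambda>t. G (z + t *\<^sub>R h) \<bullet> h"] D by auto
    then have "\<bar>\<phi> (z + h) - \<phi> z - G z \<bullet> h\<bar> = \<bar>(G (z + t *\<^sub>R h) - G z) \<bullet> h\<bar>"
      by (simp add: f_def inner_diff_left)
    also have "\<dots> \<le> norm (G (z + t *\<^sub>R h) - G z) * norm h" by (rule Cauchy_Schwarz_ineq2)
    also have "\<dots> \<le> (K * norm (t *\<^sub>R h)) * norm h" using GL[of "z + t *\<^sub>R h" z] by (intro mult_right_mono) auto
    also have "\<dots> \<le> (K * (1 * norm h)) * norm h" using t K by (intro mult_right_mono mult_left_mono) (auto intro: mult_left_le_one_le)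
    finally show ?thesis using True by (simp add: power2_eq_square)
  next
    case False
    then have "norm (z + h) > R" using norm_diff_ineq[of z h] h by linarith
    then show ?thesis using False GR[of z] R(2)[of z] R(2)[of "z + h"] by simp
  qed
  then show ?thesis using K R(1) unfolding G_def by (intro exI[of _ K] exI[of _ "R + 1"]) auto
qed

text \<open>The derivative falls on the kernel. Its Taylor remainder, integrated against
  \<open>u\<close>, is at most a constant times the square of \<open>norm h\<close>, where the
  constant involves only the integral of |u| over a ball around \<open>x\<close>.\<close>

lemma conv_has_derivative:
  fixes u :: "real^'n::finite \<Rightarrow> real"
  assumes u: "sq_int lebesgue u" and phi: "\<phi> \<in> test_fun"
  shows "(conv u \<phi> has_derivative (\<lambda>h. (\<chi> i. conv u (partial i \<phi>) x) \<bullet> h)) (at x)"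
proof -
  obtain L R where L: "L > 0" "R > 0" "\<And>z h. norm h \<le> 1 \<Longrightarrow> 
     \<bar>\<phi> (z + h) - \<phi> z - (\<chi> i. partial i \<phi> z) \<bullet> h\<bar> \<le> L * (norm h)\<^sup>2 * indicator (cball 0 R) z"
    using test_fun_Taylor[OF phi] by blast
  have ind: "integrable lebesgue (\<lambda>y. \<bar>u y\<bar> * indicator (cball x R) y)"
  proof -
    have "sq_int lebesgue (\<lambda>y. indicat_real (cball x R) y)"
      using integrable_indicator_cball[of x R] unfolding sq_int_def 
      by (simp add: power2_eq_square flip: indicator_inter_arith)
    then show ?thesis using sq_int_mult[OF sq_int_abs[OF u]] by blast
  qed
  define C where "C = L * (\<integral>y. \<bar>u y\<bar> * indicator (cball x R) y \<partial>lebesgue)"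
  have C: "0 \<le> C" unfolding C_def using L by (intro mult_nonneg_nonneg Bochner_Integration.integral_nonneg) auto
  have bd: "\<bar>conv u \<phi> (x + h) - conv u \<phi> x - (\<chi> i. conv u (partial i \<phi>) x) \<bullet> h\<bar> \<le> C * (norm h)\<^sup>2" if h: "norm h \<le> 1" for h
  proof -
    have i1: "integrable lebesgue (\<lambda>y. u y * (\<phi> (x + h - y) - \<phi> (x - y) - (\<chi> i. partial i \<phi> (x - y)) \<bullet> h))"
      unfolding inner_vec_def right_diff_distrib sum_distrib_left vec_lambda_beta inner_real_def mult.assoc[symmetric]
      by (intro Bochner_Integration.integrable_diff Bochner_Integration.integrable_sum integrable_mult_left conv_integrable u phi test_fun_partial)
    have "(\<integral>y. u y * (\<phi> (x + h - y) - \<phi> (x - y) - (\<chi> i. partial i \<phi> (x - y)) \<bullet> h) \<partial>lebesgue)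
       = conv u \<phi> (x + h) - conv u \<phi> x - (\<chi> i. conv u (partial i \<phi>) x) \<bullet> h"
      unfolding inner_vec_def right_diff_distrib sum_distrib_left vec_lambda_beta inner_real_def mult.assoc[symmetric] conv_def
      using conv_integrable[OF u phi] conv_integrable[OF u test_fun_partial[OF phi]] 
      by (subst Bochner_Integration.integral_diff Bochner_Integration.integral_sum | simp)+
    then have "\<bar>conv u \<phi> (x + h) - conv u \<phi> x - (\<chi> i. conv u (partial i \<phi>) x) \<bullet> h\<bar> 
       \<le> (\<integral>y. \<bar>u y * (\<phi> (x + h - y) - \<phi> (x - y) - (\<chi> i. partial i \<phi> (x - y)) \<bullet> h)\<bar> \<partial>lebesgue)"
      using integral_norm_bound[of lebesgue "\<lambda>y. u y * (\<phi> (x + h - y) - \<phi> (x - y) - (\<chi> i. partial i \<phi> (x - y)) \<bullet> h)"] by simp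
    also have "\<dots> \<le> (\<integral>y. (L * (norm h)\<^sup>2) * (\<bar>u y\<bar> * indicator (cball x R) y) \<partial>lebesgue)"
    proof (intro integral_mono integrable_mult_right ind)
      fix y
      have "\<bar>\<phi> (x + h - y) - \<phi> (x - y) - (\<chi> i. partial i \<phi> (x - y)) \<bullet> h\<bar> \<le> L * (norm h)\<^sup>2 * indicator (cball x R) y"
        using L(3)[OF h, of "x - y"] by (simp add: diff_add_eq indicator_def dist_norm norm_minus_commute[of x y])
      from mult_left_mono[OF this, of "\<bar>u y\<bar>"]
      show "\<bar>u y * (\<phi> (x + h - y) - \<phi> (x - y) - (\<chi> i. partial i \<phi> (x - y)) \<bullet> h)\<bar> \<le> (L * (norm h)\<^sup>2) * (\<bar>u y\<bar> * indicator (cball x R) y)"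
        by (simp add: abs_mult mult_ac)
    qed (use i1 in auto)
    also have "\<dots> = C * (norm h)\<^sup>2" by (simp add: C_def)
    finally show ?thesis .
  qed
  show ?thesis
    unfolding has_derivative_at
  proof
    show "bounded_linear (\<lambda>h. (\<chi> i. conv u (partial i \<phi>) x) \<bullet> h)" by (rule bounded_linear_inner_right)
    show "(\<lambda>h. norm (conv u \<phi> (x + h) - conv u \<phi> x - (\<chi> i. conv u (partial i \<phi>) x) \<bullet> h) / norm h) \<midarrow>0\<rightarrow> 0"
    proof (rule tendsto_sandwich[of "\<lambda>_. 0" _ _ "\<lambda>h. C * norm h"])
      have ev: "\<forall>\<^sub>F h in at (0::real^'n). norm h \<le> 1"
        unfolding eventually_at by (intro exI[of _ 1]) auto
      show "\<forall>\<^sub>F h in at 0. norm (conv u \<phi> (x + h) - conv u \<phi> x - (\<chi> i. conv u (partial i \<phi>) x) \<bullet> h) / norm h \<le> C * norm h"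
        using ev
      proof eventually_elim
        case (elim h)
        then show ?case using bd[of h] C by (cases "h = 0") (auto simp: field_simps power2_eq_square)
      qed
      have "((\<lambda>h::real^'n. C * norm h) \<longlongrightarrow> C * norm (0::real^'n)) (at 0)" 
        by (intro tendsto_mult tendsto_const tendsto_norm tendsto_ident_at)
      then show "((\<lambda>h::real^'n. C * norm h) \<longlongrightarrow> 0) (at 0)" by simp
    qed auto
  qed
qed

text \<open>The class in which inequalities are first proved by calculus, before approximation
  carries them to weak gradients. The gradient is kept as a vector field so that it can be compared
  with a weak gradient.\<close>

definition C1grad :: "(real^'n::finite \<Rightarrow> real) \<Rightarrow> (real^'n \<Rightarrow> real^'n) \<Rightarrow> bool" where
  "C1grad w G \<longleftrightarrow> (\<forall>x. (w has_derivative (\<lambda>h. G x \<bullet> h)) (at x)) \<and> continuous_on UNIV G"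

lemma C1gradD:
  assumes "C1grad w G"
  shows "(w has_derivative (\<lambda>h. G x \<bullet> h)) (at x)" "continuous_on UNIV G" "continuous_on UNIV w"
    "G \<in> borel_measurable borel" "w \<in> borel_measurable borel" 
    "G \<in> borel_measurable lebesgue" "w \<in> borel_measurable lebesgue"
    "((\<lambda>t. w (z + t *\<^sub>R h)) has_real_derivative G (z + t *\<^sub>R h) \<bullet> h) (at t)"
proof -
  show D: "(w has_derivative (\<lambda>h. G x \<bullet> h)) (at x)" for x using assms by (simp add: C1grad_def)
  show G: "continuous_on UNIV G" using assms by (simp add: C1grad_def)
  show w: "continuous_on UNIV w"
    using D by (meson continuous_at_imp_continuous_on has_derivative_continuous)
  show "G \<in> borel_measurable borel" "w \<in> borel_measurable borel" 
    using G w by (simp_all add: borel_measurable_continuous_onI)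
  show "G \<in> borel_measurable lebesgue" "w \<in> borel_measurable lebesgue"
    using G w by (simp_all add: continuous_borel_lebesgue)
  show "((\<lambda>t. w (z + t *\<^sub>R h)) has_real_derivative G (z + t *\<^sub>R h) \<bullet> h) (at t)"
    by (rule gradient_line_derivative[OF D])
qed

lemma continuous_on_vec: "(\<And>i. continuous_on S (\<lambda>x. f x $ i)) \<Longrightarrow> continuous_on S (f :: _ \<Rightarrow> real^'n::finite)"
  using continuous_on_vec_lambda[of S "\<lambda>i x. f x $ i"] by simp

lemma conv_continuous: "sq_int lebesgue u \<Longrightarrow> \<phi> \<in> test_fun \<Longrightarrow> continuous_on UNIV (conv u \<phi>)"
  using conv_has_derivative by (meson continuous_at_imp_continuous_on has_derivative_continuous)

lemma C1grad_conv:
  "sq_int lebesgue u \<Longrightarrow> \<phi> \<in> test_fun \<Longrightarrow> C1grad (conv u \<phi>) (\<lambda>x. \<chi> i. conv u (partial i \<phi>) x)"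
  unfolding C1grad_def
  by (auto intro!: conv_has_derivative continuous_on_vec conv_continuous test_fun_partial)

section \<open>Approximate identities\<close>

lemma lebesgue_lborel_integral:
  fixes f :: "'a::euclidean_space \<Rightarrow> real"
  assumes "f \<in> borel_measurable borel"
  shows "(\<integral>x. f x \<partial>lebesgue) = (\<integral>x. f x \<partial>lborel)" "integrable lebesgue f \<longleftrightarrow> integrable lborel f"
  using assms by (auto simp: integral_completion integrable_completion)

lemma nn_integral_lebesgue_lborel:
  "f \<in> borel_measurable borel \<Longrightarrow> (\<integral>\<^sup>+x. f x \<partial>lebesgue) = (\<integral>\<^sup>+x. f x \<partial>lborel)"
  by (simp add: nn_integral_completion)

text \<open>The standard mollifier: mass 1, supported in the ball of radius 1/k. The summand 0 gives
  the argument the shape of the affine substitution lemmas.\<close>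

definition eta :: "real \<Rightarrow> real^'n::finite \<Rightarrow> real" where
  "eta k x = (k ^ CARD('n) / (\<integral>y. bump (y::real^'n) \<partial>lebesgue)) * bump (0 + k *\<^sub>R x)"

lemma bump_integral_pos: "0 < (\<integral>y. bump (y::real^'n::finite) \<partial>lebesgue)"
proof -
  have "(\<integral>y. bump (y::real^'n) \<partial>lebesgue) \<noteq> 0"
  proof
    assume "(\<integral>y. bump (y::real^'n) \<partial>lebesgue) = 0"
    then have "AE y in lebesgue. bump (y::real^'n) = 0"
      using integral_nonneg_eq_0_iff_AE[OF test_fun_integrable[OF bump_test_fun]] bump_nonneg by auto
    then have "AE y in lebesgue. (y::real^'n) \<in> - ball 0 1"
      by eventually_elim (use bump_pos in \<open>force simp: mem_ball_0\<close>)
    then have "(0::real^'n) \<in> - ball 0 1" by (rule mem_closed_if_AE_lebesgue[rotated]) auto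
    then show False by simp
  qed
  moreover have "0 \<le> (\<integral>y. bump (y::real^'n) \<partial>lebesgue)"
    by (intro Bochner_Integration.integral_nonneg bump_nonneg)
  ultimately show ?thesis by simp
qed

lemma eta_facts:
  fixes x :: "real^'n::finite"
  assumes k: "0 < k"
  shows "(eta k :: real^'n \<Rightarrow> real) \<in> test_fun" "0 \<le> eta k x" "1 / k \<le> norm x \<Longrightarrow> eta k x = 0"
    "(\<integral>x. eta k (x::real^'n) \<partial>lebesgue) = 1"
proof -
  show "(eta k :: real^'n \<Rightarrow> real) \<in> test_fun" unfolding eta_def[abs_def]
    using k by (intro test_fun_cmult test_fun_affine bump_test_fun) auto
  show "0 \<le> eta k x" unfolding eta_def using k bump_integral_pos bump_nonneg
    by (intro mult_nonneg_nonneg divide_nonneg_nonneg) (auto intro: less_imp_le)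
  show "1 / k \<le> norm x \<Longrightarrow> eta k x = 0" 
    unfolding eta_def using k bump_zero[of "k *\<^sub>R x"] by (simp add: field_simps)
  show "(\<integral>x. eta k (x::real^'n) \<partial>lebesgue) = 1"
    unfolding eta_def[abs_def] 
    using integrable_lebesgue_affine(2)[OF _ test_fun_integrable[OF bump_test_fun], of k "0::real^'n"] k bump_integral_pos[where 'n='n]
    by (simp add: field_simps)
qed

lemma conv_shift:
  fixes u :: "real^'n::finite \<Rightarrow> real"
  assumes "sq_int lebesgue u" "\<phi> \<in> test_fun"
  shows "integrable lebesgue (\<lambda>z. u (x - z) * \<phi> z)" "conv u \<phi> x = (\<integral>z. u (x - z) * \<phi> z \<partial>lebesgue)"
  using integrable_lebesgue_affine[OF _ conv_integrable[OF assms, of x], of "-1" x] by (simp_all add: conv_def)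

text \<open>Jensen's inequality for the probability density \<open>eta k\<close>, obtained from
  Cauchy-Schwarz after splitting the density into two square roots.\<close>

lemma conv_eta_pointwise:
  fixes u :: "real^'n::finite \<Rightarrow> real"
  assumes u: "sq_int lebesgue u" and [measurable]: "u \<in> borel_measurable borel" and k: "0 < k"
  shows "ennreal ((conv u (eta k) x - u x)\<^sup>2) \<le> (\<integral>\<^sup>+z. ennreal (eta k z * (u (x - z) - u x)\<^sup>2) \<partial>lborel)"
proof -
  note eta = eta_facts[OF k, where 'n='n]
  have [measurable]: "eta k \<in> borel_measurable (borel :: (real^'n) measure)"
    using test_funD(3)[OF eta(1)] by (rule borel_measurable_continuous_onI)
  have int: "integrable lebesgue (\<lambda>z. (u (x - z) - u x) * eta k z)"
    unfolding left_diff_distrib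
    by (intro Bochner_Integration.integrable_diff conv_shift u eta integrable_mult_right test_fun_integrable)
  have "conv u (eta k) x - u x = (\<integral>z. (u (x - z) - u x) * eta k z \<partial>lebesgue)"
    unfolding left_diff_distrib
    using conv_shift[OF u eta(1), of x] test_fun_integrable[OF eta(1)] eta(4) by simp
  then have "ennreal \<bar>conv u (eta k) x - u x\<bar> \<le> (\<integral>\<^sup>+z. norm ((u (x - z) - u x) * eta k z) \<partial>lebesgue)"
    using integral_norm_bound_ennreal[OF int] by simp
  also have "\<dots> = (\<integral>\<^sup>+z. ennreal (sqrt (eta k z) * \<bar>u (x - z) - u x\<bar>) * ennreal (sqrt (eta k z)) \<partial>lebesgue)"
    using eta(2) by (intro nn_integral_cong) (simp add: abs_mult mult_ac flip: ennreal_mult)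
  finally have "(ennreal \<bar>conv u (eta k) x - u x\<bar>)\<^sup>2 
      \<le> (\<integral>\<^sup>+z. ennreal (sqrt (eta k z) * \<bar>u (x - z) - u x\<bar>) * ennreal (sqrt (eta k z)) \<partial>lebesgue)\<^sup>2"
    by (rule power_mono) simp
  also have "\<dots> \<le> (\<integral>\<^sup>+z. (ennreal (sqrt (eta k z) * \<bar>u (x - z) - u x\<bar>))\<^sup>2 \<partial>lebesgue) * (\<integral>\<^sup>+z. (ennreal (sqrt (eta k (z::real^'n))))\<^sup>2 \<partial>lebesgue)"
    by (rule Cauchy_Schwarz_nn_integral) (auto intro!: measurable_completion)
  also have "(\<integral>\<^sup>+z. (ennreal (sqrt (eta k (z::real^'n))))\<^sup>2 \<partial>lebesgue) = (\<integral>\<^sup>+z. ennreal (eta k (z::real^'n)) \<partial>lebesgue)"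
    using eta(2) by (intro nn_integral_cong) (simp add: ennreal_power)
  also have "\<dots> = 1"
    using eta by (subst nn_integral_eq_integral) (auto intro: test_fun_integrable)
  also have "(\<integral>\<^sup>+z. (ennreal (sqrt (eta k z) * \<bar>u (x - z) - u x\<bar>))\<^sup>2 \<partial>lebesgue) 
     = (\<integral>\<^sup>+z. ennreal (eta k z * (u (x - z) - u x)\<^sup>2) \<partial>lebesgue)"
    using eta(2) by (intro nn_integral_cong) (simp add: ennreal_power power_mult_distrib)
  also have "\<dots> = (\<integral>\<^sup>+z. ennreal (eta k z * (u (x - z) - u x)\<^sup>2) \<partial>lborel)"
    by (rule nn_integral_lebesgue_lborel) simp
  finally show ?thesis by (simp add: ennreal_power)
qed

text \<open>Integrating the pointwise inequality in \<open>x\<close> and exchanging the integrals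
  leaves an average, over shifts shorter than 1/k, of squared translation errors. Borel
  measurability of \<open>u\<close> makes u(x - z) measurable in the pair (x, z), as the exchange
  requires.\<close>

lemma conv_eta_L2_borel:
  fixes u :: "real^'n::finite \<Rightarrow> real"
  assumes u: "sq_int lebesgue u" and [measurable]: "u \<in> borel_measurable borel" and k: "0 < k" and e: "0 \<le> e"
    and le: "\<And>z. norm z < 1 / k \<Longrightarrow> nrm2 lebesgue (\<lambda>x. u (x + z) - u x) \<le> e"
  shows "sq_int lebesgue (conv u (eta k))" "nrm2 lebesgue (\<lambda>x. conv u (eta k) x - u x) \<le> e"
proof -
  note eta = eta_facts[OF k, where 'n='n]
  have [measurable]: "eta k \<in> borel_measurable (borel :: (real^'n) measure)"
    using test_funD(3)[OF eta(1)] by (rule borel_measurable_continuous_onI)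
  have [measurable]: "conv u (eta k) \<in> borel_measurable borel"
    using conv_continuous[OF u eta(1)] by (rule borel_measurable_continuous_onI)
  have ul: "u \<in> borel_measurable lebesgue" using u by (simp add: sq_int_def)
  have "(\<integral>\<^sup>+x. ennreal ((conv u (eta k) x - u x)\<^sup>2) \<partial>lborel) 
     \<le> (\<integral>\<^sup>+x. (\<integral>\<^sup>+z. ennreal (eta k z * (u (x - z) - u x)\<^sup>2) \<partial>lborel) \<partial>lborel)"
    by (intro nn_integral_mono conv_eta_pointwise u k) simp
  also have "\<dots> = (\<integral>\<^sup>+z. (\<integral>\<^sup>+x. ennreal (eta k z * (u (x - z) - u x)\<^sup>2) \<partial>lborel) \<partial>lborel)"
    by (rule lborel_pair.Fubini'[symmetric]) measurable
  also have "\<dots> \<le> (\<integral>\<^sup>+z. ennreal (eta k (z::real^'n)) * ennreal (e\<^sup>2) \<partial>lborel)"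
  proof (rule nn_integral_mono)
    fix z :: "real^'n"
    show "(\<integral>\<^sup>+x. ennreal (eta k z * (u (x - z) - u x)\<^sup>2) \<partial>lborel) \<le> ennreal (eta k z) * ennreal (e\<^sup>2)"
    proof (cases "norm z < 1 / k")
      case True
      have s: "sq_int lebesgue (\<lambda>x. u (x + (- z)) - u x)" by (intro sq_int_diff sq_int_translate u)
      have "(\<integral>\<^sup>+x. ennreal (eta k z * (u (x - z) - u x)\<^sup>2) \<partial>lborel)
          = ennreal (eta k z) * (\<integral>\<^sup>+x. ennreal ((norm (u (x + (- z)) - u x))\<^sup>2) \<partial>lborel)"
        using eta(2) by (simp add: ennreal_mult nn_integral_cmult)
      also have "(\<integral>\<^sup>+x. ennreal ((norm (u (x + (- z)) - u x))\<^sup>2) \<partial>lborel) = (\<integral>\<^sup>+x. ennreal ((norm (u (x + (- z)) - u x))\<^sup>2) \<partial>lebesgue)"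
        by (rule nn_integral_lebesgue_lborel[symmetric]) simp
      also have "\<dots> = ennreal ((nrm2 lebesgue (\<lambda>x. u (x + (- z)) - u x))\<^sup>2)"
        by (rule nn_integral_sq_int[OF s])
      also have "\<dots> \<le> ennreal (e\<^sup>2)" using True by (intro ennreal_leI power_mono le) auto
      finally show ?thesis by (simp add: mult_left_mono)
    next
      case False
      then show ?thesis using eta(3)[of z] by simp
    qed
  qed
  also have "\<dots> = (\<integral>\<^sup>+z. ennreal (eta k (z::real^'n)) \<partial>lebesgue) * ennreal (e\<^sup>2)"
    by (subst nn_integral_multc) (auto simp: nn_integral_lebesgue_lborel)
  also have "(\<integral>\<^sup>+z. ennreal (eta k (z::real^'n)) \<partial>lebesgue) = 1"
    using eta by (subst nn_integral_eq_integral) (auto intro: test_fun_integrable)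
  finally have "(\<integral>\<^sup>+x. ennreal ((norm (conv u (eta k) x - u x))\<^sup>2) \<partial>lebesgue) \<le> ennreal (e\<^sup>2)"
    by (subst nn_integral_lebesgue_lborel) auto
  note * = nn_integral_sq_le_imp[OF _ this e]
  have m: "(\<lambda>x. conv u (eta k) x - u x) \<in> borel_measurable lebesgue"
    by (intro borel_measurable_diff ul continuous_borel_lebesgue conv_continuous u eta)
  show "nrm2 lebesgue (\<lambda>x. conv u (eta k) x - u x) \<le> e" using *(2) m by simp
  show "sq_int lebesgue (conv u (eta k))" using sq_int_add[OF *(1)[OF m] u] by simp
qed

lemma conv_cong_AE:
  assumes "AE x in lebesgue. u x = v x" "u \<in> borel_measurable lebesgue" "v \<in> borel_measurable lebesgue" "\<phi> \<in> test_fun"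
  shows "conv u \<phi> = conv v \<phi>"
proof
  fix x
  have [measurable]: "(\<lambda>y. \<phi> (x - y)) \<in> borel_measurable lebesgue"
    using test_fun_sq_int[OF test_fun_reflect[OF assms(4)]] by (simp add: sq_int_def)
  show "conv u \<phi> x = conv v \<phi> x"
    unfolding conv_def
    by (intro integral_cong_AE) (use assms in \<open>auto elim!: eventually_mono intro!: borel_measurable_times\<close>)
qed

text \<open>Replaces \<open>u\<close> by a Borel representative, which changes neither the
  convolution nor any of the norms.\<close>

lemma conv_eta_L2_bound:
  fixes u :: "real^'n::finite \<Rightarrow> real"
  assumes u: "sq_int lebesgue u" and k: "0 < k" and e: "0 \<le> e"
    and le: "\<And>z. norm z < 1 / k \<Longrightarrow> nrm2 lebesgue (\<lambda>x. u (x + z) - u x) \<le> e"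
  shows "sq_int lebesgue (conv u (eta k))" "nrm2 lebesgue (\<lambda>x. conv u (eta k) x - u x) \<le> e"
proof -
  have um: "u \<in> borel_measurable lebesgue" using u by (simp add: sq_int_def)
  obtain v where v: "v \<in> borel_measurable lborel" "AE x in lborel. u x = v x"
    using completion_ex_borel_measurable_real[OF um] by auto
  have vm: "v \<in> borel_measurable lebesgue" using v(1) by (rule measurable_completion)
  have uv: "AE x in lebesgue. u x = v x" using v(2) by (rule AE_completion)
  have vs: "sq_int lebesgue v" using sq_int_cong_AE[OF u vm uv] .
  have le': "nrm2 lebesgue (\<lambda>x. v (x + z) - v x) \<le> e" if z: "norm z < 1 / k" for z
  proof -
    have "AE x in lebesgue. u (z + 1 *\<^sub>R x) = v (z + 1 *\<^sub>R x)" by (rule AE_lebesgue_affine[OF _ uv]) simp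
    then have "AE x in lebesgue. v (x + z) - v x = u (x + z) - u x"
      using uv by eventually_elim (simp add: add.commute)
    then have "nrm2 lebesgue (\<lambda>x. v (x + z) - v x) = nrm2 lebesgue (\<lambda>x. u (x + z) - u x)"
      using sq_int_diff[OF sq_int_translate(1)[OF u] u, of z] sq_int_diff[OF sq_int_translate(1)[OF vs] vs, of z]
      by (intro nrm2_cong_AE) (auto simp: sq_int_def)
    then show ?thesis using le[OF z] by simp
  qed
  have eq: "conv u (eta k) = conv v (eta k)"
    by (rule conv_cong_AE[OF uv um vm eta_facts(1)[OF k]])
  have vb: "v \<in> borel_measurable borel" using v(1) by simp
  note * = conv_eta_L2_borel[OF vs vb k e le']
  show "sq_int lebesgue (conv u (eta k))" using *(1) eq by simp
  then have cm: "conv u (eta k) \<in> borel_measurable lebesgue" by (simp add: sq_int_def)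
  have "nrm2 lebesgue (\<lambda>x. conv u (eta k) x - u x) = nrm2 lebesgue (\<lambda>x. conv u (eta k) x - v x)"
    by (rule nrm2_cong_AE) (use cm um vm uv in \<open>auto elim!: eventually_mono\<close>)
  then show "nrm2 lebesgue (\<lambda>x. conv u (eta k) x - u x) \<le> e" using *(2) eq by simp
qed

lemma conv_eta_L2:
  fixes u :: "real^'n::finite \<Rightarrow> real"
  assumes u: "sq_int lebesgue u" and e: "0 < e"
  shows "\<exists>k0>0. \<forall>k\<ge>k0. sq_int lebesgue (conv u (eta k)) \<and> nrm2 lebesgue (\<lambda>x. conv u (eta k) x - u x) \<le> e"
proof -
  obtain d where d: "d > 0" "\<And>z. norm z < d \<Longrightarrow> nrm2 lebesgue (\<lambda>x. u (x + z) - u x) < e"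
    using L2_translation_continuous[OF u e] by auto
  show ?thesis
  proof (intro exI[of _ "1 / d"] conjI allI impI)
    show "0 < 1 / d" using d by simp
    fix k assume k: "1 / d \<le> k"
    have k0: "0 < k" using d k by (meson less_le_trans zero_less_divide_1_iff)
    have kd: "1 / k \<le> d" using d k k0 by (simp add: field_simps)
    have le: "nrm2 lebesgue (\<lambda>x. u (x + z) - u x) \<le> e" if "norm z < 1 / k" for z
      using d(2)[of z] that kd by simp
    show "sq_int lebesgue (conv u (eta k))" "nrm2 lebesgue (\<lambda>x. conv u (eta k) x - u x) \<le> e"
      using conv_eta_L2_bound[OF u k0 less_imp_le[OF e] le] by auto
  qed
qed

lemma conv_eta_LIMSEQ:
  fixes u :: "real^'n::finite \<Rightarrow> real"
  assumes u: "sq_int lebesgue u"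
  shows "\<exists>k0. \<forall>k\<ge>k0. sq_int lebesgue (conv u (eta (real k)))"
    and "(\<lambda>k. nrm2 lebesgue (\<lambda>x. conv u (eta (real k)) x - u x)) \<longlonglongrightarrow> 0"
proof -
  have *: "\<exists>k0::nat. \<forall>k\<ge>k0. sq_int lebesgue (conv u (eta (real k))) \<and> nrm2 lebesgue (\<lambda>x. conv u (eta (real k)) x - u x) \<le> e"
    if e: "0 < e" for e
  proof -
    obtain k1 where k1: "\<forall>k\<ge>k1. sq_int lebesgue (conv u (eta k)) \<and> nrm2 lebesgue (\<lambda>x. conv u (eta k) x - u x) \<le> e"
      using conv_eta_L2[OF u e] by auto
    obtain n where "real n \<ge> k1" using real_arch_simple by blast
    then show ?thesis using k1 by (intro exI[of _ n]) (auto intro: order_trans)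
  qed
  show "\<exists>k0. \<forall>k\<ge>k0. sq_int lebesgue (conv u (eta (real k)))" using *[of 1] by auto
  show "(\<lambda>k. nrm2 lebesgue (\<lambda>x. conv u (eta (real k)) x - u x)) \<longlonglongrightarrow> 0"
  proof (rule LIMSEQ_I)
    fix r :: real assume r: "0 < r"
    then obtain k0 where k0: "\<And>k. k \<ge> k0 \<Longrightarrow> nrm2 lebesgue (\<lambda>x. conv u (eta (real k)) x - u x) \<le> r / 2"
      using *[of "r/2"] by auto
    have "norm (nrm2 lebesgue (\<lambda>x. conv u (eta (real n)) x - u x) - 0) < r" if "n \<ge> k0" for n
      using k0[OF that] r by simp
    then show "\<exists>no. \<forall>n\<ge>no. norm (nrm2 lebesgue (\<lambda>x. conv u (eta (real n)) x - u x) - 0) < r"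
      by blast
  qed
qed

text \<open>Reflected mollifiers are test functions, so every mollification of \<open>u\<close>
  vanishes identically, while the mollifications converge to \<open>u\<close> in L2.\<close>

lemma fundamental_lemma:
  fixes u :: "real^'n::finite \<Rightarrow> real"
  assumes u: "sq_int lebesgue u" and 0: "\<And>\<phi>. \<phi> \<in> test_fun \<Longrightarrow> (\<integral>x. u x * \<phi> x \<partial>lebesgue) = 0"
  shows "AE x in lebesgue. u x = 0"
proof -
  have "conv u (eta (real (Suc k))) x = 0" for k x
    unfolding conv_def by (intro 0 test_fun_reflect eta_facts) simp
  then have "(\<lambda>k. nrm2 lebesgue (\<lambda>x. conv u (eta (real (Suc k))) x - u x)) = (\<lambda>k. nrm2 lebesgue u)"
    by (simp add: nrm2_uminus)
  then have "nrm2 lebesgue u = 0"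
    using LIMSEQ_Suc[OF conv_eta_LIMSEQ(2)[OF u]] LIMSEQ_unique tendsto_const by metis
  then show ?thesis by (rule nrm2_zero_imp_AE[OF u])
qed

section \<open>Weak gradients and their approximation by C^1 functions\<close>

lemma L2_vec_iff: "g \<in> L2_vec \<longleftrightarrow> sq_int lebesgue g"
  by (simp add: L2_vec_def sq_int_def)

lemma Lp_2_iff: "u \<in> Lp 2 \<longleftrightarrow> sq_int lebesgue u"
  by (simp add: Lp_def sq_int_def powr_numeral)

lemma H1_iff: "u \<in> H1 \<longleftrightarrow> sq_int lebesgue u \<and> (\<exists>g. has_weak_grad u g)"
  by (simp add: H1_def Lp_2_iff)

lemma has_weak_gradD:
  assumes "has_weak_grad u g"
  shows "sq_int lebesgue g" "\<phi> \<in> test_fun \<Longrightarrow> (\<integral>x. u x * partial i \<phi> x \<partial>lebesgue) = - (\<integral>x. g x $ i * \<phi> x \<partial>lebesgue)"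
  using assms by (auto simp: has_weak_grad_def L2_vec_iff)

lemma has_weak_gradI:
  assumes "sq_int lebesgue g" 
    and "\<And>\<phi> i. \<phi> \<in> test_fun \<Longrightarrow> (\<integral>x. u x * partial i \<phi> x \<partial>lebesgue) = - (\<integral>x. g x $ i * \<phi> x \<partial>lebesgue)"
  shows "has_weak_grad u g"
  using assms by (auto simp: has_weak_grad_def L2_vec_iff)

lemma weak_grad_unique:
  assumes "has_weak_grad u g" "has_weak_grad u g'"
  shows "AE x in lebesgue. g x = g' x"
proof -
  note s = has_weak_gradD(1)[OF assms(1)] has_weak_gradD(1)[OF assms(2)]
  have "AE x in lebesgue. g x $ i - g' x $ i = 0" for i
  proof (rule fundamental_lemma)
    show "sq_int lebesgue (\<lambda>x. g x $ i - g' x $ i)" by (intro sq_int_diff sq_int_component s)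
    fix \<phi> :: "real^'a \<Rightarrow> real" assume phi: "\<phi> \<in> test_fun"
    show "(\<integral>x. (g x $ i - g' x $ i) * \<phi> x \<partial>lebesgue) = 0"
      using has_weak_gradD(2)[OF assms(1) phi, of i] has_weak_gradD(2)[OF assms(2) phi, of i]
        sq_int_mult[OF sq_int_component[OF s(1)] test_fun_sq_int[OF phi], of i] 
        sq_int_mult[OF sq_int_component[OF s(2)] test_fun_sq_int[OF phi], of i]
      by (simp add: left_diff_distrib)
  qed
  then have "AE x in lebesgue. \<forall>i\<in>UNIV. g x $ i - g' x $ i = 0" by (intro AE_finite_allI) auto
  then show ?thesis by eventually_elim (simp add: vec_eq_iff)
qed

lemma nrm2_component_le: "sq_int M f \<Longrightarrow> nrm2 M (\<lambda>x. f x $ i) \<le> nrm2 M (f :: _ \<Rightarrow> real^'n::finite)"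
  by (rule nrm2_mono) (auto simp: component_le_norm_cart)

lemma integral_mult_tendsto:
  assumes "\<And>k. sq_int M (f k)" "sq_int M g" "(\<lambda>k. nrm2 M (\<lambda>x. f k x - g x)) \<longlonglongrightarrow> 0" "sq_int M (h :: _ \<Rightarrow> real)"
  shows "(\<lambda>k. \<integral>x. f k x * h x \<partial>M) \<longlonglongrightarrow> (\<integral>x. g x * h x \<partial>M)"
  using integral_inner_tendsto[OF assms] by simp

text \<open>The weak gradient is a closed operator: both sides of the defining identity are L2
  pairings with fixed test functions. All calculus rules below are obtained through this
  closure.\<close>

lemma has_weak_grad_limit:
  assumes w: "\<And>k. has_weak_grad (w k) (G k)" "\<And>k. sq_int lebesgue (w k)"
    and "sq_int lebesgue u" "sq_int lebesgue g"
    and "(\<lambda>k. nrm2 lebesgue (\<lambda>x. w k x - u x)) \<longlonglongrightarrow> 0" "(\<lambda>k. nrm2 lebesgue (\<lambda>x. G k x - g x)) \<longlonglongrightarrow> 0"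
  shows "has_weak_grad u g"
proof (rule has_weak_gradI)
  fix \<phi> :: "real^'a \<Rightarrow> real" and i assume phi: "\<phi> \<in> test_fun"
  have 1: "(\<lambda>k. \<integral>x. w k x * partial i \<phi> x \<partial>lebesgue) \<longlonglongrightarrow> (\<integral>x. u x * partial i \<phi> x \<partial>lebesgue)"
    by (intro integral_mult_tendsto assms test_fun_sq_int test_fun_partial phi)
  have "(\<lambda>k. nrm2 lebesgue (\<lambda>x. G k x $ i - g x $ i)) \<longlonglongrightarrow> 0"
  proof (rule tendsto_sandwich[OF _ _ tendsto_const assms(6)])
    have "sq_int lebesgue (\<lambda>x. G k x - g x)" for k by (intro sq_int_diff has_weak_gradD(1)[OF w(1)] assms)
    from nrm2_component_le[OF this, of _ i] 
    show "\<forall>\<^sub>F n in sequentially. nrm2 lebesgue (\<lambda>x. G n x $ i - g x $ i) \<le> nrm2 lebesgue (\<lambda>x. G n x - g x)" by simp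
  qed auto
  then have 2: "(\<lambda>k. \<integral>x. G k x $ i * \<phi> x \<partial>lebesgue) \<longlonglongrightarrow> (\<integral>x. g x $ i * \<phi> x \<partial>lebesgue)"
    by (intro integral_mult_tendsto sq_int_component has_weak_gradD(1)[OF w(1)] assms test_fun_sq_int phi)
  show "(\<integral>x. u x * partial i \<phi> x \<partial>lebesgue) = - (\<integral>x. g x $ i * \<phi> x \<partial>lebesgue)"
    using LIMSEQ_unique[OF 1] tendsto_minus[OF 2] has_weak_gradD(2)[OF w(1) phi] by simp
qed fact

lemma C1grad_mult:
  assumes "C1grad w G" "C1grad v H"
  shows "C1grad (\<lambda>x. w x * v x) (\<lambda>x. w x *\<^sub>R H x + v x *\<^sub>R G x)"
  unfolding C1grad_def
proof (intro conjI allI)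
  show "((\<lambda>x. w x * v x) has_derivative (\<lambda>h. (w x *\<^sub>R H x + v x *\<^sub>R G x) \<bullet> h)) (at x)" for x
    by (rule has_derivative_eq_rhs[OF has_derivative_mult[OF C1gradD(1)[OF assms(1)] C1gradD(1)[OF assms(2)]]])
       (auto simp: inner_add_left)
  show "continuous_on UNIV (\<lambda>x. w x *\<^sub>R H x + v x *\<^sub>R G x)"
    by (intro continuous_intros C1gradD[OF assms(1)] C1gradD[OF assms(2)])
qed

lemma C1grad_test_fun: 
  assumes "\<phi> \<in> test_fun" shows "C1grad \<phi> (\<lambda>x. \<chi> i. partial i \<phi> x)"
  unfolding C1grad_def
  by (auto intro!: has_derivative_partial test_funD continuous_on_vec test_fun_partial assms)

text \<open>By translation invariance every difference quotient of \<open>f\<close> has integral 0.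
  Dominated convergence passes this to the partial derivative; the mean value theorem supplies the
  bound.\<close>

lemma integral_gradient_zero:
  fixes f :: "real^'n::finite \<Rightarrow> real"
  assumes f: "C1grad f F" and R: "\<And>x. R < norm x \<Longrightarrow> f x = 0"
  shows "(\<integral>x. F x $ i \<partial>lebesgue) = 0"
proof -
  let ?e = "axis i 1 :: real^'n"
  have FR: "F x = 0" if "R < norm x" for x
  proof -
    have "(\<lambda>h. F x \<bullet> h) = (\<lambda>h. 0)" by (rule has_derivative_zero_outside[OF R C1gradD(1)[OF f] that])
    then show ?thesis by (metis inner_eq_zero_iff)
  qed
  obtain B where B: "B > 0" "\<And>x. norm (F x) \<le> B * indicator (cball 0 R) x"
    using continuous_support_bounded[OF C1gradD(2)[OF f] FR] by auto
  have FB: "norm (F x) \<le> B" for x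
    by (rule order_trans[OF B(2)]) (use B(1) in \<open>auto simp: indicator_def\<close>)
  obtain B' where B': "\<And>x. norm (f x) \<le> B' * indicator (cball 0 R) x"
    using continuous_support_bounded[OF C1gradD(3)[OF f] R] by auto
  \<comment> \<open>Steps of length at most 1 keep all difference quotients supported in the ball of
    radius R + 1.\<close>
  define h where "h k = inverse (real (Suc k))" for k
  have h: "0 < h k" "h k \<le> 1" for k by (auto simp: h_def field_simps)
  define q where "q k x = (f (x + h k *\<^sub>R ?e) - f x) / h k" for k x
  have [measurable]: "f \<in> borel_measurable lebesgue" using f by (rule C1gradD)
  have fi: "integrable lebesgue f"
    by (rule Bochner_Integration.integrable_bound[of _ "\<lambda>x. B' * indicator (cball 0 R) x"]) 
       (use B' in \<open>auto intro: order_trans[OF _ abs_ge_self]\<close>)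
  have fs: "integrable lebesgue (\<lambda>x. f (x + z))" "(\<integral>x. f (x + z) \<partial>lebesgue) = (\<integral>x. f x \<partial>lebesgue)" for z
    using integrable_lebesgue_affine[OF _ fi, of 1 z] by (simp_all add: add.commute)
  have q0: "(\<integral>x. q k x \<partial>lebesgue) = 0" for k
    unfolding q_def using fs fi by simp
  have "(\<lambda>k. \<integral>x. q k x \<partial>lebesgue) \<longlonglongrightarrow> (\<integral>x. F x $ i \<partial>lebesgue)"
  proof (rule integral_dominated_convergence)
    show "integrable lebesgue (\<lambda>x. B * indicator (cball (0::real^'n) (R + 1)) x)" by simp
    show "(\<lambda>x. F x $ i) \<in> borel_measurable lebesgue" using C1gradD(6)[OF f] by measurable
    show "q k \<in> borel_measurable lebesgue" for k
      using fs(1)[of "h k *\<^sub>R ?e"] unfolding q_def[abs_def] by measurable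
    show "AE x in lebesgue. (\<lambda>k. q k x) \<longlonglongrightarrow> F x $ i"
    proof (rule AE_I2)
      fix x
      have D: "((\<lambda>t. f (x + t *\<^sub>R ?e)) has_real_derivative F x $ i) (at 0)"
        using C1gradD(8)[OF f, of x ?e 0] by (simp add: inner_axis)
      have h0: "h \<longlonglongrightarrow> 0" unfolding h_def by (rule LIMSEQ_inverse_real_of_nat)
      have "filterlim h (at 0) sequentially"
        using h0 h(1) unfolding filterlim_at by (auto intro!: always_eventually simp: less_imp_neq[symmetric])
      then have "(\<lambda>k. (f (x + (0 + h k) *\<^sub>R ?e) - f (x + 0 *\<^sub>R ?e)) / h k) \<longlonglongrightarrow> F x $ i"
        using D unfolding DERIV_def by (rule filterlim_compose[rotated])
      then show "(\<lambda>k. q k x) \<longlonglongrightarrow> F x $ i" by (simp add: q_def)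
    qed
    show "AE x in lebesgue. norm (q k x) \<le> B * indicator (cball 0 (R + 1)) x" for k
    proof (rule AE_I2)
      fix x
      show "norm (q k x) \<le> B * indicator (cball 0 (R + 1)) x"
      proof (cases "norm x \<le> R + 1")
        case True
        obtain t where t: "f (x + h k *\<^sub>R ?e) - f (x + 0 *\<^sub>R ?e) = (h k - 0) * (F (x + t *\<^sub>R ?e) \<bullet> ?e)"
          using MVT2[of 0 "h k" "\<lambda>t. f (x + t *\<^sub>R ?e)" "\<lambda>t. F (x + t *\<^sub>R ?e) \<bullet> ?e"] C1gradD(8)[OF f] h by auto
        then have "norm (q k x) = \<bar>F (x + t *\<^sub>R ?e) \<bullet> ?e\<bar>" using h(1)[of k] by (simp add: q_def)
        also have "\<dots> \<le> norm (F (x + t *\<^sub>R ?e)) * norm ?e" by (rule Cauchy_Schwarz_ineq2)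
        also have "\<dots> \<le> B" using FB by simp
        finally show ?thesis using True by simp
      next
        case False
        have "norm (x + h k *\<^sub>R ?e) \<ge> norm x - norm (h k *\<^sub>R ?e)" by (rule norm_diff_ineq)
        then have "R < norm (x + h k *\<^sub>R ?e)" using False h[of k] by simp
        then show ?thesis using False R by (simp add: q_def)
      qed
    qed
  qed
  then have "(\<lambda>k::nat. 0) \<longlonglongrightarrow> (\<integral>x. F x $ i \<partial>lebesgue)" by (simp only: q0)
  then show ?thesis by (rule LIMSEQ_unique) (rule tendsto_const)
qed

lemma C1grad_has_weak_grad:
  assumes w: "C1grad w G" "sq_int lebesgue w" "sq_int lebesgue G"
  shows "has_weak_grad w G"
proof (rule has_weak_gradI[OF w(3)])
  fix \<phi> :: "real^'a \<Rightarrow> real" and i assume phi: "\<phi> \<in> test_fun"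
  obtain R where R: "\<And>x. R < norm x \<Longrightarrow> \<phi> x = 0" using test_funD(4)[OF phi] by auto
  have "(\<integral>x. (w x *\<^sub>R (\<chi> i. partial i \<phi> x) + \<phi> x *\<^sub>R G x) $ i \<partial>lebesgue) = 0"
    by (rule integral_gradient_zero[OF C1grad_mult[OF w(1) C1grad_test_fun[OF phi]]]) (use R in auto)
  then have "(\<integral>x. w x * partial i \<phi> x + G x $ i * \<phi> x \<partial>lebesgue) = 0"
    by (simp add: mult.commute)
  then show "(\<integral>x. w x * partial i \<phi> x \<partial>lebesgue) = - (\<integral>x. G x $ i * \<phi> x \<partial>lebesgue)"
    using sq_int_mult[OF w(2) test_fun_sq_int[OF test_fun_partial[OF phi]], of i]
      sq_int_mult[OF sq_int_component[OF w(3)] test_fun_sq_int[OF phi], of i] by simp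
qed

lemma partial_reflect:
  assumes "\<phi> \<in> test_fun"
  shows "partial i (\<lambda>y. \<phi> (x - y)) y = - partial i \<phi> (x - y)"
proof -
  have D: "((\<lambda>y. \<phi> (x - y)) has_derivative (\<lambda>h. frechet_derivative \<phi> (at (x - y)) (- h))) (at y)"
    by (rule has_derivative_compose[of "\<lambda>y. x - y" "\<lambda>h. - h" y UNIV \<phi>, OF _ has_derivative_frechet[OF test_funD(2)[OF assms]]])
       (auto intro!: derivative_eq_intros)
  moreover have "bounded_linear (frechet_derivative \<phi> (at (x - y)))"
    by (intro has_derivative_bounded_linear[OF has_derivative_frechet] test_funD assms)
  ultimately show ?thesis
    unfolding partial_eq[OF D] by (simp add: linear_neg bounded_linear.linear partial_def)
qed

text \<open>Moves the derivative from the kernel to the weak gradient. The sign from reflecting the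
  kernel cancels the sign in the definition of the weak gradient.\<close>

lemma conv_weak_grad:
  assumes "has_weak_grad u g" "\<phi> \<in> test_fun"
  shows "conv u (partial i \<phi>) x = conv (\<lambda>y. g y $ i) \<phi> x"
  using has_weak_gradD(2)[OF assms(1) test_fun_reflect[OF assms(2)], of i x] partial_reflect[OF assms(2), of i x]
  by (simp add: conv_def)

lemma nrm2_le_sum_components:
  assumes "sq_int M (f :: _ \<Rightarrow> real^'n::finite)"
  shows "nrm2 M f \<le> (\<Sum>i\<in>UNIV. nrm2 M (\<lambda>x. f x $ i))"
proof (rule power2_le_imp_le)
  have "(nrm2 M f)\<^sup>2 = (\<integral>x. (\<Sum>i\<in>UNIV. (f x $ i)\<^sup>2) \<partial>M)"
    unfolding nrm2_power2 by (simp add: norm_vec_def L2_set_def sum_nonneg)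
  also have "\<dots> = (\<Sum>i\<in>UNIV. (nrm2 M (\<lambda>x. f x $ i))\<^sup>2)"
    unfolding nrm2_power2 using sq_int_integrable[OF sq_int_component[OF assms]] by simp
  also have "\<dots> \<le> (\<Sum>i\<in>UNIV. nrm2 M (\<lambda>x. f x $ i))\<^sup>2"
  proof -
    have "(L2_set (\<lambda>i. nrm2 M (\<lambda>x. f x $ i)) UNIV)\<^sup>2 \<le> (\<Sum>i\<in>UNIV. nrm2 M (\<lambda>x. f x $ i))\<^sup>2"
      by (intro power_mono L2_set_le_sum) auto
    then show ?thesis by (simp add: L2_set_def sum_nonneg)
  qed
  finally show "(nrm2 M f)\<^sup>2 \<le> (\<Sum>i\<in>UNIV. nrm2 M (\<lambda>x. f x $ i))\<^sup>2" .
qed (simp add: sum_nonneg)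

lemma sq_int_vecI:
  assumes "\<And>i. sq_int M (\<lambda>x. f x $ i)"
  shows "sq_int M (f :: _ \<Rightarrow> real^'n::finite)"
proof -
  have "f = (\<lambda>x. \<Sum>i\<in>UNIV. (f x $ i) *\<^sub>R axis i 1)"
    using basis_expansion by (metis (no_types, lifting) ext scalar_mult_eq_scaleR sum.cong)
  moreover have "(\<lambda>x. \<Sum>i\<in>UNIV. (f x $ i) *\<^sub>R axis i (1::real)) \<in> borel_measurable M"
    using assms by (intro borel_measurable_sum borel_measurable_scaleR) (auto simp: sq_int_def)
  ultimately have m: "f \<in> borel_measurable M" by simp
  have "integrable M (\<lambda>x. \<Sum>i\<in>UNIV. (norm (f x $ i))\<^sup>2)"
    using assms by (intro Bochner_Integration.integrable_sum sq_int_integrable)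
  then show ?thesis using m by (simp add: sq_int_def norm_vec_def L2_set_def sum_nonneg)
qed

text \<open>Norm convergence serves limits of pairings and of norms; the almost everywhere
  convergence serves Fatou and dominated convergence.\<close>

definition C1_approx :: 
    "(real^'n::finite \<Rightarrow> real) \<Rightarrow> (real^'n \<Rightarrow> real^'n) \<Rightarrow> (nat \<Rightarrow> real^'n \<Rightarrow> real) \<Rightarrow> (nat \<Rightarrow> real^'n \<Rightarrow> real^'n) \<Rightarrow> bool" where
  "C1_approx u g w G \<longleftrightarrow> (\<forall>k. C1grad (w k) (G k) \<and> sq_int lebesgue (w k) \<and> sq_int lebesgue (G k)) \<and>
    (\<lambda>k. nrm2 lebesgue (\<lambda>x. w k x - u x)) \<longlonglongrightarrow> 0 \<and> (\<lambda>k. nrm2 lebesgue (\<lambda>x. G k x - g x)) \<longlonglongrightarrow> 0 \<and>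
    (AE x in lebesgue. (\<lambda>k. w k x) \<longlonglongrightarrow> u x) \<and> (AE x in lebesgue. (\<lambda>k. G k x) \<longlonglongrightarrow> g x)"

lemma C1_approxD:
  assumes "C1_approx u g w G"
  shows "C1grad (w k) (G k)" "sq_int lebesgue (w k)" "sq_int lebesgue (G k)"
    "(\<lambda>k. nrm2 lebesgue (\<lambda>x. w k x - u x)) \<longlonglongrightarrow> 0" "(\<lambda>k. nrm2 lebesgue (\<lambda>x. G k x - g x)) \<longlonglongrightarrow> 0"
    "AE x in lebesgue. (\<lambda>k. w k x) \<longlonglongrightarrow> u x" "AE x in lebesgue. (\<lambda>k. G k x) \<longlonglongrightarrow> g x"
  using assms by (simp_all add: C1_approx_def)

lemma H1_approx:
  assumes g: "has_weak_grad u g" and u: "sq_int lebesgue u"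
  shows "\<exists>w G. C1_approx u g w G"
proof -
  have gs: "sq_int lebesgue g" using g by (rule has_weak_gradD)
  obtain k0 where k0: "\<And>k. k \<ge> k0 \<Longrightarrow> sq_int lebesgue (conv u (eta (real k)))"
    using conv_eta_LIMSEQ(1)[OF u] by auto
  obtain k1 where k1: "\<And>k i. k \<ge> k1 i \<Longrightarrow> sq_int lebesgue (conv (\<lambda>x. g x $ i) (eta (real k)))"
    using conv_eta_LIMSEQ(1)[OF sq_int_component[OF gs]] by metis
  \<comment> \<open>One shift of the index that makes the mollifier parameter positive and all of
    the finitely many mollifications, of the function and of each gradient component, square
    integrable.\<close>
  define N where "N = 1 + k0 + (\<Sum>i\<in>UNIV. k1 i)"
  have N: "N \<ge> 1" "N \<ge> k0" "N \<ge> k1 i" for i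
    using member_le_sum[of i UNIV k1] by (auto simp: N_def)
  define w where "w k = conv u (eta (real (k + N)))" for k
  define G where "G k x = (\<chi> i. conv u (partial i (eta (real (k + N)))) x)" for k x
  have et: "eta (real (k + N)) \<in> test_fun" for k using N(1) by (intro eta_facts) simp
  have C: "C1grad (w k) (G k)" for k unfolding w_def G_def[abs_def] by (rule C1grad_conv[OF u et])
  have Gi: "G k x $ i = conv (\<lambda>x. g x $ i) (eta (real (k + N))) x" for k x i
    using conv_weak_grad[OF g et] by (simp add: G_def)
  have ws: "sq_int lebesgue (w k)" for k unfolding w_def using N by (intro k0) simp
  have Gis: "sq_int lebesgue (\<lambda>x. G k x $ i)" for k i
    unfolding Gi using k1[of i "k + N"] N(3)[of i] by simp
  then have Gs: "sq_int lebesgue (G k)" for k by (rule sq_int_vecI)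
  have wl: "(\<lambda>k. nrm2 lebesgue (\<lambda>x. w k x - u x)) \<longlonglongrightarrow> 0"
    unfolding w_def by (rule LIMSEQ_ignore_initial_segment[OF conv_eta_LIMSEQ(2)[OF u]])
  have Gil: "(\<lambda>k. nrm2 lebesgue (\<lambda>x. G k x $ i - g x $ i)) \<longlonglongrightarrow> 0" for i
    unfolding Gi by (rule LIMSEQ_ignore_initial_segment[OF conv_eta_LIMSEQ(2)[OF sq_int_component[OF gs]]])
  have Gl: "(\<lambda>k. nrm2 lebesgue (\<lambda>x. G k x - g x)) \<longlonglongrightarrow> 0"
  proof (rule tendsto_sandwich[of "\<lambda>_. 0"])
    show "\<forall>\<^sub>F k in sequentially. nrm2 lebesgue (\<lambda>x. G k x - g x) \<le> (\<Sum>i\<in>UNIV. nrm2 lebesgue (\<lambda>x. G k x $ i - g x $ i))"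
      using nrm2_le_sum_components[OF sq_int_diff[OF Gs gs]] by simp
    have "(\<lambda>k. \<Sum>i\<in>UNIV. nrm2 lebesgue (\<lambda>x. G k x $ i - g x $ i)) \<longlonglongrightarrow> (\<Sum>i\<in>(UNIV::'a set). 0)"
      by (intro tendsto_sum Gil)
    then show "(\<lambda>k. \<Sum>i\<in>UNIV. nrm2 lebesgue (\<lambda>x. G k x $ i - g x $ i)) \<longlonglongrightarrow> 0" by simp
  qed auto
  \<comment> \<open>Two successive extractions: the first for the functions, the second, inside it,
    for the gradients.\<close>
  obtain r1 :: "nat \<Rightarrow> nat" where r1: "strict_mono r1" "AE x in lebesgue. (\<lambda>k. w (r1 k) x) \<longlonglongrightarrow> u x"
    using nrm2_AE_subseq[OF ws u wl] by auto
  have Gl1: "(\<lambda>k. nrm2 lebesgue (\<lambda>x. G (r1 k) x - g x)) \<longlonglongrightarrow> 0"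
    using LIMSEQ_subseq_LIMSEQ[OF Gl r1(1)] by (simp add: comp_def)
  obtain r2 :: "nat \<Rightarrow> nat" where r2: "strict_mono r2" "AE x in lebesgue. (\<lambda>k. G (r1 (r2 k)) x) \<longlonglongrightarrow> g x"
    using nrm2_AE_subseq[OF Gs gs Gl1] by auto
  show ?thesis
    unfolding C1_approx_def
  proof (intro exI[of _ "\<lambda>k. w (r1 (r2 k))"] exI[of _ "\<lambda>k. G (r1 (r2 k))"] conjI)
    show "(\<lambda>k. nrm2 lebesgue (\<lambda>x. w (r1 (r2 k)) x - u x)) \<longlonglongrightarrow> 0"
      using LIMSEQ_subseq_LIMSEQ[OF LIMSEQ_subseq_LIMSEQ[OF wl r1(1)] r2(1)] by (simp add: comp_def)
    show "(\<lambda>k. nrm2 lebesgue (\<lambda>x. G (r1 (r2 k)) x - g x)) \<longlonglongrightarrow> 0"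
      using LIMSEQ_subseq_LIMSEQ[OF Gl1 r2(1)] by (simp add: comp_def)
    show "AE x in lebesgue. (\<lambda>k. w (r1 (r2 k)) x) \<longlonglongrightarrow> u x"
      using r1(2) 
    proof eventually_elim
      case (elim x)
      then show ?case using LIMSEQ_subseq_LIMSEQ[OF elim r2(1)] by (simp add: comp_def)
    qed
  qed (use C ws Gs r2 in auto)
qed

section \<open>Translations and dilations in the first Sobolev space\<close>

lemma has_weak_grad_some: "has_weak_grad u g \<Longrightarrow> has_weak_grad u (weak_grad u)"
  unfolding weak_grad_def by (rule someI[of "has_weak_grad u"])

lemma has_weak_grad_weak_grad: "u \<in> H1 \<Longrightarrow> has_weak_grad u (weak_grad u)"
  unfolding H1_def by (auto intro: has_weak_grad_some)

lemma H1_sq_int [intro]: "u \<in> H1 \<Longrightarrow> sq_int lebesgue u"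
  by (simp add: H1_iff)

lemma weak_grad_sq_int [intro]: "u \<in> H1 \<Longrightarrow> sq_int lebesgue (weak_grad u)"
  by (rule has_weak_gradD[OF has_weak_grad_weak_grad])

lemma weak_grad_AE: "has_weak_grad u g \<Longrightarrow> AE x in lebesgue. weak_grad u x = g x"
  by (rule weak_grad_unique[OF has_weak_grad_some])

definition gnrm :: "(real^'n::finite \<Rightarrow> real) \<Rightarrow> real" where
  "gnrm u = nrm2 lebesgue (weak_grad u)"

lemma gnrm_nonneg [simp]: "0 \<le> gnrm u" by (simp add: gnrm_def)

lemma H1I: "sq_int lebesgue u \<Longrightarrow> has_weak_grad u g \<Longrightarrow> u \<in> H1"
  by (auto simp: H1_iff)

lemma gnrm_eq: 
  assumes "has_weak_grad u g" shows "gnrm u = nrm2 lebesgue g"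
proof -
  have "has_weak_grad u (weak_grad u)" using assms by (rule has_weak_grad_some)
  then show ?thesis unfolding gnrm_def 
    using weak_grad_AE[OF assms] has_weak_gradD(1)[OF assms] has_weak_gradD(1) 
    by (intro nrm2_cong_AE) (auto simp: sq_int_def)
qed

lemma has_weak_grad_lincomb:
  assumes "has_weak_grad u g" "has_weak_grad v h" "sq_int lebesgue u" "sq_int lebesgue v"
  shows "has_weak_grad (\<lambda>x. a * u x + b * v x) (\<lambda>x. a *\<^sub>R g x + b *\<^sub>R h x)"
proof (rule has_weak_gradI)
  note s = has_weak_gradD(1)[OF assms(1)] has_weak_gradD(1)[OF assms(2)]
  show "sq_int lebesgue (\<lambda>x. a *\<^sub>R g x + b *\<^sub>R h x)" by (intro sq_int_add sq_int_scaleR s)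
  fix \<phi> :: "real^'a \<Rightarrow> real" and i assume phi: "\<phi> \<in> test_fun"
  note p = test_fun_sq_int[OF test_fun_partial[OF phi], of i] test_fun_sq_int[OF phi]
  have "(\<integral>x. (a * u x + b * v x) * partial i \<phi> x \<partial>lebesgue) = a * (\<integral>x. u x * partial i \<phi> x \<partial>lebesgue) + b * (\<integral>x. v x * partial i \<phi> x \<partial>lebesgue)"
    using sq_int_mult[OF assms(3) p(1)] sq_int_mult[OF assms(4) p(1)] by (simp add: distrib_right mult.assoc)
  also have "\<dots> = - (a * (\<integral>x. g x $ i * \<phi> x \<partial>lebesgue) + b * (\<integral>x. h x $ i * \<phi> x \<partial>lebesgue))"
    by (simp add: has_weak_gradD(2)[OF assms(1) phi] has_weak_gradD(2)[OF assms(2) phi])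
  also have "\<dots> = - (\<integral>x. (a *\<^sub>R g x + b *\<^sub>R h x) $ i * \<phi> x \<partial>lebesgue)"
    using sq_int_mult[OF sq_int_component[OF s(1)] p(2)] sq_int_mult[OF sq_int_component[OF s(2)] p(2)]
    by (simp add: distrib_right mult.assoc)
  finally show "(\<integral>x. (a * u x + b * v x) * partial i \<phi> x \<partial>lebesgue) = - (\<integral>x. (a *\<^sub>R g x + b *\<^sub>R h x) $ i * \<phi> x \<partial>lebesgue)" .
qed

lemma H1_lincomb: "u \<in> H1 \<Longrightarrow> v \<in> H1 \<Longrightarrow> (\<lambda>x. a * u x + b * v x) \<in> H1"
  by (rule H1I[OF sq_int_add[OF sq_int_cmult sq_int_cmult] has_weak_grad_lincomb[OF has_weak_grad_weak_grad has_weak_grad_weak_grad]])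
     (simp_all add: H1_sq_int)

lemma weak_grad_lincomb: 
  assumes "u \<in> H1" "v \<in> H1"
  shows "AE x in lebesgue. weak_grad (\<lambda>x. a * u x + b * v x) x = a *\<^sub>R weak_grad u x + b *\<^sub>R weak_grad v x"
  using assms by (intro weak_grad_AE has_weak_grad_lincomb has_weak_grad_weak_grad H1_sq_int)

section \<open>L2 estimates for translations and dilations\<close>

lemma FTC_square_bound:
  fixes f :: "real \<Rightarrow> real"
  assumes "a \<le> b" and D: "\<And>t. (f has_real_derivative f' t) (at t)" and c: "continuous_on UNIV f'"
  shows "ennreal ((f b - f a)\<^sup>2) \<le> ennreal (b - a) * (\<integral>\<^sup>+t. ennreal ((f' t)\<^sup>2) * indicator {a..b} t \<partial>lborel)"
proof -
  have [measurable]: "f' \<in> borel_measurable borel" using c by (rule borel_measurable_continuous_onI)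
  have FTC: "has_bochner_integral lborel (\<lambda>x. f' x * indicator {a..b} x) (f b - f a)"
    by (rule has_bochner_integral_FTC_Icc_real[OF assms(1) D])
       (use c in \<open>auto simp: continuous_on_eq_continuous_at\<close>)
  then have "ennreal \<bar>f b - f a\<bar> \<le> (\<integral>\<^sup>+t. norm (f' t * indicator {a..b} t) \<partial>lborel)"
    using integral_norm_bound_ennreal[of lborel "\<lambda>x. f' x * indicator {a..b} x"] 
    by (auto simp: has_bochner_integral_iff)
  also have "\<dots> = (\<integral>\<^sup>+t. ennreal (\<bar>f' t\<bar> * indicator {a..b} t) * indicator {a..b} t \<partial>lborel)"
    by (intro nn_integral_cong) (auto simp: indicator_def)
  finally have "(ennreal \<bar>f b - f a\<bar>)\<^sup>2 \<le> (\<integral>\<^sup>+t. ennreal (\<bar>f' t\<bar> * indicator {a..b} t) * indicator {a..b} t \<partial>lborel)\<^sup>2"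
    by (rule power_mono) simp
  also have "\<dots> \<le> (\<integral>\<^sup>+t. (ennreal (\<bar>f' t\<bar> * indicator {a..b} t))\<^sup>2 \<partial>lborel) * (\<integral>\<^sup>+t. (indicator {a..b} t)\<^sup>2 \<partial>lborel)"
    by (rule Cauchy_Schwarz_nn_integral) auto
  also have "(\<integral>\<^sup>+t. (indicator {a..b} t)\<^sup>2 \<partial>lborel) = (\<integral>\<^sup>+t. indicator {a..b} t \<partial>lborel)"
    by (intro nn_integral_cong) (auto simp: indicator_def)
  also have "\<dots> = ennreal (b - a)" using assms(1) by simp
  also have "(\<integral>\<^sup>+t. (ennreal (\<bar>f' t\<bar> * indicator {a..b} t))\<^sup>2 \<partial>lborel) = (\<integral>\<^sup>+t. ennreal ((f' t)\<^sup>2) * indicator {a..b} t \<partial>lborel)"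
    by (intro nn_integral_cong) (auto simp: indicator_def ennreal_power)
  finally show ?thesis by (simp add: ennreal_power mult.commute)
qed

lemma nn_integral_lborel_affine:
  fixes f :: "'a::euclidean_space \<Rightarrow> ennreal"
  assumes [measurable]: "f \<in> borel_measurable borel" and c: "c \<noteq> 0"
  shows "(\<integral>\<^sup>+x. f x \<partial>lborel) = ennreal (\<bar>c\<bar> ^ DIM('a)) * (\<integral>\<^sup>+x. f (t + c *\<^sub>R x) \<partial>lborel)"
  using nn_integral_lebesgue_affine[OF c, of f t] 
  by (simp add: nn_integral_lebesgue_lborel measurable_completion)

text \<open>The fundamental theorem along the segment from x to x + z, then Fubini; each slice of
  the segment contributes the same integral by translation invariance.\<close>

lemma C1_translation:
  fixes w :: "real^'n::finite \<Rightarrow> real"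
  assumes w: "C1grad w G"
  shows "(\<integral>\<^sup>+x. ennreal ((w (x + z) - w x)\<^sup>2) \<partial>lborel) \<le> ennreal ((norm z)\<^sup>2) * (\<integral>\<^sup>+x. ennreal ((norm (G x))\<^sup>2) \<partial>lborel)"
proof -
  note [measurable] = C1gradD(4,5)[OF w]
  have "(\<integral>\<^sup>+x. ennreal ((w (x + z) - w x)\<^sup>2) \<partial>lborel) 
     \<le> (\<integral>\<^sup>+x. (\<integral>\<^sup>+t. ennreal ((norm z)\<^sup>2 * (norm (G (x + t *\<^sub>R z)))\<^sup>2) * indicator {0..1} t \<partial>lborel) \<partial>lborel)"
  proof (rule nn_integral_mono)
    fix x :: "real^'n"
    have "ennreal ((w (x + 1 *\<^sub>R z) - w (x + 0 *\<^sub>R z))\<^sup>2) 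
      \<le> ennreal (1 - 0) * (\<integral>\<^sup>+t. ennreal ((G (x + t *\<^sub>R z) \<bullet> z)\<^sup>2) * indicator {0..1} t \<partial>lborel)"
      by (rule FTC_square_bound[where f="\<lambda>t. w (x + t *\<^sub>R z)" and f'="\<lambda>t. G (x + t *\<^sub>R z) \<bullet> z"])
         (auto intro!: C1gradD(8)[OF w] continuous_intros continuous_on_compose2[OF C1gradD(2)[OF w]])
    also have "\<dots> \<le> (\<integral>\<^sup>+t. ennreal ((norm z)\<^sup>2 * (norm (G (x + t *\<^sub>R z)))\<^sup>2) * indicator {0..1} t \<partial>lborel)"
    proof -
      have "(G (x + t *\<^sub>R z) \<bullet> z)\<^sup>2 \<le> (norm z)\<^sup>2 * (norm (G (x + t *\<^sub>R z)))\<^sup>2" for t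
        using Cauchy_Schwarz_ineq[of "G (x + t *\<^sub>R z)" z] by (simp add: power2_norm_eq_inner mult.commute)
      then show ?thesis by (auto intro!: nn_integral_mono mult_right_mono ennreal_leI)
    qed
    finally show "ennreal ((w (x + z) - w x)\<^sup>2) \<le> (\<integral>\<^sup>+t. ennreal ((norm z)\<^sup>2 * (norm (G (x + t *\<^sub>R z)))\<^sup>2) * indicator {0..1} t \<partial>lborel)"
      by simp
  qed
  also have "\<dots> = (\<integral>\<^sup>+t. (\<integral>\<^sup>+x. ennreal ((norm z)\<^sup>2 * (norm (G (x + t *\<^sub>R z)))\<^sup>2) * indicator {0..1} t \<partial>lborel) \<partial>lborel)"
    by (rule lborel_pair.Fubini'[symmetric]) measurable
  also have "\<dots> = (\<integral>\<^sup>+t. (ennreal ((norm z)\<^sup>2) * (\<integral>\<^sup>+x. ennreal ((norm (G x))\<^sup>2) \<partial>lborel)) * indicator {0..1} (t::real) \<partial>lborel)"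
  proof (rule nn_integral_cong)
    fix t :: real
    have "(\<integral>\<^sup>+x. ennreal ((norm z)\<^sup>2 * (norm (G (x + t *\<^sub>R z)))\<^sup>2) * indicator {0..1} t \<partial>lborel)
        = ennreal ((norm z)\<^sup>2) * (\<integral>\<^sup>+x. ennreal ((norm (G (t *\<^sub>R z + 1 *\<^sub>R x)))\<^sup>2) \<partial>lborel) * indicator {0..1} t"
      by (simp add: nn_integral_multc nn_integral_cmult ennreal_mult add.commute)
    also have "(\<integral>\<^sup>+x. ennreal ((norm (G (t *\<^sub>R z + 1 *\<^sub>R x)))\<^sup>2) \<partial>lborel) = (\<integral>\<^sup>+x. ennreal ((norm (G x))\<^sup>2) \<partial>lborel)"
      using nn_integral_lborel_affine[of "\<lambda>x. ennreal ((norm (G x))\<^sup>2)" 1 "t *\<^sub>R z"] by simp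
    finally show "(\<integral>\<^sup>+x. ennreal ((norm z)\<^sup>2 * (norm (G (x + t *\<^sub>R z)))\<^sup>2) * indicator {0..1} t \<partial>lborel) = 
      ennreal ((norm z)\<^sup>2) * (\<integral>\<^sup>+x. ennreal ((norm (G x))\<^sup>2) \<partial>lborel) * indicator {0..1} t" .
  qed
  also have "\<dots> = ennreal ((norm z)\<^sup>2) * (\<integral>\<^sup>+x. ennreal ((norm (G x))\<^sup>2) \<partial>lborel)"
    by (subst nn_integral_cmult) auto
  finally show ?thesis .
qed

text \<open>The fundamental theorem along rays. The derivative of w(s x) in \<open>s\<close> is G(s
  x) . x, and its factor |x| is cancelled by the division by \<open>norm x\<close>. Substituting s x
  contributes s^-N, which is at most 1 because the parameter runs upwards from 1.\<close>

lemma C1_dilation: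
  fixes w :: "real^'n::finite \<Rightarrow> real"
  assumes w: "C1grad w G" and t: "1 \<le> t"
  shows "(\<integral>\<^sup>+x. ennreal (((w (t *\<^sub>R x) - w x) / norm x)\<^sup>2) \<partial>lborel) \<le> ennreal ((t - 1)\<^sup>2) * (\<integral>\<^sup>+x. ennreal ((norm (G x))\<^sup>2) \<partial>lborel)"
proof -
  note [measurable] = C1gradD(4,5)[OF w]
  have "(\<integral>\<^sup>+x. ennreal (((w (t *\<^sub>R x) - w x) / norm x)\<^sup>2) \<partial>lborel) 
     \<le> (\<integral>\<^sup>+x. (\<integral>\<^sup>+s. ennreal ((t - 1) * (norm (G (s *\<^sub>R x)))\<^sup>2) * indicator {1..t} s \<partial>lborel) \<partial>lborel)"
  proof (rule nn_integral_mono)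
    fix x :: "real^'n"
    have "ennreal ((w (0 + t *\<^sub>R x) - w (0 + 1 *\<^sub>R x))\<^sup>2) 
      \<le> ennreal (t - 1) * (\<integral>\<^sup>+s. ennreal ((G (0 + s *\<^sub>R x) \<bullet> x)\<^sup>2) * indicator {1..t} s \<partial>lborel)"
      by (rule FTC_square_bound[where f="\<lambda>s. w (0 + s *\<^sub>R x)" and f'="\<lambda>s. G (0 + s *\<^sub>R x) \<bullet> x", OF t C1gradD(8)[OF w]])
         (auto intro!: continuous_intros continuous_on_compose2[OF C1gradD(2)[OF w]])
    then have 1: "ennreal ((w (t *\<^sub>R x) - w x)\<^sup>2) \<le> ennreal (t - 1) * (\<integral>\<^sup>+s. ennreal ((G (s *\<^sub>R x) \<bullet> x)\<^sup>2) * indicator {1..t} s \<partial>lborel)"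
      by simp
    have 2: "(G (s *\<^sub>R x) \<bullet> x)\<^sup>2 \<le> (norm x)\<^sup>2 * (norm (G (s *\<^sub>R x)))\<^sup>2" for s
      using Cauchy_Schwarz_ineq[of "G (s *\<^sub>R x)" x] by (simp add: power2_norm_eq_inner mult.commute)
    have "ennreal (((w (t *\<^sub>R x) - w x) / norm x)\<^sup>2) = ennreal (1 / (norm x)\<^sup>2) * ennreal ((w (t *\<^sub>R x) - w x)\<^sup>2)"
      by (simp add: power_divide flip: ennreal_mult)
    also have "\<dots> \<le> ennreal (1 / (norm x)\<^sup>2) * (ennreal (t - 1) * (\<integral>\<^sup>+s. ennreal ((G (s *\<^sub>R x) \<bullet> x)\<^sup>2) * indicator {1..t} s \<partial>lborel))"
      by (intro mult_left_mono 1) auto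
    also have "\<dots> = (\<integral>\<^sup>+s. ennreal (1 / (norm x)\<^sup>2) * (ennreal (t - 1) * (ennreal ((G (s *\<^sub>R x) \<bullet> x)\<^sup>2) * indicator {1..t} s)) \<partial>lborel)"
      by (simp add: nn_integral_cmult)
    also have "\<dots> \<le> (\<integral>\<^sup>+s. ennreal ((t - 1) * (norm (G (s *\<^sub>R x)))\<^sup>2) * indicator {1..t} s \<partial>lborel)"
    proof (rule nn_integral_mono)
      fix s
      have "1 / (norm x)\<^sup>2 * ((t - 1) * (G (s *\<^sub>R x) \<bullet> x)\<^sup>2) \<le> (t - 1) * (norm (G (s *\<^sub>R x)))\<^sup>2"
      \<comment> \<open>At the origin the quotient is 0 by the convention for division.\<close>
      proof (cases "x = 0")
        case False
        then show ?thesis using mult_left_mono[OF 2[of s], of "t - 1"] t by (simp add: field_simps)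
      qed (use t in simp)
      then show "ennreal (1 / (norm x)\<^sup>2) * (ennreal (t - 1) * (ennreal ((G (s *\<^sub>R x) \<bullet> x)\<^sup>2) * indicator {1..t} s))
         \<le> ennreal ((t - 1) * (norm (G (s *\<^sub>R x)))\<^sup>2) * indicator {1..t} s"
        using t by (auto simp: indicator_def simp flip: ennreal_mult intro!: ennreal_leI)
    qed
    finally show "ennreal (((w (t *\<^sub>R x) - w x) / norm x)\<^sup>2) \<le> (\<integral>\<^sup>+s. ennreal ((t - 1) * (norm (G (s *\<^sub>R x)))\<^sup>2) * indicator {1..t} s \<partial>lborel)" .
  qed
  also have "\<dots> = (\<integral>\<^sup>+s. (\<integral>\<^sup>+x. ennreal ((t - 1) * (norm (G (s *\<^sub>R x)))\<^sup>2) * indicator {1..t} s \<partial>lborel) \<partial>lborel)"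
    by (rule lborel_pair.Fubini'[symmetric]) measurable
  also have "\<dots> \<le> (\<integral>\<^sup>+s. (ennreal (t - 1) * (\<integral>\<^sup>+x. ennreal ((norm (G x))\<^sup>2) \<partial>lborel)) * indicator {1..t} (s::real) \<partial>lborel)"
  proof (rule nn_integral_mono)
    fix s :: real
    show "(\<integral>\<^sup>+x. ennreal ((t - 1) * (norm (G (s *\<^sub>R x)))\<^sup>2) * indicator {1..t} s \<partial>lborel)
        \<le> (ennreal (t - 1) * (\<integral>\<^sup>+x. ennreal ((norm (G x))\<^sup>2) \<partial>lborel)) * indicator {1..t} s"
    proof (cases "s \<in> {1..t}")
      case True
      then have s: "s \<noteq> 0" "1 \<le> s" by auto
      have "(\<integral>\<^sup>+x. ennreal ((norm (G x))\<^sup>2) \<partial>lborel) = ennreal (\<bar>s\<bar> ^ CARD('n)) * (\<integral>\<^sup>+x. ennreal ((norm (G (0 + s *\<^sub>R x)))\<^sup>2) \<partial>lborel)"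
        using nn_integral_lborel_affine[of "\<lambda>x. ennreal ((norm (G x))\<^sup>2)" s 0] s by simp
      moreover have "1 \<le> ennreal (\<bar>s\<bar> ^ CARD('n))" using s by (simp add: one_le_power)
      ultimately have "(\<integral>\<^sup>+x. ennreal ((norm (G (s *\<^sub>R x)))\<^sup>2) \<partial>lborel) \<le> (\<integral>\<^sup>+x. ennreal ((norm (G x))\<^sup>2) \<partial>lborel)"
        using mult_right_mono[of 1 "ennreal (\<bar>s\<bar> ^ CARD('n))" "\<integral>\<^sup>+x. ennreal ((norm (G (0 + s *\<^sub>R x)))\<^sup>2) \<partial>lborel"] by simp
      then show ?thesis using t
        by (simp add: nn_integral_multc nn_integral_cmult ennreal_mult mult_left_mono mult_right_mono)
    qed simp
  qed
  also have "\<dots> = ennreal (t - 1) * (\<integral>\<^sup>+x. ennreal ((norm (G x))\<^sup>2) \<partial>lborel) * ennreal (t - 1)"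
    using t by (subst nn_integral_cmult) auto
  also have "\<dots> = ennreal ((t - 1)\<^sup>2) * (\<integral>\<^sup>+x. ennreal ((norm (G x))\<^sup>2) \<partial>lborel)"
    using t by (simp add: power2_eq_square ennreal_mult mult_ac)
  finally show ?thesis .
qed

lemma C1_nn_integral_grad:
  "C1grad w G \<Longrightarrow> sq_int lebesgue G \<Longrightarrow> (\<integral>\<^sup>+x. ennreal ((norm (G x))\<^sup>2) \<partial>lborel) = ennreal ((nrm2 lebesgue G)\<^sup>2)"
  using C1gradD(4)[of w G] by (subst nn_integral_sq_int[symmetric]) (auto simp: nn_integral_lebesgue_lborel)

lemma H1_translation:
  fixes u :: "real^'n::finite \<Rightarrow> real"
  assumes g: "has_weak_grad u g" and u: "sq_int lebesgue u"
  shows "nrm2 lebesgue (\<lambda>x. u (x + z) - u x) \<le> norm z * nrm2 lebesgue g"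
proof -
  obtain w G where "C1_approx u g w G" using H1_approx[OF g u] by auto
  note wG = C1_approxD[OF this]
  note us = sq_int_diff[OF sq_int_translate(1)[OF u, of z] u]
  have "(\<integral>\<^sup>+x. ennreal ((norm (u (x + z) - u x))\<^sup>2) \<partial>lebesgue) \<le> ennreal ((norm z * nrm2 lebesgue g)\<^sup>2)"
  proof (rule nn_integral_Fatou[where c="\<lambda>k. (norm z * nrm2 lebesgue (G k))\<^sup>2" and f="\<lambda>k x. (norm (w k (x + z) - w k x))\<^sup>2"])
    have "sq_int lebesgue (\<lambda>x. w k (x + z) - w k x)" for k by (intro sq_int_diff sq_int_translate wG)
    then show "(\<lambda>x. (norm (w k (x + z) - w k x))\<^sup>2) \<in> borel_measurable lebesgue" for k
      using sq_int_integrable by blast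
    show "(\<lambda>x. (norm (u (x + z) - u x))\<^sup>2) \<in> borel_measurable lebesgue"
      using sq_int_integrable[OF us] by auto
    have "AE x in lebesgue. (\<lambda>k. w k (z + 1 *\<^sub>R x)) \<longlonglongrightarrow> u (z + 1 *\<^sub>R x)"
      by (rule AE_lebesgue_affine[OF _ wG(6)]) simp
    then show "AE x in lebesgue. (\<lambda>k. (norm (w k (x + z) - w k x))\<^sup>2) \<longlonglongrightarrow> (norm (u (x + z) - u x))\<^sup>2"
      using wG(6) 
    proof eventually_elim
      case (elim x)
      then show ?case by (intro tendsto_intros) (auto simp: add.commute)
    qed
    show "(\<lambda>k. (norm z * nrm2 lebesgue (G k))\<^sup>2) \<longlonglongrightarrow> (norm z * nrm2 lebesgue g)\<^sup>2"
      by (intro tendsto_intros nrm2_tendsto wG has_weak_gradD(1)[OF g])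
    show "(\<integral>\<^sup>+x. ennreal ((norm (w k (x + z) - w k x))\<^sup>2) \<partial>lebesgue) \<le> ennreal ((norm z * nrm2 lebesgue (G k))\<^sup>2)" for k
    proof -
      note [measurable] = C1gradD(5)[OF wG(1)[of k]]
      show ?thesis using C1_translation[OF wG(1)[of k], of z]
        by (simp add: nn_integral_lebesgue_lborel C1_nn_integral_grad[OF wG(1,3)] power_mult_distrib ennreal_mult)
    qed
  qed
  then show ?thesis using us by (intro nn_integral_sq_le_imp(2)) (auto simp: sq_int_def)
qed

text \<open>The quotient by \<open>norm x\<close> is the right object because V times a dilation
  difference then splits as V(x) |x| times a function of L2 norm O(t - 1).\<close>

lemma H1_dilation:
  fixes u :: "real^'n::finite \<Rightarrow> real"
  assumes g: "has_weak_grad u g" and u: "sq_int lebesgue u" and t: "1 \<le> t"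
  shows "sq_int lebesgue (\<lambda>x. (u (t *\<^sub>R x) - u x) / norm x)"
    "nrm2 lebesgue (\<lambda>x. (u (t *\<^sub>R x) - u x) / norm x) \<le> (t - 1) * nrm2 lebesgue g"
proof -
  obtain w G where "C1_approx u g w G" using H1_approx[OF g u] by auto
  note wG = C1_approxD[OF this]
  have t0: "t \<noteq> 0" using t by simp
  have "sq_int lebesgue (\<lambda>x. u (0 + t *\<^sub>R x))" using sq_int_affine(1)[OF t0 u, of 0] .
  then have [measurable]: "(\<lambda>x. u (t *\<^sub>R x)) \<in> borel_measurable lebesgue" "u \<in> borel_measurable lebesgue" 
    using u by (auto simp: sq_int_def)
  have nm [measurable]: "(\<lambda>x::real^'n. norm x) \<in> borel_measurable lebesgue"
    by (intro continuous_borel_lebesgue continuous_intros)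
  have um: "(\<lambda>x. (u (t *\<^sub>R x) - u x) / norm x) \<in> borel_measurable lebesgue" by measurable
  have "(\<integral>\<^sup>+x. ennreal ((norm ((u (t *\<^sub>R x) - u x) / norm x))\<^sup>2) \<partial>lebesgue) \<le> ennreal (((t - 1) * nrm2 lebesgue g)\<^sup>2)"
  proof (rule nn_integral_Fatou[where c="\<lambda>k. ((t - 1) * nrm2 lebesgue (G k))\<^sup>2" and f="\<lambda>k x. (norm ((w k (t *\<^sub>R x) - w k x) / norm x))\<^sup>2"])
    show "(\<lambda>x. (norm ((w k (t *\<^sub>R x) - w k x) / norm x))\<^sup>2) \<in> borel_measurable lebesgue" for k
    proof -
      have "(\<lambda>x. w k (t *\<^sub>R x)) \<in> borel_measurable lebesgue" 
        by (intro continuous_borel_lebesgue continuous_on_compose2[OF C1gradD(3)[OF wG(1)]] continuous_intros) auto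
      then show ?thesis using C1gradD(7)[OF wG(1)[of k]] by measurable
    qed
    show "(\<lambda>x. (norm ((u (t *\<^sub>R x) - u x) / norm x))\<^sup>2) \<in> borel_measurable lebesgue"
      using um by measurable
    have "AE x in lebesgue. (\<lambda>k. w k (0 + t *\<^sub>R x)) \<longlonglongrightarrow> u (0 + t *\<^sub>R x)"
      by (rule AE_lebesgue_affine[OF t0 wG(6)])
    then show "AE x in lebesgue. (\<lambda>k. (norm ((w k (t *\<^sub>R x) - w k x) / norm x))\<^sup>2) \<longlonglongrightarrow> (norm ((u (t *\<^sub>R x) - u x) / norm x))\<^sup>2"
      using wG(6) 
    proof eventually_elim
      case (elim x)
      then show ?case unfolding divide_inverse by (intro tendsto_intros) auto
    qed
    show "(\<lambda>k. ((t - 1) * nrm2 lebesgue (G k))\<^sup>2) \<longlonglongrightarrow> ((t - 1) * nrm2 lebesgue g)\<^sup>2"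
      by (intro tendsto_intros nrm2_tendsto wG has_weak_gradD(1)[OF g])
    show "(\<integral>\<^sup>+x. ennreal ((norm ((w k (t *\<^sub>R x) - w k x) / norm x))\<^sup>2) \<partial>lebesgue) \<le> ennreal (((t - 1) * nrm2 lebesgue (G k))\<^sup>2)" for k
    proof -
      note [measurable] = C1gradD(5)[OF wG(1)[of k]]
      show ?thesis using C1_dilation[OF wG(1)[of k] t]
        by (simp add: nn_integral_lebesgue_lborel C1_nn_integral_grad[OF wG(1,3)] power_mult_distrib ennreal_mult power_divide)
    qed
  qed
  from nn_integral_sq_le_imp[OF um this] t
  show "sq_int lebesgue (\<lambda>x. (u (t *\<^sub>R x) - u x) / norm x)"
    "nrm2 lebesgue (\<lambda>x. (u (t *\<^sub>R x) - u x) / norm x) \<le> (t - 1) * nrm2 lebesgue g" by auto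
qed

section \<open>The Sobolev inequality\<close>

lemma C1grad_compose:
  assumes w: "C1grad w G" and F: "\<And>s. (F has_real_derivative f s) (at s)" "continuous_on UNIV f"
  shows "C1grad (\<lambda>x. F (w x)) (\<lambda>x. f (w x) *\<^sub>R G x)"
  unfolding C1grad_def
proof (intro conjI allI)
  show "((\<lambda>x. F (w x)) has_derivative (\<lambda>h. (f (w x) *\<^sub>R G x) \<bullet> h)) (at x)" for x
    by (rule has_derivative_eq_rhs[OF has_derivative_compose[OF C1gradD(1)[OF w] F(1)[unfolded has_field_derivative_def]]])
       simp
  show "continuous_on UNIV (\<lambda>x. f (w x) *\<^sub>R G x)"
    by (intro continuous_intros C1gradD[OF w] continuous_on_compose2[OF F(2) C1gradD(3)[OF w]]) auto
qed

text \<open>Integrated over all shifts, the autocorrelation of |v| is the square of its integral,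
  which Cauchy-Schwarz on the support of \<open>v\<close> bounds.\<close>

lemma nn_integral_shift_product_le:
  fixes v :: "real^'n::finite \<Rightarrow> real"
  assumes [measurable]: "v \<in> borel_measurable borel"
  shows "(\<integral>\<^sup>+z. (\<integral>\<^sup>+x. ennreal (\<bar>v x\<bar> * \<bar>v (x + z)\<bar>) \<partial>lborel) \<partial>lborel) 
     \<le> (\<integral>\<^sup>+x. ennreal ((v x)\<^sup>2) \<partial>lborel) * emeasure lborel {x. v x \<noteq> 0}"
proof -
  define I where "I = (\<integral>\<^sup>+x. ennreal \<bar>v x\<bar> \<partial>lborel)"
  have "(\<integral>\<^sup>+z. (\<integral>\<^sup>+x. ennreal (\<bar>v x\<bar> * \<bar>v (x + z)\<bar>) \<partial>lborel) \<partial>lborel) 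
    = (\<integral>\<^sup>+x. (\<integral>\<^sup>+z. ennreal (\<bar>v x\<bar> * \<bar>v (x + z)\<bar>) \<partial>lborel) \<partial>lborel)"
    by (rule lborel_pair.Fubini') measurable
  also have "\<dots> = (\<integral>\<^sup>+x. ennreal \<bar>v x\<bar> * I \<partial>lborel)"
  proof (rule nn_integral_cong)
    fix x :: "real^'n"
    have "(\<integral>\<^sup>+z. ennreal \<bar>v (x + 1 *\<^sub>R z)\<bar> \<partial>lborel) = I"
      using nn_integral_lborel_affine[of "\<lambda>x. ennreal \<bar>v x\<bar>" 1 x] by (simp add: I_def)
    then show "(\<integral>\<^sup>+z. ennreal (\<bar>v x\<bar> * \<bar>v (x + z)\<bar>) \<partial>lborel) = ennreal \<bar>v x\<bar> * I"
      by (simp add: ennreal_mult nn_integral_cmult)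
  qed
  also have "\<dots> = I\<^sup>2" by (simp add: nn_integral_multc I_def power2_eq_square)
  also have "I = (\<integral>\<^sup>+x. ennreal \<bar>v x\<bar> * indicator {x. v x \<noteq> 0} x \<partial>lborel)"
    unfolding I_def by (intro nn_integral_cong) (auto simp: indicator_def)
  also have "\<dots>\<^sup>2 \<le> (\<integral>\<^sup>+x. (ennreal \<bar>v x\<bar>)\<^sup>2 \<partial>lborel) * (\<integral>\<^sup>+x. (indicator {x. v x \<noteq> 0} x)\<^sup>2 \<partial>lborel)"
    by (rule Cauchy_Schwarz_nn_integral) auto
  also have "(\<integral>\<^sup>+x. (indicator {x. v x \<noteq> 0} x)\<^sup>2 \<partial>lborel) = (\<integral>\<^sup>+x. indicator {x. v x \<noteq> 0} x \<partial>lborel)"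
    by (intro nn_integral_cong) (auto simp: indicator_def)
  finally show ?thesis by (simp add: ennreal_power)
qed

text \<open>On a ball with twice the volume of the support, the average of the autocorrelation
  of \<open>v\<close> is at most half of its value at \<open>0\<close>, while the translation estimate bounds the deviation.\<close>

lemma Faber_Krahn:
  fixes v :: "real^'n::finite \<Rightarrow> real"
  assumes v: "C1grad v H" "sq_int lebesgue v" "sq_int lebesgue H"
    and m: "emeasure lborel {x. v x \<noteq> 0} \<le> ennreal m" "0 < m" 
    and r: "0 < r" "emeasure lborel (ball (0::real^'n) r) = ennreal (2 * m)"
  shows "(nrm2 lebesgue v)\<^sup>2 \<le> r\<^sup>2 * (nrm2 lebesgue H)\<^sup>2"
proof -
  define N where "N = (nrm2 lebesgue v)\<^sup>2"
  define D where "D = r\<^sup>2 * (nrm2 lebesgue H)\<^sup>2"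
  have ND: "0 \<le> N" "0 \<le> D" by (auto simp: N_def D_def)
  note [measurable] = C1gradD(5)[OF v(1)]
  have [measurable]: "ball (0::real^'n) r \<in> sets borel" by simp
  have vs: "sq_int lebesgue (\<lambda>x. v (x + z))" for z by (intro sq_int_translate v)
  have prod: "integrable lebesgue (\<lambda>x. \<bar>v x\<bar> * \<bar>v (x + z)\<bar>)" for z
    using sq_int_integrable_mult[OF v(2) vs] by simp
  have *: "ennreal N \<le> ennreal (D / 2) + (\<integral>\<^sup>+x. ennreal (\<bar>v x\<bar> * \<bar>v (x + z)\<bar>) \<partial>lborel)" if z: "z \<in> ball 0 r" for z
  proof -
    have "(nrm2 lebesgue (\<lambda>x. v (x + z) - v x))\<^sup>2 = 2 * N - 2 * (\<integral>x. v x * v (x + z) \<partial>lebesgue)"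
      using nrm2_add_power2[OF vs[of z] sq_int_uminus[OF v(2)]] 
      by (simp add: nrm2_uminus sq_int_translate(2)[OF v(2)] N_def mult.commute[of "v _" "v (_ + _)"])
    moreover have "(nrm2 lebesgue (\<lambda>x. v (x + z) - v x))\<^sup>2 \<le> (norm z * nrm2 lebesgue H)\<^sup>2"
      by (intro power_mono H1_translation C1grad_has_weak_grad v) auto
    moreover have "(norm z * nrm2 lebesgue H)\<^sup>2 \<le> (r * nrm2 lebesgue H)\<^sup>2"
      using z by (intro power_mono mult_right_mono) (auto intro: less_imp_le)
    ultimately have "N \<le> D / 2 + (\<integral>x. v x * v (x + z) \<partial>lebesgue)" by (simp add: D_def power_mult_distrib)
    also have "\<dots> \<le> D / 2 + (\<integral>x. \<bar>v x\<bar> * \<bar>v (x + z)\<bar> \<partial>lebesgue)"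
      by (intro add_left_mono integral_mono prod sq_int_mult v vs) (simp flip: abs_mult)
    finally have "ennreal N \<le> ennreal (D / 2 + (\<integral>x. \<bar>v x\<bar> * \<bar>v (x + z)\<bar> \<partial>lebesgue))" by (rule ennreal_leI)
    also have "\<dots> = ennreal (D / 2) + ennreal (\<integral>x. \<bar>v x\<bar> * \<bar>v (x + z)\<bar> \<partial>lebesgue)"
      using ND by (intro ennreal_plus) (auto intro!: Bochner_Integration.integral_nonneg)
    also have "ennreal (\<integral>x. \<bar>v x\<bar> * \<bar>v (x + z)\<bar> \<partial>lebesgue) = (\<integral>\<^sup>+x. ennreal (\<bar>v x\<bar> * \<bar>v (x + z)\<bar>) \<partial>lebesgue)"
      by (intro nn_integral_eq_integral[symmetric] prod) auto
    also have "\<dots> = (\<integral>\<^sup>+x. ennreal (\<bar>v x\<bar> * \<bar>v (x + z)\<bar>) \<partial>lborel)"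
      by (rule nn_integral_lebesgue_lborel) simp
    finally show ?thesis .
  qed
  have "(\<integral>\<^sup>+z. ennreal N * indicator (ball (0::real^'n) r) z \<partial>lborel) 
     \<le> (\<integral>\<^sup>+z. ennreal (D / 2) * indicator (ball (0::real^'n) r) z + (\<integral>\<^sup>+x. ennreal (\<bar>v x\<bar> * \<bar>v (x + z)\<bar>) \<partial>lborel) \<partial>lborel)"
    using * by (intro nn_integral_mono) (auto simp: indicator_def)
  also have "\<dots> = ennreal (D / 2) * ennreal (2 * m) + (\<integral>\<^sup>+z. (\<integral>\<^sup>+x. ennreal (\<bar>v x\<bar> * \<bar>v (x + z)\<bar>) \<partial>lborel) \<partial>lborel)"
    by (subst nn_integral_add) (measurable, simp add: nn_integral_cmult r)
  also have "\<dots> \<le> ennreal (D / 2) * ennreal (2 * m) + (\<integral>\<^sup>+x. ennreal ((v x)\<^sup>2) \<partial>lborel) * emeasure lborel {x. v x \<noteq> 0}"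
    by (intro add_left_mono nn_integral_shift_product_le) simp
  also have "\<dots> \<le> ennreal (D / 2) * ennreal (2 * m) + ennreal N * ennreal m"
  proof (intro add_left_mono mult_mono m(1))
    have "(\<integral>\<^sup>+x. ennreal ((v x)\<^sup>2) \<partial>lborel) = (\<integral>\<^sup>+x. ennreal ((norm (v x))\<^sup>2) \<partial>lebesgue)"
      by (subst nn_integral_lebesgue_lborel) auto
    then show "(\<integral>\<^sup>+x. ennreal ((v x)\<^sup>2) \<partial>lborel) \<le> ennreal N"
      using nn_integral_sq_int[OF v(2)] by (simp add: N_def)
  qed auto
  also have "\<dots> = ennreal (D * m + N * m)"
    using ND m(2) by (simp add: ennreal_plus flip: ennreal_mult)
  also have "(\<integral>\<^sup>+z. ennreal N * indicator (ball (0::real^'n) r) z \<partial>lborel) = ennreal (N * (2 * m))"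
    using ND m(2) by (simp add: nn_integral_cmult r ennreal_mult)
  finally have "N * (2 * m) \<le> D * m + N * m" using ND m(2) by (subst (asm) ennreal_le_iff) auto
  then have "N * m \<le> D * m" by simp
  then show ?thesis using m(2) by (simp add: N_def D_def)
qed

text \<open>The radius of the ball with volume 2 m has a square proportional to m^(2/N). This power
  of the measure of the support is what produces the critical exponent in the Sobolev
  inequality.\<close>

lemma Faber_Krahn_measure:
  "\<exists>K>0. \<forall>v H. \<forall>m>0. C1grad v H \<longrightarrow> sq_int lebesgue v \<longrightarrow> sq_int lebesgue H \<longrightarrow> 
     emeasure lborel {x::real^'n::finite. v x \<noteq> 0} \<le> ennreal m \<longrightarrow>
     (nrm2 lebesgue v)\<^sup>2 \<le> K * m powr (2 / real CARD('n)) * (nrm2 lebesgue H)\<^sup>2"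
proof -
  define \<omega> where "\<omega> = unit_ball_vol (real CARD('n))"
  have \<omega>: "0 < \<omega>" unfolding \<omega>_def by simp
  define K where "K = (2 / \<omega>) powr (2 / real CARD('n))"
  have "(nrm2 lebesgue v)\<^sup>2 \<le> K * m powr (2 / real CARD('n)) * (nrm2 lebesgue H)\<^sup>2"
    if v: "C1grad v H" "sq_int lebesgue v" "sq_int lebesgue H" and m: "0 < m" "emeasure lborel {x::real^'n. v x \<noteq> 0} \<le> ennreal m"
    for v H m
  proof -
    define r where "r = (2 * m / \<omega>) powr (1 / real CARD('n))"
    have r0: "0 < r" using m \<omega> by (simp add: r_def)
    have "r ^ CARD('n) = 2 * m / \<omega>"
      using m \<omega> by (simp add: r_def powr_power)
    then have "emeasure lborel (ball (0::real^'n) r) = ennreal (2 * m)"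
      using r0 less_imp_neq[OF \<omega>] by (simp add: emeasure_ball \<omega>_def ennreal_mult[symmetric])
    from Faber_Krahn[OF v m(2,1) r0 this]
    have "(nrm2 lebesgue v)\<^sup>2 \<le> r\<^sup>2 * (nrm2 lebesgue H)\<^sup>2" .
    also have "r\<^sup>2 = (2 / \<omega> * m) powr (2 / real CARD('n))"
      by (simp add: r_def power2_eq_square flip: powr_add)
    also have "\<dots> = K * m powr (2 / real CARD('n))"
      using m \<omega> by (subst powr_mult) (auto simp: K_def)
    finally show ?thesis .
  qed
  then show ?thesis using \<omega> by (intro exI[of _ K]) (auto simp: K_def)
qed

section \<open>Truncation between two levels and the critical exponent\<close>

definition pos2 :: "real \<Rightarrow> real" where "pos2 t = (max 0 t)\<^sup>2"

lemma pos2_DERIV: "(pos2 has_real_derivative 2 * max 0 t) (at t)"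
proof (cases "t = 0")
  case True
  have "((\<lambda>h. (pos2 (0 + h) - pos2 0) / h) \<longlongrightarrow> 0) (at 0)"
  proof (rule filterlim_cong[THEN iffD1, rotated -1])
    have "((\<lambda>h::real. max 0 h) \<longlongrightarrow> max 0 0) (at 0)" by (intro tendsto_intros)
    then show "((\<lambda>h::real. max 0 h) \<longlongrightarrow> 0) (at 0)" by simp
    show "\<forall>\<^sub>F h in at 0. max 0 h = (pos2 (0 + h) - pos2 0) / h"
      unfolding eventually_at_filter by (auto simp: pos2_def max_def power2_eq_square intro!: always_eventually)
  qed auto
  then show ?thesis using True by (simp add: DERIV_def)
next
  case False
  consider "t < 0" | "0 < t" using False by linarith
  then show ?thesis
  proof cases
    case 1
    have "((\<lambda>t. 0) has_real_derivative 0) (at t)" by simp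
    then have "(pos2 has_real_derivative 0) (at t)"
    proof (rule DERIV_cong_ev[OF refl _ refl, THEN iffD1, rotated])
      have "\<forall>\<^sub>F x in nhds t. x < 0" using 1 by (intro order_tendstoD(2)[of "\<lambda>x. x" t]) (auto simp: filterlim_ident)
      then show "\<forall>\<^sub>F x in nhds t. 0 = pos2 x" by eventually_elim (simp add: pos2_def)
    qed
    then show ?thesis using 1 by simp
  next
    case 2
    have "((\<lambda>t. t\<^sup>2) has_real_derivative 2 * t) (at t)" by (auto intro!: derivative_eq_intros)
    then have "(pos2 has_real_derivative 2 * t) (at t)"
    proof (rule DERIV_cong_ev[OF refl _ refl, THEN iffD1, rotated])
      have "\<forall>\<^sub>F x in nhds t. 0 < x" using 2 by (intro order_tendstoD(1)[of "\<lambda>x. x" t]) (auto simp: filterlim_ident)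
      then show "\<forall>\<^sub>F x in nhds t. x\<^sup>2 = pos2 x" by eventually_elim (simp add: pos2_def)
    qed
    then show ?thesis using 2 by simp
  qed
qed

text \<open>A C^1 transition from 0 to 1 on the unit interval: the quadratic spline with second
  derivative 4 on the first half and -4 on the second.\<close>

definition step :: "real \<Rightarrow> real" where 
  "step t = 2 * (pos2 t - 2 * pos2 (t - 1/2) + pos2 (t - 1))"

definition step' :: "real \<Rightarrow> real" where 
  "step' t = 4 * (max 0 t - 2 * max 0 (t - 1/2) + max 0 (t - 1))"

lemma step_DERIV: "(step has_real_derivative step' t) (at t)"
proof -
  have "((\<lambda>t. pos2 (t - c)) has_real_derivative 2 * max 0 (t - c)) (at t)" for c
    using DERIV_chain2[OF pos2_DERIV DERIV_diff[OF DERIV_ident DERIV_const], of c t UNIV] by simp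
  note d = this
  show ?thesis unfolding step_def[abs_def] step'_def
    by (rule DERIV_cong[OF DERIV_cmult[OF DERIV_add[OF DERIV_diff[OF pos2_DERIV DERIV_cmult[OF d]] d]]]) simp
qed

lemma step_facts:
  "t \<le> 0 \<Longrightarrow> step t = 0" "1 \<le> t \<Longrightarrow> step t = 1" "\<bar>step t\<bar> \<le> 1"
  "t \<le> 0 \<or> 1 \<le> t \<Longrightarrow> step' t = 0" "\<bar>step' t\<bar> \<le> 2"
proof -
  show "t \<le> 0 \<Longrightarrow> step t = 0" by (simp add: step_def pos2_def)
  show 1: "1 \<le> t \<Longrightarrow> step t = 1" by (simp add: step_def pos2_def power2_eq_square algebra_simps)
  show "\<bar>step t\<bar> \<le> 1"
  proof -
    consider "t \<le> 0" | "0 < t" "t \<le> 1/2" | "1/2 < t" "t < 1" | "1 \<le> t" by linarith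
    then show ?thesis
    proof cases
      case 2
      then have "t\<^sup>2 \<le> (1/2)\<^sup>2" by (intro power_mono) auto
      then show ?thesis using 2 by (simp add: step_def pos2_def power2_eq_square)
    next
      case 3
      then have eq: "step t = 1 - 2 * (1 - t)\<^sup>2" by (simp add: step_def pos2_def power2_eq_square algebra_simps)
      have "(1 - t)\<^sup>2 \<le> (1/2)\<^sup>2" using 3 by (intro power_mono) auto
      then show ?thesis unfolding eq by (simp add: power2_eq_square abs_le_iff)
    qed (simp_all add: 1, simp add: step_def pos2_def)
  qed
  show "t \<le> 0 \<or> 1 \<le> t \<Longrightarrow> step' t = 0" "\<bar>step' t\<bar> \<le> 2" by (auto simp: step'_def max_def)
qed

text \<open>The distribution function of |w|.\<close>

definition superlevel :: "('a \<Rightarrow> real) \<Rightarrow> 'a::euclidean_space measure \<Rightarrow> real \<Rightarrow> real" where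
  "superlevel w M s = measure M {x. s < \<bar>w x\<bar>}"

lemma Chebyshev_superlevel:
  fixes w :: "real^'n::finite \<Rightarrow> real"
  assumes [measurable]: "w \<in> borel_measurable borel" and w: "sq_int lebesgue w" and s: "0 < s"
  shows "emeasure lborel {x. s < \<bar>w x\<bar>} = ennreal (superlevel w lborel s)"
    "s\<^sup>2 * superlevel w lborel s \<le> (nrm2 lebesgue w)\<^sup>2"
proof -
  have "ennreal (s\<^sup>2) * emeasure lborel {x. s < \<bar>w x\<bar>} = (\<integral>\<^sup>+x. ennreal (s\<^sup>2) * indicator {x. s < \<bar>w x\<bar>} x \<partial>lborel)"
    by (simp add: nn_integral_cmult)
  also have "\<dots> \<le> (\<integral>\<^sup>+x. ennreal ((norm (w x))\<^sup>2) \<partial>lborel)"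
    using s by (intro nn_integral_mono) (auto simp: indicator_def abs_le_square_iff[symmetric] intro!: ennreal_leI)
  also have "\<dots> = ennreal ((nrm2 lebesgue w)\<^sup>2)"
    using nn_integral_sq_int[OF w] by (subst (asm) nn_integral_lebesgue_lborel) auto
  finally have le: "ennreal (s\<^sup>2) * emeasure lborel {x. s < \<bar>w x\<bar>} \<le> ennreal ((nrm2 lebesgue w)\<^sup>2)" .
  then have fin: "emeasure lborel {x. s < \<bar>w x\<bar>} \<noteq> \<infinity>"
    using s by (auto simp: ennreal_mult_eq_top_iff top_unique)
  then show eq: "emeasure lborel {x. s < \<bar>w x\<bar>} = ennreal (superlevel w lborel s)"
    unfolding superlevel_def by (intro emeasure_eq_ennreal_measure) auto
  show "s\<^sup>2 * superlevel w lborel s \<le> (nrm2 lebesgue w)\<^sup>2"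
    using le unfolding eq by (simp add: superlevel_def flip: ennreal_mult)
qed

text \<open>Apply the Faber-Krahn estimate to \<open>w\<close> truncated between the levels s and 2
  s. The truncation equals s where |w| >= 2 s, is supported where |w| > s, and its gradient lives on
  the set between the two levels.\<close>

lemma superlevel_halving:
  "\<exists>K>0. \<forall>w G. \<forall>s>0. C1grad w G \<longrightarrow> sq_int lebesgue w \<longrightarrow> sq_int lebesgue G \<longrightarrow>
     s\<^sup>2 * superlevel w lborel (2 * s) \<le> K * (superlevel w lborel s) powr (2 / real CARD('n)) * 
       (\<integral>x. (norm (G x))\<^sup>2 * indicator {x::real^'n::finite. s < \<bar>w x\<bar> \<and> \<bar>w x\<bar> \<le> 2 * s} x \<partial>lborel)"
proof -
  obtain K where K: "K > 0" and FK: "\<And>v H m. m > 0 \<Longrightarrow> C1grad v H \<Longrightarrow> sq_int lebesgue v \<Longrightarrow> sq_int lebesgue H \<Longrightarrow> 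
     emeasure lborel {x::real^'n. v x \<noteq> 0} \<le> ennreal m \<Longrightarrow>
     (nrm2 lebesgue v)\<^sup>2 \<le> K * m powr (2 / real CARD('n)) * (nrm2 lebesgue H)\<^sup>2"
    using Faber_Krahn_measure[where 'n='n] by metis
  have "s\<^sup>2 * superlevel w lborel (2 * s) \<le> (9 * K) * (superlevel w lborel s) powr (2 / real CARD('n)) * 
       (\<integral>x. (norm (G x))\<^sup>2 * indicator {x. s < \<bar>w x\<bar> \<and> \<bar>w x\<bar> \<le> 2 * s} x \<partial>lborel)" (is "_ \<le> _ * ?I")
    if wG: "C1grad w G" "sq_int lebesgue w" "sq_int lebesgue G" and s: "0 < s" 
    for w :: "real^'n \<Rightarrow> real" and G and s :: real
  proof -
    note [measurable] = C1gradD(4,5)[OF wG(1)]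
    define A where "A = {x. s < \<bar>w x\<bar> \<and> \<bar>w x\<bar> \<le> 2 * s}"
    have [measurable]: "A \<in> sets borel" unfolding A_def by measurable
    have Gint: "integrable lborel (\<lambda>x. (norm (G x))\<^sup>2)"
      using sq_int_integrable[OF wG(3)] by (subst (asm) lebesgue_lborel_integral) auto
    \<comment> \<open>The map ((y/s)^2 - 1)/3 sends |y| between s and 2 s to the unit interval.
      Using the square instead of |y| keeps the truncation differentiable at 0.\<close>
    define F where "F y = s * step (((y / s)\<^sup>2 - 1) / 3)" for y
    define f where "f y = step' (((y / s)\<^sup>2 - 1) / 3) * (2 * y / (3 * s))" for y
    have FD: "(F has_real_derivative f y) (at y)" for y
      unfolding F_def[abs_def] f_def using s
      by (auto intro!: derivative_eq_intros DERIV_chain2[OF step_DERIV] simp: power2_eq_square field_simps)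
    have fc: "continuous_on UNIV f" unfolding f_def[abs_def] step'_def using s by (intro continuous_intros) auto
    have sq_iff: "y\<^sup>2 \<le> 1 \<longleftrightarrow> \<bar>y\<bar> \<le> 1" "4 \<le> y\<^sup>2 \<longleftrightarrow> 2 \<le> \<bar>y\<bar>" for y :: real
      using abs_le_square_iff[of y 1] abs_le_square_iff[of 2 y] by simp_all
    have F0: "F y = 0" if "\<bar>y\<bar> \<le> s" for y
      using that s sq_iff(1)[of "y / s"] unfolding F_def by (subst step_facts(1)) (auto simp: field_simps)
    have F1: "F y = s" if "2 * s \<le> \<bar>y\<bar>" for y
      using that s sq_iff(2)[of "y / s"] unfolding F_def by (subst step_facts(2)) (auto simp: field_simps)
    have Fb: "\<bar>F y\<bar> \<le> s" for y
      using step_facts(3)[of "((y / s)\<^sup>2 - 1) / 3"] s by (simp add: F_def abs_mult mult_left_le)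
    have f0: "f y = 0" if "\<bar>y\<bar> \<le> s \<or> 2 * s \<le> \<bar>y\<bar>" for y
      using that s sq_iff[of "y / s"] unfolding f_def by (subst step_facts(4)) (auto simp: field_simps)
    have fb: "\<bar>f y\<bar> \<le> 3" if "\<bar>y\<bar> \<le> 2 * s" for y
    proof -
      \<comment> \<open>A bound 2 for \<open>step'\<close> and 4/3 for the inner derivative; 8/3 is
        rounded up to 3, whose square 9 multiplies the constant below.\<close>
      have "\<bar>f y\<bar> \<le> 2 * (4 / 3)"
        unfolding f_def abs_mult using that s by (intro mult_mono step_facts(5)) (auto simp: field_simps)
      then show ?thesis by simp
    qed
    define v where "v x = F (w x)" for x
    define H where "H x = f (w x) *\<^sub>R G x" for x
    have vH: "C1grad v H" unfolding v_def[abs_def] H_def[abs_def] by (rule C1grad_compose[OF wG(1) FD fc])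
    have vs: "sq_int lebesgue v"
    proof (rule sq_int_bound[OF wG(2), where C=1])
      show "v \<in> borel_measurable lebesgue" by (rule C1gradD(7)[OF vH])
      show "AE x in lebesgue. norm (v x) \<le> 1 * norm (w x)"
      proof (rule AE_I2)
        fix x show "norm (v x) \<le> 1 * norm (w x)"
          using F0[of "w x"] Fb[of "w x"] by (cases "\<bar>w x\<bar> \<le> s") (auto simp: v_def)
      qed
    qed
    have HG: "norm (H x) \<le> 3 * norm (G x) * indicator A x" for x
    proof (cases "x \<in> A")
      case True
      then show ?thesis using fb[of "w x"] by (auto simp: H_def A_def intro!: mult_right_mono)
    next
      case False
      then show ?thesis using f0[of "w x"] by (auto simp: H_def A_def)
    qed
    have Hs: "sq_int lebesgue H"
    proof (rule sq_int_bound[OF wG(3), where C=3])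
      show "H \<in> borel_measurable lebesgue" by (rule C1gradD(6)[OF vH])
      show "AE x in lebesgue. norm (H x) \<le> 3 * norm (G x)"
        by (rule AE_I2, rule order_trans[OF HG]) (auto simp: indicator_def)
    qed
    note [measurable] = C1gradD(4,5)[OF vH]
    have HI: "(nrm2 lebesgue H)\<^sup>2 \<le> 9 * ?I"
    proof -
      have "(nrm2 lebesgue H)\<^sup>2 = (\<integral>x. (norm (H x))\<^sup>2 \<partial>lborel)" 
        unfolding nrm2_power2 by (subst lebesgue_lborel_integral) auto
      also have "\<dots> \<le> (\<integral>x. 9 * ((norm (G x))\<^sup>2 * indicator A x) \<partial>lborel)"
      proof (rule integral_mono)
        show "integrable lborel (\<lambda>x. (norm (H x))\<^sup>2)"
          using sq_int_integrable[OF Hs] by (subst (asm) lebesgue_lborel_integral) auto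
        show "integrable lborel (\<lambda>x. 9 * ((norm (G x))\<^sup>2 * indicator A x))"
          by (intro integrable_mult_right integrable_real_mult_indicator Gint) simp
        fix x
        have "(norm (H x))\<^sup>2 \<le> (3 * norm (G x) * indicator A x)\<^sup>2" by (intro power_mono HG) auto
        then show "(norm (H x))\<^sup>2 \<le> 9 * ((norm (G x))\<^sup>2 * indicator A x)"
          by (cases "x \<in> A") (simp_all add: power_mult_distrib)
      qed
      finally show ?thesis by (simp add: A_def)
    qed
    have I0: "0 \<le> ?I" by (intro Bochner_Integration.integral_nonneg) auto
    have lower: "s\<^sup>2 * superlevel w lborel (2 * s) \<le> (nrm2 lebesgue v)\<^sup>2"
    proof -
      have "ennreal (s\<^sup>2) * emeasure lborel {x. 2 * s < \<bar>w x\<bar>} = (\<integral>\<^sup>+x. ennreal (s\<^sup>2) * indicator {x. 2 * s < \<bar>w x\<bar>} x \<partial>lborel)"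
        by (simp add: nn_integral_cmult)
      also have "\<dots> \<le> (\<integral>\<^sup>+x. ennreal ((norm (v x))\<^sup>2) \<partial>lborel)"
        using F1 by (intro nn_integral_mono) (auto simp: indicator_def v_def)
      also have "\<dots> = ennreal ((nrm2 lebesgue v)\<^sup>2)"
        using nn_integral_sq_int[OF vs] by (subst (asm) nn_integral_lebesgue_lborel) auto
      finally show ?thesis
        using Chebyshev_superlevel(1)[OF _ wG(2), of "2 * s"] s by (simp add: superlevel_def flip: ennreal_mult)
    qed
    have sub: "emeasure lborel {x. v x \<noteq> 0} \<le> ennreal (superlevel w lborel s)"
    proof -
      have "emeasure lborel {x. v x \<noteq> 0} \<le> emeasure lborel {x. s < \<bar>w x\<bar>}"
        using F0 by (intro emeasure_mono) (force simp: v_def)+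
      then show ?thesis using Chebyshev_superlevel(1)[OF _ wG(2) s] by simp
    qed
    show ?thesis
    \<comment> \<open>The Faber-Krahn estimate requires a positive measure bound; if the superlevel
      set is null, so is the smaller one at 2 s.\<close>
    proof (cases "superlevel w lborel s = 0")
      case True
      then have "emeasure lborel {x. s < \<bar>w x\<bar>} = 0" using Chebyshev_superlevel(1)[OF _ wG(2) s] by simp
      moreover have "emeasure lborel {x. 2 * s < \<bar>w x\<bar>} \<le> emeasure lborel {x. s < \<bar>w x\<bar>}"
        using s by (intro emeasure_mono) auto
      ultimately have "superlevel w lborel (2 * s) = 0" by (simp add: superlevel_def measure_def)
      then show ?thesis using True by simp
    next
      case False
      then have pos: "0 < superlevel w lborel s" by (simp add: superlevel_def zero_less_measure_iff)
      have "s\<^sup>2 * superlevel w lborel (2 * s) \<le> K * (superlevel w lborel s) powr (2 / real CARD('n)) * (nrm2 lebesgue H)\<^sup>2"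
        using lower FK[OF pos vH vs Hs sub] by linarith
      also have "\<dots> \<le> K * (superlevel w lborel s) powr (2 / real CARD('n)) * (9 * ?I)"
        using K by (intro mult_left_mono HI) auto
      finally show ?thesis by simp
    qed
  qed
  then show ?thesis using K by (intro exI[of _ "9 * K"]) auto
qed

lemma crit_exp_facts:
  assumes "CARD('n::finite) \<ge> 3"
  shows "2 < crit_exp TYPE('n)" "crit_exp TYPE('n) * (2 / real CARD('n)) = crit_exp TYPE('n) - 2"
    "1 / (1 - 2 / real CARD('n)) = crit_exp TYPE('n) / 2" "2 / real CARD('n) < 1" 
    "2 / crit_exp TYPE('n) = 1 - 2 / real CARD('n)" "(crit_exp TYPE('n) - 2) * (real CARD('n) / 2) = crit_exp TYPE('n)"
  using assms unfolding crit_exp_def by (auto simp: field_simps)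

text \<open>\<open>M\<close> is the fixed point of x -> M^(1-\<theta>) x^\<theta>. A value above the
  fixed point can only come from a still larger argument.\<close>

lemma powr_gap:
  fixes x y M \<theta> :: real
  assumes "y \<le> M powr (1 - \<theta>) * x powr \<theta>" "M < y" "0 \<le> M" "0 \<le> x" "0 < \<theta>" "\<theta> < 1"
  shows "y < x"
proof (rule ccontr)
  assume "\<not> y < x"
  then have "x powr \<theta> \<le> y powr \<theta>" using assms by (intro powr_mono2) auto
  then have "y \<le> M powr (1 - \<theta>) * y powr \<theta>"
    using assms(1) mult_left_mono[of "x powr \<theta>" "y powr \<theta>" "M powr (1 - \<theta>)"] by simp
  also have "\<dots> < y powr (1 - \<theta>) * y powr \<theta>"
    using assms by (intro mult_strict_right_mono powr_less_mono2) auto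
  also have "\<dots> = y" using assms by (simp flip: powr_add)
  finally show False by simp
qed

text \<open>If \<open>y\<close> lies between a dyadic level and its double, the summand of that
  level alone already dominates the power of \<open>y\<close>.\<close>

lemma dyadic_pointwise:
  fixes y p :: real
  assumes p: "0 < p" and y: "(1/2)^J < y" "y \<le> (1/2)^J * 2^N"
  shows "y powr p \<le> (\<Sum>j<N. (2 * ((1/2)^J * 2^j)) powr p * indicator {t. (1/2)^J * 2^j < t} y)"
  using y(2)
proof (induction N)
  case 0
  then show ?case using y(1) by simp
next
  case (Suc N)
  show ?case
  proof (cases "y \<le> (1/2)^J * 2^N")
    case True
    then show ?thesis using Suc.IH by (simp add: add_increasing2)
  next
    case False
    have y0: "0 < y" using y(1) by (rule less_trans[rotated]) simp
    have "y powr p \<le> (2 * ((1/2)^J * 2^N)) powr p"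
      using Suc.prems p y0 by (intro powr_mono2) (auto simp: mult_ac)
    then show ?thesis using False by (simp add: sum_nonneg add_increasing)
  qed
qed

text \<open>With b(s) = s^p |{|w| > s}| and \<Phi>(s) the gradient energy on {|w| <= s}, level
  halving reads b(2 s) <= C b(s)^\<theta> (\<Phi>(2 s) - \<Phi>(s)). The recursion is used twice:
  first with the increment replaced by the total energy, which bounds \<open>b\<close> by a constant
  \<open>M\<close>; then with b^\<theta> <= M^\<theta>, so that the increments telescope over dyadic
  levels.\<close>

theorem C1_Sobolev:
  assumes n: "CARD('n::finite) \<ge> 3"
  shows "\<exists>S>0. \<forall>w G. C1grad w G \<longrightarrow> sq_int lebesgue w \<longrightarrow> sq_int lebesgue G \<longrightarrow>
    (\<integral>\<^sup>+x. ennreal (\<bar>w (x::real^'n)\<bar> powr crit_exp TYPE('n)) \<partial>lebesgue) \<le> ennreal (S * nrm2 lebesgue G powr crit_exp TYPE('n))"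
proof -
  define p where "p = crit_exp TYPE('n)"
  define \<theta> where "\<theta> = 2 / real CARD('n)"
  note pe = crit_exp_facts[OF n, folded p_def \<theta>_def]
  have \<theta>: "0 < \<theta>" "\<theta> < 1" using pe by (auto simp: \<theta>_def)
  have p2: "2 < p" "0 < p" using pe by auto
  obtain K where K: "K > 0" and half: "\<forall>w G. \<forall>s>0. C1grad w G \<longrightarrow> sq_int lebesgue w \<longrightarrow> sq_int lebesgue G \<longrightarrow>
     s\<^sup>2 * superlevel w lborel (2 * s) \<le> K * (superlevel w lborel s) powr \<theta> * 
       (\<integral>x. (norm (G x))\<^sup>2 * indicator {x::real^'n. s < \<bar>w x\<bar> \<and> \<bar>w x\<bar> \<le> 2 * s} x \<partial>lborel)"
    using superlevel_halving[where 'n='n, folded \<theta>_def] by (elim exE conjE) (rule that)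
  define C where "C = 2 powr p * K"
  have C: "0 < C" using K by (simp add: C_def)
  define S where "S = 2 powr p * C powr (p / 2)"
  have "(\<integral>\<^sup>+x. ennreal (\<bar>w x\<bar> powr p) \<partial>lebesgue) \<le> ennreal (S * nrm2 lebesgue G powr p)"
    if wG: "C1grad w G" "sq_int lebesgue w" "sq_int lebesgue G" for w :: "real^'n \<Rightarrow> real" and G
  proof -
    note [measurable] = C1gradD(4,5)[OF wG(1)]
    have Gint: "integrable lborel (\<lambda>x. (norm (G x))\<^sup>2)"
      using sq_int_integrable[OF wG(3)] by (subst (asm) lebesgue_lborel_integral) auto
    define g where "g = (nrm2 lebesgue G)\<^sup>2"
    have g_eq: "g = (\<integral>x. (norm (G x))\<^sup>2 \<partial>lborel)" 
      unfolding g_def nrm2_power2 by (subst lebesgue_lborel_integral) auto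
    have g0: "0 \<le> g" by (simp add: g_def)
    define \<Phi> where "\<Phi> s = (\<integral>x. (norm (G x))\<^sup>2 * indicator {x. \<bar>w x\<bar> \<le> s} x \<partial>lborel)" for s
    have \<Phi>int: "integrable lborel (\<lambda>x. (norm (G x))\<^sup>2 * indicator {x. \<bar>w x\<bar> \<le> s} x)" for s
      by (intro integrable_real_mult_indicator Gint) simp
    have \<Phi>: "0 \<le> \<Phi> s" "\<Phi> s \<le> g" for s
    proof -
      show "0 \<le> \<Phi> s" unfolding \<Phi>_def by (intro Bochner_Integration.integral_nonneg) auto
      show "\<Phi> s \<le> g" unfolding \<Phi>_def g_eq by (intro integral_mono \<Phi>int Gint) (auto simp: indicator_def)
    qed
    have ring: "(\<integral>x. (norm (G x))\<^sup>2 * indicator {x. s < \<bar>w x\<bar> \<and> \<bar>w x\<bar> \<le> 2 * s} x \<partial>lborel) = \<Phi> (2 * s) - \<Phi> s" 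
      if "0 < s" for s
    proof -
      have "\<Phi> (2 * s) - \<Phi> s = (\<integral>x. (norm (G x))\<^sup>2 * indicator {x. \<bar>w x\<bar> \<le> 2 * s} x - (norm (G x))\<^sup>2 * indicator {x. \<bar>w x\<bar> \<le> s} x \<partial>lborel)"
        unfolding \<Phi>_def by (rule Bochner_Integration.integral_diff[OF \<Phi>int \<Phi>int, symmetric])
      also have "\<dots> = (\<integral>x. (norm (G x))\<^sup>2 * indicator {x. s < \<bar>w x\<bar> \<and> \<bar>w x\<bar> \<le> 2 * s} x \<partial>lborel)"
        using that by (intro Bochner_Integration.integral_cong) (auto simp: indicator_def)
      finally show ?thesis by simp
    qed
    define A where "A s = superlevel w lborel s" for s
    define b where "b s = s powr p * A s" for s
    have A0: "0 \<le> A s" for s by (simp add: A_def superlevel_def)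
    have b0: "0 \<le> b s" for s by (simp add: b_def A0)
    have rec: "b (2 * s) \<le> C * b s powr \<theta> * (\<Phi> (2 * s) - \<Phi> s)" if s: "0 < s" for s
    proof -
      have "s\<^sup>2 * A (2 * s) \<le> K * A s powr \<theta> * (\<Phi> (2 * s) - \<Phi> s)"
        using half[rule_format, OF s wG] unfolding ring[OF s] A_def .
      from mult_left_mono[OF this, of "2 powr p * s powr (p - 2)"]
      have "2 powr p * s powr (p - 2) * (s\<^sup>2 * A (2 * s)) \<le> C * (s powr (p - 2) * A s powr \<theta>) * (\<Phi> (2 * s) - \<Phi> s)"
        by (simp add: C_def mult_ac)
      also have "s powr (p - 2) * A s powr \<theta> = b s powr \<theta>"
        unfolding b_def using s A0 by (simp add: powr_mult powr_powr pe(2))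
      also have "2 powr p * s powr (p - 2) * (s\<^sup>2 * A (2 * s)) = b (2 * s)"
      proof -
        have "s powr (p - 2) * s\<^sup>2 = s powr p" using s by (simp add: powr_diff powr_numeral)
        then show ?thesis using s unfolding b_def by (simp add: powr_mult mult_ac)
      qed
      finally show ?thesis .
    qed
    \<comment> \<open>The fixed point of the recursion x -> C g x^\<theta>.\<close>
    define M where "M = (C * g) powr (1 / (1 - \<theta>))"
    have M0: "0 \<le> M" by (simp add: M_def)
    have M: "M powr (1 - \<theta>) = C * g" using \<theta> C g0 by (simp add: M_def powr_powr)
    have rec': "b (2 * s) \<le> M powr (1 - \<theta>) * b s powr \<theta>" if s: "0 < s" for s
    proof -
      have "b (2 * s) \<le> C * b s powr \<theta> * (\<Phi> (2 * s) - \<Phi> s)" by (rule rec[OF s])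
      also have "\<dots> \<le> C * b s powr \<theta> * g"
        using C \<Phi>(2)[of "2 * s"] \<Phi>(1)[of s] by (intro mult_left_mono) auto
      finally show ?thesis by (simp add: M mult_ac)
    qed
    have bM: "b s \<le> M" if s: "0 < s" for s
    \<comment> \<open>If b(s) exceeded \<open>M\<close>, then \<open>b\<close> would be at least
      b(s) along s/2^j. Chebyshev bounds it there by a power t^(p-2) of the level t, which tends to
      0.\<close>
    proof (rule ccontr)
      assume "\<not> b s \<le> M"
      then have bs: "M < b s" by simp
      have grow: "b s \<le> b ((1/2)^j * s)" for j
      proof (induction j)
        case (Suc j)
        have "b (2 * ((1/2)^Suc j * s)) \<le> M powr (1 - \<theta>) * b ((1/2)^Suc j * s) powr \<theta>"
          using s by (intro rec') simp
        moreover have "M < b (2 * ((1/2)^Suc j * s))" using Suc bs by simp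
        ultimately have "b (2 * ((1/2)^Suc j * s)) < b ((1/2)^Suc j * s)"
          using M0 b0 \<theta> by (rule powr_gap)
        then show ?case using Suc by simp
      qed simp
      have up: "b ((1/2)^j * s) \<le> ((1/2)^j * s) powr (p - 2) * (nrm2 lebesgue w)\<^sup>2" for j
      proof -
        define t where "t = (1/2)^j * s"
        have t: "0 < t" using s by (simp add: t_def)
        have "b t = t powr (p - 2) * (t\<^sup>2 * A t)" using t by (simp add: b_def powr_diff powr_numeral)
        also have "\<dots> \<le> t powr (p - 2) * (nrm2 lebesgue w)\<^sup>2"
          using Chebyshev_superlevel(2)[OF _ wG(2) t] by (intro mult_left_mono) (auto simp: A_def)
        finally show ?thesis by (simp add: t_def)
      qed
      have "(\<lambda>j. (1/2)^j * s) \<longlonglongrightarrow> 0" by (intro tendsto_mult_left_zero LIMSEQ_power_zero) simp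
      then have "(\<lambda>j. ((1/2)^j * s) powr (p - 2)) \<longlonglongrightarrow> 0"
        using p2 s by (intro tendsto_zero_powrI[OF _ tendsto_const]) (auto intro!: always_eventually)
      then have "(\<lambda>j. ((1/2)^j * s) powr (p - 2) * (nrm2 lebesgue w)\<^sup>2) \<longlonglongrightarrow> 0"
        by (rule tendsto_mult_left_zero)
      then have "b s \<le> 0"
        by (rule LIMSEQ_le_const) (use grow up in \<open>auto intro: order_trans\<close>)
      then show False using bs M0 by simp
    qed
    \<comment> \<open>Only finitely many dyadic levels are involved, with a bound that does not
      depend on \<open>J\<close>; Fatou removes the restriction afterwards.\<close>
    have bound: "(\<integral>\<^sup>+x. ennreal (\<bar>w x\<bar> powr p * indicator {x. (1/2)^J < \<bar>w x\<bar> \<and> \<bar>w x\<bar> \<le> 2^J} x) \<partial>lborel) \<le> ennreal (2 powr p * M)" for J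
    proof -
      define s :: "nat \<Rightarrow> real" where "s j = (1/2)^J * 2^j" for j
      have s: "0 < s j" for j by (simp add: s_def)
      have "(\<integral>\<^sup>+x. ennreal (\<bar>w x\<bar> powr p * indicator {x. (1/2)^J < \<bar>w x\<bar> \<and> \<bar>w x\<bar> \<le> 2^J} x) \<partial>lborel) 
         \<le> (\<integral>\<^sup>+x. (\<Sum>j<2*J. ennreal ((2 * s j) powr p) * indicator {x. s j < \<bar>w x\<bar>} x) \<partial>lborel)"
      proof (rule nn_integral_mono)
        fix x
        show "ennreal (\<bar>w x\<bar> powr p * indicator {x. (1/2)^J < \<bar>w x\<bar> \<and> \<bar>w x\<bar> \<le> 2^J} x) 
          \<le> (\<Sum>j<2*J. ennreal ((2 * s j) powr p) * indicator {x. s j < \<bar>w x\<bar>} x)"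
        proof (cases "(1/2)^J < \<bar>w x\<bar> \<and> \<bar>w x\<bar> \<le> 2^J")
          case True
          have "(1/2)^J * 2^(2*J) = (2::real)^J" by (simp add: power_one_over power_add mult_2)
          then have "\<bar>w x\<bar> powr p \<le> (\<Sum>j<2*J. (2 * s j) powr p * indicator {t. s j < t} \<bar>w x\<bar>)"
            unfolding s_def using True p2 by (intro dyadic_pointwise) auto
          then have "ennreal (\<bar>w x\<bar> powr p) \<le> (\<Sum>j<2*J. ennreal ((2 * s j) powr p * indicator {t. s j < t} \<bar>w x\<bar>))"
            by (subst sum_ennreal) (auto intro: ennreal_leI)
          also have "\<dots> = (\<Sum>j<2*J. ennreal ((2 * s j) powr p) * indicator {x. s j < \<bar>w x\<bar>} x)"
            by (intro sum.cong) (auto simp: indicator_def)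
          finally show ?thesis using True by simp
        qed simp
      qed
      also have "\<dots> = (\<Sum>j<2*J. ennreal ((2 * s j) powr p) * emeasure lborel {x. s j < \<bar>w x\<bar>})"
        by (subst nn_integral_sum) (measurable, intro sum.cong refl, simp add: nn_integral_cmult)
      also have "\<dots> = (\<Sum>j<2*J. ennreal (2 powr p * b (s j)))"
      proof (intro sum.cong refl)
        fix j
        show "ennreal ((2 * s j) powr p) * emeasure lborel {x. s j < \<bar>w x\<bar>} = ennreal (2 powr p * b (s j))"
          using Chebyshev_superlevel(1)[OF _ wG(2) s] s[of j] A0
          by (simp add: b_def A_def powr_mult mult.assoc flip: ennreal_mult)
      qed
      also have "\<dots> = ennreal (\<Sum>j<2*J. 2 powr p * b (s j))"
        using b0 by (intro sum_ennreal) auto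
      also have "\<dots> \<le> ennreal (2 powr p * M)"
      proof (rule ennreal_leI)
        have "b (s j) \<le> C * M powr \<theta> * (\<Phi> (s j) - \<Phi> (s j / 2))" for j
        proof -
          have "b (2 * (s j / 2)) \<le> C * b (s j / 2) powr \<theta> * (\<Phi> (2 * (s j / 2)) - \<Phi> (s j / 2))"
            using s[of j] by (intro rec) simp
          also have "\<dots> \<le> C * M powr \<theta> * (\<Phi> (2 * (s j / 2)) - \<Phi> (s j / 2))"
          proof (intro mult_right_mono mult_left_mono powr_mono2)
            show "b (s j / 2) \<le> M" using s[of j] by (intro bM) simp
            show "0 \<le> \<Phi> (2 * (s j / 2)) - \<Phi> (s j / 2)"
              using s[of j] by (subst ring[symmetric]) (auto intro!: Bochner_Integration.integral_nonneg)
          qed (use \<theta> b0 C in auto)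
          finally show ?thesis by simp
        qed
        then have "(\<Sum>j<2*J. b (s j)) \<le> (\<Sum>j<2*J. C * M powr \<theta> * (\<Phi> (s j) - \<Phi> (s j / 2)))"
          by (rule sum_mono)
        also have "\<dots> = C * M powr \<theta> * (\<Sum>j<2*J. (\<Phi> (s (Suc j) / 2) - \<Phi> (s j / 2)))"
          by (simp add: sum_distrib_left s_def)
        also have "\<dots> = C * M powr \<theta> * (\<Phi> (s (2*J) / 2) - \<Phi> (s 0 / 2))"
          by (simp add: sum_lessThan_telescope[of "\<lambda>j. \<Phi> (s j / 2)"])
        also have "\<dots> \<le> C * M powr \<theta> * g"
          using C \<Phi>(2)[of "s (2*J) / 2"] \<Phi>(1)[of "s 0 / 2"] by (intro mult_left_mono) auto
        \<comment> \<open>The choice of \<open>M\<close> closes the estimate: the sum over all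
          levels is again at most \<open>M\<close>.\<close>
        also have "\<dots> = M powr (1 - \<theta>) * M powr \<theta>" by (simp add: M)
        also have "\<dots> = M" using M0 by (cases "M = 0") (auto simp flip: powr_add)
        finally show "(\<Sum>j<2*J. 2 powr p * b (s j)) \<le> 2 powr p * M" by (simp flip: sum_distrib_left)
      qed
      finally show ?thesis .
    qed
    have "(\<integral>\<^sup>+x. ennreal (\<bar>w x\<bar> powr p) \<partial>lborel) \<le> ennreal (2 powr p * M)"
    proof (rule nn_integral_Fatou[OF _ _ _ bound tendsto_const])
      show "AE x in lborel. (\<lambda>J. \<bar>w x\<bar> powr p * indicator {x. (1/2)^J < \<bar>w x\<bar> \<and> \<bar>w x\<bar> \<le> 2^J} x) \<longlonglongrightarrow> \<bar>w x\<bar> powr p"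
      proof (intro AE_I2 tendsto_eventually)
        fix x
        show "\<forall>\<^sub>F J in sequentially. \<bar>w x\<bar> powr p * indicator {x. (1/2)^J < \<bar>w x\<bar> \<and> \<bar>w x\<bar> \<le> 2^J} x = \<bar>w x\<bar> powr p"
        proof (cases "w x = 0")
          case False
          have "(\<lambda>J. (1/2::real)^J) \<longlonglongrightarrow> 0" by (intro LIMSEQ_power_zero) simp
          then have 1: "\<forall>\<^sub>F J in sequentially. (1/2)^J < \<bar>w x\<bar>" using False by (intro order_tendstoD(2)) auto
          obtain N where N: "\<bar>w x\<bar> < 2^N" using real_arch_pow[of 2 "\<bar>w x\<bar>"] by auto
          have "\<forall>\<^sub>F J in sequentially. \<bar>w x\<bar> \<le> 2^J" 
          proof (rule eventually_sequentiallyI[of N])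
            fix J assume "N \<le> J"
            then have "(2::real)^N \<le> 2^J" by (intro power_increasing) auto
            then show "\<bar>w x\<bar> \<le> 2^J" using N by linarith
          qed
          with 1 show ?thesis by eventually_elim simp
        qed (use p2 in simp)
      qed
    qed measurable
    also have "2 powr p * M = S * nrm2 lebesgue G powr p"
    proof -
      have "g powr (p / 2) = nrm2 lebesgue G powr p"
      proof (cases "nrm2 lebesgue G = 0")
        case False
        then have "g = nrm2 lebesgue G powr 2" by (simp add: g_def powr_numeral)
        then show ?thesis by (simp only: powr_powr) simp
      qed (use p2 in \<open>simp add: g_def\<close>)
      then show ?thesis using C g0 by (simp add: M_def S_def pe(3) powr_mult)
    qed
    finally show ?thesis by (simp add: nn_integral_lebesgue_lborel)
  qed
  moreover have "0 < S" using C by (simp add: S_def)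
  ultimately show ?thesis unfolding p_def by blast
qed

theorem Sobolev:
  assumes n: "CARD('n::finite) \<ge> 3"
  shows "\<exists>S>0. \<forall>u\<in>H1. integrable lebesgue (\<lambda>x::real^'n. \<bar>u x\<bar> powr crit_exp TYPE('n)) \<and>
     (\<integral>x. \<bar>u x\<bar> powr crit_exp TYPE('n) \<partial>lebesgue) \<le> S * gnrm u powr crit_exp TYPE('n)"
proof -
  define p where "p = crit_exp TYPE('n)"
  have p: "0 < p" using crit_exp_facts(1)[OF n] by (simp add: p_def)
  obtain S where S: "S > 0" and Sob: "\<forall>w G. C1grad w G \<longrightarrow> sq_int lebesgue w \<longrightarrow> sq_int lebesgue G \<longrightarrow>
    (\<integral>\<^sup>+x. ennreal (\<bar>w (x::real^'n)\<bar> powr p) \<partial>lebesgue) \<le> ennreal (S * nrm2 lebesgue G powr p)"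
    using C1_Sobolev[OF n, folded p_def] by (elim exE conjE) (rule that)
  have "integrable lebesgue (\<lambda>x. \<bar>u x\<bar> powr p) \<and> (\<integral>x. \<bar>u x\<bar> powr p \<partial>lebesgue) \<le> S * gnrm u powr p"
    if u: "u \<in> H1" for u :: "real^'n \<Rightarrow> real"
  proof -
    obtain w G where "C1_approx u (weak_grad u) w G" using H1_approx[OF has_weak_grad_weak_grad[OF u] H1_sq_int[OF u]] by auto
    note wG = C1_approxD[OF this]
    have um[measurable]: "u \<in> borel_measurable lebesgue" using u by (auto simp: H1_iff sq_int_def)
    have "(\<integral>\<^sup>+x. ennreal (\<bar>u x\<bar> powr p) \<partial>lebesgue) \<le> ennreal (S * gnrm u powr p)"
    proof (rule nn_integral_Fatou[OF _ _ _ Sob[rule_format, OF wG(1,2,3)]])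
      show "(\<lambda>x. \<bar>w k x\<bar> powr p) \<in> borel_measurable lebesgue" for k
        using C1gradD(7)[OF wG(1)[of k]] by measurable
      show "AE x in lebesgue. (\<lambda>k. \<bar>w k x\<bar> powr p) \<longlonglongrightarrow> \<bar>u x\<bar> powr p"
        using wG(6) by eventually_elim (use p in \<open>intro tendsto_powr' tendsto_intros; auto\<close>)
      show "(\<lambda>k. S * nrm2 lebesgue (G k) powr p) \<longlonglongrightarrow> S * gnrm u powr p"
        unfolding gnrm_def using p 
        by (intro tendsto_powr' tendsto_intros nrm2_tendsto wG weak_grad_sq_int u) auto
    qed simp
    from nn_integral_bound_integrable[OF _ _ this] S show ?thesis by simp
  qed
  then show ?thesis using S unfolding p_def by blast
qed

section \<open>Chain and product rules\<close>

lemma H1_diff: "u \<in> H1 \<Longrightarrow> v \<in> H1 \<Longrightarrow> (\<lambda>x. u x - v x) \<in> H1"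
  using H1_lincomb[of u v 1 "-1"] by simp

lemma H1_add: "u \<in> H1 \<Longrightarrow> v \<in> H1 \<Longrightarrow> (\<lambda>x. u x + v x) \<in> H1"
  using H1_lincomb[of u v 1 "1"] by simp

lemma H1_cmult: "u \<in> H1 \<Longrightarrow> (\<lambda>x. c * u x) \<in> H1"
  using H1_lincomb[of u u c 0] by simp

lemma gnrm_lincomb_eq: 
  assumes "u \<in> H1" "v \<in> H1"
  shows "gnrm (\<lambda>x. a * u x + b * v x) = nrm2 lebesgue (\<lambda>x. a *\<^sub>R weak_grad u x + b *\<^sub>R weak_grad v x)"
  using assms by (intro gnrm_eq has_weak_grad_lincomb has_weak_grad_weak_grad H1_sq_int)

lemma gnrm_lincomb_le: 
  assumes "u \<in> H1" "v \<in> H1"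
  shows "gnrm (\<lambda>x. a * u x + b * v x) \<le> \<bar>a\<bar> * gnrm u + \<bar>b\<bar> * gnrm v"
  unfolding gnrm_lincomb_eq[OF assms] 
  using nrm2_triangle[OF sq_int_scaleR[OF weak_grad_sq_int[OF assms(1)]] sq_int_scaleR[OF weak_grad_sq_int[OF assms(2)]], of a b]
  by (simp add: nrm2_scaleR gnrm_def)

lemma gnrm_cmult: "u \<in> H1 \<Longrightarrow> gnrm (\<lambda>x. c * u x) = \<bar>c\<bar> * gnrm u"
  using gnrm_lincomb_eq[of u u c 0] by (simp add: nrm2_scaleR gnrm_def)

lemma gnrm_diff_le: "u \<in> H1 \<Longrightarrow> v \<in> H1 \<Longrightarrow> gnrm (\<lambda>x. u x - v x) \<le> gnrm u + gnrm v"
  using gnrm_lincomb_le[of u v 1 "-1"] by simp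

lemma gnrm_add_le: "u \<in> H1 \<Longrightarrow> v \<in> H1 \<Longrightarrow> gnrm (\<lambda>x. u x + v x) \<le> gnrm u + gnrm v"
  using gnrm_lincomb_le[of u v 1 "1"] by simp

lemma sq_int_mult_bounded:
  assumes "sq_int M (g :: _ \<Rightarrow> 'b::euclidean_space)" "b \<in> borel_measurable M" "\<And>x. \<bar>b x\<bar> \<le> B"
  shows "sq_int M (\<lambda>x. b x *\<^sub>R g x)"
  by (rule sq_int_bound[OF assms(1), where C=B]) (use assms in \<open>auto simp: sq_int_def intro!: mult_right_mono\<close>)

lemma nrm2_mult_bounded:
  assumes "sq_int M (g :: _ \<Rightarrow> 'b::euclidean_space)" "\<And>x. \<bar>b x\<bar> \<le> B"
  shows "nrm2 M (\<lambda>x. b x *\<^sub>R g x) \<le> B * nrm2 M g"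
proof -
  have B: "0 \<le> B" using assms(2) abs_ge_zero order_trans by blast
  have "nrm2 M (\<lambda>x. b x *\<^sub>R g x) \<le> nrm2 M (\<lambda>x. B *\<^sub>R g x)"
    using assms B by (intro nrm2_mono sq_int_scaleR) (auto intro!: mult_right_mono)
  then show ?thesis using B by (simp add: nrm2_scaleR)
qed

lemma Lipschitz_of_bounded_DERIV:
  fixes F :: "real \<Rightarrow> real"
  assumes "\<And>s. (F has_real_derivative f s) (at s)" "\<And>s. \<bar>f s\<bar> \<le> L"
  shows "\<bar>F a - F b\<bar> \<le> L * \<bar>a - b\<bar>"
  using field_differentiable_bound[of UNIV F f L a b] assms
  by (auto intro: has_field_derivative_at_within)

text \<open>The gradients converge because
  \<open>f(w\<^sub>k) G\<^sub>k - f(u) g = f(w\<^sub>k) (G\<^sub>k - g) + (f(w\<^sub>k) - f(u)) g\<close>, the last term by dominated convergence.\<close>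

lemma weak_chain_rule:
  assumes g: "has_weak_grad u g" and u: "sq_int lebesgue u"
    and F: "\<And>s. (F has_real_derivative f s) (at s)" "continuous_on UNIV f" "\<And>s. \<bar>f s\<bar> \<le> L" "F 0 = 0"
  shows "has_weak_grad (\<lambda>x. F (u x)) (\<lambda>x. f (u x) *\<^sub>R g x)" "sq_int lebesgue (\<lambda>x. F (u x))"
proof -
  obtain w G where "C1_approx u g w G" using H1_approx[OF g u] by auto
  note wG = C1_approxD[OF this]
  have gs: "sq_int lebesgue g" by (rule has_weak_gradD[OF g])
  have "continuous_on UNIV F" using DERIV_isCont[OF F(1)] by (simp add: continuous_on_eq_continuous_at)
  then have [measurable]: "F \<in> borel_measurable borel" "f \<in> borel_measurable borel" 
    using F(2) by (simp_all add: borel_measurable_continuous_onI)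
  have meas[measurable]: "u \<in> borel_measurable lebesgue" "w k \<in> borel_measurable lebesgue" for k
    using u wG(2) by (auto simp: sq_int_def)
  have Lip: "\<bar>F a - F b\<bar> \<le> L * \<bar>a - b\<bar>" for a b by (rule Lipschitz_of_bounded_DERIV[OF F(1,3)])
  have L: "0 \<le> L" using F(3) abs_ge_zero order_trans by blast
  have Fs: "sq_int lebesgue (\<lambda>x. F (v x))" if "sq_int lebesgue v" "v \<in> borel_measurable lebesgue" for v :: "real^'a \<Rightarrow> real"
    by (rule sq_int_bound[OF that(1), where C=L]) (use that(2) Lip[of _ 0] F(4) in auto)
  show Fu: "sq_int lebesgue (\<lambda>x. F (u x))" using Fs u by simp
  have fs: "sq_int lebesgue (\<lambda>x. f (v x) *\<^sub>R h x)" if "sq_int lebesgue h" "v \<in> borel_measurable lebesgue" 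
    for v and h :: "real^'a \<Rightarrow> real^'a"
    using that by (intro sq_int_mult_bounded[where B=L] F) auto
  show "has_weak_grad (\<lambda>x. F (u x)) (\<lambda>x. f (u x) *\<^sub>R g x)"
  proof (rule has_weak_grad_limit)
    show "has_weak_grad (\<lambda>x. F (w k x)) (\<lambda>x. f (w k x) *\<^sub>R G k x)" for k
      by (intro C1grad_has_weak_grad C1grad_compose wG F Fs fs meas)
    show "sq_int lebesgue (\<lambda>x. F (w k x))" for k using Fs wG by simp
    show "sq_int lebesgue (\<lambda>x. f (u x) *\<^sub>R g x)" by (intro fs gs meas)
    show "(\<lambda>k. nrm2 lebesgue (\<lambda>x. F (w k x) - F (u x))) \<longlonglongrightarrow> 0"
    proof (rule tendsto_sandwich[of "\<lambda>_. 0" _ _ "\<lambda>k. L * nrm2 lebesgue (\<lambda>x. w k x - u x)"])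
      have "nrm2 lebesgue (\<lambda>x. F (w k x) - F (u x)) \<le> nrm2 lebesgue (\<lambda>x. L * (w k x - u x))" for k
        using Lip L by (intro nrm2_mono sq_int_cmult sq_int_diff wG u) (auto simp: abs_mult)
      then show "\<forall>\<^sub>F k in sequentially. nrm2 lebesgue (\<lambda>x. F (w k x) - F (u x)) \<le> L * nrm2 lebesgue (\<lambda>x. w k x - u x)"
        using L by (simp add: nrm2_cmult)
      show "(\<lambda>k. L * nrm2 lebesgue (\<lambda>x. w k x - u x)) \<longlonglongrightarrow> 0" using tendsto_mult_right_zero[OF wG(4)] .
    qed auto
    have 1: "(\<lambda>k. nrm2 lebesgue (\<lambda>x. f (w k x) *\<^sub>R g x - f (u x) *\<^sub>R g x)) \<longlonglongrightarrow> 0"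
    proof (rule nrm2_dominated(3)[where w="\<lambda>x. L *\<^sub>R g x"])
      show "AE x in lebesgue. (\<lambda>k. f (w k x) *\<^sub>R g x) \<longlonglongrightarrow> f (u x) *\<^sub>R g x"
        using wG(6) 
      proof eventually_elim
        case (elim x)
        have "isCont f (u x)" using F(2) by (simp add: continuous_on_eq_continuous_at)
        from isCont_tendsto_compose[OF this elim] show ?case by (intro tendsto_intros)
      qed
    qed (use F(3) L fs[OF gs] gs in \<open>auto simp: sq_int_def power_mult_distrib intro!: mult_right_mono\<close>)
    have 2: "(\<lambda>k. nrm2 lebesgue (\<lambda>x. f (w k x) *\<^sub>R (G k x - g x))) \<longlonglongrightarrow> 0"
    proof (rule tendsto_sandwich[of "\<lambda>_. 0" _ _ "\<lambda>k. L * nrm2 lebesgue (\<lambda>x. G k x - g x)"])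
      show "\<forall>\<^sub>F k in sequentially. nrm2 lebesgue (\<lambda>x. f (w k x) *\<^sub>R (G k x - g x)) \<le> L * nrm2 lebesgue (\<lambda>x. G k x - g x)"
        by (intro always_eventually allI nrm2_mult_bounded F sq_int_diff wG gs)
      show "(\<lambda>k. L * nrm2 lebesgue (\<lambda>x. G k x - g x)) \<longlonglongrightarrow> 0" using tendsto_mult_right_zero[OF wG(5)] .
    qed auto
    show "(\<lambda>k. nrm2 lebesgue (\<lambda>x. f (w k x) *\<^sub>R G k x - f (u x) *\<^sub>R g x)) \<longlonglongrightarrow> 0"
    proof (rule tendsto_sandwich[OF _ _ tendsto_const tendsto_add_zero[OF 2 1]])
      have "nrm2 lebesgue (\<lambda>x. f (w k x) *\<^sub>R (G k x - g x) + (f (w k x) *\<^sub>R g x - f (u x) *\<^sub>R g x)) 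
        \<le> nrm2 lebesgue (\<lambda>x. f (w k x) *\<^sub>R (G k x - g x)) + nrm2 lebesgue (\<lambda>x. f (w k x) *\<^sub>R g x - f (u x) *\<^sub>R g x)" for k
        by (intro nrm2_triangle sq_int_diff fs gs wG meas)
      then show "\<forall>\<^sub>F k in sequentially. nrm2 lebesgue (\<lambda>x. f (w k x) *\<^sub>R G k x - f (u x) *\<^sub>R g x)
        \<le> nrm2 lebesgue (\<lambda>x. f (w k x) *\<^sub>R (G k x - g x)) + nrm2 lebesgue (\<lambda>x. f (w k x) *\<^sub>R g x - f (u x) *\<^sub>R g x)"
        by (simp add: scaleR_diff_right)
    qed auto
  qed fact
qed

text \<open>The functions sqrt(s^2 + e^2) - e are C^1, vanish at 0, have slope at most 1 and tend to
  |s|. Their slopes tend to \<open>sgn s\<close>, with value 0 at 0, so dominated convergence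
  identifies the gradient, including on the zero set of \<open>u\<close>.\<close>

lemma weak_grad_abs:
  assumes g: "has_weak_grad u g" and u: "sq_int lebesgue u"
  shows "has_weak_grad (\<lambda>x. \<bar>u x\<bar>) (\<lambda>x. sgn (u x) *\<^sub>R g x)"
proof -
  define e where "e k = inverse (real (Suc k))" for k
  have e: "e k > 0" for k by (simp add: e_def)
  have e0: "e \<longlonglongrightarrow> 0" unfolding e_def by (rule LIMSEQ_inverse_real_of_nat)
  define F where "F k s = sqrt (s\<^sup>2 + (e k)\<^sup>2) - e k" for k s
  define f where "f k s = s / sqrt (s\<^sup>2 + (e k)\<^sup>2)" for k s
  have pos: "0 < s\<^sup>2 + (e k)\<^sup>2" for k s using e[of k] by (intro add_nonneg_pos) auto
  have F: "(F k has_real_derivative f k s) (at s)" for k s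
    unfolding F_def[abs_def] f_def using pos[of s k] by (auto intro!: derivative_eq_intros simp: field_simps)
  have fc: "continuous_on UNIV (f k)" for k
    unfolding f_def[abs_def] using pos[of _ k] by (intro continuous_intros) (auto simp: less_imp_neq[symmetric])
  have fb: "\<bar>f k s\<bar> \<le> 1" for k s
  proof -
    have "\<bar>s\<bar> \<le> sqrt (s\<^sup>2 + (e k)\<^sup>2)" by (rule real_le_rsqrt) simp
    then show ?thesis using pos[of s k] by (simp add: f_def)
  qed
  have F0: "F k 0 = 0" for k using e[of k] by (simp add: F_def)
  have Fb: "\<bar>F k s\<bar> \<le> \<bar>s\<bar>" for k s using Lipschitz_of_bounded_DERIV[OF F fb, of k s 0] F0 by simp
  note chain = weak_chain_rule[OF g u F fc fb F0]
  have gs: "sq_int lebesgue g" by (rule has_weak_gradD[OF g])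
  have [measurable]: "u \<in> borel_measurable lebesgue" "g \<in> borel_measurable lebesgue" using u gs by (auto simp: sq_int_def)
  have Flim: "(\<lambda>k. F k s) \<longlonglongrightarrow> \<bar>s\<bar>" for s
  proof -
    have "(\<lambda>k. F k s) \<longlonglongrightarrow> sqrt (s\<^sup>2 + 0\<^sup>2) - 0" unfolding F_def by (intro tendsto_intros e0)
    then show ?thesis by simp
  qed
  have flim: "(\<lambda>k. f k s) \<longlonglongrightarrow> sgn s" for s
  proof (cases "s = 0")
    case False
    then have "(\<lambda>k. f k s) \<longlonglongrightarrow> s / sqrt (s\<^sup>2 + 0\<^sup>2)" unfolding f_def by (intro tendsto_intros e0) auto
    then show ?thesis by (simp add: real_sgn_eq)
  qed (simp add: f_def)
  show ?thesis
  proof (rule has_weak_grad_limit[OF chain])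
    show "sq_int lebesgue (\<lambda>x. \<bar>u x\<bar>)" using u by (rule sq_int_abs)
    show "(\<lambda>k. nrm2 lebesgue (\<lambda>x. F k (u x) - \<bar>u x\<bar>)) \<longlonglongrightarrow> 0"
      by (rule nrm2_dominated(3)[where w=u]) (use chain(2) u Flim Fb in \<open>auto simp: sq_int_def\<close>)
    have fm: "(\<lambda>x. f k (u x) *\<^sub>R g x) \<in> borel_measurable lebesgue" for k
      using has_weak_gradD(1)[OF chain(1)] by (simp add: sq_int_def)
    have fb': "norm (f k (u x) *\<^sub>R g x) \<le> norm (g x)" for k x using fb[of k "u x"] by (simp add: mult_left_le_one_le)
    have sm: "(\<lambda>x. sgn (u x) *\<^sub>R g x) \<in> borel_measurable lebesgue" by measurable
    have lim: "AE x in lebesgue. (\<lambda>k. f k (u x) *\<^sub>R g x) \<longlonglongrightarrow> sgn (u x) *\<^sub>R g x"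
      by (intro AE_I2 tendsto_intros flim)
    show "sq_int lebesgue (\<lambda>x. sgn (u x) *\<^sub>R g x)" "(\<lambda>k. nrm2 lebesgue (\<lambda>x. f k (u x) *\<^sub>R g x - sgn (u x) *\<^sub>R g x)) \<longlonglongrightarrow> 0"
      by (rule nrm2_dominated[OF fm sm gs lim AE_I2[OF fb']])+
  qed
qed

text \<open>The C^1 approximations of \<open>u\<close> are multiplied by \<psi>; the bounds on
  \<psi> and its gradient turn their convergence into convergence of the products.\<close>

lemma weak_product_rule:
  assumes g: "has_weak_grad u g" and u: "sq_int lebesgue u"
    and psi: "C1grad \<psi> \<Psi>" "\<And>x. \<bar>\<psi> x\<bar> \<le> B" "\<And>x. norm (\<Psi> x) \<le> B"
  shows "has_weak_grad (\<lambda>x. \<psi> x * u x) (\<lambda>x. \<psi> x *\<^sub>R g x + u x *\<^sub>R \<Psi> x)" "sq_int lebesgue (\<lambda>x. \<psi> x * u x)"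
proof -
  obtain w G where "C1_approx u g w G" using H1_approx[OF g u] by auto
  note wG = C1_approxD[OF this]
  have gs: "sq_int lebesgue g" by (rule has_weak_gradD[OF g])
  note [measurable] = C1gradD(6,7)[OF psi(1)]
  have B: "0 \<le> B" using psi(2) abs_ge_zero order_trans by blast
  have s1: "sq_int lebesgue (\<lambda>x. \<psi> x * v x)" if "sq_int lebesgue v" for v
    using sq_int_mult_bounded[OF that _ psi(2)] by simp
  have s2: "sq_int lebesgue (\<lambda>x. \<psi> x *\<^sub>R h x)" if "sq_int lebesgue h" for h :: "real^'a \<Rightarrow> real^'a"
    by (intro sq_int_mult_bounded[OF that _ psi(2)]) simp
  have s3: "sq_int lebesgue (\<lambda>x. v x *\<^sub>R \<Psi> x) \<and> nrm2 lebesgue (\<lambda>x. v x *\<^sub>R \<Psi> x) \<le> B * nrm2 lebesgue v" if "sq_int lebesgue v" for v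
  proof
    have le: "norm (v x *\<^sub>R \<Psi> x) \<le> norm (B * v x)" for x 
      using mult_left_mono[OF psi(3)[of x], of "\<bar>v x\<bar>"] B by (simp add: abs_mult mult.commute)
    show "sq_int lebesgue (\<lambda>x. v x *\<^sub>R \<Psi> x)"
      by (rule sq_int_bound[OF that, where C=B]) (use le that B in \<open>auto simp: sq_int_def abs_mult\<close>)
    have "nrm2 lebesgue (\<lambda>x. v x *\<^sub>R \<Psi> x) \<le> nrm2 lebesgue (\<lambda>x. B * v x)"
      using le by (intro nrm2_mono sq_int_cmult that) auto
    then show "nrm2 lebesgue (\<lambda>x. v x *\<^sub>R \<Psi> x) \<le> B * nrm2 lebesgue v" using B by (simp add: nrm2_cmult)
  qed
  show "sq_int lebesgue (\<lambda>x. \<psi> x * u x)" by (rule s1[OF u])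
  show "has_weak_grad (\<lambda>x. \<psi> x * u x) (\<lambda>x. \<psi> x *\<^sub>R g x + u x *\<^sub>R \<Psi> x)"
  proof (rule has_weak_grad_limit)
    show "has_weak_grad (\<lambda>x. \<psi> x * w k x) (\<lambda>x. \<psi> x *\<^sub>R G k x + w k x *\<^sub>R \<Psi> x)" for k
      using s3[OF wG(2)] by (intro C1grad_has_weak_grad C1grad_mult psi wG s1 s2 sq_int_add) auto
    show "sq_int lebesgue (\<lambda>x. \<psi> x * w k x)" for k by (intro s1 wG)
    show "sq_int lebesgue (\<lambda>x. \<psi> x *\<^sub>R g x + u x *\<^sub>R \<Psi> x)" using s3[OF u] by (intro sq_int_add s2 gs) auto
    have 0: "(\<lambda>k. B * nrm2 lebesgue (\<lambda>x. w k x - u x)) \<longlonglongrightarrow> 0" "(\<lambda>k. B * nrm2 lebesgue (\<lambda>x. G k x - g x)) \<longlonglongrightarrow> 0"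
      by (intro tendsto_mult_right_zero wG)+
    show "(\<lambda>k. nrm2 lebesgue (\<lambda>x. \<psi> x * w k x - \<psi> x * u x)) \<longlonglongrightarrow> 0"
    proof (rule tendsto_sandwich[OF _ _ tendsto_const 0(1)])
      show "\<forall>\<^sub>F k in sequentially. nrm2 lebesgue (\<lambda>x. \<psi> x * w k x - \<psi> x * u x) \<le> B * nrm2 lebesgue (\<lambda>x. w k x - u x)"
        using nrm2_mult_bounded[OF sq_int_diff[OF wG(2) u] psi(2)] by (simp add: right_diff_distrib)
    qed auto
    show "(\<lambda>k. nrm2 lebesgue (\<lambda>x. \<psi> x *\<^sub>R G k x + w k x *\<^sub>R \<Psi> x - (\<psi> x *\<^sub>R g x + u x *\<^sub>R \<Psi> x))) \<longlonglongrightarrow> 0"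
    proof (rule tendsto_sandwich[OF _ _ tendsto_const tendsto_add_zero[OF 0(2,1)]])
      have "nrm2 lebesgue (\<lambda>x. \<psi> x *\<^sub>R (G k x - g x) + (w k x - u x) *\<^sub>R \<Psi> x) 
        \<le> nrm2 lebesgue (\<lambda>x. \<psi> x *\<^sub>R (G k x - g x)) + nrm2 lebesgue (\<lambda>x. (w k x - u x) *\<^sub>R \<Psi> x)" for k
        using s3[OF sq_int_diff[OF wG(2) u]] by (intro nrm2_triangle s2 sq_int_diff wG gs) auto
      also have "\<dots> k \<le> B * nrm2 lebesgue (\<lambda>x. G k x - g x) + B * nrm2 lebesgue (\<lambda>x. w k x - u x)" for k
        using s3[OF sq_int_diff[OF wG(2) u]] by (intro add_mono nrm2_mult_bounded psi sq_int_diff wG gs) auto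
      finally show "\<forall>\<^sub>F k in sequentially. nrm2 lebesgue (\<lambda>x. \<psi> x *\<^sub>R G k x + w k x *\<^sub>R \<Psi> x - (\<psi> x *\<^sub>R g x + u x *\<^sub>R \<Psi> x))
        \<le> B * nrm2 lebesgue (\<lambda>x. G k x - g x) + B * nrm2 lebesgue (\<lambda>x. w k x - u x)"
        by (simp add: algebra_simps)
    qed auto
  qed fact
qed

section \<open>Form-compact potentials\<close>

definition lnrm :: "real \<Rightarrow> (real^'n::finite \<Rightarrow> real) \<Rightarrow> real" where
  "lnrm R u = nrm2 lebesgue (\<lambda>x. indicator (cball 0 R) x * u x)"

lemma lnrm_nonneg [simp]: "0 \<le> lnrm R u" by (simp add: lnrm_def)

lemma sq_int_indicator_mult:
  fixes u :: "'a::euclidean_space \<Rightarrow> real"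
  shows "sq_int lebesgue u \<Longrightarrow> sq_int lebesgue (\<lambda>x. indicator (cball 0 R) x * u x)"
  using sq_int_mult_bounded[of lebesgue u "indicator (cball 0 R)" 1] by (simp add: indicator_def)

lemma lnrm_le: "sq_int lebesgue u \<Longrightarrow> lnrm R u \<le> nrm2 lebesgue u"
  unfolding lnrm_def by (rule nrm2_mono) (auto simp: indicator_def)

lemma lnrm_mono: "sq_int lebesgue u \<Longrightarrow> R \<le> R' \<Longrightarrow> lnrm R u \<le> lnrm R' u"
  unfolding lnrm_def by (intro nrm2_mono sq_int_indicator_mult) (auto simp: indicator_def)

lemma lnrm_power2: "(lnrm R u)\<^sup>2 = (\<integral>x. (u x)\<^sup>2 * indicator (cball 0 R) x \<partial>lebesgue)"
  unfolding lnrm_def nrm2_power2 by (intro Bochner_Integration.integral_cong) (auto simp: indicator_def)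

text \<open>Potentials whose quadratic form is compact relative to the \<open>H\<^sup>1\<close> norm.\<close>

definition compact_pot :: "(real^'n::finite \<Rightarrow> real) \<Rightarrow> bool" where
  "compact_pot A \<longleftrightarrow> A \<in> borel_measurable lebesgue \<and> (\<forall>u\<in>H1. integrable lebesgue (\<lambda>x. \<bar>A x\<bar> * (u x)\<^sup>2)) \<and>
     (\<forall>e>0. \<exists>C\<ge>0. \<exists>R. \<forall>u\<in>H1. (\<integral>x. \<bar>A x\<bar> * (u x)\<^sup>2 \<partial>lebesgue) \<le> e * ((gnrm u)\<^sup>2 + (nrm2 lebesgue u)\<^sup>2) + C * (lnrm R u)\<^sup>2)"

lemma compact_potD:
  assumes "compact_pot A"
  shows "A \<in> borel_measurable lebesgue" "u \<in> H1 \<Longrightarrow> integrable lebesgue (\<lambda>x. \<bar>A x\<bar> * (u x)\<^sup>2)"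
    "0 < e \<Longrightarrow> \<exists>C\<ge>0. \<exists>R. \<forall>u\<in>H1. (\<integral>x. \<bar>A x\<bar> * (u x)\<^sup>2 \<partial>lebesgue) \<le> e * ((gnrm u)\<^sup>2 + (nrm2 lebesgue u)\<^sup>2) + C * (lnrm R u)\<^sup>2"
  using assms by (auto simp: compact_pot_def)

text \<open>Assembles the potential from its two parts, and later the square of V(x) |x| from the
  squares of its parts.\<close>

lemma compact_pot_dominated:
  assumes A: "compact_pot A1" "compact_pot A2" and B: "B \<in> borel_measurable lebesgue"
    and le: "AE x in lebesgue. \<bar>B x\<bar> \<le> c * (\<bar>A1 x\<bar> + \<bar>A2 x\<bar>)" and c: "0 < c"
  shows "compact_pot B"
proof -
  have um: "u \<in> H1 \<Longrightarrow> u \<in> borel_measurable lebesgue" for u :: "real^'a \<Rightarrow> real"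
    by (simp add: H1_iff sq_int_def)
  have dom: "AE x in lebesgue. \<bar>B x\<bar> * (u x)\<^sup>2 \<le> c * (\<bar>A1 x\<bar> * (u x)\<^sup>2 + \<bar>A2 x\<bar> * (u x)\<^sup>2)" for u
    using le by eventually_elim (use mult_right_mono[OF _ zero_le_power2] in \<open>fastforce simp: algebra_simps\<close>)
  have int: "integrable lebesgue (\<lambda>x. \<bar>B x\<bar> * (u x)\<^sup>2)" if u: "u \<in> H1" for u
  proof (rule Bochner_Integration.integrable_bound)
    show "integrable lebesgue (\<lambda>x. c * (\<bar>A1 x\<bar> * (u x)\<^sup>2 + \<bar>A2 x\<bar> * (u x)\<^sup>2))"
      by (intro integrable_mult_right Bochner_Integration.integrable_add compact_potD(2)[OF A(1) u] compact_potD(2)[OF A(2) u])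
    show "(\<lambda>x. \<bar>B x\<bar> * (u x)\<^sup>2) \<in> borel_measurable lebesgue" using B um[OF u] by measurable
    show "AE x in lebesgue. norm (\<bar>B x\<bar> * (u x)\<^sup>2) \<le> norm (c * (\<bar>A1 x\<bar> * (u x)\<^sup>2 + \<bar>A2 x\<bar> * (u x)\<^sup>2))"
      using dom[of u] by eventually_elim (use c in simp)
  qed
  show ?thesis unfolding compact_pot_def
  proof (intro conjI allI impI ballI B int)
    fix e :: real assume e: "0 < e"
    obtain C1 R1 where C1: "C1 \<ge> 0" "\<And>u. u \<in> H1 \<Longrightarrow> (\<integral>x. \<bar>A1 x\<bar> * (u x)\<^sup>2 \<partial>lebesgue) \<le> (e / (2 * c)) * ((gnrm u)\<^sup>2 + (nrm2 lebesgue u)\<^sup>2) + C1 * (lnrm R1 u)\<^sup>2"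
      using compact_potD(3)[OF A(1), of "e / (2 * c)"] e c by auto
    obtain C2 R2 where C2: "C2 \<ge> 0" "\<And>u. u \<in> H1 \<Longrightarrow> (\<integral>x. \<bar>A2 x\<bar> * (u x)\<^sup>2 \<partial>lebesgue) \<le> (e / (2 * c)) * ((gnrm u)\<^sup>2 + (nrm2 lebesgue u)\<^sup>2) + C2 * (lnrm R2 u)\<^sup>2"
      using compact_potD(3)[OF A(2), of "e / (2 * c)"] e c by auto
    have "(\<integral>x. \<bar>B x\<bar> * (u x)\<^sup>2 \<partial>lebesgue) \<le> e * ((gnrm u)\<^sup>2 + (nrm2 lebesgue u)\<^sup>2) + (c * C1 + c * C2) * (lnrm (max R1 R2) u)\<^sup>2"
      if u: "u \<in> H1" for u
    proof -
      have "(\<integral>x. \<bar>B x\<bar> * (u x)\<^sup>2 \<partial>lebesgue) \<le> (\<integral>x. c * (\<bar>A1 x\<bar> * (u x)\<^sup>2 + \<bar>A2 x\<bar> * (u x)\<^sup>2) \<partial>lebesgue)"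
        by (intro integral_mono_AE int u dom integrable_mult_right Bochner_Integration.integrable_add compact_potD(2)[OF A(1) u] compact_potD(2)[OF A(2) u])
      also have "\<dots> = c * ((\<integral>x. \<bar>A1 x\<bar> * (u x)\<^sup>2 \<partial>lebesgue) + (\<integral>x. \<bar>A2 x\<bar> * (u x)\<^sup>2 \<partial>lebesgue))"
        using compact_potD(2)[OF A(1) u] compact_potD(2)[OF A(2) u] by simp
      also have "\<dots> \<le> c * (((e / (2 * c)) * ((gnrm u)\<^sup>2 + (nrm2 lebesgue u)\<^sup>2) + C1 * (lnrm R1 u)\<^sup>2) + 
          ((e / (2 * c)) * ((gnrm u)\<^sup>2 + (nrm2 lebesgue u)\<^sup>2) + C2 * (lnrm R2 u)\<^sup>2))"
        using c by (intro mult_left_mono add_mono C1 C2 u) auto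
      also have "\<dots> = e * ((gnrm u)\<^sup>2 + (nrm2 lebesgue u)\<^sup>2) + (c * C1 * (lnrm R1 u)\<^sup>2 + c * C2 * (lnrm R2 u)\<^sup>2)"
        using c by (simp add: field_simps)
      also have "\<dots> \<le> e * ((gnrm u)\<^sup>2 + (nrm2 lebesgue u)\<^sup>2) + (c * C1 * (lnrm (max R1 R2) u)\<^sup>2 + c * C2 * (lnrm (max R1 R2) u)\<^sup>2)"
        using c C1(1) C2(1) u by (intro add_left_mono add_mono mult_left_mono power_mono lnrm_mono) auto
      finally show ?thesis by (simp add: algebra_simps)
    qed
    then show "\<exists>C\<ge>0. \<exists>R. \<forall>u\<in>H1. (\<integral>x. \<bar>B x\<bar> * (u x)\<^sup>2 \<partial>lebesgue) \<le> e * ((gnrm u)\<^sup>2 + (nrm2 lebesgue u)\<^sup>2) + C * (lnrm R u)\<^sup>2"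
      using c C1(1) C2(1) by (intro exI[of _ "c * C1 + c * C2"] exI[of _ "max R1 R2"]) auto
  qed
qed

text \<open>With \<theta> = 2/N one has p (1 - \<theta>) = 2, so interpolating between |A|^(N/2) and
  |u|^p gives exactly |A| u^2; the Sobolev inequality turns the second factor into the
  gradient.\<close>

lemma pot_Hoelder:
  assumes n: "CARD('n::finite) \<ge> 3"
  shows "\<exists>S>0. \<forall>A. \<forall>u\<in>H1. A \<in> borel_measurable lebesgue \<longrightarrow> integrable lebesgue (\<lambda>x::real^'n. \<bar>A x\<bar> powr (real CARD('n) / 2)) \<longrightarrow>
     integrable lebesgue (\<lambda>x. \<bar>A x\<bar> * (u x)\<^sup>2) \<and>
     (\<integral>x. \<bar>A x\<bar> * (u x)\<^sup>2 \<partial>lebesgue) \<le> S * (\<integral>x. \<bar>A x\<bar> powr (real CARD('n) / 2) \<partial>lebesgue) powr (2 / real CARD('n)) * (gnrm u)\<^sup>2"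
proof -
  define p where "p = crit_exp TYPE('n)"
  define \<theta> where "\<theta> = 2 / real CARD('n)"
  note pe = crit_exp_facts[OF n, folded p_def \<theta>_def]
  have \<theta>: "0 < \<theta>" "\<theta> < 1" "real CARD('n) / 2 = 1 / \<theta>" using pe by (auto simp: \<theta>_def)
  have p\<theta>: "p * (1 - \<theta>) = 2" using pe(1,5) by (simp add: field_simps)
  obtain S where S: "S > 0" and Sob: "\<forall>u\<in>H1. integrable lebesgue (\<lambda>x::real^'n. \<bar>u x\<bar> powr p) \<and> (\<integral>x. \<bar>u x\<bar> powr p \<partial>lebesgue) \<le> S * gnrm u powr p"
    using Sobolev[OF n, folded p_def] by (elim exE conjE) (rule that)
  have "integrable lebesgue (\<lambda>x. \<bar>A x\<bar> * (u x)\<^sup>2) \<and>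
     (\<integral>x. \<bar>A x\<bar> * (u x)\<^sup>2 \<partial>lebesgue) \<le> S powr (1 - \<theta>) * (\<integral>x. \<bar>A x\<bar> powr (1 / \<theta>) \<partial>lebesgue) powr \<theta> * (gnrm u)\<^sup>2"
    if u: "u \<in> H1" and A: "A \<in> borel_measurable lebesgue" "integrable lebesgue (\<lambda>x::real^'n. \<bar>A x\<bar> powr (1 / \<theta>))" for u A
  proof -
    note Sob = Sob[rule_format, OF u]
    have eq: "(\<bar>A x\<bar> powr (1 / \<theta>)) powr \<theta> * (\<bar>u x\<bar> powr p) powr (1 - \<theta>) = \<bar>A x\<bar> * (u x)\<^sup>2" for x
      using \<theta> by (simp add: powr_powr p\<theta> powr_numeral)
    note H = Hoelder_interpolation[OF A(2) _ Sob[THEN conjunct1] _ \<theta>(1,2), simplified, unfolded eq]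
    have "(\<integral>x. \<bar>A x\<bar> * (u x)\<^sup>2 \<partial>lebesgue) \<le> (\<integral>x. \<bar>A x\<bar> powr (1 / \<theta>) \<partial>lebesgue) powr \<theta> * (\<integral>x. \<bar>u x\<bar> powr p \<partial>lebesgue) powr (1 - \<theta>)"
      by (rule H(2))
    also have "\<dots> \<le> (\<integral>x. \<bar>A x\<bar> powr (1 / \<theta>) \<partial>lebesgue) powr \<theta> * (S * gnrm u powr p) powr (1 - \<theta>)"
      using Sob \<theta> by (intro mult_left_mono powr_mono2) (auto intro!: Bochner_Integration.integral_nonneg)
    also have "(S * gnrm u powr p) powr (1 - \<theta>) = S powr (1 - \<theta>) * (gnrm u)\<^sup>2"
      using S by (simp add: powr_mult powr_powr p\<theta> powr_numeral)
    finally show ?thesis using H(1) by (simp add: mult_ac)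
  qed
  then show ?thesis using S unfolding \<theta>(3) \<theta>_def[symmetric] by (intro exI[of _ "S powr (1 - \<theta>)"]) auto
qed

text \<open>Where |A| and |x| are both at most \<open>k\<close>, the form is bounded by
  \<open>k\<close> times a local mass. Off that set the L^(N/2) norm of \<open>A\<close> tends to 0
  by dominated convergence, so the gradient absorbs that part with a small factor.\<close>

lemma compact_pot_Lp:
  fixes A :: "real^'n::finite \<Rightarrow> real"
  assumes n: "CARD('n) \<ge> 3" and A[measurable]: "A \<in> borel_measurable lebesgue" 
    and Ai: "integrable lebesgue (\<lambda>x. \<bar>A x\<bar> powr (real CARD('n) / 2))"
  shows "compact_pot A"
proof -
  define q where "q = real CARD('n) / 2"
  have q: "0 < q" "2 / real CARD('n) = 1 / q" by (auto simp: q_def)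
  obtain S where S: "S > 0" and H: "\<forall>A. \<forall>u\<in>H1. A \<in> borel_measurable lebesgue \<longrightarrow> integrable lebesgue (\<lambda>x::real^'n. \<bar>A x\<bar> powr q) \<longrightarrow>
     integrable lebesgue (\<lambda>x. \<bar>A x\<bar> * (u x)\<^sup>2) \<and>
     (\<integral>x. \<bar>A x\<bar> * (u x)\<^sup>2 \<partial>lebesgue) \<le> S * (\<integral>x. \<bar>A x\<bar> powr q \<partial>lebesgue) powr (1 / q) * (gnrm u)\<^sup>2"
    using pot_Hoelder[OF n, folded q_def, unfolded q(2)] by (elim exE conjE) (rule that)
  note Ai = Ai[folded q_def]
  have int: "integrable lebesgue (\<lambda>x. \<bar>A x\<bar> * (u x)\<^sup>2)" if "u \<in> H1" for u using H that A Ai by blast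
  define good where "good k = {x. \<bar>A x\<bar> \<le> real k \<and> norm x \<le> real k}" for k
  have [measurable]: "(\<lambda>x::real^'n. norm x) \<in> borel_measurable lebesgue"
    by (intro continuous_borel_lebesgue continuous_intros)
  have [measurable]: "good k \<in> sets lebesgue" for k 
  proof -
    have "{x \<in> space lebesgue. \<bar>A x\<bar> \<le> real k \<and> norm x \<le> real k} \<in> sets lebesgue" by measurable
    then show ?thesis by (simp add: good_def)
  qed
  define B where "B k x = A x * indicator (- good k) x" for k x
  have [measurable]: "B k \<in> borel_measurable lebesgue" for k unfolding B_def[abs_def] by measurable
  have Bi: "integrable lebesgue (\<lambda>x. \<bar>B k x\<bar> powr q)" for k
    by (rule Bochner_Integration.integrable_bound[OF Ai]) (auto simp: B_def indicator_def)
  have "(\<lambda>k. \<integral>x. \<bar>B k x\<bar> powr q \<partial>lebesgue) \<longlonglongrightarrow> (\<integral>x. (0::real) \<partial>(lebesgue :: (real^'n) measure))"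
  proof (rule integral_dominated_convergence[where w="\<lambda>x. \<bar>A x\<bar> powr q"])
    show "AE x in lebesgue. (\<lambda>k. \<bar>B k x\<bar> powr q) \<longlonglongrightarrow> 0"
    proof (intro AE_I2 tendsto_eventually)
      fix x
      obtain N where N: "max \<bar>A x\<bar> (norm x) \<le> real N" using real_arch_simple by blast
      show "\<forall>\<^sub>F k in sequentially. \<bar>B k x\<bar> powr q = 0"
      proof (rule eventually_sequentiallyI[of N])
        fix k assume "N \<le> k"
        then have "real N \<le> real k" by simp
        then show "\<bar>B k x\<bar> powr q = 0" using N by (simp add: B_def good_def)
      qed
    qed
    show "AE x in lebesgue. norm (\<bar>B k x\<bar> powr q) \<le> \<bar>A x\<bar> powr q" for k
      by (auto simp: B_def indicator_def)
  qed (use Ai in auto)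
  then have lim: "(\<lambda>k. S * (\<integral>x. \<bar>B k x\<bar> powr q \<partial>lebesgue) powr (1 / q)) \<longlonglongrightarrow> S * 0 powr (1 / q)"
    using q by (intro tendsto_mult tendsto_const tendsto_powr') (auto intro!: Bochner_Integration.integral_nonneg)
  show ?thesis unfolding compact_pot_def
  proof (intro conjI ballI allI impI int A)
    fix e :: real assume e: "0 < e"
    have "\<forall>\<^sub>F k in sequentially. S * (\<integral>x. \<bar>B k x\<bar> powr q \<partial>lebesgue) powr (1 / q) < e"
      using order_tendstoD(2)[OF lim, of e] e by simp
    then obtain k where k: "S * (\<integral>x. \<bar>B k x\<bar> powr q \<partial>lebesgue) powr (1 / q) < e"
      using eventually_happens'[OF sequentially_bot] by blast
    have "(\<integral>x. \<bar>A x\<bar> * (u x)\<^sup>2 \<partial>lebesgue) \<le> e * ((gnrm u)\<^sup>2 + (nrm2 lebesgue u)\<^sup>2) + real k * (lnrm (real k) u)\<^sup>2" if u: "u \<in> H1" for u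
    proof -
      note HB = H[rule_format, OF u \<open>B k \<in> borel_measurable lebesgue\<close> Bi]
      have li: "integrable lebesgue (\<lambda>x. (u x)\<^sup>2 * indicator (cball 0 (real k)) x)"
        using sq_int_integrable[OF H1_sq_int[OF u]] by (intro integrable_real_mult_indicator) auto
      have "(\<integral>x. \<bar>A x\<bar> * (u x)\<^sup>2 \<partial>lebesgue) \<le> (\<integral>x. \<bar>B k x\<bar> * (u x)\<^sup>2 + real k * ((u x)\<^sup>2 * indicator (cball 0 (real k)) x) \<partial>lebesgue)"
      proof (rule integral_mono)
        fix x
        show "\<bar>A x\<bar> * (u x)\<^sup>2 \<le> \<bar>B k x\<bar> * (u x)\<^sup>2 + real k * ((u x)\<^sup>2 * indicator (cball 0 (real k)) x)"
          by (cases "x \<in> good k") (auto simp: B_def good_def intro!: mult_right_mono)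
      qed (use HB li int[OF u] in auto)
      also have "\<dots> = (\<integral>x. \<bar>B k x\<bar> * (u x)\<^sup>2 \<partial>lebesgue) + real k * (lnrm (real k) u)\<^sup>2"
        unfolding lnrm_power2 using HB li by simp
      also have "(\<integral>x. \<bar>B k x\<bar> * (u x)\<^sup>2 \<partial>lebesgue) \<le> e * (gnrm u)\<^sup>2"
        using HB k by (intro order_trans[OF HB[THEN conjunct2]] mult_right_mono) auto
      finally show ?thesis 
        using mult_nonneg_nonneg[OF less_imp_le[OF e] zero_le_power2[of "nrm2 lebesgue u"]] unfolding distrib_left by linarith
    qed
    then show "\<exists>C\<ge>0. \<exists>R. \<forall>u\<in>H1. (\<integral>x. \<bar>A x\<bar> * (u x)\<^sup>2 \<partial>lebesgue) \<le> e * ((gnrm u)\<^sup>2 + (nrm2 lebesgue u)\<^sup>2) + C * (lnrm R u)\<^sup>2"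
      by (intro exI[of _ "real k"] exI[of _ "real k"]) auto
  qed
qed

text \<open>Outside a large ball |A| is below \<open>e\<close>; inside it the essential bound feeds
  the local term.\<close>

lemma compact_pot_Linf:
  fixes A :: "real^'n::finite \<Rightarrow> real"
  assumes A[measurable]: "A \<in> borel_measurable lebesgue" and K: "AE x in lebesgue. \<bar>A x\<bar> \<le> K" 
    and lim: "(A \<longlongrightarrow> 0) at_infinity"
  shows "compact_pot A"
proof -
  have um: "u \<in> H1 \<Longrightarrow> u \<in> borel_measurable lebesgue" for u :: "real^'n \<Rightarrow> real"
    by (simp add: H1_iff sq_int_def)
  have int: "integrable lebesgue (\<lambda>x. \<bar>A x\<bar> * (u x)\<^sup>2)" if u: "u \<in> H1" for u
  proof (rule Bochner_Integration.integrable_bound)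
    show "integrable lebesgue (\<lambda>x. \<bar>K\<bar> * (norm (u x))\<^sup>2)" using sq_int_integrable[OF H1_sq_int[OF u]] by simp
    show "AE x in lebesgue. norm (\<bar>A x\<bar> * (u x)\<^sup>2) \<le> norm (\<bar>K\<bar> * (norm (u x))\<^sup>2)"
      using K by eventually_elim (auto intro!: mult_right_mono)
  qed (use um[OF u] in measurable)
  show ?thesis unfolding compact_pot_def
  proof (intro conjI ballI allI impI int A)
    fix e :: real assume e: "0 < e"
    obtain R where R: "\<And>x. norm x \<ge> R \<Longrightarrow> \<bar>A x\<bar> < e"
      using tendstoD[OF lim e] by (auto simp: eventually_at_infinity)
    have "(\<integral>x. \<bar>A x\<bar> * (u x)\<^sup>2 \<partial>lebesgue) \<le> e * ((gnrm u)\<^sup>2 + (nrm2 lebesgue u)\<^sup>2) + \<bar>K\<bar> * (lnrm R u)\<^sup>2" if u: "u \<in> H1" for u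
    proof -
      have ui: "integrable lebesgue (\<lambda>x. (u x)\<^sup>2)" using sq_int_real[OF H1_sq_int[OF u]] .
      have li: "integrable lebesgue (\<lambda>x. (u x)\<^sup>2 * indicator (cball 0 R) x)"
        using ui by (intro integrable_real_mult_indicator) auto
      have "(\<integral>x. \<bar>A x\<bar> * (u x)\<^sup>2 \<partial>lebesgue) \<le> (\<integral>x. e * (u x)\<^sup>2 + \<bar>K\<bar> * ((u x)\<^sup>2 * indicator (cball 0 R) x) \<partial>lebesgue)"
      proof (rule integral_mono_AE)
        show "AE x in lebesgue. \<bar>A x\<bar> * (u x)\<^sup>2 \<le> e * (u x)\<^sup>2 + \<bar>K\<bar> * ((u x)\<^sup>2 * indicator (cball 0 R) x)"
          using K
        proof eventually_elim
          case (elim x)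
          have "\<bar>A x\<bar> \<le> e + \<bar>K\<bar> * indicator (cball 0 R) x"
          proof (cases "norm x \<le> R")
            case True then show ?thesis using elim e by simp
          next
            case False then show ?thesis using R[of x] by simp
          qed
          from mult_right_mono[OF this, of "(u x)\<^sup>2"] show ?case by (simp add: algebra_simps)
        qed
      qed (use ui li int[OF u] in auto)
      also have "\<dots> = e * (nrm2 lebesgue u)\<^sup>2 + \<bar>K\<bar> * (lnrm R u)\<^sup>2"
        unfolding lnrm_power2 nrm2_power2 using ui li by simp
      finally show ?thesis using mult_nonneg_nonneg[OF less_imp_le[OF e] zero_le_power2[of "gnrm u"]] by (simp add: algebra_simps)
    qed
    then show "\<exists>C\<ge>0. \<exists>R. \<forall>u\<in>H1. (\<integral>x. \<bar>A x\<bar> * (u x)\<^sup>2 \<partial>lebesgue) \<le> e * ((gnrm u)\<^sup>2 + (nrm2 lebesgue u)\<^sup>2) + C * (lnrm R u)\<^sup>2"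
      by (intro exI[of _ "\<bar>K\<bar>"] exI[of _ R]) auto
  qed
qed

text \<open>Estimating the local norm by the full one leaves relative form bound zero with respect
  to the gradient, for uses where no compactness is at stake.\<close>

lemma compact_pot_form_bound:
  assumes A: "compact_pot A" and e: "0 < e"
  shows "\<exists>C\<ge>0. \<forall>u\<in>H1. (\<integral>x. \<bar>A x\<bar> * (u x)\<^sup>2 \<partial>lebesgue) \<le> e * (gnrm u)\<^sup>2 + C * (nrm2 lebesgue u)\<^sup>2"
proof -
  obtain C R where C: "C \<ge> 0" "\<And>u. u \<in> H1 \<Longrightarrow> (\<integral>x. \<bar>A x\<bar> * (u x)\<^sup>2 \<partial>lebesgue) \<le> e * ((gnrm u)\<^sup>2 + (nrm2 lebesgue u)\<^sup>2) + C * (lnrm R u)\<^sup>2"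
    using compact_potD(3)[OF A e] by auto
  have "(\<integral>x. \<bar>A x\<bar> * (u x)\<^sup>2 \<partial>lebesgue) \<le> e * (gnrm u)\<^sup>2 + (e + C) * (nrm2 lebesgue u)\<^sup>2" if u: "u \<in> H1" for u
  proof -
    have "C * (lnrm R u)\<^sup>2 \<le> C * (nrm2 lebesgue u)\<^sup>2"
      using C(1) u by (intro mult_left_mono power_mono lnrm_le) auto
    then show ?thesis using C(2)[OF u] by (simp add: algebra_simps)
  qed
  then show ?thesis using C(1) e by (intro exI[of _ "e + C"]) auto
qed

section \<open>Local compactness\<close>

lemma conv_diff:
  assumes "sq_int lebesgue u" "sq_int lebesgue v" "\<phi> \<in> test_fun"
  shows "conv (\<lambda>x. u x - v x) \<phi> x = conv u \<phi> x - conv v \<phi> x"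
  using conv_integrable[OF assms(1,3)] conv_integrable[OF assms(2,3)] by (simp add: conv_def left_diff_distrib)

text \<open>Cauchy-Schwarz against the reflected kernel, and the translation estimate applied to the
  kernel itself. The constant depends on the kernel only, which gives equicontinuity over bounded
  sets of L2.\<close>

lemma conv_Lipschitz:
  fixes \<phi> :: "real^'n::finite \<Rightarrow> real"
  assumes phi: "\<phi> \<in> test_fun"
  shows "\<exists>L\<ge>0. \<forall>u x y. sq_int lebesgue u \<longrightarrow> \<bar>conv u \<phi> x\<bar> \<le> L * nrm2 lebesgue u \<and> \<bar>conv u \<phi> x - conv u \<phi> y\<bar> \<le> L * norm (x - y) * nrm2 lebesgue u"
proof -
  define \<Phi> where "\<Phi> x = (\<chi> i. partial i \<phi> x)" for x
  have \<Phi>s: "sq_int lebesgue \<Phi>" unfolding \<Phi>_def by (rule sq_int_vecI) (auto intro: test_fun_sq_int test_fun_partial phi)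
  have wg: "has_weak_grad \<phi> \<Phi>" 
    using C1grad_has_weak_grad[OF C1grad_test_fun[OF phi] test_fun_sq_int[OF phi]] \<Phi>s by (simp add: \<Phi>_def[abs_def])
  define L where "L = nrm2 lebesgue \<Phi> + nrm2 lebesgue \<phi>"
  have reflect: "sq_int lebesgue (\<lambda>y. f (x - y)) \<and> nrm2 lebesgue (\<lambda>y. f (x - y)) = nrm2 lebesgue f" if "sq_int lebesgue f" for f :: "real^'n \<Rightarrow> real" and x
    using sq_int_affine[OF _ that, of "-1" x] by simp
  have 1: "\<bar>conv u \<phi> x\<bar> \<le> L * nrm2 lebesgue u" if u: "sq_int lebesgue u" for u x
  proof -
    have "\<bar>conv u \<phi> x\<bar> \<le> nrm2 lebesgue u * nrm2 lebesgue (\<lambda>y. \<phi> (x - y))"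
      unfolding conv_def using reflect[OF test_fun_sq_int[OF phi]] by (intro integral_mult_le u) auto
    also have "\<dots> = nrm2 lebesgue \<phi> * nrm2 lebesgue u"
      using reflect[OF test_fun_sq_int[OF phi]] by simp
    also have "\<dots> \<le> L * nrm2 lebesgue u" by (intro mult_right_mono) (auto simp: L_def)
    finally show ?thesis .
  qed
  have 2: "\<bar>conv u \<phi> x - conv u \<phi> y\<bar> \<le> L * norm (x - y) * nrm2 lebesgue u" if u: "sq_int lebesgue u" for u x y
  proof -
    let ?d = "\<lambda>z. \<phi> (z + (x - y)) - \<phi> z"
    have d: "sq_int lebesgue ?d" by (intro sq_int_diff sq_int_translate test_fun_sq_int phi)
    have "conv u \<phi> x - conv u \<phi> y = (\<integral>z. u z * ?d (y - z) \<partial>lebesgue)"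
      unfolding conv_def using conv_integrable[OF u phi] by (simp add: right_diff_distrib)
    then have "\<bar>conv u \<phi> x - conv u \<phi> y\<bar> \<le> nrm2 lebesgue u * nrm2 lebesgue (\<lambda>z. ?d (y - z))"
      using reflect[OF d, of y] integral_mult_le[OF u, of "\<lambda>z. ?d (y - z)"] by simp
    also have "nrm2 lebesgue (\<lambda>z. ?d (y - z)) = nrm2 lebesgue ?d" using reflect[OF d, of y] by simp
    also have "nrm2 lebesgue u * nrm2 lebesgue ?d \<le> nrm2 lebesgue u * (norm (x - y) * nrm2 lebesgue \<Phi>)"
      by (intro mult_left_mono H1_translation wg test_fun_sq_int phi) simp
    also have "\<dots> \<le> L * norm (x - y) * nrm2 lebesgue u"
      by (simp add: L_def algebra_simps)
    finally show ?thesis .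
  qed
  show ?thesis using 1 2 by (intro exI[of _ L]) (auto simp: L_def)
qed

lemma finite_family_subseq:
  fixes a :: "'i \<Rightarrow> nat \<Rightarrow> real"
  assumes "finite I" "\<And>i. i \<in> I \<Longrightarrow> bounded (range (a i))"
  shows "\<exists>r::nat\<Rightarrow>nat. strict_mono r \<and> (\<forall>i\<in>I. convergent (\<lambda>n. a i (r n)))"
  using assms
proof (induction I)
  case empty
  then show ?case using strict_mono_id by blast
next
  case (insert i I)
  then obtain r :: "nat \<Rightarrow> nat" where r: "strict_mono r" "\<forall>i\<in>I. convergent (\<lambda>n. a i (r n))" by auto
  have "bounded (range (\<lambda>n. a i (r n)))" using insert.prems[of i] by (auto intro: bounded_subset)
  then obtain l s where s: "strict_mono (s::nat \<Rightarrow> nat)" "((\<lambda>n. a i (r n)) \<circ> s) \<longlonglongrightarrow> l"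
    using bounded_imp_convergent_subsequence by blast
  have "convergent (\<lambda>n. a j (r (s n)))" if "j \<in> insert i I" for j
  proof (cases "j = i")
    case True then show ?thesis using s(2) by (auto simp: comp_def convergent_def)
  next
    case False then show ?thesis using that r(2) convergent_subseq_convergent[OF _ s(1)] by (auto simp: comp_def)
  qed
  then show ?case using strict_mono_o[OF r(1) s(1)] by (intro exI[of _ "\<lambda>n. r (s n)"]) (simp add: o_def)
qed

text \<open>The mollified sequence is equi-Lipschitz, so it is controlled on a ball by its values on a finite net.\<close>

lemma Rellich_step:
  fixes u :: "nat \<Rightarrow> real^'n::finite \<Rightarrow> real"
  assumes u: "\<And>k. u k \<in> H1" and B: "\<And>k. gnrm (u k) \<le> B" "\<And>k. nrm2 lebesgue (u k) \<le> B" and e: "0 < e"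
  shows "\<exists>r::nat\<Rightarrow>nat. strict_mono r \<and> (\<exists>N. \<forall>m\<ge>N. \<forall>n\<ge>N. lnrm R (\<lambda>x. u (r m) x - u (r n) x) < e)"
proof -
  have B0: "0 \<le> B" using B(1)[of 0] gnrm_nonneg order_trans by blast
  note us = H1_sq_int[OF u]
  \<comment> \<open>Differences of two members have norms at most 2 B. The parameter
    \<open>k\<close> makes their mollification error below e/2, \<open>e1\<close> keeps the
    mollified part over the ball below e/2, and the mesh \<open>d\<close> limits its variation to
    \<open>e1\<close>.\<close>
  define k where "k = 4 * (B + 1) / e"
  have k: "0 < k" "2 * B / k < e / 2" using B0 e by (auto simp: k_def field_simps)
  define \<phi> where "\<phi> = (eta k :: real^'n \<Rightarrow> real)"
  have phi: "\<phi> \<in> test_fun" unfolding \<phi>_def by (rule eta_facts[OF k(1)])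
  obtain L where L: "L \<ge> 0" "\<And>u x y. sq_int lebesgue u \<Longrightarrow> \<bar>conv u \<phi> x\<bar> \<le> L * nrm2 lebesgue u"
    "\<And>u x y. sq_int lebesgue u \<Longrightarrow> \<bar>conv u \<phi> x - conv u \<phi> y\<bar> \<le> L * norm (x - y) * nrm2 lebesgue u"
    using conv_Lipschitz[OF phi] by auto
  define I where "I = nrm2 lebesgue (\<lambda>x::real^'n. indicat_real (cball 0 R) x)"
  have I: "sq_int lebesgue (\<lambda>x::real^'n. indicat_real (cball 0 R) x)"
    by (rule sq_int_bounded_support[where B=1 and R=R]) auto
  have I0: "0 \<le> I" by (simp add: I_def)
  define e1 where "e1 = e / (4 * (I + 1))"
  have e1: "0 < e1" "2 * e1 * I < e / 2" using e I0 by (auto simp: e1_def field_simps)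
  define d where "d = e1 / (2 * L * B + 1)"
  have d: "0 < d" "L * d * (2 * B) \<le> e1"
  proof -
    have *: "0 < 2 * L * B + 1" using L(1) B0 by (intro add_nonneg_pos) auto
    show "0 < d" using * e1 by (simp add: d_def)
    have "d * (2 * L * B) \<le> d * (2 * L * B + 1)" using \<open>0 < d\<close> by (intro mult_left_mono) auto
    then show "L * d * (2 * B) \<le> e1" using * by (simp add: d_def mult_ac)
  qed
  have "compact (cball (0::real^'n) R)" by simp
  then obtain Q where Q: "finite Q" "cball (0::real^'n) R \<subseteq> (\<Union>q\<in>Q. ball q d)"
    using d(1) unfolding compact_eq_totally_bounded by blast
  have "bounded (range (\<lambda>n. conv (u n) \<phi> q))" for q
    unfolding bounded_iff
  proof (intro exI[of _ "L * B"] ballI)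
    fix y assume "y \<in> range (\<lambda>n. conv (u n) \<phi> q)"
    then obtain n where "y = conv (u n) \<phi> q" by auto
    then show "norm y \<le> L * B" using L(2)[OF us[of n], of q] mult_left_mono[OF B(2)[of n] L(1)] by simp
  qed
  then obtain r :: "nat \<Rightarrow> nat" where r: "strict_mono r" "\<And>q. q \<in> Q \<Longrightarrow> convergent (\<lambda>n. conv (u (r n)) \<phi> q)"
    using finite_family_subseq[OF Q(1), of "\<lambda>q n. conv (u n) \<phi> q"] by auto
  have "\<exists>N. \<forall>m\<ge>N. \<forall>n\<ge>N. \<bar>conv (u (r m)) \<phi> q - conv (u (r n)) \<phi> q\<bar> < e1" if "q \<in> Q" for q
    using CauchyD[OF convergent_Cauchy[OF r(2)[OF that]] e1(1)] by simp
  then obtain N where N: "\<And>q m n. q \<in> Q \<Longrightarrow> m \<ge> N q \<Longrightarrow> n \<ge> N q \<Longrightarrow> \<bar>conv (u (r m)) \<phi> q - conv (u (r n)) \<phi> q\<bar> < e1"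
    by metis
  define M where "M = (\<Sum>q\<in>Q. N q)"
  have MN: "N q \<le> M" if "q \<in> Q" for q using member_le_sum[OF that _ Q(1), of N] by (simp add: M_def)
  have "lnrm R (\<lambda>x. u (r m) x - u (r n) x) < e" if mn: "m \<ge> M" "n \<ge> M" for m n
  proof -
    define w where "w x = u (r m) x - u (r n) x" for x
    have w: "w \<in> H1" unfolding w_def[abs_def] by (intro H1_diff u)
    note ws = H1_sq_int[OF w]
    have wB: "gnrm w \<le> 2 * B" "nrm2 lebesgue w \<le> 2 * B"
      using gnrm_diff_le[OF u[of "r m"] u[of "r n"]] nrm2_triangle_diff[OF us[of "r m"] us[of "r n"]] B(1)[of "r m"] B(1)[of "r n"] B(2)[of "r m"] B(2)[of "r n"]
      unfolding w_def[abs_def] by linarith+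
    have moll: "sq_int lebesgue (conv w \<phi>)" "nrm2 lebesgue (\<lambda>x. conv w \<phi> x - w x) \<le> 2 * B / k"
    proof -
      have "nrm2 lebesgue (\<lambda>x. w (x + z) - w x) \<le> 2 * B / k" if z: "norm z < 1 / k" for z
      proof -
        have "nrm2 lebesgue (\<lambda>x. w (x + z) - w x) \<le> norm z * gnrm w"
          unfolding gnrm_def by (intro H1_translation has_weak_grad_weak_grad w ws)
        also have "\<dots> \<le> (1 / k) * (2 * B)" using z wB k by (intro mult_mono) auto
        finally show ?thesis by simp
      qed
      then show "sq_int lebesgue (conv w \<phi>)" "nrm2 lebesgue (\<lambda>x. conv w \<phi> x - w x) \<le> 2 * B / k"
        unfolding \<phi>_def using conv_eta_L2_bound[OF ws k(1), of "2 * B / k"] B0 k by auto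
    qed
    have small: "\<bar>conv w \<phi> x\<bar> \<le> 2 * e1" if x: "x \<in> cball 0 R" for x
    proof -
      obtain q where q: "q \<in> Q" "dist q x < d" using Q(2) x by auto
      have "\<bar>conv w \<phi> x - conv w \<phi> q\<bar> \<le> L * norm (x - q) * nrm2 lebesgue w" by (rule L(3)[OF ws])
      also have "\<dots> \<le> L * d * (2 * B)" using q L(1) wB d(1) by (intro mult_mono) (auto simp: dist_norm norm_minus_commute)
      also have "\<dots> \<le> e1" by (rule d)
      finally have 1: "\<bar>conv w \<phi> x - conv w \<phi> q\<bar> \<le> e1" .
      have "\<bar>conv w \<phi> q\<bar> < e1"
        unfolding w_def[abs_def] conv_diff[OF us us phi] using mn MN[OF q(1)] by (intro N q) auto
      then show ?thesis using 1 by linarith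
    qed
    have i1: "sq_int lebesgue (\<lambda>x. indicator (cball 0 R) x * (w x - conv w \<phi> x))" by (intro sq_int_indicator_mult sq_int_diff ws moll)
    have i2: "sq_int lebesgue (\<lambda>x. indicator (cball 0 R) x * conv w \<phi> x)" by (intro sq_int_indicator_mult moll)
    have "lnrm R w \<le> nrm2 lebesgue (\<lambda>x. indicator (cball 0 R) x * (w x - conv w \<phi> x)) + nrm2 lebesgue (\<lambda>x. indicator (cball 0 R) x * conv w \<phi> x)"
      unfolding lnrm_def using nrm2_triangle[OF i1 i2] by (simp add: algebra_simps)
    also have "nrm2 lebesgue (\<lambda>x. indicator (cball 0 R) x * (w x - conv w \<phi> x)) \<le> 2 * B / k"
      using lnrm_le[OF sq_int_diff[OF ws moll(1)], of R] moll(2) nrm2_minus_commute[of lebesgue w "conv w \<phi>"] by (simp add: lnrm_def)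
    also have "nrm2 lebesgue (\<lambda>x. indicator (cball 0 R) x * conv w \<phi> x) \<le> nrm2 lebesgue (\<lambda>x::real^'n. (2 * e1) * indicat_real (cball 0 R) x)"
      using small e1 by (intro nrm2_mono sq_int_cmult I AE_I2) (auto simp: indicator_def)
    also have "\<dots> = 2 * e1 * I" using e1 unfolding I_def by (subst nrm2_cmult) simp
    finally show ?thesis using k(2) e1(2) unfolding w_def[abs_def] by linarith
  qed
  then show ?thesis using r(1) by blast
qed

lemma Rellich:
  fixes u :: "nat \<Rightarrow> real^'n::finite \<Rightarrow> real"
  assumes u: "\<And>k. u k \<in> H1" and B: "\<And>k. gnrm (u k) \<le> B" "\<And>k. nrm2 lebesgue (u k) \<le> B"
  shows "\<exists>r::nat\<Rightarrow>nat. strict_mono r \<and> (\<forall>R. \<forall>e>0. \<exists>N. \<forall>m\<ge>N. \<forall>n\<ge>N. lnrm R (\<lambda>x. u (r m) x - u (r n) x) < e)"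
proof -
  \<comment> \<open>Ball radius and tolerance are tied to one index \<open>j\<close>, so countably
    many extractions suffice. The property survives passage to subsequences, as the diagonal
    argument requires.\<close>
  define P where "P j s \<longleftrightarrow> (\<exists>N. \<forall>m\<ge>N. \<forall>n\<ge>N. lnrm (real j) (\<lambda>x. u (s m) x - u (s n) x) < inverse (real (Suc j)))" 
    for j and s :: "nat \<Rightarrow> nat"
  interpret subseqs P
  proof
    fix j and s :: "nat \<Rightarrow> nat" assume "strict_mono s"
    show "\<exists>r'. strict_mono r' \<and> P j (s \<circ> r')"
      using Rellich_step[of "\<lambda>k. u (s k)" B "inverse (real (Suc j))" "real j"] u B by (simp add: P_def)
  qed
  have P: "P j (diagseq \<circ> (+) (Suc j))" for j
  proof (rule diagseq_holds)
    fix k and s r :: "nat \<Rightarrow> nat" assume r: "strict_mono r" and "P k s"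
    then obtain N where "\<forall>m\<ge>N. \<forall>n\<ge>N. lnrm (real k) (\<lambda>x. u (s m) x - u (s n) x) < inverse (real (Suc k))"
      by (auto simp: P_def)
    moreover have "m \<le> r m" for m using r by (rule strict_mono_imp_increasing)
    ultimately show "P k (s \<circ> r)" unfolding P_def by (intro exI[of _ N]) (auto intro: order_trans)
  qed
  have "\<exists>N. \<forall>m\<ge>N. \<forall>n\<ge>N. lnrm R (\<lambda>x. u (diagseq m) x - u (diagseq n) x) < e" if e: "0 < e" for R e
  proof -
    obtain j1 where j1: "inverse (real (Suc j1)) < e" using reals_Archimedean[OF e] by auto
    obtain j2 where j2: "R \<le> real j2" using real_arch_simple by blast
    define j where "j = max j1 j2"
    have "inverse (real (Suc j)) \<le> inverse (real (Suc j1))" by (intro le_imp_inverse_le) (auto simp: j_def)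
    then have j: "inverse (real (Suc j)) < e" "R \<le> real j" using j1 j2 by linarith (use j2 in \<open>simp add: j_def\<close>)
    obtain N where N: "\<And>m n. m \<ge> N \<Longrightarrow> n \<ge> N \<Longrightarrow> lnrm (real j) (\<lambda>x. u (diagseq (Suc j + m)) x - u (diagseq (Suc j + n)) x) < inverse (real (Suc j))"
      using P[of j] by (auto simp: P_def)
    have "lnrm R (\<lambda>x. u (diagseq m) x - u (diagseq n) x) < e" if "m \<ge> Suc j + N" "n \<ge> Suc j + N" for m n
    proof -
      have "lnrm R (\<lambda>x. u (diagseq m) x - u (diagseq n) x) \<le> lnrm (real j) (\<lambda>x. u (diagseq m) x - u (diagseq n) x)"
        by (intro lnrm_mono j sq_int_diff H1_sq_int u)
      also have "\<dots> < inverse (real (Suc j))" using N[of "m - Suc j" "n - Suc j"] that by simp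
      finally show ?thesis using j by simp
    qed
    then show ?thesis by blast
  qed
  then show ?thesis using subseq_diagseq by blast
qed

text \<open>The part with the small factor is controlled by the uniform bounds, the local part by
  Rellich. Compactness is stated as a Cauchy condition on differences because no limit function is
  available yet.\<close>

lemma compact_pot_Cauchy:
  fixes u :: "nat \<Rightarrow> real^'n::finite \<Rightarrow> real"
  assumes A: "compact_pot A" and u: "\<And>k. u k \<in> H1" and B: "\<And>k. gnrm (u k) \<le> B" "\<And>k. nrm2 lebesgue (u k) \<le> B"
  shows "\<exists>r::nat\<Rightarrow>nat. strict_mono r \<and> (\<forall>e>0. \<exists>N. \<forall>m\<ge>N. \<forall>n\<ge>N. (\<integral>x. \<bar>A x\<bar> * (u (r m) x - u (r n) x)\<^sup>2 \<partial>lebesgue) < e)"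
proof -
  have B0: "0 \<le> B" using B(1)[of 0] gnrm_nonneg order_trans by blast
  obtain r :: "nat \<Rightarrow> nat" where r: "strict_mono r" "\<And>R e. e > 0 \<Longrightarrow> \<exists>N. \<forall>m\<ge>N. \<forall>n\<ge>N. lnrm R (\<lambda>x. u (r m) x - u (r n) x) < e"
    using Rellich[of u B, OF u B] by blast
  have "\<exists>N. \<forall>m\<ge>N. \<forall>n\<ge>N. (\<integral>x. \<bar>A x\<bar> * (u (r m) x - u (r n) x)\<^sup>2 \<partial>lebesgue) < e" if e: "0 < e" for e
  proof -
    \<comment> \<open>Differences have gradient and mass norms at most 2 B, so their squares add up
      to at most 8 B^2; the small part then stays below e/2.\<close>
    define e1 where "e1 = (e / 16) / (B\<^sup>2 + 1)"
    have pos: "0 < B\<^sup>2 + 1" by (intro add_nonneg_pos) auto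
    have e1: "0 < e1" using e pos by (simp add: e1_def)
    have "e1 * (8 * B\<^sup>2) < e1 * (8 * (B\<^sup>2 + 1))" using e1 by simp
    also have "\<dots> = 8 * (e1 * (B\<^sup>2 + 1))" by simp
    also have "\<dots> = e / 2" using pos unfolding e1_def by (subst nonzero_divide_eq_eq[THEN iffD1, OF _ refl]) auto
    finally have e1: "0 < e1" "e1 * (8 * B\<^sup>2) < e / 2" using e1 by auto
    obtain C R where C: "C \<ge> 0" "\<And>v. v \<in> H1 \<Longrightarrow> (\<integral>x. \<bar>A x\<bar> * (v x)\<^sup>2 \<partial>lebesgue) \<le> e1 * ((gnrm v)\<^sup>2 + (nrm2 lebesgue v)\<^sup>2) + C * (lnrm R v)\<^sup>2"
      using compact_potD(3)[OF A e1(1)] by auto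
    define e2 where "e2 = sqrt (e / (2 * (C + 1)))"
    have e2: "0 < e2" "C * e2\<^sup>2 < e / 2" using e C(1) by (auto simp: e2_def field_simps)
    obtain N where N: "\<And>m n. m \<ge> N \<Longrightarrow> n \<ge> N \<Longrightarrow> lnrm R (\<lambda>x. u (r m) x - u (r n) x) < e2" using r(2)[OF e2(1)] by blast
    have "(\<integral>x. \<bar>A x\<bar> * (u (r m) x - u (r n) x)\<^sup>2 \<partial>lebesgue) < e" if mn: "m \<ge> N" "n \<ge> N" for m n
    proof -
      let ?w = "\<lambda>x. u (r m) x - u (r n) x"
      have w: "?w \<in> H1" by (intro H1_diff u)
      have "gnrm ?w \<le> 2 * B" "nrm2 lebesgue ?w \<le> 2 * B"
        using gnrm_diff_le[OF u[of "r m"] u[of "r n"]] nrm2_triangle_diff[OF H1_sq_int[OF u] H1_sq_int[OF u], of "r m" "r n"] 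
          B(1)[of "r m"] B(1)[of "r n"] B(2)[of "r m"] B(2)[of "r n"] by linarith+
      then have "(gnrm ?w)\<^sup>2 \<le> (2 * B)\<^sup>2" "(nrm2 lebesgue ?w)\<^sup>2 \<le> (2 * B)\<^sup>2"
        by (intro power_mono; simp)+
      then have "e1 * ((gnrm ?w)\<^sup>2 + (nrm2 lebesgue ?w)\<^sup>2) \<le> e1 * (8 * B\<^sup>2)"
        using e1 by (intro mult_left_mono) (auto simp: power_mult_distrib)
      moreover have "C * (lnrm R ?w)\<^sup>2 \<le> C * e2\<^sup>2"
        using N[OF mn] C(1) by (intro mult_left_mono power_mono) auto
      ultimately show ?thesis using C(2)[OF w] e1(2) e2(2) by linarith
    qed
    then show ?thesis by blast
  qed
  then show ?thesis using r(1) by blast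
qed

section \<open>The energy functional\<close>

lemma abs_powr_mult_DERIV:
  fixes q s :: real
  assumes q: "0 < q"
  shows "((\<lambda>s. \<bar>s\<bar> powr q * s) has_real_derivative (q + 1) * \<bar>s\<bar> powr q) (at s)"
proof (cases "s = 0")
  case True
  have "((\<lambda>h. (\<bar>0 + h\<bar> powr q * (0 + h) - \<bar>0\<bar> powr q * 0) / h) \<longlongrightarrow> 0) (at (0::real))"
  proof (rule filterlim_cong[THEN iffD1, rotated -1])
    have "((\<lambda>h::real. \<bar>h\<bar> powr q) \<longlongrightarrow> \<bar>0\<bar> powr q) (at 0)" using q by (intro tendsto_powr' tendsto_intros) auto
    then show "((\<lambda>h::real. \<bar>h\<bar> powr q) \<longlongrightarrow> 0) (at 0)" by simp
    show "\<forall>\<^sub>F h in at 0. \<bar>h\<bar> powr q = (\<bar>0 + h\<bar> powr q * (0 + h) - \<bar>0\<bar> powr q * 0) / h"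
      unfolding eventually_at_filter by (auto intro!: always_eventually)
  qed auto
  then show ?thesis using True by (simp add: DERIV_def)
next
  case False
  define a where "a = sgn s"
  have a: "\<bar>s\<bar> = a * s" "0 < a * s" using False by (auto simp: a_def sgn_if)
  have "((\<lambda>t. (a * t) powr q * t) has_real_derivative (q + 1) * (a * s) powr q) (at s)"
  proof -
    have *: "((\<lambda>t. a * t) has_real_derivative a) (at s)" by (auto intro!: derivative_eq_intros)
    have "((\<lambda>t. (a * t) powr q * t) has_real_derivative (q * (a * s) powr (q - 1) * a) * s + (a * s) powr q) (at s)"
      using a(2) by (auto intro!: derivative_eq_intros * simp: field_simps)
    moreover have "(a * s) powr (q - 1) * (a * s) = (a * s) powr q" using a(2) by (simp add: powr_diff)
    then have "(q * (a * s) powr (q - 1) * a) * s = q * (a * s) powr q" by (simp only: mult.assoc)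
    ultimately show ?thesis by (simp add: distrib_right)
  qed
  then show ?thesis unfolding a(1)
  proof (rule DERIV_cong_ev[OF refl _ refl, THEN iffD1, rotated])
    have "((\<lambda>t. a * t) \<longlongrightarrow> a * s) (nhds s)" by (intro tendsto_mult tendsto_const filterlim_ident)
    then have "\<forall>\<^sub>F t in nhds s. 0 < a * t" using a(2) by (rule order_tendstoD)
    then show "\<forall>\<^sub>F t in nhds s. (a * t) powr q * t = \<bar>t\<bar> powr q * t"
    proof eventually_elim
      case (elim t)
      then have "\<bar>t\<bar> = a * t" using False by (auto simp: a_def sgn_if split: if_splits)
      then show ?case by simp
    qed
  qed
qed

lemma abs_powr_split: "\<bar>s::real\<bar> powr p = \<bar>s\<bar> powr (p - 2) * s\<^sup>2"
  using powr_add[of "\<bar>s\<bar>" "p - 2" 2] by (cases "s = 0") (auto simp: powr_numeral)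

text \<open>The weight of the remainder is kept explicit: smallness of gradients or form-compactness
  of this weight is what later controls it. Monotonicity of the power p - 2 > 0 bounds the second
  derivative along the segment.\<close>

lemma powr_Taylor:
  fixes p a h :: real
  assumes p: "2 < p"
  shows "\<bar>\<bar>a + h\<bar> powr p - \<bar>a\<bar> powr p - p * (\<bar>a\<bar> powr (p - 2) * a * h)\<bar> \<le> p * (p - 1) * ((\<bar>a\<bar> + \<bar>h\<bar>) powr (p - 2) * h\<^sup>2)"
proof -
  define f where "f s = \<bar>s\<bar> powr (p - 2) * s" for s :: real
  have fD: "(f has_real_derivative (p - 1) * \<bar>s\<bar> powr (p - 2)) (at s)" for s
    using abs_powr_mult_DERIV[of "p - 2" s] p unfolding f_def[abs_def] by simp
  have F: "\<bar>s\<bar> powr p = f s * s" for s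
    by (simp add: f_def abs_powr_split[of s p] power2_eq_square)
  have FD: "((\<lambda>t. f t * t) has_real_derivative p * f s) (at s)" for s
    by (rule DERIV_cong[OF DERIV_mult[OF fD DERIV_ident]]) (simp add: f_def algebra_simps)
  define M where "M = \<bar>a\<bar> + \<bar>h\<bar>"
  have Lip: "\<bar>f x - f y\<bar> \<le> (p - 1) * M powr (p - 2) * \<bar>x - y\<bar>" if "\<bar>x\<bar> \<le> M" "\<bar>y\<bar> \<le> M" for x y
  proof -
    have "norm (f x - f y) \<le> ((p - 1) * M powr (p - 2)) * norm (x - y)"
    proof (rule field_differentiable_bound[of "{-M..M}"])
      show "(f has_field_derivative (p - 1) * \<bar>z\<bar> powr (p - 2)) (at z within {- M..M})" for z
        using fD by (rule has_field_derivative_at_within)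
      show "norm ((p - 1) * \<bar>z\<bar> powr (p - 2)) \<le> (p - 1) * M powr (p - 2)" if "z \<in> {-M..M}" for z
        using that p by (auto simp: abs_mult intro!: mult_left_mono powr_mono2)
    qed (use that in auto)
    then show ?thesis by simp
  qed
  have "\<exists>t. 0 < t \<and> t < 1 \<and> f (a + 1 * h) * (a + 1 * h) - f (a + 0 * h) * (a + 0 * h) = (1 - 0) * (p * f (a + t * h) * h)"
  proof (rule MVT2)
    fix t :: real
    have *: "((\<lambda>t. a + t * h) has_real_derivative h) (at t)" by (auto intro!: derivative_eq_intros)
    show "((\<lambda>t. f (a + t * h) * (a + t * h)) has_real_derivative p * f (a + t * h) * h) (at t)"
      by (rule DERIV_chain2[OF FD *])
  qed simp
  then obtain t where t: "0 < t" "t < 1" "f (a + h) * (a + h) - f a * a = p * f (a + t * h) * h" by auto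
  have "\<bar>a + t * h\<bar> \<le> \<bar>a\<bar> + \<bar>t * h\<bar>" by (rule abs_triangle_ineq)
  moreover have th: "\<bar>t * h\<bar> \<le> \<bar>h\<bar>" using t by (simp add: abs_mult mult_left_le_one_le)
  ultimately have "\<bar>f (a + t * h) - f a\<bar> \<le> (p - 1) * M powr (p - 2) * \<bar>a + t * h - a\<bar>"
    by (intro Lip) (auto simp: M_def)
  also have "\<dots> \<le> (p - 1) * M powr (p - 2) * \<bar>h\<bar>" using p th by (intro mult_left_mono) auto
  finally have *: "\<bar>f (a + t * h) - f a\<bar> \<le> (p - 1) * M powr (p - 2) * \<bar>h\<bar>" .
  have "\<bar>a + h\<bar> powr p - \<bar>a\<bar> powr p - p * (\<bar>a\<bar> powr (p - 2) * a * h) = p * ((f (a + t * h) - f a) * h)"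
    unfolding F t(3) by (simp add: f_def[of a] algebra_simps)
  then have "\<bar>\<bar>a + h\<bar> powr p - \<bar>a\<bar> powr p - p * (\<bar>a\<bar> powr (p - 2) * a * h)\<bar> = p * (\<bar>f (a + t * h) - f a\<bar> * \<bar>h\<bar>)"
    using p by (simp add: abs_mult)
  also have "\<dots> \<le> p * (((p - 1) * M powr (p - 2) * \<bar>h\<bar>) * \<bar>h\<bar>)"
    using p * by (intro mult_left_mono mult_right_mono) auto
  also have "\<dots> = p * (p - 1) * (M powr (p - 2) * h\<^sup>2)" by (simp add: power2_eq_square mult_ac)
  finally show ?thesis by (simp add: M_def)
qed

text \<open>Cauchy-Schwarz after splitting \<open>A\<close> into \<open>sgn (A x)\<close> and two
  factors \<open>sqrt \<bar>A x\<bar>\<close>, since \<open>A\<close> may change sign.\<close>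

lemma compact_pot_bilinear:
  assumes A: "compact_pot A" and u: "u \<in> H1" and v: "v \<in> H1"
  shows "integrable lebesgue (\<lambda>x. A x * u x * v x)"
    "\<bar>\<integral>x. A x * u x * v x \<partial>lebesgue\<bar> \<le> sqrt (\<integral>x. \<bar>A x\<bar> * (u x)\<^sup>2 \<partial>lebesgue) * sqrt (\<integral>x. \<bar>A x\<bar> * (v x)\<^sup>2 \<partial>lebesgue)"
proof -
  have [measurable]: "A \<in> borel_measurable lebesgue" "u \<in> borel_measurable lebesgue" "v \<in> borel_measurable lebesgue"
    using compact_potD(1)[OF A] u v by (auto simp: H1_iff sq_int_def)
  define f where "f x = sgn (A x) * sqrt \<bar>A x\<bar> * u x" for x
  define g where "g x = sqrt \<bar>A x\<bar> * v x" for x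
  have [measurable]: "f \<in> borel_measurable lebesgue" "g \<in> borel_measurable lebesgue"
    unfolding f_def[abs_def] g_def[abs_def] by measurable
  have f2: "(norm (f x))\<^sup>2 = \<bar>A x\<bar> * (u x)\<^sup>2" and g2: "(norm (g x))\<^sup>2 = \<bar>A x\<bar> * (v x)\<^sup>2" 
    and fg: "f x * g x = A x * u x * v x" for x
    by (auto simp: f_def g_def power_mult_distrib sgn_if mult_ac simp flip: abs_mult)
  have s: "sq_int lebesgue f" "sq_int lebesgue g"
    using compact_potD(2)[OF A u] compact_potD(2)[OF A v] unfolding sq_int_def f2 g2 by auto
  show "integrable lebesgue (\<lambda>x. A x * u x * v x)" using sq_int_mult[OF s] by (simp add: fg)
  show "\<bar>\<integral>x. A x * u x * v x \<partial>lebesgue\<bar> \<le> sqrt (\<integral>x. \<bar>A x\<bar> * (u x)\<^sup>2 \<partial>lebesgue) * sqrt (\<integral>x. \<bar>A x\<bar> * (v x)\<^sup>2 \<partial>lebesgue)"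
    using integral_mult_le[OF s] unfolding nrm2_def f2 g2 fg .
qed

lemma compact_pot_integrable: "compact_pot A \<Longrightarrow> u \<in> H1 \<Longrightarrow> integrable lebesgue (\<lambda>x. A x * (u x)\<^sup>2)"
  using compact_pot_bilinear(1)[of A u u] by (simp add: power2_eq_square mult.assoc)

lemma compact_pot_abs_le: "compact_pot A \<Longrightarrow> u \<in> H1 \<Longrightarrow> \<bar>\<integral>x. A x * (u x)\<^sup>2 \<partial>lebesgue\<bar> \<le> (\<integral>x. \<bar>A x\<bar> * (u x)\<^sup>2 \<partial>lebesgue)"
  using integral_norm_bound[of lebesgue "\<lambda>x. A x * (u x)\<^sup>2"] by (simp add: abs_mult)

lemma H1_abs: "u \<in> H1 \<Longrightarrow> (\<lambda>x. \<bar>u x\<bar>) \<in> H1" "u \<in> H1 \<Longrightarrow> gnrm (\<lambda>x. \<bar>u x\<bar>) \<le> gnrm u"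
proof -
  assume u: "u \<in> H1"
  note w = weak_grad_abs[OF has_weak_grad_weak_grad[OF u] H1_sq_int[OF u]]
  show "(\<lambda>x. \<bar>u x\<bar>) \<in> H1" by (rule H1I[OF sq_int_abs[OF H1_sq_int[OF u]] w])
  show "gnrm (\<lambda>x. \<bar>u x\<bar>) \<le> gnrm u"
    unfolding gnrm_eq[OF w] gnrm_def by (intro nrm2_mono weak_grad_sq_int u) (auto simp: sgn_if)
qed

lemma gnrm_le_H1_norm: "gnrm u \<le> H1_norm u" and nrm2_le_H1_norm: "nrm2 lebesgue u \<le> H1_norm u"
  and H1_norm_le: "H1_norm u \<le> gnrm u + nrm2 lebesgue u"
proof -
  have eq: "H1_norm u = sqrt ((gnrm u)\<^sup>2 + (nrm2 lebesgue u)\<^sup>2)"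
    by (simp add: H1_norm_def gnrm_def nrm2_power2)
  show "gnrm u \<le> H1_norm u" "nrm2 lebesgue u \<le> H1_norm u" unfolding eq by (auto intro: real_le_rsqrt)
  show "H1_norm u \<le> gnrm u + nrm2 lebesgue u" unfolding eq by (rule sqrt_sum_squares_le_sum) auto
qed

lemma H1_norm_nonneg: "0 \<le> H1_norm u"
  using gnrm_le_H1_norm gnrm_nonneg order_trans by blast

text \<open>The potential enters only through form-compactness; its decomposition into an integrable
  and a bounded part is used just to establish that. The second condition, on the square of V(x)
  |x|, is added where the Pohozaev argument starts.\<close>

locale nls =
  fixes V :: "real^'n::finite \<Rightarrow> real" and p :: real
  assumes dim: "CARD('n) \<ge> 3" and Vpot: "compact_pot V" and p_eq: "p = crit_exp TYPE('n)"
begin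

definition Nf :: "(real^'n \<Rightarrow> real) \<Rightarrow> real" where "Nf u = (\<integral>x. \<bar>u x\<bar> powr p \<partial>lebesgue)"

definition Qf :: "(real^'n \<Rightarrow> real) \<Rightarrow> real" where "Qf u = (\<integral>x. V x * (u x)\<^sup>2 \<partial>lebesgue)"

definition dE :: "(real^'n \<Rightarrow> real) \<Rightarrow> (real^'n \<Rightarrow> real) \<Rightarrow> real" where
  "dE u v = (\<integral>x. weak_grad u x \<bullet> weak_grad v x \<partial>lebesgue) + (\<integral>x. V x * u x * v x \<partial>lebesgue) 
     - (\<integral>x. \<bar>u x\<bar> powr (p - 2) * u x * v x \<partial>lebesgue)"

text \<open>The remainder of the critical integral. It is left unestimated because its two uses
  differ: on a small ball the Sobolev inequality makes it small, for dilations of a fixed function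
  its weight is form-compact.\<close>

definition rem :: "(real^'n \<Rightarrow> real) \<Rightarrow> (real^'n \<Rightarrow> real) \<Rightarrow> real" where
  "rem u h = (\<integral>x. (\<bar>u x\<bar> + \<bar>h x\<bar>) powr (p - 2) * (h x)\<^sup>2 \<partial>lebesgue)"

lemmas p_facts = crit_exp_facts[OF dim, folded p_eq]

lemma p_gt: "2 < p" "0 < p" using p_facts(1) by auto

lemma energy_eq: "energy V u = (gnrm u)\<^sup>2 / 2 + Qf u / 2 - Nf u / p"
  by (simp add: energy_def gnrm_def nrm2_power2 Qf_def Nf_def p_eq[symmetric])

lemma H1_powr_integrable: "(u :: real^'n \<Rightarrow> real) \<in> H1 \<Longrightarrow> integrable lebesgue (\<lambda>x. \<bar>u x\<bar> powr p)"
  using Sobolev[OF dim, folded p_eq] by blast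

lemma Nf_nonneg: "0 \<le> Nf u" unfolding Nf_def by (intro Bochner_Integration.integral_nonneg) auto

text \<open>(p - 2) N/2 = p at the critical exponent, so the weight lies in L^(N/2). Linearized at a
  fixed function, even the critical term is form-compact.\<close>

lemma compact_pot_powr: 
  assumes u: "(u :: real^'n \<Rightarrow> real) \<in> H1" shows "compact_pot (\<lambda>x. \<bar>u x\<bar> powr (p - 2))"
proof (rule compact_pot_Lp[OF dim])
  show "(\<lambda>x. \<bar>u x\<bar> powr (p - 2)) \<in> borel_measurable lebesgue" using u by (auto simp: H1_iff sq_int_def)
  show "integrable lebesgue (\<lambda>x. \<bar>\<bar>u x\<bar> powr (p - 2)\<bar> powr (real CARD('n) / 2))"
    using H1_powr_integrable[OF u] by (simp add: powr_powr p_facts(6)[simplified])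
qed

text \<open>The quantitative counterpart: a bound through gradient norms alone, hence uniform over
  functions with small gradient.\<close>

lemma weight_bound:
  "\<exists>K>0. \<forall>v\<in>H1. \<forall>h\<in>H1. (\<integral>x. \<bar>v (x :: real^'n)\<bar> powr (p - 2) * (h x)\<^sup>2 \<partial>lebesgue) \<le> K * gnrm v powr (p - 2) * (gnrm h)\<^sup>2"
proof -
  define q where "q = real CARD('n) / 2"
  have q: "0 < q" "2 / real CARD('n) = 1 / q" "(p - 2) * q = p" "p * (1 / q) = p - 2" 
    using p_facts(2,6) by (auto simp: q_def)
  obtain S where S: "S > 0" and Sob: "\<forall>u\<in>H1. integrable lebesgue (\<lambda>x::real^'n. \<bar>u x\<bar> powr p) \<and> (\<integral>x. \<bar>u x\<bar> powr p \<partial>lebesgue) \<le> S * gnrm u powr p"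
    using Sobolev[OF dim, folded p_eq] by (elim exE conjE) (rule that)
  obtain T where T: "T > 0" and H: "\<forall>A. \<forall>u\<in>H1. A \<in> borel_measurable lebesgue \<longrightarrow> integrable lebesgue (\<lambda>x::real^'n. \<bar>A x\<bar> powr q) \<longrightarrow>
     integrable lebesgue (\<lambda>x. \<bar>A x\<bar> * (u x)\<^sup>2) \<and>
     (\<integral>x. \<bar>A x\<bar> * (u x)\<^sup>2 \<partial>lebesgue) \<le> T * (\<integral>x. \<bar>A x\<bar> powr q \<partial>lebesgue) powr (1 / q) * (gnrm u)\<^sup>2"
    using pot_Hoelder[OF dim, folded q_def, unfolded q(2)] by (elim exE conjE) (rule that)
  have "(\<integral>x. \<bar>v x\<bar> powr (p - 2) * (h x)\<^sup>2 \<partial>lebesgue) \<le> T * S powr (1 / q) * gnrm v powr (p - 2) * (gnrm h)\<^sup>2" 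
    if v: "v \<in> H1" and h: "h \<in> H1" for v h :: "real^'n \<Rightarrow> real"
  proof -
    have vq: "\<bar>\<bar>v x\<bar> powr (p - 2)\<bar> powr q = \<bar>v x\<bar> powr p" for x by (simp add: powr_powr q(3))
    have m: "(\<lambda>x. \<bar>v x\<bar> powr (p - 2)) \<in> borel_measurable lebesgue" using v by (auto simp: H1_iff sq_int_def)
    have "(\<integral>x. \<bar>\<bar>v x\<bar> powr (p - 2)\<bar> * (h x)\<^sup>2 \<partial>lebesgue) \<le> T * (\<integral>x. \<bar>\<bar>v x\<bar> powr (p - 2)\<bar> powr q \<partial>lebesgue) powr (1 / q) * (gnrm h)\<^sup>2"
      using H[rule_format, OF h m] Sob[rule_format, OF v] unfolding vq by blast
    also have "\<dots> \<le> T * (S * gnrm v powr p) powr (1 / q) * (gnrm h)\<^sup>2"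
      unfolding vq using T q(1) Sob[rule_format, OF v] 
      by (intro mult_right_mono mult_left_mono powr_mono2) (auto intro!: Bochner_Integration.integral_nonneg)
    also have "(S * gnrm v powr p) powr (1 / q) = S powr (1 / q) * gnrm v powr (p - 2)"
      using S by (simp only: powr_mult powr_powr q(4))
    finally show ?thesis by (simp add: mult_ac)
  qed
  then show ?thesis using S T by (intro exI[of _ "T * S powr (1 / q)"]) auto
qed

text \<open>The gradient and potential terms expand exactly; the whole error comes from the critical
  term, whose factor 1/p cancels the \<open>p\<close> of \<open>powr_Taylor\<close>.\<close>

lemma energy_Taylor:
  assumes u: "u \<in> H1" and h: "h \<in> H1"
  shows "\<bar>energy V (\<lambda>x. u x + h x) - energy V u - dE u h - (gnrm h)\<^sup>2 / 2 - Qf h / 2\<bar> \<le> (p - 1) * rem u h"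
proof -
  note uh = H1_add[OF u h]
  have um[measurable]: "u \<in> borel_measurable lebesgue" "h \<in> borel_measurable lebesgue" 
    using u h by (auto simp: H1_iff sq_int_def)
  have 1: "(gnrm (\<lambda>x. u x + h x))\<^sup>2 = (gnrm u)\<^sup>2 + 2 * (\<integral>x. weak_grad u x \<bullet> weak_grad h x \<partial>lebesgue) + (gnrm h)\<^sup>2"
    using gnrm_lincomb_eq[OF u h, of 1 1] nrm2_add_power2[OF weak_grad_sq_int[OF u] weak_grad_sq_int[OF h]] by (simp add: gnrm_def)
  have 2: "Qf (\<lambda>x. u x + h x) = Qf u + 2 * (\<integral>x. V x * u x * h x \<partial>lebesgue) + Qf h"
  proof -
    have "Qf (\<lambda>x. u x + h x) = (\<integral>x. V x * (u x)\<^sup>2 + 2 * (V x * u x * h x) + V x * (h x)\<^sup>2 \<partial>lebesgue)"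
      unfolding Qf_def by (intro Bochner_Integration.integral_cong) (auto simp: power2_eq_square algebra_simps)
    then show ?thesis unfolding Qf_def
      using compact_pot_integrable[OF Vpot u] compact_pot_integrable[OF Vpot h] compact_pot_bilinear(1)[OF Vpot u h] by simp
  qed
  let ?f = "\<lambda>x. \<bar>u x\<bar> powr (p - 2) * u x * h x"
  have fi: "integrable lebesgue ?f" by (rule compact_pot_bilinear(1)[OF compact_pot_powr[OF u] u h])
  have ri: "integrable lebesgue (\<lambda>x. (\<bar>u x\<bar> + \<bar>h x\<bar>) powr (p - 2) * (h x)\<^sup>2)"
    using compact_pot_integrable[OF compact_pot_powr[OF H1_add[OF H1_abs(1)[OF u] H1_abs(1)[OF h]]] h] by simp
  have "\<bar>Nf (\<lambda>x. u x + h x) - Nf u - p * (\<integral>x. ?f x \<partial>lebesgue)\<bar> = \<bar>\<integral>x. \<bar>u x + h x\<bar> powr p - \<bar>u x\<bar> powr p - p * ?f x \<partial>lebesgue\<bar>"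
    unfolding Nf_def using H1_powr_integrable[OF uh] H1_powr_integrable[OF u] fi by simp
  also have "\<dots> \<le> (\<integral>x. \<bar>\<bar>u x + h x\<bar> powr p - \<bar>u x\<bar> powr p - p * ?f x\<bar> \<partial>lebesgue)"
    using integral_norm_bound[of lebesgue "\<lambda>x. \<bar>u x + h x\<bar> powr p - \<bar>u x\<bar> powr p - p * ?f x"] by simp
  also have "\<dots> \<le> (\<integral>x. p * (p - 1) * ((\<bar>u x\<bar> + \<bar>h x\<bar>) powr (p - 2) * (h x)\<^sup>2) \<partial>lebesgue)"
    using H1_powr_integrable[OF uh] H1_powr_integrable[OF u] fi ri powr_Taylor[OF p_gt(1)] by (intro integral_mono) auto
  also have "\<dots> = p * ((p - 1) * rem u h)" by (simp add: rem_def)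
  finally have 3: "\<bar>Nf (\<lambda>x. u x + h x) - Nf u - p * (\<integral>x. ?f x \<partial>lebesgue)\<bar> / p \<le> (p - 1) * rem u h"
    using p_gt by (simp add: field_simps)
  have "energy V (\<lambda>x. u x + h x) - energy V u - dE u h - (gnrm h)\<^sup>2 / 2 - Qf h / 2 
      = - (Nf (\<lambda>x. u x + h x) - Nf u - p * (\<integral>x. ?f x \<partial>lebesgue)) / p"
    unfolding energy_eq dE_def 1 2 using p_gt by (simp add: field_simps)
  then have "\<bar>energy V (\<lambda>x. u x + h x) - energy V u - dE u h - (gnrm h)\<^sup>2 / 2 - Qf h / 2\<bar>
      = \<bar>Nf (\<lambda>x. u x + h x) - Nf u - p * (\<integral>x. ?f x \<partial>lebesgue)\<bar> / p"
    using p_gt by (simp only: abs_divide abs_minus_cancel abs_of_pos)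
  then show ?thesis using 3 by simp
qed

lemma rem_bound: "\<exists>K>0. \<forall>u\<in>H1. \<forall>h\<in>H1. rem u h \<le> K * (gnrm u + gnrm h) powr (p - 2) * (gnrm h)\<^sup>2"
proof -
  obtain K where K: "K > 0" "\<forall>v\<in>H1. \<forall>h\<in>H1. (\<integral>x. \<bar>v (x :: real^'n)\<bar> powr (p - 2) * (h x)\<^sup>2 \<partial>lebesgue) \<le> K * gnrm v powr (p - 2) * (gnrm h)\<^sup>2"
    using weight_bound by blast
  have "rem u h \<le> K * (gnrm u + gnrm h) powr (p - 2) * (gnrm h)\<^sup>2" if u: "u \<in> H1" and h: "h \<in> H1" for u h
  proof -
    let ?v = "\<lambda>x. \<bar>u x\<bar> + \<bar>h x\<bar>"
    have v: "?v \<in> H1" by (intro H1_add H1_abs u h)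
    have "gnrm ?v \<le> gnrm u + gnrm h"
      using gnrm_add_le[OF H1_abs(1)[OF u] H1_abs(1)[OF h]] H1_abs(2)[OF u] H1_abs(2)[OF h] by linarith
    moreover have "rem u h \<le> K * gnrm ?v powr (p - 2) * (gnrm h)\<^sup>2"
      using K(2)[rule_format, OF v h] by (simp add: rem_def)
    moreover have "gnrm ?v powr (p - 2) \<le> (gnrm u + gnrm h) powr (p - 2)" if "gnrm ?v \<le> gnrm u + gnrm h"
      using that p_gt by (intro powr_mono2) auto
    ultimately show ?thesis using K(1) 
      by (meson less_imp_le mult_left_mono mult_right_mono order_trans zero_le_power2)
  qed
  then show ?thesis using K(1) by blast
qed

lemma dE_bilinear:
  assumes u: "u \<in> H1" and v: "v \<in> H1" and w: "w \<in> H1"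
  shows "dE u (\<lambda>x. a * v x + b * w x) = a * dE u v + b * dE u w"
proof -
  have "(\<integral>x. weak_grad u x \<bullet> weak_grad (\<lambda>x. a * v x + b * w x) x \<partial>lebesgue) 
      = (\<integral>x. a * (weak_grad u x \<bullet> weak_grad v x) + b * (weak_grad u x \<bullet> weak_grad w x) \<partial>lebesgue)"
  proof (rule integral_cong_AE)
    show "AE x in lebesgue. weak_grad u x \<bullet> weak_grad (\<lambda>x. a * v x + b * w x) x = a * (weak_grad u x \<bullet> weak_grad v x) + b * (weak_grad u x \<bullet> weak_grad w x)"
      using weak_grad_lincomb[OF v w, of a b] by eventually_elim (simp add: inner_add_right)
  qed (use weak_grad_sq_int[OF u] weak_grad_sq_int[OF v] weak_grad_sq_int[OF w] weak_grad_sq_int[OF H1_lincomb[OF v w, of a b]] in \<open>auto simp: sq_int_def\<close>)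
  also have "\<dots> = a * (\<integral>x. weak_grad u x \<bullet> weak_grad v x \<partial>lebesgue) + b * (\<integral>x. weak_grad u x \<bullet> weak_grad w x \<partial>lebesgue)"
    using sq_int_inner[OF weak_grad_sq_int[OF u] weak_grad_sq_int[OF v]] sq_int_inner[OF weak_grad_sq_int[OF u] weak_grad_sq_int[OF w]] by simp
  finally have 1: "(\<integral>x. weak_grad u x \<bullet> weak_grad (\<lambda>x. a * v x + b * w x) x \<partial>lebesgue) 
      = a * (\<integral>x. weak_grad u x \<bullet> weak_grad v x \<partial>lebesgue) + b * (\<integral>x. weak_grad u x \<bullet> weak_grad w x \<partial>lebesgue)" .
  have 2: "(\<integral>x. A x * u x * (a * v x + b * w x) \<partial>lebesgue) = a * (\<integral>x. A x * u x * v x \<partial>lebesgue) + b * (\<integral>x. A x * u x * w x \<partial>lebesgue)"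
    if A: "compact_pot A" for A
  proof -
    have "(\<integral>x. A x * u x * (a * v x + b * w x) \<partial>lebesgue) = (\<integral>x. a * (A x * u x * v x) + b * (A x * u x * w x) \<partial>lebesgue)"
      by (intro Bochner_Integration.integral_cong) (auto simp: algebra_simps)
    then show ?thesis using compact_pot_bilinear(1)[OF A u v] compact_pot_bilinear(1)[OF A u w] by simp
  qed
  show ?thesis unfolding dE_def 1 2[OF Vpot] 2[OF compact_pot_powr[OF u]] by (simp add: algebra_simps)
qed

text \<open>As 1 - 2/p is positive, negative energy forces \<open>dE u u\<close> to be negative;
  divided by the mass this is the sign of the Lagrange multiplier.\<close>

lemma dE_self: 
  assumes u: "u \<in> H1" shows "dE u u = 2 * energy V u - (1 - 2 / p) * Nf u"
proof -
  have "\<bar>y\<bar> powr (p - 2) * y * y = \<bar>y\<bar> powr p" for y :: real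
    by (simp add: abs_powr_split[of y p] power2_eq_square)
  moreover have "(gnrm u)\<^sup>2 = (\<integral>x. weak_grad u x \<bullet> weak_grad u x \<partial>lebesgue)"
    by (simp add: gnrm_def nrm2_power2 power2_norm_eq_inner)
  ultimately have "dE u u = (gnrm u)\<^sup>2 + Qf u - Nf u"
    by (simp add: dE_def Qf_def Nf_def power2_eq_square[of "u _"] mult.assoc)
  then show ?thesis by (simp add: energy_eq left_diff_distrib)
qed

lemma form_le_H1_norm:
  assumes A: "compact_pot A"
  shows "\<exists>C\<ge>0. \<forall>u\<in>H1. (\<integral>x. \<bar>A x\<bar> * (u x)\<^sup>2 \<partial>lebesgue) \<le> C * (H1_norm u)\<^sup>2"
proof -
  obtain C where C: "C \<ge> 0" "\<And>u. u \<in> H1 \<Longrightarrow> (\<integral>x. \<bar>A x\<bar> * (u x)\<^sup>2 \<partial>lebesgue) \<le> 1 * (gnrm u)\<^sup>2 + C * (nrm2 lebesgue u)\<^sup>2"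
    using compact_pot_form_bound[OF A, of 1] by auto
  have "(\<integral>x. \<bar>A x\<bar> * (u x)\<^sup>2 \<partial>lebesgue) \<le> (1 + C) * (H1_norm u)\<^sup>2" if u: "u \<in> H1" for u
  proof -
    have "1 * (gnrm u)\<^sup>2 + C * (nrm2 lebesgue u)\<^sup>2 \<le> 1 * (H1_norm u)\<^sup>2 + C * (H1_norm u)\<^sup>2"
      using C(1) by (intro add_mono mult_left_mono power_mono gnrm_le_H1_norm nrm2_le_H1_norm) auto
    then show ?thesis using C(2)[OF u] by (simp add: algebra_simps)
  qed
  then show ?thesis using C(1) by (intro exI[of _ "1 + C"]) auto
qed

lemma energy_has_H1_derivative:
  assumes u: "u \<in> H1"
  shows "has_H1_derivative (energy V) (dE u) u"
  unfolding has_H1_derivative_def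
proof (intro conjI ballI allI impI dE_bilinear[OF u])
  obtain CV where CV: "CV \<ge> 0" "\<And>u. u \<in> H1 \<Longrightarrow> (\<integral>x. \<bar>V x\<bar> * (u x)\<^sup>2 \<partial>lebesgue) \<le> CV * (H1_norm u)\<^sup>2"
    using form_le_H1_norm[OF Vpot] by blast
  obtain CP where CP: "CP \<ge> 0" "\<And>v. v \<in> H1 \<Longrightarrow> (\<integral>x. \<bar>\<bar>u x\<bar> powr (p - 2)\<bar> * (v x)\<^sup>2 \<partial>lebesgue) \<le> CP * (H1_norm v)\<^sup>2"
    using form_le_H1_norm[OF compact_pot_powr[OF u]] by blast
  have form: "\<bar>\<integral>x. A x * u x * v x \<partial>lebesgue\<bar> \<le> C * H1_norm u * H1_norm v" 
    if A: "compact_pot A" and C: "C \<ge> 0" "\<And>v. v \<in> H1 \<Longrightarrow> (\<integral>x. \<bar>A x\<bar> * (v x)\<^sup>2 \<partial>lebesgue) \<le> C * (H1_norm v)\<^sup>2" and v: "v \<in> H1" for A C v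
  proof -
    have "\<bar>\<integral>x. A x * u x * v x \<partial>lebesgue\<bar> \<le> sqrt (\<integral>x. \<bar>A x\<bar> * (u x)\<^sup>2 \<partial>lebesgue) * sqrt (\<integral>x. \<bar>A x\<bar> * (v x)\<^sup>2 \<partial>lebesgue)"
      by (rule compact_pot_bilinear(2)[OF A u v])
    also have "\<dots> \<le> sqrt (C * (H1_norm u)\<^sup>2) * sqrt (C * (H1_norm v)\<^sup>2)"
      by (intro mult_mono real_sqrt_le_mono C u v) (auto intro!: Bochner_Integration.integral_nonneg mult_nonneg_nonneg C)
    also have "\<dots> = (sqrt C * sqrt C) * H1_norm u * H1_norm v"
      by (simp add: real_sqrt_mult abs_of_nonneg[OF H1_norm_nonneg] del: real_sqrt_mult_self)
    also have "\<dots> = C * H1_norm u * H1_norm v" using C(1) by simp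
    finally show ?thesis .
  qed
  show "\<exists>C. \<forall>v\<in>H1. \<bar>dE u v\<bar> \<le> C * H1_norm v"
  proof (intro exI[of _ "(1 + CV + CP) * H1_norm u"] ballI)
    fix v :: "real^'n \<Rightarrow> real" assume v: "v \<in> H1"
    have "\<bar>\<integral>x. weak_grad u x \<bullet> weak_grad v x \<partial>lebesgue\<bar> \<le> gnrm u * gnrm v"
      unfolding gnrm_def by (intro integral_inner_le weak_grad_sq_int u v)
    also have "\<dots> \<le> H1_norm u * H1_norm v" by (intro mult_mono gnrm_le_H1_norm H1_norm_nonneg) auto
    finally have 1: "\<bar>\<integral>x. weak_grad u x \<bullet> weak_grad v x \<partial>lebesgue\<bar> \<le> H1_norm u * H1_norm v" .
    show "\<bar>dE u v\<bar> \<le> (1 + CV + CP) * H1_norm u * H1_norm v"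
      using 1 form[OF Vpot CV v] form[OF compact_pot_powr[OF u] CP v] unfolding dE_def by (simp add: algebra_simps)
  qed
  obtain K where K: "K > 0" "\<forall>u\<in>H1. \<forall>h\<in>H1. rem u h \<le> K * (gnrm u + gnrm h) powr (p - 2) * (gnrm h)\<^sup>2"
    using rem_bound by blast
  define M where "M = 1 / 2 + CV / 2 + (p - 1) * K * (gnrm u + 1) powr (p - 2)"
  have M: "0 < M" using CV(1) K(1) p_gt unfolding M_def by (intro add_pos_nonneg) auto
  have bd: "\<bar>energy V (\<lambda>x. u x + h x) - energy V u - dE u h\<bar> \<le> M * (H1_norm h)\<^sup>2" 
    if h: "h \<in> H1" and h1: "H1_norm h < 1" for h
  proof -
    have g2: "(gnrm h)\<^sup>2 \<le> (H1_norm h)\<^sup>2" by (intro power_mono gnrm_le_H1_norm) simp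
    have "rem u h \<le> K * (gnrm u + gnrm h) powr (p - 2) * (gnrm h)\<^sup>2" using K(2) u h by blast
    also have "\<dots> \<le> K * (gnrm u + 1) powr (p - 2) * (H1_norm h)\<^sup>2"
      using K(1) p_gt h1 gnrm_le_H1_norm[of h] g2 by (intro mult_mono mult_left_mono powr_mono2) (auto intro!: mult_nonneg_nonneg)
    finally have "(p - 1) * rem u h \<le> (p - 1) * (K * (gnrm u + 1) powr (p - 2) * (H1_norm h)\<^sup>2)"
      using p_gt by (intro mult_left_mono) auto
    moreover have "\<bar>Qf h\<bar> \<le> CV * (H1_norm h)\<^sup>2"
      unfolding Qf_def using compact_pot_abs_le[OF Vpot h] CV(2)[OF h] by linarith
    moreover have "M * (H1_norm h)\<^sup>2 = (H1_norm h)\<^sup>2 / 2 + CV * (H1_norm h)\<^sup>2 / 2 + (p - 1) * (K * (gnrm u + 1) powr (p - 2) * (H1_norm h)\<^sup>2)"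
      by (simp add: M_def algebra_simps)
    ultimately show ?thesis using energy_Taylor[OF u h] g2 zero_le_power2[of "gnrm h"] by linarith
  qed
  fix \<epsilon> :: real assume e: "0 < \<epsilon>"
  show "\<exists>\<delta>>0. \<forall>h\<in>H1. H1_norm h < \<delta> \<longrightarrow> \<bar>energy V (\<lambda>x. u x + h x) - energy V u - dE u h\<bar> \<le> \<epsilon> * H1_norm h"
  proof (intro exI[of _ "min 1 (\<epsilon> / M)"] conjI ballI impI)
    show "0 < min 1 (\<epsilon> / M)" using e M by simp
    fix h :: "real^'n \<Rightarrow> real" assume h: "h \<in> H1" and hn: "H1_norm h < min 1 (\<epsilon> / M)"
    have "M * H1_norm h \<le> \<epsilon>" using hn M by (simp add: field_simps)
    from mult_right_mono[OF this H1_norm_nonneg[of h]] 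
    show "\<bar>energy V (\<lambda>x. u x + h x) - energy V u - dE u h\<bar> \<le> \<epsilon> * H1_norm h"
      using bd[OF h] hn by (simp add: power2_eq_square mult.assoc)
  qed
qed

end

text \<open>Constrained criticality only asserts that some derivative exists; uniqueness allows it
  to be replaced by the explicit first variation.\<close>

lemma has_H1_derivative_unique:
  assumes L: "has_H1_derivative F L u" and L': "has_H1_derivative F L' u" and v: "v \<in> H1"
  shows "L v = L' v"
proof -
  define N where "N = H1_norm v + 1"
  have N: "0 < N" using H1_norm_nonneg[of v] by (simp add: N_def)
  have lin: "L (\<lambda>x. t * v x) = t * L v" "L' (\<lambda>x. t * v x) = t * L' v" for t
  proof -
    have "L (\<lambda>x. t * v x + 0 * v x) = t * L v + 0 * L v" using L v unfolding has_H1_derivative_def by blast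
    then show "L (\<lambda>x. t * v x) = t * L v" by simp
    have "L' (\<lambda>x. t * v x + 0 * v x) = t * L' v + 0 * L' v" using L' v unfolding has_H1_derivative_def by blast
    then show "L' (\<lambda>x. t * v x) = t * L' v" by simp
  qed
  have "\<bar>L v - L' v\<bar> \<le> e * (2 * N)" if e: "0 < e" for e
  proof -
    obtain d1 where d1: "d1 > 0" "\<And>h. h \<in> H1 \<Longrightarrow> H1_norm h < d1 \<Longrightarrow> \<bar>F (\<lambda>x. u x + h x) - F u - L h\<bar> \<le> e * H1_norm h"
      using L e unfolding has_H1_derivative_def by blast
    obtain d2 where d2: "d2 > 0" "\<And>h. h \<in> H1 \<Longrightarrow> H1_norm h < d2 \<Longrightarrow> \<bar>F (\<lambda>x. u x + h x) - F u - L' h\<bar> \<le> e * H1_norm h"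
      using L' e unfolding has_H1_derivative_def by blast
    define S where "S = gnrm v + nrm2 lebesgue v + 1"
    define t where "t = (min d1 d2 / 2) / S"
    have S: "0 < S" using gnrm_nonneg[of v] nrm2_nonneg[of lebesgue v] unfolding S_def by linarith
    have t: "0 < t" using d1 d2 S by (simp add: t_def)
    have tv: "(\<lambda>x. t * v x) \<in> H1" by (rule H1_cmult[OF v])
    have Hn: "H1_norm (\<lambda>x. t * v x) = t * H1_norm v"
    proof -
      have "H1_norm (\<lambda>x. t * v x) = sqrt ((gnrm (\<lambda>x. t * v x))\<^sup>2 + (nrm2 lebesgue (\<lambda>x. t * v x))\<^sup>2)"
        by (simp add: H1_norm_def gnrm_def nrm2_power2)
      also have "\<dots> = sqrt (t\<^sup>2 * ((gnrm v)\<^sup>2 + (nrm2 lebesgue v)\<^sup>2))"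
        using v by (simp add: gnrm_cmult nrm2_cmult power_mult_distrib algebra_simps)
      also have "\<dots> = t * H1_norm v" using t by (simp add: real_sqrt_mult H1_norm_def gnrm_def nrm2_power2)
      finally show ?thesis .
    qed
    have "t * H1_norm v \<le> t * S" using t H1_norm_le[of v] by (intro mult_left_mono) (auto simp: S_def)
    also have "\<dots> = min d1 d2 / 2" using S by (simp add: t_def)
    finally have small: "H1_norm (\<lambda>x. t * v x) < d1" "H1_norm (\<lambda>x. t * v x) < d2" 
      unfolding Hn using d1(1) d2(1) by auto
    have "\<bar>t * L v - t * L' v\<bar> \<le> 2 * (e * (t * H1_norm v))"
      using d1(2)[OF tv small(1)] d2(2)[OF tv small(2)] unfolding lin Hn by linarith
    then have "t * \<bar>L v - L' v\<bar> \<le> t * (e * (2 * H1_norm v))"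
      unfolding right_diff_distrib[symmetric] abs_mult using t by (simp add: mult_ac)
    then have "\<bar>L v - L' v\<bar> \<le> e * (2 * H1_norm v)" using t by simp
    also have "\<dots> \<le> e * (2 * N)" using e by (intro mult_left_mono) (auto simp: N_def)
    finally show ?thesis .
  qed
  \<comment> \<open>With this choice of \<open>e\<close> the estimate says that the difference is at
    most half of itself.\<close>
  from this[of "\<bar>L v - L' v\<bar> / (4 * N)"] show ?thesis using N by (cases "L v = L' v") auto
qed

lemma has_H1_derivative_continuous:
  assumes L: "has_H1_derivative F L u" and u: "u \<in> H1" and v: "\<And>k. v k \<in> H1"
    and lim: "(\<lambda>k. H1_norm (\<lambda>x. v k x - u x)) \<longlonglongrightarrow> 0"
  shows "(\<lambda>k. F (v k)) \<longlonglongrightarrow> F u"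
proof -
  obtain C where C: "\<And>v. v \<in> H1 \<Longrightarrow> \<bar>L v\<bar> \<le> C * H1_norm v" using L unfolding has_H1_derivative_def by blast
  obtain d where d: "d > 0" "\<And>h. h \<in> H1 \<Longrightarrow> H1_norm h < d \<Longrightarrow> \<bar>F (\<lambda>x. u x + h x) - F u - L h\<bar> \<le> 1 * H1_norm h"
    using L unfolding has_H1_derivative_def using zero_less_one by blast
  have "(\<lambda>k. F (v k) - F u) \<longlonglongrightarrow> 0"
  proof (rule Lim_null_comparison)
    have "\<forall>\<^sub>F k in sequentially. H1_norm (\<lambda>x. v k x - u x) < d" using order_tendstoD(2)[OF lim d(1)] .
    then show "\<forall>\<^sub>F k in sequentially. norm (F (v k) - F u) \<le> (C + 1) * H1_norm (\<lambda>x. v k x - u x)"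
    proof eventually_elim
      case (elim k)
      have h: "(\<lambda>x. v k x - u x) \<in> H1" by (intro H1_diff v u)
      show ?case using d(2)[OF h elim] C[OF h] by (simp add: distrib_right)
    qed
    show "(\<lambda>k. (C + 1) * H1_norm (\<lambda>x. v k x - u x)) \<longlonglongrightarrow> 0" by (rule tendsto_mult_right_zero[OF lim])
  qed
  then show ?thesis by (simp add: LIM_zero_iff)
qed

section \<open>Minimization on a small ball\<close>

lemma H1_complete:
  fixes u :: "nat \<Rightarrow> real^'n::finite \<Rightarrow> real"
  assumes u: "\<And>k. u k \<in> H1"
    and C: "\<And>e. 0 < e \<Longrightarrow> \<exists>N. \<forall>m\<ge>N. \<forall>n\<ge>N. gnrm (\<lambda>x. u m x - u n x) < e \<and> nrm2 lebesgue (\<lambda>x. u m x - u n x) < e"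
  shows "\<exists>v\<in>H1. (\<lambda>k. H1_norm (\<lambda>x. u k x - v x)) \<longlonglongrightarrow> 0"
proof -
  have gd: "gnrm (\<lambda>x. u m x - u n x) = nrm2 lebesgue (\<lambda>x. weak_grad (u m) x - weak_grad (u n) x)" for m n
    using gnrm_lincomb_eq[OF u[of m] u[of n], of 1 "-1"] by simp
  obtain v where v: "sq_int lebesgue v" "(\<lambda>k. nrm2 lebesgue (\<lambda>x. u k x - v x)) \<longlonglongrightarrow> 0"
    using sq_int_complete[of lebesgue u] H1_sq_int[OF u] C by meson
  obtain g where g: "sq_int lebesgue g" "(\<lambda>k. nrm2 lebesgue (\<lambda>x. weak_grad (u k) x - g x)) \<longlonglongrightarrow> 0"
    using sq_int_complete[of lebesgue "\<lambda>k. weak_grad (u k)"] weak_grad_sq_int[OF u] C unfolding gd by meson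
  have vg: "has_weak_grad v g"
    by (rule has_weak_grad_limit[OF has_weak_grad_weak_grad[OF u] H1_sq_int[OF u] v(1) g(1) v(2) g(2)])
  have vH: "v \<in> H1" by (rule H1I[OF v(1) vg])
  have "gnrm (\<lambda>x. u k x - v x) = nrm2 lebesgue (\<lambda>x. weak_grad (u k) x - g x)" for k
    using gnrm_eq[OF has_weak_grad_lincomb[OF has_weak_grad_weak_grad[OF u] vg H1_sq_int[OF u] v(1), of 1 k "-1"]] by simp
  then have "(\<lambda>k. gnrm (\<lambda>x. u k x - v x) + nrm2 lebesgue (\<lambda>x. u k x - v x)) \<longlonglongrightarrow> 0"
    using tendsto_add_zero[OF g(2) v(2)] by simp
  then have "(\<lambda>k. H1_norm (\<lambda>x. u k x - v x)) \<longlonglongrightarrow> 0"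
    by (rule Lim_null_comparison[rotated]) (simp add: H1_norm_nonneg H1_norm_le)
  then show ?thesis using vH by blast
qed

context nls
begin

text \<open>First clause: inside the ball the critical term is absorbed, so at gradient norm
  \<open>r\<close> and small mass the energy is positive. Second clause: the Taylor remainder takes
  at most half of the quadratic gradient term, which leaves uniform convexity up to the
  potential.\<close>

definition barrier :: "real \<Rightarrow> real \<Rightarrow> bool" where
  "barrier r C \<longleftrightarrow> 0 < r \<and> 0 < C \<and>
     (\<forall>u\<in>H1. gnrm u \<le> r \<longrightarrow> (gnrm u)\<^sup>2 / 8 - C / 2 * (nrm2 lebesgue u)\<^sup>2 \<le> energy V u) \<and>
     (\<forall>m\<in>H1. \<forall>d\<in>H1. gnrm m \<le> r \<longrightarrow> gnrm d \<le> r \<longrightarrow> (p - 1) * rem m d \<le> (gnrm d)\<^sup>2 / 4)"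

lemma Qf_bound: "\<exists>C>0. \<forall>u\<in>H1. \<bar>Qf u\<bar> \<le> (gnrm u)\<^sup>2 / 2 + C * (nrm2 lebesgue u)\<^sup>2"
proof -
  obtain C where C: "C \<ge> 0" "\<And>u. u \<in> H1 \<Longrightarrow> (\<integral>x. \<bar>V x\<bar> * (u x)\<^sup>2 \<partial>lebesgue) \<le> 1/2 * (gnrm u)\<^sup>2 + C * (nrm2 lebesgue u)\<^sup>2"
    using compact_pot_form_bound[OF Vpot, of "1/2"] by auto
  have "\<bar>Qf u\<bar> \<le> (gnrm u)\<^sup>2 / 2 + (C + 1) * (nrm2 lebesgue u)\<^sup>2" if u: "u \<in> H1" for u
    using C(2)[OF u] compact_pot_abs_le[OF Vpot u] zero_le_power2[of "nrm2 lebesgue u"] unfolding Qf_def distrib_right by linarith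
  then show ?thesis using C(1) by (intro exI[of _ "C + 1"]) auto
qed

lemma small_radius:
  assumes "0 < a" "0 < b" shows "\<exists>r>0. a * r powr (p - 2) \<le> b"
proof (intro exI[of _ "(b / a) powr (1 / (p - 2))"] conjI)
  show "a * ((b / a) powr (1 / (p - 2))) powr (p - 2) \<le> b" using assms p_gt by (simp add: powr_powr)
qed (use assms in simp)

lemma barrier_exists: "\<exists>r C. barrier r C"
proof -
  obtain S where S: "S > 0" and Sob: "\<forall>u\<in>H1. integrable lebesgue (\<lambda>x::real^'n. \<bar>u x\<bar> powr p) \<and> (\<integral>x. \<bar>u x\<bar> powr p \<partial>lebesgue) \<le> S * gnrm u powr p"
    using Sobolev[OF dim, folded p_eq] by (elim exE conjE) (rule that)
  obtain K where K: "K > 0" "\<forall>u\<in>H1. \<forall>h\<in>H1. rem u h \<le> K * (gnrm u + gnrm h) powr (p - 2) * (gnrm h)\<^sup>2"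
    using rem_bound by blast
  obtain C where C: "C > 0" "\<forall>u\<in>H1. \<bar>Qf u\<bar> \<le> (gnrm u)\<^sup>2 / 2 + C * (nrm2 lebesgue u)\<^sup>2"
    using Qf_bound by blast
  \<comment> \<open>One constant serves both clauses: the Sobolev constant for the energy bound, and
    the remainder constant with \<open>gnrm m + gnrm d\<close> at most 2 r. The energy keeps 1/2 -
    1/4 - 1/8 = 1/8 of the squared gradient.\<close>
  define a where "a = S / p + (p - 1) * K * 2 powr (p - 2)"
  have a: "0 < a" "S / p \<le> a" "(p - 1) * K * 2 powr (p - 2) \<le> a" using S K(1) p_gt by (auto simp: a_def add_pos_pos)
  obtain r where r: "r > 0" "a * r powr (p - 2) \<le> 1 / 8" using small_radius[OF a(1), of "1/8"] by auto
  have 1: "(gnrm u)\<^sup>2 / 8 - C / 2 * (nrm2 lebesgue u)\<^sup>2 \<le> energy V u" if u: "u \<in> H1" and ur: "gnrm u \<le> r" for u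
  proof -
    have "Nf u / p \<le> S * gnrm u powr p / p" using Sob u p_gt by (simp add: Nf_def divide_right_mono)
    also have "\<dots> = (S / p) * gnrm u powr (p - 2) * (gnrm u)\<^sup>2" using abs_powr_split[of "gnrm u" p] by simp
    also have "\<dots> \<le> a * r powr (p - 2) * (gnrm u)\<^sup>2"
      using a S ur p_gt by (intro mult_right_mono mult_mono powr_mono2) auto
    also have "\<dots> \<le> 1 / 8 * (gnrm u)\<^sup>2" by (intro mult_right_mono r) simp
    finally have "Nf u / p \<le> (gnrm u)\<^sup>2 / 8" by simp
    moreover have "\<bar>Qf u\<bar> \<le> (gnrm u)\<^sup>2 / 2 + C * (nrm2 lebesgue u)\<^sup>2" using C u by blast
    ultimately show ?thesis unfolding energy_eq by (simp add: abs_le_iff)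
  qed
  have 2: "(p - 1) * rem m d \<le> (gnrm d)\<^sup>2 / 4" if m: "m \<in> H1" "gnrm m \<le> r" and d: "d \<in> H1" "gnrm d \<le> r" for m d
  proof -
    have "rem m d \<le> K * (gnrm m + gnrm d) powr (p - 2) * (gnrm d)\<^sup>2" using K m d by blast
    also have "\<dots> \<le> K * (2 * r) powr (p - 2) * (gnrm d)\<^sup>2"
      using K(1) m d p_gt by (intro mult_right_mono mult_left_mono powr_mono2) auto
    finally have "(p - 1) * rem m d \<le> (p - 1) * (K * (2 * r) powr (p - 2) * (gnrm d)\<^sup>2)"
      using p_gt by (intro mult_left_mono) auto
    also have "\<dots> = ((p - 1) * K * 2 powr (p - 2)) * r powr (p - 2) * (gnrm d)\<^sup>2"
      using r(1) by (simp add: powr_mult)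
    also have "\<dots> \<le> a * r powr (p - 2) * (gnrm d)\<^sup>2" by (intro mult_right_mono a) auto
    also have "\<dots> \<le> 1 / 8 * (gnrm d)\<^sup>2" by (intro mult_right_mono r) simp
    finally show ?thesis using zero_le_power2[of "gnrm d"] by linarith
  qed
  show ?thesis unfolding barrier_def using r(1) C(1) 1 2 by blast
qed

text \<open>Adding the expansions at \<open>m\<close> in the directions \<open>d\<close> and
  \<open>-d\<close> cancels the linear terms. The gradient contributes its full square, of which the
  two remainders take away at most half.\<close>

lemma energy_midpoint:
  assumes B: "barrier r C" and m: "m \<in> H1" "gnrm m \<le> r" and d: "d \<in> H1" "gnrm d \<le> r"
  shows "2 * energy V m \<le> energy V (\<lambda>x. m x + d x) + energy V (\<lambda>x. m x - d x) - (gnrm d)\<^sup>2 / 2 + (\<integral>x. \<bar>V x\<bar> * (d x)\<^sup>2 \<partial>lebesgue)"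
proof -
  have d': "(\<lambda>x. - 1 * d x) \<in> H1" by (rule H1_cmult[OF d(1)])
  have T1: "\<bar>energy V (\<lambda>x. m x + d x) - energy V m - dE m d - (gnrm d)\<^sup>2 / 2 - Qf d / 2\<bar> \<le> (p - 1) * rem m d"
    by (rule energy_Taylor[OF m(1) d(1)])
  have "dE m (\<lambda>x. - 1 * d x) = - dE m d" using dE_bilinear[OF m(1) d(1) d(1), of "-1" 0] by simp
  moreover have "gnrm (\<lambda>x. - 1 * d x) = gnrm d" using gnrm_cmult[OF d(1), of "-1"] by simp
  ultimately have T2: "\<bar>energy V (\<lambda>x. m x - d x) - energy V m + dE m d - (gnrm d)\<^sup>2 / 2 - Qf d / 2\<bar> \<le> (p - 1) * rem m d"
    using energy_Taylor[OF m(1) d'] by (simp add: Qf_def rem_def)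
  have "(p - 1) * rem m d \<le> (gnrm d)\<^sup>2 / 4" using B m d unfolding barrier_def by blast
  moreover have "\<bar>Qf d\<bar> \<le> (\<integral>x. \<bar>V x\<bar> * (d x)\<^sup>2 \<partial>lebesgue)" unfolding Qf_def by (rule compact_pot_abs_le[OF Vpot d(1)])
  ultimately show ?thesis using T1 T2 by linarith
qed

text \<open>Under amplification the quadratic part grows like s^2, the negative critical part at
  least as fast because p > 2.\<close>

lemma energy_scale:
  assumes u: "u \<in> H1" and s: "1 \<le> s"
  shows "energy V (\<lambda>x. s * u x) \<le> s\<^sup>2 * energy V u"
proof -
  have "Nf (\<lambda>x. s * u x) = s powr p * Nf u" using s by (simp add: Nf_def abs_mult powr_mult)
  moreover have "s\<^sup>2 \<le> s powr p" using s p_gt powr_mono[of 2 p s] by (simp add: powr_numeral)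
  ultimately have "s\<^sup>2 * (Nf u / p) \<le> Nf (\<lambda>x. s * u x) / p"
    using Nf_nonneg p_gt by (simp add: divide_right_mono mult_right_mono)
  moreover have "Qf (\<lambda>x. s * u x) = s\<^sup>2 * Qf u"
    unfolding Qf_def by (subst integral_mult_right_zero[symmetric]) (simp add: power_mult_distrib mult_ac)
  moreover have "(gnrm (\<lambda>x. s * u x))\<^sup>2 = s\<^sup>2 * (gnrm u)\<^sup>2" using gnrm_cmult[OF u] by (simp add: power_mult_distrib)
  ultimately show ?thesis unfolding energy_eq right_diff_distrib distrib_left by simp
qed

definition small_sphere :: "real \<Rightarrow> real \<Rightarrow> (real^'n \<Rightarrow> real) set" where
  "small_sphere r \<rho> = {u \<in> H1. nrm2 lebesgue u = \<rho> \<and> gnrm u \<le> r}"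

text \<open>Origin of the smallness condition on the mass: negative energy and the first clause of
  the barrier force the squared gradient below 4 C \<rho>^2.\<close>

lemma negative_energy_interior:
  assumes B: "barrier r C" and \<rho>: "4 * C * \<rho>\<^sup>2 < r\<^sup>2" and u: "u \<in> H1" "gnrm u \<le> r" "nrm2 lebesgue u \<le> \<rho>" "energy V u < 0"
  shows "gnrm u < r"
proof -
  have b: "(gnrm u)\<^sup>2 / 8 - C / 2 * (nrm2 lebesgue u)\<^sup>2 \<le> energy V u" "0 < C" "0 < r" using B u unfolding barrier_def by blast+
  have "(nrm2 lebesgue u)\<^sup>2 \<le> \<rho>\<^sup>2" using u by (intro power_mono) auto
  then have "C / 2 * (nrm2 lebesgue u)\<^sup>2 \<le> C / 2 * \<rho>\<^sup>2" using b by (intro mult_left_mono) auto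
  then have "(gnrm u)\<^sup>2 < 8 * (C / 2 * \<rho>\<^sup>2)" using b(1) u(4) by linarith
  then have "(gnrm u)\<^sup>2 < 4 * C * \<rho>\<^sup>2" by simp
  then have "(gnrm u)\<^sup>2 < r\<^sup>2" using \<rho> by simp
  then show ?thesis by (rule power2_less_imp_less) (use b(3) in simp)
qed

text \<open>Along the ray from \<open>u\<close> the energy stays negative, so the ray cannot reach the barrier before the mass is \<open>\<rho>\<close>.\<close>

lemma subsphere_energy:
  assumes B: "barrier r C" and \<rho>: "0 < \<rho>" "4 * C * \<rho>\<^sup>2 < r\<^sup>2" 
    and m: "m < 0" "\<And>w. w \<in> small_sphere r \<rho> \<Longrightarrow> m \<le> energy V w"
    and u: "u \<in> H1" "gnrm u \<le> r" "nrm2 lebesgue u \<le> \<rho>"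
  shows "(nrm2 lebesgue u)\<^sup>2 * m \<le> \<rho>\<^sup>2 * energy V u"
proof (cases "energy V u < 0")
  case False
  have "(nrm2 lebesgue u)\<^sup>2 * m \<le> 0" using m by (simp add: mult_nonneg_nonpos)
  moreover have "0 \<le> \<rho>\<^sup>2 * energy V u" using False by simp
  ultimately show ?thesis by simp
next
  case True
  have r: "0 < r" using B by (simp add: barrier_def)
  define s where "s = nrm2 lebesgue u"
  have "s \<noteq> 0"
  proof
    assume "s = 0"
    then have "(gnrm u)\<^sup>2 / 8 \<le> energy V u" using B u unfolding barrier_def s_def by force
    then show False using True zero_le_power2[of "gnrm u"] by linarith
  qed
  then have s: "0 < s" "s \<le> \<rho>" using u by (auto simp: s_def less_le)
  define t where "t = \<rho> / s"
  have t: "1 \<le> t" using s by (simp add: t_def)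
  have neg: "energy V (\<lambda>x. c * u x) < 0" if "1 \<le> c" for c
  proof -
    have "c\<^sup>2 * energy V u < 0" using True that by (simp add: mult_pos_neg)
    then show ?thesis using energy_scale[OF u(1) that] by linarith
  qed
  have "t * gnrm u \<le> r"
  proof (rule ccontr)
    assume "\<not> t * gnrm u \<le> r"
    then have g: "r < t * gnrm u" by simp
    then have g0: "0 < gnrm u" using r gnrm_nonneg[of u] by (cases "gnrm u = 0") (simp_all add: less_le)
    \<comment> \<open>The point at which the ray would meet gradient norm \<open>r\<close>. Its
      energy is negative and its mass does not exceed \<rho>, so it would lie strictly inside the
      ball.\<close>
    define c where "c = r / gnrm u"
    have c: "1 \<le> c" "c \<le> t" "c * gnrm u = r" using g0 u g by (auto simp: c_def field_simps)
    have "c * s \<le> t * s" using c s by (intro mult_right_mono) auto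
    then have "c * s \<le> \<rho>" using s by (simp add: t_def)
    then have "gnrm (\<lambda>x. c * u x) < r"
      using c by (intro negative_energy_interior[OF B \<rho>(2)] neg H1_cmult u) (auto simp: gnrm_cmult[OF u(1)] nrm2_cmult s_def)
    then show False using c by (simp add: gnrm_cmult[OF u(1)])
  qed
  moreover have "nrm2 lebesgue (\<lambda>x. t * u x) = \<rho>"
    unfolding nrm2_cmult s_def[symmetric] using t s by (simp add: t_def)
  ultimately have "(\<lambda>x. t * u x) \<in> small_sphere r \<rho>"
    using t H1_cmult[OF u(1)] by (simp add: small_sphere_def gnrm_cmult[OF u(1)])
  then have "m \<le> t\<^sup>2 * energy V u" using m(2) energy_scale[OF u(1) t] by (meson order_trans)
  then have "s\<^sup>2 * m \<le> s\<^sup>2 * (t\<^sup>2 * energy V u)" by (intro mult_left_mono) auto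
  also have "\<dots> = (s * t)\<^sup>2 * energy V u" by (simp add: power_mult_distrib mult.assoc)
  also have "s * t = \<rho>" using s by (simp add: t_def)
  finally show ?thesis by (simp add: s_def)
qed

text \<open>Comparing a minimizing sequence with its midpoints, whose mass is smaller by a quarter of the
  squared distance, shows that the sequence converges strongly.\<close>

lemma small_sphere_minimizer:
  assumes B: "barrier r C" and \<rho>: "0 < \<rho>" "4 * C * \<rho>\<^sup>2 < r\<^sup>2" 
    and neg: "u0 \<in> small_sphere r \<rho>" "energy V u0 < 0"
  shows "\<exists>U\<in>small_sphere r \<rho>. energy V U < 0 \<and> (\<forall>w\<in>small_sphere r \<rho>. energy V U \<le> energy V w)"
proof -
  define m where "m = Inf (energy V ` small_sphere r \<rho>)"
  have bdd: "bdd_below (energy V ` small_sphere r \<rho>)"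
  proof (rule bdd_belowI2)
    fix u assume "u \<in> small_sphere r \<rho>"
    then have "(gnrm u)\<^sup>2 / 8 - C / 2 * \<rho>\<^sup>2 \<le> energy V u" using B unfolding barrier_def small_sphere_def by blast
    then show "- (C / 2 * \<rho>\<^sup>2) \<le> energy V u" using zero_le_power2[of "gnrm u"] by linarith
  qed
  have m_le: "m \<le> energy V w" if "w \<in> small_sphere r \<rho>" for w
    unfolding m_def using that by (intro cInf_lower bdd) auto
  have m0: "m < 0" using m_le[OF neg(1)] neg(2) by linarith
  have "\<exists>u. u \<in> small_sphere r \<rho> \<and> energy V u < m + inverse (real (Suc k))" for k
    using cInf_lessD[of "energy V ` small_sphere r \<rho>" "m + inverse (real (Suc k))"] neg(1) by (auto simp: m_def)
  then obtain u where u: "\<And>k. u k \<in> small_sphere r \<rho>" "\<And>k. energy V (u k) < m + inverse (real (Suc k))" by metis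
  have uH: "u k \<in> H1" "nrm2 lebesgue (u k) = \<rho>" "gnrm (u k) \<le> r" for k using u(1)[of k] by (auto simp: small_sphere_def)
  have uB: "gnrm (u k) \<le> max r \<rho>" "nrm2 lebesgue (u k) \<le> max r \<rho>" for k using uH(2,3)[of k] by auto
  obtain s :: "nat \<Rightarrow> nat" where s: "strict_mono s" 
    and Cau: "\<forall>e>0. \<exists>N. \<forall>m\<ge>N. \<forall>n\<ge>N. (\<integral>x. \<bar>V x\<bar> * (u (s m) x - u (s n) x)\<^sup>2 \<partial>lebesgue) < e"
    using compact_pot_Cauchy[of V u "max r \<rho>", OF Vpot uH(1) uB] by blast
  \<comment> \<open>For the midpoint \<open>w\<close> and half difference \<open>d\<close>, the
    squared masses add up to \<rho>^2. The bound on smaller spheres then gives E(w) >= m +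
    (-m/\<rho>^2) |d|^2. Because m < 0 the lost mass is a gain that controls the L2 distance; the
    midpoint inequality controls the gradients.\<close>
  have key: "(gnrm (\<lambda>x. u i x - u j x))\<^sup>2 / 8 + (- m / (2 * \<rho>\<^sup>2)) * (nrm2 lebesgue (\<lambda>x. u i x - u j x))\<^sup>2 
     \<le> (energy V (u i) - m) + (energy V (u j) - m) + (\<integral>x. \<bar>V x\<bar> * (u i x - u j x)\<^sup>2 \<partial>lebesgue) / 4" for i j
  proof -
    define w where "w x = 1/2 * u i x + 1/2 * u j x" for x
    define d where "d x = 1/2 * u i x + - (1/2) * u j x" for x
    have wd: "w \<in> H1" "d \<in> H1" unfolding w_def[abs_def] d_def[abs_def] by (intro H1_lincomb uH)+
    have gw: "gnrm w \<le> r" "gnrm d \<le> r"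
      using gnrm_lincomb_le[OF uH(1)[of i] uH(1)[of j], of "1/2" "1/2"] gnrm_lincomb_le[OF uH(1)[of i] uH(1)[of j], of "1/2" "-(1/2)"] 
        uH(3)[of i] uH(3)[of j] unfolding w_def[abs_def] d_def[abs_def] by simp_all
    have deq: "d = (\<lambda>x. 1/2 * (u i x - u j x))" by (auto simp: d_def fun_eq_iff algebra_simps)
    have dg: "gnrm d = gnrm (\<lambda>x. u i x - u j x) / 2" "nrm2 lebesgue d = nrm2 lebesgue (\<lambda>x. u i x - u j x) / 2"
      unfolding deq gnrm_cmult[OF H1_diff[OF uH(1) uH(1)]] nrm2_cmult by simp_all
    have wd_sum: "(\<lambda>x. w x + d x) = u i" "(\<lambda>x. w x - d x) = u j" by (auto simp: w_def d_def fun_eq_iff)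
    have Vd: "(\<integral>x. \<bar>V x\<bar> * (d x)\<^sup>2 \<partial>lebesgue) = (\<integral>x. \<bar>V x\<bar> * (u i x - u j x)\<^sup>2 \<partial>lebesgue) / 4"
      unfolding deq by (simp add: power_divide)
    have mid: "2 * energy V w \<le> energy V (u i) + energy V (u j) - (gnrm d)\<^sup>2 / 2 + (\<integral>x. \<bar>V x\<bar> * (d x)\<^sup>2 \<partial>lebesgue)"
      using energy_midpoint[OF B wd(1) gw(1) wd(2) gw(2)] unfolding wd_sum .
    have par: "(nrm2 lebesgue w)\<^sup>2 + (nrm2 lebesgue d)\<^sup>2 = \<rho>\<^sup>2"
    proof -
      have "(nrm2 lebesgue (u i))\<^sup>2 = (nrm2 lebesgue w)\<^sup>2 + 2 * (\<integral>x. w x * d x \<partial>lebesgue) + (nrm2 lebesgue d)\<^sup>2"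
        using nrm2_add_power2[OF H1_sq_int[OF wd(1)] H1_sq_int[OF wd(2)]] unfolding wd_sum by simp
      moreover have "(nrm2 lebesgue (u j))\<^sup>2 = (nrm2 lebesgue w)\<^sup>2 - 2 * (\<integral>x. w x * d x \<partial>lebesgue) + (nrm2 lebesgue d)\<^sup>2"
        using nrm2_add_power2[OF H1_sq_int[OF wd(1)] sq_int_uminus[OF H1_sq_int[OF wd(2)]]] wd_sum by (simp add: nrm2_uminus)
      ultimately show ?thesis using uH(2) by simp
    qed
    then have "(nrm2 lebesgue w)\<^sup>2 \<le> \<rho>\<^sup>2" using zero_le_power2[of "nrm2 lebesgue d"] by linarith
    then have "nrm2 lebesgue w \<le> \<rho>" by (rule power2_le_imp_le) (use \<rho> in simp)
    from subsphere_energy[OF B \<rho> m0 m_le wd(1) gw(1) this]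
    moreover have "(nrm2 lebesgue w)\<^sup>2 = \<rho>\<^sup>2 - (nrm2 lebesgue d)\<^sup>2" using par by simp
    ultimately have "\<rho>\<^sup>2 * (m + (- m / \<rho>\<^sup>2) * (nrm2 lebesgue d)\<^sup>2) \<le> \<rho>\<^sup>2 * energy V w" 
      using \<rho>(1) by (simp add: algebra_simps)
    then have "m + (- m / \<rho>\<^sup>2) * (nrm2 lebesgue d)\<^sup>2 \<le> energy V w" using \<rho>(1) by simp
    then show ?thesis using mid unfolding dg Vd by (simp add: power_divide)
  qed
  have "\<exists>N. \<forall>i\<ge>N. \<forall>j\<ge>N. gnrm (\<lambda>x. u (s i) x - u (s j) x) < e \<and> nrm2 lebesgue (\<lambda>x. u (s i) x - u (s j) x) < e" if e: "0 < e" for e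
  proof -
    define c where "c = min (1 / 8) (- m / (2 * \<rho>\<^sup>2))"
    have c: "0 < c" "c \<le> 1 / 8" "c \<le> - m / (2 * \<rho>\<^sup>2)" using m0 \<rho>(1) by (auto simp: c_def divide_neg_pos)
    define e1 where "e1 = c * e\<^sup>2 / 3"
    have e1: "0 < e1" using c e by (simp add: e1_def)
    obtain N1 where N1: "inverse (real (Suc N1)) < e1" using reals_Archimedean[OF e1] by auto
    obtain N2 where N2: "\<And>m n. m \<ge> N2 \<Longrightarrow> n \<ge> N2 \<Longrightarrow> (\<integral>x. \<bar>V x\<bar> * (u (s m) x - u (s n) x)\<^sup>2 \<partial>lebesgue) < e1" using Cau e1 by blast
    have Es: "energy V (u (s i)) - m < e1" if "N1 \<le> i" for i
    proof -
      have "N1 \<le> s i" using that strict_mono_imp_increasing[OF s, of i] by linarith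
      then have "inverse (real (Suc (s i))) \<le> inverse (real (Suc N1))" by (intro le_imp_inverse_le) auto
      then show ?thesis using u(2)[of "s i"] N1 by linarith
    qed
    have "gnrm (\<lambda>x. u (s i) x - u (s j) x) < e \<and> nrm2 lebesgue (\<lambda>x. u (s i) x - u (s j) x) < e" if ij: "i \<ge> max N1 N2" "j \<ge> max N1 N2" for i j
    proof -
      let ?d = "\<lambda>x. u (s i) x - u (s j) x"
      have "c * (gnrm ?d)\<^sup>2 + c * (nrm2 lebesgue ?d)\<^sup>2 \<le> (1 / 8) * (gnrm ?d)\<^sup>2 + (- m / (2 * \<rho>\<^sup>2)) * (nrm2 lebesgue ?d)\<^sup>2"
        by (intro add_mono mult_right_mono c) auto
      also have "\<dots> < c * e\<^sup>2"
        using key[of "s i" "s j"] Es[of i] Es[of j] N2[of i j] ij e1 unfolding e1_def by simp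
      finally have "(gnrm ?d)\<^sup>2 + (nrm2 lebesgue ?d)\<^sup>2 < e\<^sup>2" using c(1) by (simp flip: distrib_left)
      then have "(gnrm ?d)\<^sup>2 < e\<^sup>2" "(nrm2 lebesgue ?d)\<^sup>2 < e\<^sup>2" 
        using zero_le_power2[of "gnrm ?d"] zero_le_power2[of "nrm2 lebesgue ?d"] by linarith+
      then show ?thesis using power2_less_imp_less[OF _ less_imp_le[OF e]] by blast
    qed
    then show ?thesis by blast
  qed
  from H1_complete[of "\<lambda>k. u (s k)", OF uH(1) this] obtain U where U: "U \<in> H1" "(\<lambda>k. H1_norm (\<lambda>x. u (s k) x - U x)) \<longlonglongrightarrow> 0" by blast
  have lim0: "(\<lambda>k. nrm2 lebesgue (\<lambda>x. u (s k) x - U x)) \<longlonglongrightarrow> 0" "(\<lambda>k. gnrm (\<lambda>x. u (s k) x - U x)) \<longlonglongrightarrow> 0"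
    by (rule tendsto_sandwich[OF always_eventually always_eventually tendsto_const U(2)]; simp add: nrm2_le_H1_norm gnrm_le_H1_norm)+
  have "(\<lambda>k. nrm2 lebesgue (u (s k))) \<longlonglongrightarrow> nrm2 lebesgue U" 
    by (intro nrm2_tendsto H1_sq_int uH U lim0)
  then have nU: "nrm2 lebesgue U = \<rho>" using uH(2) LIMSEQ_unique tendsto_const by (metis (no_types, lifting) ext)
  have gU: "gnrm U \<le> r"
  proof -
    have "gnrm U \<le> r + gnrm (\<lambda>x. u (s k) x - U x)" for k
    proof -
      have "gnrm (\<lambda>x. u (s k) x - (u (s k) x - U x)) \<le> gnrm (u (s k)) + gnrm (\<lambda>x. u (s k) x - U x)"
        by (intro gnrm_diff_le uH H1_diff U)
      then show ?thesis using uH(3)[of "s k"] by simp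
    qed
    moreover have "(\<lambda>k. r + gnrm (\<lambda>x. u (s k) x - U x)) \<longlonglongrightarrow> r + 0" by (intro tendsto_intros lim0)
    ultimately show ?thesis using LIMSEQ_le_const by fastforce
  qed
  have US: "U \<in> small_sphere r \<rho>" using U(1) nU gU by (simp add: small_sphere_def)
  have "(\<lambda>k. energy V (u (s k))) \<longlonglongrightarrow> energy V U"
    by (rule has_H1_derivative_continuous[OF energy_has_H1_derivative[OF U(1)] U(1) uH(1) U(2)])
  moreover have "(\<lambda>k. m + inverse (real (Suc (s k)))) \<longlonglongrightarrow> m + 0"
    using LIMSEQ_subseq_LIMSEQ[OF LIMSEQ_inverse_real_of_nat s] by (intro tendsto_intros) (simp add: comp_def)
  ultimately have "energy V U \<le> m"
    using LIMSEQ_le[of "\<lambda>k. energy V (u (s k))" "energy V U" "\<lambda>k. m + inverse (real (Suc (s k)))" m] u(2) by (auto intro: less_imp_le)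
  then show ?thesis using US m0 m_le by (intro bexI[of _ U]) (auto intro: order_trans)
qed

text \<open>Subtracting from \<open>v\<close> its L2 projection onto \<open>U\<close> leaves a
  tangent vector, on which the first variation vanishes; testing with \<open>U\<close> itself
  identifies the multiplier.\<close>

lemma dE_Lagrange:
  assumes U: "U \<in> H1" and \<rho>: "0 < \<rho>" "nrm2 lebesgue U = \<rho>"
    and tangent: "\<And>v. v \<in> H1 \<Longrightarrow> (\<integral>x. U x * v x \<partial>lebesgue) = 0 \<Longrightarrow> dE U v = 0" and v: "v \<in> H1"
  shows "dE U v = dE U U / \<rho>\<^sup>2 * (\<integral>x. U x * v x \<partial>lebesgue)"
proof -
  define a where "a = (\<integral>x. U x * v x \<partial>lebesgue) / \<rho>\<^sup>2"
  have UU: "(\<integral>x. U x * U x \<partial>lebesgue) = \<rho>\<^sup>2" using \<rho>(2) nrm2_power2[of lebesgue U] by (simp add: power2_eq_square)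
  have w: "(\<lambda>x. 1 * v x + (- a) * U x) \<in> H1" by (intro H1_lincomb v U)
  have "(\<integral>x. U x * (1 * v x + (- a) * U x) \<partial>lebesgue) = (\<integral>x. U x * v x + (- a) * (U x * U x) \<partial>lebesgue)"
    by (simp add: algebra_simps)
  also have "\<dots> = (\<integral>x. U x * v x \<partial>lebesgue) + (- a) * (\<integral>x. U x * U x \<partial>lebesgue)"
    using sq_int_mult[OF H1_sq_int[OF U] H1_sq_int[OF v]] sq_int_mult[OF H1_sq_int[OF U] H1_sq_int[OF U]] by simp
  also have "\<dots> = 0" unfolding UU a_def using \<rho>(1) by simp
  finally have "dE U (\<lambda>x. 1 * v x + (- a) * U x) = 0" by (rule tangent[OF w])
  then have "dE U v = a * dE U U" unfolding dE_bilinear[OF U v U] by simp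
  then show ?thesis by (simp add: a_def)
qed

text \<open>The curve \<open>s \<mapsto> c(s) (U + s v)\<close> with \<open>c(s) = \<rho> / |U + s v|\<^sub>2\<close> stays on the sphere, and \<open>1 - c(s) = O(s\<^sup>2)\<close>.\<close>

lemma minimizer_tangent:
  assumes U: "U \<in> small_sphere r \<rho>" and \<rho>: "0 < \<rho>" and Ur: "gnrm U < r" 
    and min: "\<And>w. w \<in> small_sphere r \<rho> \<Longrightarrow> energy V U \<le> energy V w"
    and v: "v \<in> H1" and orth: "(\<integral>x. U x * v x \<partial>lebesgue) = 0"
  shows "dE U v = 0"
proof (rule ccontr)
  assume nz: "dE U v \<noteq> 0"
  have UH: "U \<in> H1" "nrm2 lebesgue U = \<rho>" using U by (auto simp: small_sphere_def)
  define a where "a = \<bar>dE U v\<bar>"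
  have a: "0 < a" using nz by (simp add: a_def)
  \<comment> \<open>Chooses the direction in which the energy decreases at rate
    \<open>a\<close>.\<close>
  define \<sigma> where "\<sigma> = - sgn (dE U v)"
  have \<sigma>: "\<bar>\<sigma>\<bar> = 1" "\<sigma> * dE U v = - a" using nz by (auto simp: \<sigma>_def a_def sgn_if)
  define b where "b = \<bar>dE U U\<bar>"
  define k where "k = (nrm2 lebesgue v)\<^sup>2 / \<rho>\<^sup>2"
  have k: "0 \<le> k" by (simp add: k_def)
  \<comment> \<open>The increment \<open>h\<close> along the curve has norm at most \<tau> Z: its
    \<open>U\<close> part is at most k \<tau>, its \<open>v\<close> part at most \<tau>.\<close>
  define Z where "Z = k * (gnrm U + nrm2 lebesgue U) + (gnrm v + nrm2 lebesgue v) + 1"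
  have Z: "0 < Z" unfolding Z_def using k by (intro add_nonneg_pos add_nonneg_nonneg mult_nonneg_nonneg) auto
  define \<epsilon> where "\<epsilon> = a / (8 * Z)"
  have \<epsilon>: "0 < \<epsilon>" using a Z by (simp add: \<epsilon>_def)
  obtain \<delta> where \<delta>: "\<delta> > 0" "\<And>h. h \<in> H1 \<Longrightarrow> H1_norm h < \<delta> \<Longrightarrow> \<bar>energy V (\<lambda>x. U x + h x) - energy V U - dE U h\<bar> \<le> \<epsilon> * H1_norm h"
    using energy_has_H1_derivative[OF UH(1)] \<epsilon> unfolding has_H1_derivative_def by blast
  \<comment> \<open>The bounds serve in turn: \<tau>^2 <= \<tau>; the factor \<open>c\<close> is at
    least 1/2; \<open>h\<close> stays within the differentiability radius; the curve stays inside
    the gradient ball; the error from renormalization is at most \<tau> a/8.\<close>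
  define \<tau> where "\<tau> = min (min 1 (1 / (2 * (k + 1)))) (min (min (\<delta> / (2 * Z)) ((r - gnrm U) / (2 * Z))) (a / (8 * (k * b + 1))))"
  have kb: "0 < k * b + 1" using k by (intro add_nonneg_pos) (auto simp: b_def)
  have \<tau>0: "0 < \<tau>" unfolding \<tau>_def using k \<delta>(1) Z Ur a kb by (auto simp: add_nonneg_pos)
  have \<tau>: "\<tau> \<le> 1" "\<tau> \<le> 1 / (2 * (k + 1))" "\<tau> \<le> \<delta> / (2 * Z)" "\<tau> \<le> (r - gnrm U) / (2 * Z)" "\<tau> \<le> a / (8 * (k * b + 1))"
    unfolding \<tau>_def by auto
  define s where "s = \<sigma> * \<tau>"
  have s: "\<bar>s\<bar> = \<tau>" using \<sigma>(1) \<tau>0 by (simp add: s_def abs_mult)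
  have s2: "s\<^sup>2 = \<tau>\<^sup>2" using s by (metis power2_abs)
  define M where "M = \<rho>\<^sup>2 + s\<^sup>2 * (nrm2 lebesgue v)\<^sup>2"
  have M: "\<rho>\<^sup>2 \<le> M" "0 < M" using \<rho> by (auto simp: M_def add_pos_nonneg)
  define c where "c = \<rho> / sqrt M"
  have c0: "0 < c" using \<rho> M by (simp add: c_def)
  have sqM: "\<rho> \<le> sqrt M" using M \<rho> by (intro real_le_rsqrt) auto
  have c1: "c \<le> 1" using sqM \<rho> M by (simp add: c_def)
  \<comment> \<open>Since c <= 1, the difference 1 - c is at most 1 - c^2, which involves no
    root.\<close>
  have c2: "1 - c \<le> k * \<tau>\<^sup>2"
  proof -
    have "c\<^sup>2 = \<rho>\<^sup>2 / M" using M by (simp add: c_def power_divide)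
    then have "1 - c\<^sup>2 = s\<^sup>2 * (nrm2 lebesgue v)\<^sup>2 / M" using M by (simp add: field_simps M_def)
    also have "\<dots> \<le> s\<^sup>2 * (nrm2 lebesgue v)\<^sup>2 / \<rho>\<^sup>2" using M \<rho> by (intro divide_left_mono) auto
    also have "\<dots> = k * \<tau>\<^sup>2" by (simp add: k_def s2)
    finally have "1 - c\<^sup>2 \<le> k * \<tau>\<^sup>2" .
    moreover have "c\<^sup>2 \<le> c" using c0 c1 by (simp add: power2_eq_square mult_left_le_one_le)
    ultimately show ?thesis by linarith
  qed
  define w where "w x = c * U x + (c * s) * v x" for x
  have wH: "w \<in> H1" unfolding w_def[abs_def] by (intro H1_lincomb UH v)
  have wn: "nrm2 lebesgue w = \<rho>"
  proof (rule power2_eq_imp_eq)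
    have "(nrm2 lebesgue (\<lambda>x. U x + s * v x))\<^sup>2 = M"
      using nrm2_add_power2[OF H1_sq_int[OF UH(1)] sq_int_cmult[OF H1_sq_int[OF v]], of s] orth UH(2)
      by (simp add: nrm2_cmult M_def power_mult_distrib mult.left_commute mult.assoc)
    moreover have "nrm2 lebesgue w = c * nrm2 lebesgue (\<lambda>x. U x + s * v x)"
      using nrm2_cmult[of lebesgue c "\<lambda>x. U x + s * v x"] c0 by (simp add: w_def[abs_def] algebra_simps)
    ultimately have "(nrm2 lebesgue w)\<^sup>2 = c\<^sup>2 * M" by (simp add: power_mult_distrib)
    then show "(nrm2 lebesgue w)\<^sup>2 = \<rho>\<^sup>2" using M by (simp add: c_def power_divide)
  qed (use \<rho> in auto)
  define h where "h x = (c - 1) * U x + (c * s) * v x" for x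
  have hH: "h \<in> H1" unfolding h_def[abs_def] by (intro H1_lincomb UH v)
  have Uh: "(\<lambda>x. U x + h x) = w" by (auto simp: h_def w_def fun_eq_iff algebra_simps)
  have t2: "\<tau>\<^sup>2 \<le> \<tau>" using \<tau>0 \<tau>(1) by (simp add: power2_eq_square mult_left_le_one_le)
  have hn: "gnrm h \<le> \<tau> * Z" "H1_norm h \<le> \<tau> * Z"
  proof -
    have coef: "\<bar>c - 1\<bar> \<le> \<tau> * k" "\<bar>c * s\<bar> \<le> \<tau>"
    proof -
      have "k * \<tau>\<^sup>2 \<le> k * \<tau>" using t2 k by (intro mult_left_mono) auto
      then show "\<bar>c - 1\<bar> \<le> \<tau> * k" using c1 c2 by (simp add: mult.commute)
      show "\<bar>c * s\<bar> \<le> \<tau>" using c0 c1 \<tau>0 by (simp add: abs_mult s mult_left_le_one_le)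
    qed
    have 1: "gnrm h \<le> (\<tau> * k) * gnrm U + \<tau> * gnrm v"
      unfolding h_def[abs_def] by (rule order_trans[OF gnrm_lincomb_le[OF UH(1) v]]) (intro add_mono mult_right_mono coef; simp)
    have 2: "nrm2 lebesgue h \<le> (\<tau> * k) * nrm2 lebesgue U + \<tau> * nrm2 lebesgue v"
    proof -
      have "nrm2 lebesgue h \<le> \<bar>c - 1\<bar> * nrm2 lebesgue U + \<bar>c * s\<bar> * nrm2 lebesgue v"
        using nrm2_triangle[OF sq_int_cmult[OF H1_sq_int[OF UH(1)]] sq_int_cmult[OF H1_sq_int[OF v]], of "c - 1" "c * s"] 
        by (simp add: h_def[abs_def] nrm2_cmult)
      also have "\<dots> \<le> (\<tau> * k) * nrm2 lebesgue U + \<tau> * nrm2 lebesgue v" by (intro add_mono mult_right_mono coef; simp)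
      finally show ?thesis .
    qed
    have 3: "(\<tau> * k) * gnrm U + \<tau> * gnrm v + ((\<tau> * k) * nrm2 lebesgue U + \<tau> * nrm2 lebesgue v) = \<tau> * Z - \<tau>"
      by (simp add: Z_def algebra_simps)
    show "H1_norm h \<le> \<tau> * Z" using H1_norm_le[of h] 1 2 3 \<tau>0 by linarith
    then show "gnrm h \<le> \<tau> * Z" using gnrm_le_H1_norm[of h] by linarith
  qed
  have "\<tau> * Z \<le> \<delta> / 2" "\<tau> * Z \<le> (r - gnrm U) / 2" using \<tau>(3,4) Z by (simp_all add: field_simps)
  then have small: "H1_norm h < \<delta>" "gnrm h \<le> r - gnrm U" using hn \<delta>(1) Ur by argo+
  have "gnrm w \<le> gnrm U + gnrm h" using gnrm_add_le[OF UH(1) hH] unfolding Uh .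
  then have "w \<in> small_sphere r \<rho>" using wH wn small by (simp add: small_sphere_def)
  then have "energy V U \<le> energy V w" by (rule min)
  moreover have "\<bar>energy V w - energy V U - dE U h\<bar> \<le> \<epsilon> * H1_norm h" using \<delta>(2)[OF hH small(1)] unfolding Uh .
  moreover have "\<epsilon> * H1_norm h \<le> \<epsilon> * (\<tau> * Z)" using hn \<epsilon> by (intro mult_left_mono) auto
  moreover have "\<epsilon> * (\<tau> * Z) = \<tau> * (a / 8)" using Z by (simp add: \<epsilon>_def)
  moreover have "dE U h = (c - 1) * dE U U - c * \<tau> * a"
    unfolding h_def[abs_def] dE_bilinear[OF UH(1) UH(1) v] s_def using \<sigma>(2) by (simp add: mult.assoc mult.left_commute[of \<sigma>])
  moreover have "(c - 1) * dE U U \<le> \<tau> * (a / 8)"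
  proof -
    have "(c - 1) * dE U U \<le> \<bar>c - 1\<bar> * b" using abs_ge_self[of "(c - 1) * dE U U"] by (simp add: abs_mult b_def)
    also have "\<dots> \<le> (k * \<tau>\<^sup>2) * b" using c1 c2 by (intro mult_right_mono) (auto simp: b_def)
    also have "\<dots> = \<tau> * (\<tau> * (k * b))" by (simp add: power2_eq_square mult_ac)
    also have "\<dots> \<le> \<tau> * (\<tau> * (k * b + 1))" using \<tau>0 by (intro mult_left_mono) auto
    also have "\<tau> * (k * b + 1) \<le> a / 8" using \<tau>(5) kb by (simp add: field_simps)
    finally show ?thesis using \<tau>0 by (simp add: mult_left_mono)
  qed
  moreover have "\<tau> * (a / 2) \<le> c * \<tau> * a"
  proof -
    have "k * \<tau>\<^sup>2 \<le> (k + 1) * \<tau>" using t2 k \<tau>0 by (intro mult_mono) auto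
    also have "\<dots> \<le> 1 / 2" using \<tau>(2) k by (simp add: field_simps)
    finally have "1 / 2 \<le> c" using c2 by linarith
    from mult_right_mono[OF this, of "\<tau> * a"] show ?thesis using \<tau>0 a by (simp add: mult.assoc)
  qed
  \<comment> \<open>The decrease of at least \<tau> a/2 would have to be compensated by two errors
    of size \<tau> a/8.\<close>
  ultimately have "\<tau> * (a / 2) \<le> \<tau> * (a / 8) + \<tau> * (a / 8)" by linarith
  then show False using \<tau>0 a by simp
qed

end

section \<open>Positivity\<close>

text \<open>Mollifications of \<open>a\<close> are locally constant and converge almost everywhere along a subsequence.\<close>

lemma zero_weak_grad_constant:
  fixes a :: "real^'n::finite \<Rightarrow> real"
  assumes [measurable]: "a \<in> borel_measurable lebesgue" and bd: "\<And>x. \<bar>a x\<bar> \<le> 1"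
    and zero: "\<And>\<phi> i. \<phi> \<in> test_fun \<Longrightarrow> (\<integral>x. a x * partial i \<phi> x \<partial>lebesgue) = 0"
  shows "\<exists>l. AE x in lebesgue. norm x < R \<longrightarrow> a x = l"
proof -
  \<comment> \<open>A bounded function need not be square integrable. Cutting off at radius R + 1
    repairs this, and mollification at points of norm below R with kernels of radius at most 1 does
    not notice the cut.\<close>
  define f where "f x = indicator (cball 0 (R + 1)) x * a x" for x
  have [measurable]: "f \<in> borel_measurable lebesgue" unfolding f_def[abs_def] by measurable
  have fs: "sq_int lebesgue f"
    by (rule sq_int_bounded_support[where B=1 and R="R + 1"]) (use bd in \<open>auto simp: f_def indicator_def\<close>)
  have const: "conv f (eta k) x = conv f (eta k) 0" if k: "1 \<le> k" and x: "x \<in> ball 0 R" for k x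
  proof -
    have k0: "0 < k" using k by simp
    have eta: "(eta k :: real^'n \<Rightarrow> real) \<in> test_fun" using k0 by (rule eta_facts)
    have eta0: "eta k z = 0" if "1 < norm z" for z :: "real^'n"
    proof (rule eta_facts(3)[OF k0])
      have "1 / k \<le> 1" using k by simp
      then show "1 / k \<le> norm z" using that by linarith
    qed
    have D: "(conv f (eta k) has_derivative (\<lambda>h. 0)) (at y within ball 0 R)" if y: "y \<in> ball 0 R" for y
    proof -
      have "conv f (partial i (eta k)) y = 0" for i
      proof -
        have fa: "f z * partial i (eta k) (y - z) = a z * partial i (eta k) (y - z)" for z
        proof (cases "norm z \<le> R + 1")
          case True then show ?thesis by (simp add: f_def)
        next
          case False
          have "norm z \<le> norm (y - z) + norm y" using norm_triangle_ineq[of "z - y" y] by (simp add: norm_minus_commute)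
          then have "1 < norm (y - z)" using False y by simp
          then have "partial i (eta k) (y - z) = 0"
            using has_derivative_zero_outside[OF eta0 has_derivative_frechet[OF test_funD(2)[OF eta]]] by (auto simp: partial_def)
          then show ?thesis by simp
        qed
        have "conv f (partial i (eta k)) y = (\<integral>z. a z * partial i (eta k) (y - z) \<partial>lebesgue)" by (simp only: conv_def fa)
        also have "\<dots> = - (\<integral>z. a z * partial i (\<lambda>z. eta k (y - z)) z \<partial>lebesgue)" by (simp add: partial_reflect[OF eta])
        finally show ?thesis by (simp add: zero test_fun_reflect eta)
      qed
      then have "(\<chi> i. conv f (partial i (eta k)) y) = 0" by (simp add: vec_eq_iff)
      then show ?thesis using has_derivative_at_withinI[OF conv_has_derivative[OF fs eta, of y]] by (simp add: inner_zero_left)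
    qed
    have "norm (0::real^'n) < R" using x by (simp add: le_less_trans[OF norm_ge_zero])
    then show ?thesis using has_derivative_zero_unique[OF convex_ball D x, of 0] by simp
  qed
  obtain k0 where k0: "\<And>k. k \<ge> k0 \<Longrightarrow> sq_int lebesgue (conv f (eta (real k)))" using conv_eta_LIMSEQ(1)[OF fs] by auto
  have "(\<lambda>k. nrm2 lebesgue (\<lambda>x. conv f (eta (real (k + (k0 + 1)))) x - f x)) \<longlonglongrightarrow> 0"
    by (rule LIMSEQ_ignore_initial_segment[OF conv_eta_LIMSEQ(2)[OF fs]])
  then obtain r :: "nat \<Rightarrow> nat" where r: "strict_mono r" 
    and lim: "AE x in lebesgue. (\<lambda>k. conv f (eta (real (r k + (k0 + 1)))) x) \<longlonglongrightarrow> f x"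
    using nrm2_AE_subseq[of lebesgue "\<lambda>k. conv f (eta (real (k + (k0 + 1))))" f, OF k0 fs] by auto
  define l where "l = lim (\<lambda>k. conv f (eta (real (r k + (k0 + 1)))) 0)"
  have "AE x in lebesgue. norm x < R \<longrightarrow> a x = l"
    using lim
  proof eventually_elim
    case (elim x)
    show ?case
    proof
      assume x: "norm x < R"
      then have "conv f (eta (real (r k + (k0 + 1)))) x = conv f (eta (real (r k + (k0 + 1)))) 0" for k
        by (intro const) auto
      then have "(\<lambda>k. conv f (eta (real (r k + (k0 + 1)))) 0) \<longlonglongrightarrow> f x" using elim by simp
      then have "l = f x" unfolding l_def by (rule limI)
      then show "a x = l" using x by (simp add: f_def)
    qed
  qed
  then show ?thesis by blast
qed

lemma test_fun_C1_bounds: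
  assumes phi: "\<phi> \<in> test_fun"
  shows "\<exists>B. \<forall>x. \<bar>\<phi> x\<bar> \<le> B \<and> norm (\<chi> i. partial i \<phi> x) \<le> B"
proof -
  obtain L where L: "\<And>x y. \<bar>\<phi> x - \<phi> y\<bar> \<le> L * norm (x - y)" using test_fun_Lipschitz[OF phi] by auto
  obtain R where R: "\<And>x. R < norm x \<Longrightarrow> \<phi> x = 0" using test_funD(4)[OF phi] by auto
  have "(\<chi> i. partial i \<phi> x) = 0" if "R < norm x" for x
    using has_derivative_zero_outside[OF R has_derivative_frechet[OF test_funD(2)[OF phi]] that] by (simp add: vec_eq_iff partial_def)
  then obtain B1 where B1: "\<And>x. norm (\<chi> i. partial i \<phi> x) \<le> B1 * indicator (cball 0 R) x" "B1 > 0"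
    using continuous_support_bounded[OF C1gradD(2)[OF C1grad_test_fun[OF phi]]] by blast
  obtain B2 R' where B2: "\<And>x. \<bar>\<phi> x\<bar> \<le> B2 * indicator (cball 0 R') x" "B2 > 0" using test_fun_bound[OF phi] by blast
  have "\<bar>\<phi> x\<bar> \<le> B2" "norm (\<chi> i. partial i \<phi> x) \<le> B1" for x
    by (rule order_trans[OF B2(1)], use B2(2) in \<open>simp add: indicator_def\<close>)
       (rule order_trans[OF B1(1)], use B1(2) in \<open>simp add: indicator_def\<close>)
  then have "\<bar>\<phi> x\<bar> \<le> max B1 B2 \<and> norm (\<chi> i. partial i \<phi> x) \<le> max B1 B2" for x
    by (simp add: le_max_iff_disj)
  then show ?thesis by blast
qed

lemma test_fun_grad_sq_int: "\<phi> \<in> test_fun \<Longrightarrow> sq_int lebesgue (\<lambda>x. \<chi> i. partial i \<phi> x)"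
  by (rule sq_int_vecI) (simp add: test_fun_sq_int test_fun_partial)

lemma test_fun_H1: "\<phi> \<in> test_fun \<Longrightarrow> \<phi> \<in> H1"
  by (rule H1I[OF test_fun_sq_int C1grad_has_weak_grad[OF C1grad_test_fun test_fun_sq_int test_fun_grad_sq_int]])

context nls
begin

definition weak_eq :: "(real^'n \<Rightarrow> real) \<Rightarrow> real \<Rightarrow> bool" where
  "weak_eq U \<mu> \<longleftrightarrow> U \<in> H1 \<and> (\<forall>v\<in>H1. dE U v = \<mu> * (\<integral>x. U x * v x \<partial>lebesgue))"

text \<open>The equation tested with \<open>\<phi>\<^sup>2 F(U)\<close>, \<open>F(s) = 1 / (\<surd>(s\<^sup>2 + e\<^sup>2) + s)\<close>, a smooth substitute for \<open>1 / U\<close>;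
  it satisfies \<open>F' = - F / \<surd>(s\<^sup>2 + e\<^sup>2) \<le> - F\<^sup>2\<close> on \<open>s \<ge> 0\<close>.\<close>

lemma log_gradient_bound:
  assumes U: "weak_eq U \<mu>" and pos: "\<And>x. 0 \<le> U x" and phi: "\<phi> \<in> test_fun"
  shows "\<exists>C\<ge>0. \<forall>e>0. \<forall>z. z \<in> borel_measurable borel \<longrightarrow> (\<forall>s\<ge>0. \<bar>z s\<bar> * sqrt (s\<^sup>2 + e\<^sup>2) \<le> 1) \<longrightarrow>
     sq_int lebesgue (\<lambda>x. (\<phi> x * z (U x)) *\<^sub>R weak_grad U x) \<and> (nrm2 lebesgue (\<lambda>x. (\<phi> x * z (U x)) *\<^sub>R weak_grad U x))\<^sup>2 \<le> C"
proof -
  have UH: "U \<in> H1" and eq: "\<And>v. v \<in> H1 \<Longrightarrow> dE U v = \<mu> * (\<integral>x. U x * v x \<partial>lebesgue)" using U by (auto simp: weak_eq_def)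
  have Um[measurable]: "U \<in> borel_measurable lebesgue" using UH by (simp add: H1_iff sq_int_def)
  define g where "g = weak_grad U"
  have gs: "sq_int lebesgue g" unfolding g_def by (rule weak_grad_sq_int[OF UH])
  have wg: "has_weak_grad U g" unfolding g_def by (rule has_weak_grad_weak_grad[OF UH])
  have [measurable]: "g \<in> borel_measurable lebesgue" using gs by (simp add: sq_int_def)
  define \<Phi> where "\<Phi> x = (\<chi> i. partial i \<phi> x)" for x
  have phim[measurable]: "\<phi> \<in> borel_measurable lebesgue" by (intro continuous_borel_lebesgue test_funD phi)
  have \<Phi>s: "sq_int lebesgue \<Phi>" unfolding \<Phi>_def by (rule test_fun_grad_sq_int[OF phi])
  have phis: "sq_int lebesgue \<phi>" by (rule test_fun_sq_int[OF phi])
  have phiH: "\<phi> \<in> H1" by (rule test_fun_H1[OF phi])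
  define \<psi> where "\<psi> x = \<phi> x * \<phi> x" for x
  have psi: "\<psi> \<in> test_fun" unfolding \<psi>_def by (rule test_fun_mult[OF phi phi])
  define \<Psi> where "\<Psi> x = (2 * \<phi> x) *\<^sub>R \<Phi> x" for x
  have psiC: "C1grad \<psi> \<Psi>"
    using C1grad_mult[OF C1grad_test_fun[OF phi] C1grad_test_fun[OF phi]] 
    by (simp add: \<psi>_def[abs_def] \<Psi>_def[abs_def] \<Phi>_def scaleR_add_left[symmetric])
  obtain B where B: "\<And>x. \<bar>\<phi> x\<bar> \<le> B" "\<And>x. norm (\<Phi> x) \<le> B" using test_fun_C1_bounds[OF phi] unfolding \<Phi>_def by auto
  have B0: "0 \<le> B" using B(1) abs_ge_zero order_trans by blast
  have BB: "0 \<le> B * B" by simp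
  have \<psi>b: "\<bar>\<psi> x\<bar> \<le> 2 * (B * B)" for x 
    unfolding \<psi>_def abs_mult using mult_mono[OF B(1)[of x] B(1)[of x] B0 abs_ge_zero] BB by linarith
  have \<Psi>b: "norm (\<Psi> x) \<le> 2 * (B * B)" for x 
    unfolding \<Psi>_def using mult_mono[OF B(1)[of x] B(2)[of x] B0 norm_ge_zero] by (simp add: abs_mult)
  have \<Psi>s: "sq_int lebesgue \<Psi>"
    by (rule sq_int_bound[OF \<Phi>s C1gradD(6)[OF psiC], where C="2 * B"]) 
       (use B0 in \<open>auto simp: \<Psi>_def abs_mult intro!: mult_right_mono mult_left_mono B\<close>)
  \<comment> \<open>Contains neither \<open>e\<close> nor \<open>z\<close>; this uniformity is the
    point of the lemma. The three terms come from the gradient of the cutoff, the potential and the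
    multiplier.\<close>
  define C0 where "C0 = 2 * (nrm2 lebesgue \<Phi>)\<^sup>2 + (\<integral>x. \<bar>V x\<bar> * (\<phi> x)\<^sup>2 \<partial>lebesgue) + \<bar>\<mu>\<bar> * (nrm2 lebesgue \<phi>)\<^sup>2"
  have main: "sq_int lebesgue (\<lambda>x. (\<phi> x * z (U x)) *\<^sub>R g x) \<and> (nrm2 lebesgue (\<lambda>x. (\<phi> x * z (U x)) *\<^sub>R g x))\<^sup>2 \<le> 4 * C0"
    if e: "0 < e" and zm[measurable]: "z \<in> borel_measurable borel" and z: "\<And>s. 0 \<le> s \<Longrightarrow> \<bar>z s\<bar> * sqrt (s\<^sup>2 + e\<^sup>2) \<le> 1" for e z
  proof -
    define q where "q s = sqrt (s\<^sup>2 + e\<^sup>2)" for s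
    have q2: "(q s)\<^sup>2 = s\<^sup>2 + e\<^sup>2" for s by (simp add: q_def)
    have qs: "\<bar>s\<bar> < q s" "0 < q s" for s
    proof -
      show "\<bar>s\<bar> < q s" unfolding q_def by (rule real_less_rsqrt) (use e in simp)
      then show "0 < q s" by linarith
    qed
    have qp: "0 < q s + s" for s using qs(1)[of s] by linarith
    have qe: "e \<le> q s" for s unfolding q_def by (rule real_le_rsqrt) simp
    define F where "F s = 1 / (q s + s)" for s
    define f where "f s = - F s / q s" for s
    have Fpos: "0 < F s" for s using qp by (simp add: F_def)
    have qD: "(q has_real_derivative s / q s) (at s)" for s
    proof -
      have P: "0 < s\<^sup>2 + e\<^sup>2" using e by (simp add: add_nonneg_pos)
      have D: "((\<lambda>s. s\<^sup>2 + e\<^sup>2) has_real_derivative 2 * s) (at s)" by (auto intro!: derivative_eq_intros)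
      show ?thesis 
        unfolding q_def[abs_def] by (rule DERIV_cong[OF DERIV_chain2[OF DERIV_real_sqrt[OF P] D]]) (simp add: field_simps)
    qed
    have FD: "(F has_real_derivative f s) (at s)" for s
    proof -
      have D: "(F has_real_derivative (0 * (q s + s) - 1 * (s / q s + 1)) / ((q s + s) * (q s + s))) (at s)"
        unfolding F_def[abs_def]
        by (rule DERIV_divide[OF DERIV_const DERIV_add[OF qD DERIV_ident]]) (use qp[of s] in simp)
      have "(0 * (q s + s) - 1 * (s / q s + 1)) / ((q s + s) * (q s + s)) = - ((s / q s + 1) / (q s + s)\<^sup>2)"
        unfolding power2_eq_square minus_divide_left by (rule arg_cong2[where f="(/)"]) simp_all
      from D[unfolded this] have "(F has_real_derivative - ((s / q s + 1) / (q s + s)\<^sup>2)) (at s)" .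
      moreover have "s / q s + 1 = (q s + s) / q s" using qs(2)[of s] by (simp add: field_simps)
      then have "- ((s / q s + 1) / (q s + s)\<^sup>2) = f s"
        using qp[of s] by (simp add: f_def F_def power2_eq_square)
      ultimately show ?thesis by simp
    qed
    have qc: "continuous_on UNIV q" unfolding q_def[abs_def] by (intro continuous_intros)
    have Fc: "continuous_on UNIV F" unfolding F_def[abs_def] using qp by (intro continuous_intros qc) (auto simp: less_imp_neq[symmetric])
    have fc: "continuous_on UNIV f" unfolding f_def[abs_def] using qs(2) by (intro continuous_intros qc Fc) (auto simp: less_imp_neq[symmetric])
    have [measurable]: "F \<in> borel_measurable borel" "f \<in> borel_measurable borel" using Fc fc by (simp_all add: borel_measurable_continuous_onI)
    \<comment> \<open>For negative \<open>s\<close> the denominator q + s may be small;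
      rationalizing to F = (q - s)/e^2 bounds the slope for both signs.\<close>
    have fb: "\<bar>f s\<bar> \<le> 2 / e\<^sup>2" for s
    proof -
      have "(q s - s) * (q s + s) = e\<^sup>2" using q2[of s] by (simp add: power2_eq_square algebra_simps)
      then have "F s = (q s - s) / e\<^sup>2" using qp[of s] e by (simp add: F_def field_simps)
      also have "\<dots> \<le> 2 * q s / e\<^sup>2" using qs(1)[of s] by (intro divide_right_mono) auto
      finally have "F s / q s \<le> 2 / e\<^sup>2" using qs(2)[of s] by (simp add: field_simps)
      then show ?thesis using Fpos[of s] qs(2)[of s] by (simp add: f_def)
    qed
    \<comment> \<open>The chain rule requires a function vanishing at 0. The constant F(0) is
      subtracted here and restored as a multiple of the cutoff \<psi>.\<close>
    have FDc: "((\<lambda>s. F s - F 0) has_real_derivative f s) (at s)" for s using DERIV_diff[OF FD DERIV_const] by simp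
    note ch = weak_chain_rule[OF wg H1_sq_int[OF UH] FDc fc fb diff_self]
    note pr = weak_product_rule[OF ch(1,2) psiC \<psi>b \<Psi>b]
    note lc = has_weak_grad_lincomb[OF pr(1) C1grad_has_weak_grad[OF psiC test_fun_sq_int[OF psi] \<Psi>s] pr(2) test_fun_sq_int[OF psi], of 1 "F 0"]
    define v where "v x = \<psi> x * F (U x)" for x
    define G where "G x = (\<psi> x * f (U x)) *\<^sub>R g x + F (U x) *\<^sub>R \<Psi> x" for x
    have "(\<lambda>x. 1 * (\<psi> x * (F (U x) - F 0)) + F 0 * \<psi> x) = v" by (auto simp: v_def fun_eq_iff algebra_simps)
    moreover have "(\<lambda>x. 1 *\<^sub>R (\<psi> x *\<^sub>R f (U x) *\<^sub>R g x + (F (U x) - F 0) *\<^sub>R \<Psi> x) + F 0 *\<^sub>R \<Psi> x) = G"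
      by (auto simp: G_def fun_eq_iff algebra_simps)
    ultimately have vG: "has_weak_grad v G" using lc by simp
    have "sq_int lebesgue (\<lambda>x. \<psi> x * (F (U x) - F 0) + F 0 * \<psi> x)" by (intro sq_int_add pr(2) sq_int_cmult test_fun_sq_int psi)
    moreover have "(\<lambda>x. \<psi> x * (F (U x) - F 0) + F 0 * \<psi> x) = v" by (auto simp: v_def fun_eq_iff algebra_simps)
    ultimately have vs: "sq_int lebesgue v" by simp
    have vH: "v \<in> H1" by (rule H1I[OF vs vG])
    have Gs: "sq_int lebesgue G" by (rule has_weak_gradD[OF vG])
    have UF: "0 \<le> U x * F (U x)" "U x * F (U x) \<le> 1" for x
      using pos[of x] Fpos[of "U x"] qp[of "U x"] qs(2)[of "U x"] by (auto simp: F_def)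
    have FQ: "F (U x) \<le> 1 / q (U x)" "1 / (2 * q (U x)) \<le> F (U x)" for x
      using pos[of x] qs[of "U x"] qp[of "U x"] unfolding F_def by (auto intro!: divide_left_mono mult_pos_pos)
    have psi0: "0 \<le> \<psi> x" for x by (simp add: \<psi>_def)
    have gv: "(\<integral>x. g x \<bullet> weak_grad v x \<partial>lebesgue) = (\<integral>x. g x \<bullet> G x \<partial>lebesgue)"
    proof (rule integral_cong_AE)
      show "AE x in lebesgue. g x \<bullet> weak_grad v x = g x \<bullet> G x" using weak_grad_AE[OF vG] by eventually_elim simp
    qed (use weak_grad_sq_int[OF vH] Gs in \<open>auto simp: sq_int_def\<close>)
    have E: "(\<integral>x. g x \<bullet> G x \<partial>lebesgue) = \<mu> * (\<integral>x. U x * v x \<partial>lebesgue) - (\<integral>x. V x * U x * v x \<partial>lebesgue) + (\<integral>x. \<bar>U x\<bar> powr (p - 2) * U x * v x \<partial>lebesgue)"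
      using eq[OF vH] gv unfolding dE_def g_def by simp
    have b1: "- (\<mu> * (\<integral>x. U x * v x \<partial>lebesgue)) \<le> \<bar>\<mu>\<bar> * (nrm2 lebesgue \<phi>)\<^sup>2"
    proof -
      have "\<bar>\<integral>x. U x * v x \<partial>lebesgue\<bar> \<le> (\<integral>x. (norm (\<phi> x))\<^sup>2 \<partial>lebesgue)"
      proof -
        have "\<bar>\<integral>x. U x * v x \<partial>lebesgue\<bar> \<le> (\<integral>x. \<bar>U x * v x\<bar> \<partial>lebesgue)"
          using integral_norm_bound[of lebesgue "\<lambda>x. U x * v x"] by simp
        also have "\<dots> \<le> (\<integral>x. (norm (\<phi> x))\<^sup>2 \<partial>lebesgue)"
        proof (rule integral_mono)
          show "\<bar>U x * v x\<bar> \<le> (norm (\<phi> x))\<^sup>2" for x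
            using mult_left_mono[OF UF(2)[of x] psi0[of x]] UF(1)[of x] psi0[of x]
            by (simp add: v_def \<psi>_def power2_eq_square abs_mult mult_ac pos abs_of_nonneg[OF pos] abs_of_pos[OF Fpos])
        qed (use sq_int_mult[OF H1_sq_int[OF UH] vs] sq_int_integrable[OF phis] in auto)
        finally show ?thesis .
      qed
      then have "\<bar>\<mu>\<bar> * \<bar>\<integral>x. U x * v x \<partial>lebesgue\<bar> \<le> \<bar>\<mu>\<bar> * (nrm2 lebesgue \<phi>)\<^sup>2" unfolding nrm2_power2 by (intro mult_left_mono) auto
      then show ?thesis using abs_ge_minus_self[of "\<mu> * (\<integral>x. U x * v x \<partial>lebesgue)"] by (simp add: abs_mult)
    qed
    have b2: "(\<integral>x. V x * U x * v x \<partial>lebesgue) \<le> (\<integral>x. \<bar>V x\<bar> * (\<phi> x)\<^sup>2 \<partial>lebesgue)"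
    proof (rule integral_mono)
      fix x
      have "V x * U x * v x = V x * (\<psi> x * (U x * F (U x)))" by (simp add: v_def mult_ac)
      also have "\<dots> \<le> \<bar>V x\<bar> * (\<psi> x * 1)"
        using UF[of x] psi0[of x] by (intro mult_mono mult_left_mono) auto
      finally show "V x * U x * v x \<le> \<bar>V x\<bar> * (\<phi> x)\<^sup>2" by (simp add: \<psi>_def power2_eq_square)
    qed (use compact_pot_bilinear(1)[OF Vpot UH vH] compact_potD(2)[OF Vpot phiH] in auto)
    \<comment> \<open>The critical term has the favourable sign, so no integrability beyond that of
      H1 functions is needed for it.\<close>
    have b3: "0 \<le> (\<integral>x. \<bar>U x\<bar> powr (p - 2) * U x * v x \<partial>lebesgue)"
      by (intro Bochner_Integration.integral_nonneg) (auto simp: v_def intro!: mult_nonneg_nonneg pos psi0 less_imp_le[OF Fpos])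
    \<comment> \<open>The derivative of \<open>F\<close> contributes -X^2 F1/Q to g . G; half of
      this term absorbs the mixed term by Young's inequality, the other half dominates the weighted
      gradient.\<close>
    have point: "(norm ((\<phi> x * z (U x)) *\<^sub>R g x))\<^sup>2 \<le> 4 * (2 * (norm (\<Phi> x))\<^sup>2 - g x \<bullet> G x)" for x
    proof -
      define Q where "Q = q (U x)"
      define X where "X = \<bar>\<phi> x\<bar> * norm (g x)"
      define F1 where "F1 = F (U x)"
      have Q: "0 < Q" "0 < F1" "F1 \<le> 1 / Q" "1 / (2 * Q) \<le> F1" using qs(2) Fpos FQ[of x] by (auto simp: Q_def F1_def)
      have zX: "\<bar>z (U x)\<bar> \<le> 1 / Q" using z[OF pos[of x]] Q(1) by (simp add: Q_def q_def field_simps)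
      have "(norm ((\<phi> x * z (U x)) *\<^sub>R g x))\<^sup>2 = X\<^sup>2 * \<bar>z (U x)\<bar>\<^sup>2" by (simp add: X_def abs_mult power_mult_distrib mult_ac)
      also have "\<dots> \<le> X\<^sup>2 * (1 / Q)\<^sup>2" using zX by (intro mult_left_mono power_mono) auto
      also have "\<dots> = 2 * (X\<^sup>2 * ((1 / (2 * Q)) * (1 / Q)))" by (simp add: power2_eq_square)
      also have "\<dots> \<le> 2 * (X\<^sup>2 * (F1 * (1 / Q)))" using Q by (intro mult_left_mono mult_right_mono) auto
      finally have 1: "(norm ((\<phi> x * z (U x)) *\<^sub>R g x))\<^sup>2 \<le> 2 * (X\<^sup>2 * (F1 / Q))" by simp
      have gG: "g x \<bullet> G x = - (X\<^sup>2 * (F1 / Q)) + 2 * F1 * \<phi> x * (g x \<bullet> \<Phi> x)"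
      proof -
        have X2: "X\<^sup>2 = (\<phi> x * \<phi> x) * (g x \<bullet> g x)"
          unfolding X_def power_mult_distrib power2_norm_eq_inner by (simp add: power2_eq_square)
        have "g x \<bullet> G x = (\<psi> x * f (U x)) * (g x \<bullet> g x) + F1 * (2 * \<phi> x * (g x \<bullet> \<Phi> x))"
          by (simp add: G_def \<Psi>_def F1_def inner_diff_right inner_add_right algebra_simps)
        then show ?thesis unfolding X2 by (simp add: \<psi>_def f_def Q_def F1_def)
      qed
      have "2 * F1 * \<phi> x * (g x \<bullet> \<Phi> x) \<le> 2 * (F1 * X) * norm (\<Phi> x)"
      proof -
        have "\<phi> x * (g x \<bullet> \<Phi> x) \<le> \<bar>\<phi> x\<bar> * (norm (g x) * norm (\<Phi> x))"
          using Cauchy_Schwarz_ineq2[of "g x" "\<Phi> x"] abs_ge_self[of "\<phi> x * (g x \<bullet> \<Phi> x)"] mult_left_mono[of "\<bar>g x \<bullet> \<Phi> x\<bar>" "norm (g x) * norm (\<Phi> x)" "\<bar>\<phi> x\<bar>"]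
          by (simp add: abs_mult)
        from mult_left_mono[OF this, of "2 * F1"] show ?thesis using Q by (simp add: X_def mult_ac)
      qed
      also have "\<dots> \<le> (F1 * X)\<^sup>2 / 2 + 2 * (norm (\<Phi> x))\<^sup>2"
        using zero_le_power2[of "F1 * X - 2 * norm (\<Phi> x)"] by (simp add: power2_diff)
      also have "(F1 * X)\<^sup>2 \<le> X\<^sup>2 * (F1 / Q)"
      proof -
        have "F1 * F1 \<le> F1 * (1 / Q)" using Q by (intro mult_left_mono) auto
        from mult_left_mono[OF this, of "X\<^sup>2"] show ?thesis by (simp add: power2_eq_square mult_ac)
      qed
      finally have "2 * F1 * \<phi> x * (g x \<bullet> \<Phi> x) \<le> (X\<^sup>2 * (F1 / Q)) / 2 + 2 * (norm (\<Phi> x))\<^sup>2" by simp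
      moreover have "a \<le> 2 * T \<Longrightarrow> A \<le> T / 2 + 2 * b \<Longrightarrow> a \<le> 4 * (2 * b - (- T + A))" for a b T A :: real
        by simp
      ultimately show ?thesis using 1 unfolding gG by blast
    qed
    have zs: "sq_int lebesgue (\<lambda>x. (\<phi> x * z (U x)) *\<^sub>R g x)"
    proof (rule sq_int_mult_bounded[OF gs, where B="B * (1 / e)"])
      fix x
      have "\<bar>z (U x)\<bar> * e \<le> \<bar>z (U x)\<bar> * q (U x)" by (intro mult_left_mono qe) auto
      then have "\<bar>z (U x)\<bar> \<le> 1 / e" using z[OF pos[of x]] e by (simp add: q_def field_simps)
      then show "\<bar>\<phi> x * z (U x)\<bar> \<le> B * (1 / e)" unfolding abs_mult using B(1)[of x] B0 by (intro mult_mono) auto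
    qed measurable
    have "(nrm2 lebesgue (\<lambda>x. (\<phi> x * z (U x)) *\<^sub>R g x))\<^sup>2 \<le> (\<integral>x. 4 * (2 * (norm (\<Phi> x))\<^sup>2 - g x \<bullet> G x) \<partial>lebesgue)"
      unfolding nrm2_power2 using sq_int_integrable[OF \<Phi>s] sq_int_inner[OF gs Gs] 
      by (intro integral_mono sq_int_integrable[OF zs] point) auto
    also have "\<dots> = 4 * (2 * (nrm2 lebesgue \<Phi>)\<^sup>2 - (\<integral>x. g x \<bullet> G x \<partial>lebesgue))"
      unfolding nrm2_power2 using sq_int_integrable[OF \<Phi>s] sq_int_inner[OF gs Gs] by simp
    also have "\<dots> \<le> 4 * C0" 
      by (rule mult_left_mono) (use E b1 b2 b3 in \<open>unfold C0_def, linarith\<close>, simp)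
    finally show ?thesis using zs by simp
  qed
  have "0 \<le> C0" unfolding C0_def by (intro add_nonneg_nonneg mult_nonneg_nonneg Bochner_Integration.integral_nonneg) auto
  then show ?thesis using main unfolding g_def by (intro exI[of _ "4 * C0"]) auto
qed

text \<open>\<open>\<zeta>(s) = 1 - (1 + s\<^sup>2 / e\<^sup>2)\<^sup>-\<^sup>1\<^sup>/\<^sup>K\<close> tends to the indicator of \<open>s \<noteq> 0\<close> as \<open>e \<rightarrow> 0\<close> while its logarithmic
  derivative is \<open>O(1/K)\<close>; hence the indicator of \<open>U > 0\<close> has zero weak gradient.\<close>

lemma positivity_set_zero_grad:
  assumes U: "weak_eq U \<mu>" and pos: "\<And>x. 0 \<le> U x" and phi: "\<phi> \<in> test_fun"
  shows "(\<integral>x. (if 0 < U x then 1 else 0) * partial i \<phi> x \<partial>lebesgue) = 0"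
proof -
  have UH: "U \<in> H1" using U by (auto simp: weak_eq_def)
  have Um[measurable]: "U \<in> borel_measurable lebesgue" using UH by (simp add: H1_iff sq_int_def)
  note wg = has_weak_grad_weak_grad[OF UH]
  obtain C where C: "C \<ge> 0" "\<And>e z. 0 < e \<Longrightarrow> z \<in> borel_measurable borel \<Longrightarrow> (\<forall>s\<ge>0. \<bar>z s\<bar> * sqrt (s\<^sup>2 + e\<^sup>2) \<le> 1) \<Longrightarrow>
     sq_int lebesgue (\<lambda>x. (\<phi> x * z (U x)) *\<^sub>R weak_grad U x) \<and> (nrm2 lebesgue (\<lambda>x. (\<phi> x * z (U x)) *\<^sub>R weak_grad U x))\<^sup>2 \<le> C"
    using log_gradient_bound[OF U pos phi] by blast
  obtain B R where BR: "\<And>x. \<bar>\<phi> x\<bar> \<le> B * indicator (cball 0 R) x" using test_fun_bound[OF phi] by blast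
  define I where "I = nrm2 lebesgue (\<lambda>x::real^'n. indicat_real (cball 0 R) x)"
  have I: "sq_int lebesgue (\<lambda>x::real^'n. indicat_real (cball 0 R) x)"
    by (rule sq_int_bounded_support[where B=1 and R=R]) auto
  have pi: "integrable lebesgue (partial i \<phi>)" by (intro test_fun_integrable test_fun_partial phi)
  \<comment> \<open>Two limits in order: \<open>e\<close> to 0 with \<open>K\<close> fixed, then
    \<open>K\<close> to infinity. The logarithmic gradient bound does not depend on either, so the
    factor 2/K wins.\<close>
  have bound: "\<bar>\<integral>x. (if 0 < U x then 1 else 0) * partial i \<phi> x \<partial>lebesgue\<bar> \<le> (2 / K) * (sqrt C * I)" if K: "0 < K" for K
  proof -
    have step: "\<bar>\<integral>x. (1 - (1 + (U x)\<^sup>2 / e\<^sup>2) powr (- 1 / K)) * partial i \<phi> x \<partial>lebesgue\<bar> \<le> (2 / K) * (sqrt C * I)" if e: "0 < e" for e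
    proof -
      define Z where "Z s = 1 - (1 + s\<^sup>2 / e\<^sup>2) powr (- 1 / K)" for s
      define w where "w s = 1 + s\<^sup>2 / e\<^sup>2" for s
      have w: "1 \<le> w s" for s by (simp add: w_def)
      have we: "w s * e\<^sup>2 = s\<^sup>2 + e\<^sup>2" for s using e by (simp add: w_def field_simps)
      define z where "z s = (s / e\<^sup>2) * w s powr (- 1 / K - 1)" for s
      have ZD: "(Z has_real_derivative (2 / K) * z s) (at s)" for s
      proof -
        have wD: "(w has_real_derivative 2 * s / e\<^sup>2) (at s)" 
          unfolding w_def[abs_def] by (rule DERIV_cong[OF DERIV_add[OF DERIV_const DERIV_cdivide[OF DERIV_pow]]]) simp
        have "((\<lambda>s. 1 - w s powr (- 1 / K)) has_real_derivative (2 / K) * z s) (at s)"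
          using w[of s] K by (auto intro!: derivative_eq_intros wD simp: z_def field_simps)
        then show ?thesis by (simp add: Z_def[abs_def] w_def)
      qed
      have zc: "continuous_on UNIV z"
        unfolding z_def[abs_def] using w e by (intro continuous_intros) (auto simp: w_def[abs_def] add_nonneg_eq_0_iff intro!: continuous_intros)
      have zb: "\<bar>z s\<bar> * sqrt (s\<^sup>2 + e\<^sup>2) \<le> 1" for s
      proof -
        have "w s powr (- 1 / K - 1) \<le> w s powr (- 1)" using w[of s] K by (intro powr_mono) auto
        also have "\<dots> = 1 / w s" using w[of s] by (simp add: powr_minus_divide)
        finally have "\<bar>z s\<bar> \<le> (\<bar>s\<bar> / e\<^sup>2) * (1 / w s)" unfolding z_def abs_mult by (intro mult_mono) (auto simp: abs_of_nonneg)
        also have "\<dots> = \<bar>s\<bar> / (s\<^sup>2 + e\<^sup>2)" by (simp add: we[symmetric] mult.commute)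
        finally have "\<bar>z s\<bar> * sqrt (s\<^sup>2 + e\<^sup>2) \<le> \<bar>s\<bar> / (s\<^sup>2 + e\<^sup>2) * sqrt (s\<^sup>2 + e\<^sup>2)" by (rule mult_right_mono) simp
        also have "\<dots> = \<bar>s\<bar> * (sqrt (s\<^sup>2 + e\<^sup>2) / (s\<^sup>2 + e\<^sup>2))" by simp
        also have "\<dots> = \<bar>s\<bar> / sqrt (s\<^sup>2 + e\<^sup>2)" by (subst sqrt_divide_self_eq) (auto simp: divide_inverse)
        also have "\<dots> \<le> 1" using real_le_rsqrt[of "\<bar>s\<bar>" "s\<^sup>2 + e\<^sup>2"] e by (simp add: add_nonneg_pos)
        finally show ?thesis .
      qed
      have zL: "\<bar>(2 / K) * z s\<bar> \<le> 2 / (K * e)" for s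
      proof -
        have "\<bar>z s\<bar> * e \<le> \<bar>z s\<bar> * sqrt (s\<^sup>2 + e\<^sup>2)" by (intro mult_left_mono real_le_rsqrt) auto
        then have "\<bar>z s\<bar> \<le> 1 / e" using zb[of s] e by (simp add: field_simps)
        then show ?thesis using K e by (simp add: abs_mult field_simps)
      qed
      have Z0: "Z 0 = 0" by (simp add: Z_def)
      have zc2: "continuous_on UNIV (\<lambda>s. (2 / K) * z s)" by (intro continuous_intros zc)
      note ch = weak_chain_rule[OF wg H1_sq_int[OF UH] ZD zc2 zL Z0]
      have zm: "z \<in> borel_measurable borel" using zc by (rule borel_measurable_continuous_onI)
      have "\<forall>s\<ge>0. \<bar>z s\<bar> * sqrt (s\<^sup>2 + e\<^sup>2) \<le> 1" using zb by simp
      note Cz = C(2)[OF e zm this]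
      have "(\<integral>x. Z (U x) * partial i \<phi> x \<partial>lebesgue) = - (\<integral>x. (((2 / K) * z (U x)) *\<^sub>R weak_grad U x) $ i * \<phi> x \<partial>lebesgue)"
        by (rule has_weak_gradD(2)[OF ch(1) phi])
      also have "\<dots> = - ((2 / K) * (\<integral>x. ((\<phi> x * z (U x)) *\<^sub>R weak_grad U x) $ i * indicat_real (cball 0 R) x \<partial>lebesgue))"
      proof -
        \<comment> \<open>Inserting the indicator of a ball containing the support of \<phi>
          provides a square integrable partner for Cauchy-Schwarz.\<close>
        have pw: "(((2 / K) * z (U x)) *\<^sub>R weak_grad U x) $ i * \<phi> x = (2 / K) * (((\<phi> x * z (U x)) *\<^sub>R weak_grad U x) $ i * indicat_real (cball 0 R) x)" for x
          using BR[of x] by (auto simp: indicator_def)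
        show ?thesis by (simp only: pw integral_mult_right_zero)
      qed
      finally have "\<bar>\<integral>x. Z (U x) * partial i \<phi> x \<partial>lebesgue\<bar> = (2 / K) * \<bar>\<integral>x. ((\<phi> x * z (U x)) *\<^sub>R weak_grad U x) $ i * indicat_real (cball 0 R) x \<partial>lebesgue\<bar>"
        using K by (simp add: abs_mult)
      also have "\<dots> \<le> (2 / K) * (sqrt C * I)"
      proof (intro mult_left_mono)
        have "\<bar>\<integral>x. ((\<phi> x * z (U x)) *\<^sub>R weak_grad U x) $ i * indicat_real (cball 0 R) x \<partial>lebesgue\<bar> 
           \<le> nrm2 lebesgue (\<lambda>x. ((\<phi> x * z (U x)) *\<^sub>R weak_grad U x) $ i) * I"
          unfolding I_def by (intro integral_mult_le sq_int_component I conjunct1[OF Cz])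
        also have "\<dots> \<le> nrm2 lebesgue (\<lambda>x. (\<phi> x * z (U x)) *\<^sub>R weak_grad U x) * I"
          by (intro mult_right_mono nrm2_component_le conjunct1[OF Cz]) (simp add: I_def)
        also have "\<dots> \<le> sqrt C * I" by (intro mult_right_mono real_le_rsqrt conjunct2[OF Cz]) (simp add: I_def)
        finally show "\<bar>\<integral>x. ((\<phi> x * z (U x)) *\<^sub>R weak_grad U x) $ i * indicat_real (cball 0 R) x \<partial>lebesgue\<bar> \<le> sqrt C * I" .
      qed (use K in simp)
      finally show ?thesis by (simp add: Z_def)
    qed
    define e where "e k = inverse (real (Suc k))" for k
    have e: "0 < e k" for k by (simp add: e_def)
    have "(\<lambda>k. \<integral>x. (1 - (1 + (U x)\<^sup>2 / (e k)\<^sup>2) powr (- 1 / K)) * partial i \<phi> x \<partial>lebesgue) \<longlonglongrightarrow> (\<integral>x. (if 0 < U x then 1 else 0) * partial i \<phi> x \<partial>lebesgue)"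
    proof (rule integral_dominated_convergence[where w="\<lambda>x. \<bar>partial i \<phi> x\<bar>"])
      have [measurable]: "partial i \<phi> \<in> borel_measurable lebesgue" using pi by auto
      show "(\<lambda>x. (if 0 < U x then 1 else 0) * partial i \<phi> x) \<in> borel_measurable lebesgue" by measurable
      show "(\<lambda>x. (1 - (1 + (U x)\<^sup>2 / (e k)\<^sup>2) powr (- 1 / K)) * partial i \<phi> x) \<in> borel_measurable lebesgue" for k by measurable
      show "integrable lebesgue (\<lambda>x. \<bar>partial i \<phi> x\<bar>)" using pi by simp
      show "AE x in lebesgue. norm ((1 - (1 + (U x)\<^sup>2 / (e k)\<^sup>2) powr (- 1 / K)) * partial i \<phi> x) \<le> \<bar>partial i \<phi> x\<bar>" for k
      proof (rule AE_I2)
        fix x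
        have "(1 + (U x)\<^sup>2 / (e k)\<^sup>2) powr (- 1 / K) \<le> (1 + (U x)\<^sup>2 / (e k)\<^sup>2) powr 0" using K by (intro powr_mono) auto
        then have "\<bar>1 - (1 + (U x)\<^sup>2 / (e k)\<^sup>2) powr (- 1 / K)\<bar> \<le> 1" 
          using powr_ge_zero[of "1 + (U x)\<^sup>2 / (e k)\<^sup>2" "- 1 / K"] by (auto simp: abs_le_iff add_nonneg_eq_0_iff split: if_splits)
        then show "norm ((1 - (1 + (U x)\<^sup>2 / (e k)\<^sup>2) powr (- 1 / K)) * partial i \<phi> x) \<le> \<bar>partial i \<phi> x\<bar>"
          by (simp add: abs_mult mult_left_le_one_le)
      qed
      show "AE x in lebesgue. (\<lambda>k. (1 - (1 + (U x)\<^sup>2 / (e k)\<^sup>2) powr (- 1 / K)) * partial i \<phi> x) \<longlonglongrightarrow> (if 0 < U x then 1 else 0) * partial i \<phi> x"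
      proof (rule AE_I2)
        fix x
        have "(\<lambda>k. (1 + (U x)\<^sup>2 / (e k)\<^sup>2) powr (- 1 / K)) \<longlonglongrightarrow> (if 0 < U x then 0 else 1)"
        proof (cases "0 < U x")
          case True
          have "filterlim (\<lambda>k. 1 + (U x)\<^sup>2 / (e k)\<^sup>2) at_top sequentially"
          proof (rule filterlim_at_top_mono)
            show "filterlim (\<lambda>k. (U x)\<^sup>2 * real (Suc k)) at_top sequentially"
              using True by (intro filterlim_tendsto_pos_mult_at_top[OF tendsto_const] filterlim_compose[OF filterlim_real_sequentially filterlim_Suc]) simp
            have "(U x)\<^sup>2 * real (Suc k) \<le> 1 + (U x)\<^sup>2 / (e k)\<^sup>2" for k
            proof -
              have "(U x)\<^sup>2 * real (Suc k) \<le> (U x)\<^sup>2 * (real (Suc k))\<^sup>2" by (intro mult_left_mono) (auto simp: power2_eq_square)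
              then show ?thesis by (simp add: e_def divide_inverse power_inverse[symmetric])
            qed
            then show "\<forall>\<^sub>F k in sequentially. (U x)\<^sup>2 * real (Suc k) \<le> 1 + (U x)\<^sup>2 / (e k)\<^sup>2" by simp
          qed
          then have "(\<lambda>k. (1 + (U x)\<^sup>2 / (e k)\<^sup>2) powr (- 1 / K)) \<longlonglongrightarrow> 0"
            using K by (intro tendsto_neg_powr) auto
          then show ?thesis using True by simp
        next
          case False
          then have "U x = 0" using pos[of x] by simp
          then show ?thesis by simp
        qed
        then have "(\<lambda>k. (1 - (1 + (U x)\<^sup>2 / (e k)\<^sup>2) powr (- 1 / K)) * partial i \<phi> x) \<longlonglongrightarrow> (1 - (if 0 < U x then 0 else 1)) * partial i \<phi> x"
          by (intro tendsto_intros)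
        then show "(\<lambda>k. (1 - (1 + (U x)\<^sup>2 / (e k)\<^sup>2) powr (- 1 / K)) * partial i \<phi> x) \<longlonglongrightarrow> (if 0 < U x then 1 else 0) * partial i \<phi> x"
          by (simp split: if_splits)
      qed
    qed
    from LIMSEQ_le_const2[OF tendsto_rabs[OF this]] step[OF e] show ?thesis by blast
  qed
  have "\<bar>\<integral>x. (if 0 < U x then 1 else 0) * partial i \<phi> x \<partial>lebesgue\<bar> \<le> 0"
  proof (rule field_le_epsilon)
    fix d :: real assume d: "0 < d"
    define K where "K = 2 * (sqrt C * I + 1) / d"
    have SI: "0 \<le> sqrt C * I" using C(1) by (simp add: I_def)
    have K: "0 < K" using SI d by (simp add: K_def)
    have "(2 / K) * (sqrt C * I) \<le> d" using SI d by (simp add: K_def field_simps)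
    then show "\<bar>\<integral>x. (if 0 < U x then 1 else 0) * partial i \<phi> x \<partial>lebesgue\<bar> \<le> 0 + d" using bound[OF K] by linarith
  qed
  then show ?thesis by simp
qed

text \<open>The indicator of {U > 0} is almost everywhere constant on every ball around 0, so on
  each ball U is either positive or zero almost everywhere. The balls are nested, hence one on which
  U is not zero decides for all of them.\<close>

theorem strong_maximum_principle:
  assumes U: "weak_eq U \<mu>" and pos: "\<And>x. 0 \<le> U x" and nz: "\<not> (AE x in lebesgue. U x = 0)"
  shows "AE x in lebesgue. 0 < U x"
proof -
  have Um[measurable]: "U \<in> borel_measurable lebesgue" using U by (simp add: weak_eq_def H1_iff sq_int_def)
  have dich: "(AE x in lebesgue. norm x < R \<longrightarrow> 0 < U x) \<or> (AE x in lebesgue. norm x < R \<longrightarrow> U x = 0)" for R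
  proof -
    have "\<exists>l::real. AE x in lebesgue. norm x < R \<longrightarrow> (if 0 < U x then 1 else 0) = l"
      by (rule zero_weak_grad_constant[of "\<lambda>x. if 0 < U x then 1 else 0", OF _ _ positivity_set_zero_grad[OF U pos]]) auto
    then obtain l where l: "AE x in lebesgue. norm x < R \<longrightarrow> (if 0 < U x then 1 else 0) = (l::real)" by blast
    show ?thesis
    proof (cases "l = 1")
      case True
      have "AE x in lebesgue. norm x < R \<longrightarrow> 0 < U x" using l by eventually_elim (use True in \<open>auto split: if_splits\<close>)
      then show ?thesis ..
    next
      case False
      have "AE x in lebesgue. norm x < R \<longrightarrow> U x = 0" using l by eventually_elim (use False pos in \<open>auto split: if_splits simp: less_le\<close>)
      then show ?thesis ..
    qed
  qed
  have cover: "(AE x in lebesgue. P x) \<longleftrightarrow> (\<forall>n::nat. AE x in lebesgue. norm x < real n \<longrightarrow> P x)" for P :: "real^'n \<Rightarrow> bool"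
    unfolding AE_all_countable[symmetric] by (rule arg_cong[where f="\<lambda>P. AE x in lebesgue. P x"]) (auto intro: reals_Archimedean2)
  obtain n0 where n0: "\<not> (AE x in lebesgue. norm x < real n0 \<longrightarrow> U x = 0)" using nz unfolding cover[of "\<lambda>x. U x = 0"] by blast
  \<comment> \<open>A ball containing both radii cannot carry the alternative U = 0, so it carries
    positivity and passes it to the smaller ball.\<close>
  have "AE x in lebesgue. norm x < real n \<longrightarrow> 0 < U x" for n
  proof -
    have "\<not> (AE x in lebesgue. norm x < real (max n n0) \<longrightarrow> U x = 0)"
      using n0 by (rule contrapos_nn) (auto elim!: eventually_mono)
    then have "AE x in lebesgue. norm x < real (max n n0) \<longrightarrow> 0 < U x" using dich by blast
    then show ?thesis by eventually_elim auto
  qed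
  then show ?thesis unfolding cover[of "\<lambda>x. 0 < U x"] by blast
qed

end

section \<open>Dilations and half of the Pohozaev identity\<close>

lemma partial_scaleR:
  assumes "\<phi> \<in> test_fun"
  shows "partial i (\<lambda>y. \<phi> (c *\<^sub>R y)) y = c * partial i \<phi> (c *\<^sub>R y)"
proof -
  have D: "((\<lambda>y. \<phi> (c *\<^sub>R y)) has_derivative (\<lambda>h. frechet_derivative \<phi> (at (c *\<^sub>R y)) (c *\<^sub>R h))) (at y)"
    by (rule has_derivative_compose[of "\<lambda>y. c *\<^sub>R y" "\<lambda>h. c *\<^sub>R h" y UNIV \<phi>, OF _ has_derivative_frechet[OF test_funD(2)[OF assms]]])
       (auto intro!: derivative_eq_intros)
  moreover have "bounded_linear (frechet_derivative \<phi> (at (c *\<^sub>R y)))"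
    by (intro has_derivative_bounded_linear[OF has_derivative_frechet] test_funD assms)
  ultimately show ?thesis
    unfolding partial_eq[OF D] by (simp add: linear_cmul bounded_linear.linear partial_def)
qed

lemma has_weak_grad_dilate:
  fixes u :: "real^'n::finite \<Rightarrow> real"
  assumes g: "has_weak_grad u g" and u: "sq_int lebesgue u" and c: "0 < c"
  shows "has_weak_grad (\<lambda>x. u (c *\<^sub>R x)) (\<lambda>x. c *\<^sub>R g (c *\<^sub>R x))"
proof (rule has_weak_gradI)
  have c0: "c \<noteq> 0" "1 / c \<noteq> 0" using c by auto
  show "sq_int lebesgue (\<lambda>x. c *\<^sub>R g (c *\<^sub>R x))"
    using sq_int_affine(1)[OF c0(1) has_weak_gradD(1)[OF g], of 0] by (intro sq_int_scaleR) simp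
  fix \<phi> :: "real^'n \<Rightarrow> real" and i assume phi: "\<phi> \<in> test_fun"
  define \<psi> where "\<psi> y = \<phi> ((1 / c) *\<^sub>R y)" for y
  have psi: "\<psi> \<in> test_fun" using test_fun_affine[OF phi c0(2), of 0] by (simp add: \<psi>_def[abs_def])
  have pd: "partial i \<phi> x = c * partial i \<psi> (c *\<^sub>R x)" for x
    using partial_scaleR[OF phi, of i "1 / c" "c *\<^sub>R x"] c by (simp add: \<psi>_def[abs_def])
  have "sq_int lebesgue (partial i \<psi>)" by (intro test_fun_sq_int test_fun_partial psi)
  note I1 = integrable_lebesgue_affine(2)[OF c0(1) sq_int_mult[OF u this], of 0]
  note I2 = integrable_lebesgue_affine(2)[OF c0(1) sq_int_mult[OF sq_int_component[OF has_weak_gradD(1)[OF g], of i] test_fun_sq_int[OF psi]], of 0]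
  have "(\<integral>x. u (c *\<^sub>R x) * partial i \<phi> x \<partial>lebesgue) = c * (\<integral>x. u (c *\<^sub>R x) * partial i \<psi> (c *\<^sub>R x) \<partial>lebesgue)"
    unfolding pd by (subst integral_mult_right_zero[symmetric]) (simp add: mult_ac)
  also have "\<dots> = - (c * (\<integral>x. g (c *\<^sub>R x) $ i * \<psi> (c *\<^sub>R x) \<partial>lebesgue))"
    using I1 I2 has_weak_gradD(2)[OF g psi, of i] by simp
  also have "c * (\<integral>x. g (c *\<^sub>R x) $ i * \<psi> (c *\<^sub>R x) \<partial>lebesgue) = (\<integral>x. (c *\<^sub>R g (c *\<^sub>R x)) $ i * \<phi> x \<partial>lebesgue)"
    using c by (subst integral_mult_right_zero[symmetric]) (simp add: \<psi>_def mult_ac)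
  finally show "(\<integral>x. u (c *\<^sub>R x) * partial i \<phi> x \<partial>lebesgue) = - (\<integral>x. (c *\<^sub>R g (c *\<^sub>R x)) $ i * \<phi> x \<partial>lebesgue)" .
qed

lemma H1_dilate:
  fixes u :: "real^'n::finite \<Rightarrow> real"
  assumes u: "u \<in> H1" and c: "0 < c"
  shows "(\<lambda>x. u (c *\<^sub>R x)) \<in> H1" 
    "(gnrm (\<lambda>x. u (c *\<^sub>R x)))\<^sup>2 = c\<^sup>2 * (gnrm u)\<^sup>2 / c ^ CARD('n)"
    "(nrm2 lebesgue (\<lambda>x. u (c *\<^sub>R x)))\<^sup>2 = (nrm2 lebesgue u)\<^sup>2 / c ^ CARD('n)"
proof -
  note g = has_weak_grad_dilate[OF has_weak_grad_weak_grad[OF u] H1_sq_int[OF u] c]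
  have c0: "c \<noteq> 0" using c by simp
  note A = sq_int_affine[OF c0 H1_sq_int[OF u], of 0, simplified] 
  note B = sq_int_affine[OF c0 weak_grad_sq_int[OF u], of 0, simplified] 
  show "(\<lambda>x. u (c *\<^sub>R x)) \<in> H1" by (rule H1I[OF A(1) g])
  show "(nrm2 lebesgue (\<lambda>x. u (c *\<^sub>R x)))\<^sup>2 = (nrm2 lebesgue u)\<^sup>2 / c ^ CARD('n)"
    using c by (simp add: A(2) power_divide)
  show "(gnrm (\<lambda>x. u (c *\<^sub>R x)))\<^sup>2 = c\<^sup>2 * (gnrm u)\<^sup>2 / c ^ CARD('n)"
    unfolding gnrm_eq[OF g] nrm2_scaleR B(2) using c by (simp add: power_divide power_mult_distrib gnrm_def)
qed

text \<open>After substitution the ball is {|t y| <= R}, which is contained in the original ball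
  because t >= 1; only the Jacobian remains.\<close>

lemma lnrm_dilate:
  fixes u :: "real^'n::finite \<Rightarrow> real"
  assumes u: "sq_int lebesgue u" and t: "1 \<le> t"
  shows "(lnrm R (\<lambda>x. u ((1 / t) *\<^sub>R x)))\<^sup>2 \<le> t ^ CARD('n) * (lnrm R u)\<^sup>2"
proof -
  have t0: "1 / t \<noteq> 0" "t \<noteq> 0" using t by auto
  have i: "integrable lebesgue (\<lambda>x. (u x)\<^sup>2 * indicat_real (cball 0 R) x)"
    by (intro integrable_real_mult_indicator sq_int_real[OF u]) auto
  have "integrable lebesgue (\<lambda>y. (u y)\<^sup>2 * indicat_real (cball 0 R) (t *\<^sub>R y))"
  proof (rule Bochner_Integration.integrable_bound[OF sq_int_real[OF u]])
    have [measurable]: "(\<lambda>y::real^'n. t *\<^sub>R y) \<in> lebesgue \<rightarrow>\<^sub>M lebesgue" 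
      using measurable_lebesgue_affine[OF t0(2), of "0::real^'n"] by simp
    have [measurable]: "u \<in> borel_measurable lebesgue" using u by (simp add: sq_int_def)
    show "(\<lambda>y. (u y)\<^sup>2 * indicat_real (cball 0 R) (t *\<^sub>R y)) \<in> borel_measurable lebesgue" by measurable
  qed (auto simp: indicator_def)
  note * = integrable_lebesgue_affine(2)[OF t0(1) this, of 0] and ** = this
  have "(lnrm R (\<lambda>x. u ((1 / t) *\<^sub>R x)))\<^sup>2 = (\<integral>x. (u ((1 / t) *\<^sub>R x))\<^sup>2 * indicat_real (cball 0 R) (t *\<^sub>R (1 / t) *\<^sub>R x) \<partial>lebesgue)"
    unfolding lnrm_power2 using t by simp
  also have "\<dots> = t ^ CARD('n) * (\<integral>y. (u y)\<^sup>2 * indicat_real (cball 0 R) (t *\<^sub>R y) \<partial>lebesgue)"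
    using * t by (simp add: power_divide)
  also have "\<dots> \<le> t ^ CARD('n) * (lnrm R u)\<^sup>2"
    unfolding lnrm_power2
  proof (rule mult_left_mono, rule integral_mono[OF ** i])
    fix x :: "real^'n"
    have "norm x \<le> t * norm x" using t mult_right_mono[of 1 t "norm x"] by simp
    then show "(u x)\<^sup>2 * indicat_real (cball 0 R) (t *\<^sub>R x) \<le> (u x)\<^sup>2 * indicat_real (cball 0 R) x" 
      using t by (intro mult_left_mono) (auto simp: indicator_def)
  qed (use t in simp)
  finally show ?thesis .
qed

text \<open>Uniformity in \<open>t\<close> is the point: for the remainder along dilations the
  weight |W(t x)|^(p-2) appears for all \<open>t\<close>. Apply the bound for \<open>A\<close> to
  u(x/t) and change variables; for t between 1 and 2 this costs at most 2^N, and the ball does not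
  grow.\<close>

lemma compact_pot_dilate:
  fixes A :: "real^'n::finite \<Rightarrow> real"
  assumes A: "compact_pot A" and e: "0 < e"
  shows "\<exists>C\<ge>0. \<exists>R. \<forall>u\<in>H1. \<forall>t. 1 \<le> t \<longrightarrow> t \<le> 2 \<longrightarrow> integrable lebesgue (\<lambda>x. \<bar>A (t *\<^sub>R x)\<bar> * (u x)\<^sup>2) \<and>
    (\<integral>x. \<bar>A (t *\<^sub>R x)\<bar> * (u x)\<^sup>2 \<partial>lebesgue) \<le> e * ((gnrm u)\<^sup>2 + (nrm2 lebesgue u)\<^sup>2) + C * (lnrm R u)\<^sup>2"
proof -
  define N where "N = (2::real) ^ CARD('n)"
  have N: "1 \<le> N" unfolding N_def by simp
  have "0 < e / N" using e N by simp
  from compact_potD(3)[OF A this] obtain C R where C: "0 \<le> C" and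
    CR: "\<And>u. u \<in> H1 \<Longrightarrow> (\<integral>x. \<bar>A x\<bar> * (u x)\<^sup>2 \<partial>lebesgue) \<le> e / N * ((gnrm u)\<^sup>2 + (nrm2 lebesgue u)\<^sup>2) + C * (lnrm R u)\<^sup>2" 
    by blast
  have "integrable lebesgue (\<lambda>x. \<bar>A (t *\<^sub>R x)\<bar> * (u x)\<^sup>2) \<and>
    (\<integral>x. \<bar>A (t *\<^sub>R x)\<bar> * (u x)\<^sup>2 \<partial>lebesgue) \<le> e * ((gnrm u)\<^sup>2 + (nrm2 lebesgue u)\<^sup>2) + C * N * (lnrm R u)\<^sup>2"
    if u: "u \<in> H1" and t: "1 \<le> t" "t \<le> 2" for u t
  proof -
    have tN: "t ^ CARD('n) \<le> N" unfolding N_def using t by (intro power_mono) auto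
    have t1: "1 \<le> t ^ CARD('n)" using t by simp
    define h where "h x = u ((1 / t) *\<^sub>R x)" for x
    have t0: "0 < 1 / t" "t \<noteq> 0" using t by auto
    have h: "h \<in> H1" "(gnrm h)\<^sup>2 = (1 / t)\<^sup>2 * (gnrm u)\<^sup>2 * t ^ CARD('n)" "(nrm2 lebesgue h)\<^sup>2 = (nrm2 lebesgue u)\<^sup>2 * t ^ CARD('n)"
      using H1_dilate[OF u t0(1)] by (auto simp: h_def[abs_def] power_one_over)
    note i = compact_potD(2)[OF A h(1)]
    note af = integrable_lebesgue_affine[OF t0(2) i, of 0]
    have hx: "\<bar>A (0 + t *\<^sub>R x)\<bar> * (h (0 + t *\<^sub>R x))\<^sup>2 = \<bar>A (t *\<^sub>R x)\<bar> * (u x)\<^sup>2" for x using t by (simp add: h_def)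
    have g2: "(gnrm h)\<^sup>2 \<le> N * (gnrm u)\<^sup>2"
    proof -
      have "(1 / t)\<^sup>2 * t ^ CARD('n) \<le> 1 * N" using t tN by (intro mult_mono) (auto simp: power_one_over)
      from mult_right_mono[OF this zero_le_power2[of "gnrm u"]] show ?thesis unfolding h(2) by (simp add: mult_ac)
    qed
    have n2: "(nrm2 lebesgue h)\<^sup>2 \<le> N * (nrm2 lebesgue u)\<^sup>2"
      unfolding h(3) using mult_right_mono[OF tN zero_le_power2[of "nrm2 lebesgue u"]] by (simp add: mult.commute)
    have l2: "(lnrm R h)\<^sup>2 \<le> N * (lnrm R u)\<^sup>2"
      using lnrm_dilate[OF H1_sq_int[OF u] t(1), of R] mult_right_mono[OF tN zero_le_power2[of "lnrm R u"]] by (simp add: h_def[abs_def])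
    have "(\<integral>x. \<bar>A (t *\<^sub>R x)\<bar> * (u x)\<^sup>2 \<partial>lebesgue) = (\<integral>x. \<bar>A x\<bar> * (h x)\<^sup>2 \<partial>lebesgue) / t ^ CARD('n)"
      using af(2) t unfolding hx by (simp add: divide_inverse mult.commute)
    also have "\<dots> \<le> (\<integral>x. \<bar>A x\<bar> * (h x)\<^sup>2 \<partial>lebesgue) / 1"
      using t1 by (intro divide_left_mono Bochner_Integration.integral_nonneg) auto
    also have "\<dots> \<le> e / N * ((gnrm h)\<^sup>2 + (nrm2 lebesgue h)\<^sup>2) + C * (lnrm R h)\<^sup>2" using CR[OF h(1)] by simp
    also have "\<dots> \<le> e / N * (N * (gnrm u)\<^sup>2 + N * (nrm2 lebesgue u)\<^sup>2) + C * (N * (lnrm R u)\<^sup>2)"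
      using e N C g2 n2 l2 by (intro add_mono mult_left_mono) auto
    also have "\<dots> = e * ((gnrm u)\<^sup>2 + (nrm2 lebesgue u)\<^sup>2) + C * N * (lnrm R u)\<^sup>2"
      using N by (simp add: field_simps)
    finally show ?thesis using af(1) unfolding hx by blast
  qed
  then show ?thesis using C N by (intro exI[of _ "C * N"] conjI exI[of _ R]) auto
qed

section \<open>Mass-preserving dilations of a fixed function\<close>

context nls
begin

definition scale :: "real \<Rightarrow> (real^'n \<Rightarrow> real) \<Rightarrow> real^'n \<Rightarrow> real" where
  "scale t u x = t powr (real CARD('n) / 2) * u (t *\<^sub>R x)"

lemma scale_factor:
  assumes t: "1 \<le> t" "t \<le> 2"
  shows "1 \<le> t powr (real CARD('n) / 2)" "t powr (real CARD('n) / 2) \<le> 2 ^ CARD('n)"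
    "t powr (real CARD('n) / 2) - 1 \<le> real CARD('n) * 2 ^ CARD('n) * (t - 1)"
proof -
  have le: "t powr (real CARD('n) / 2) \<le> t ^ CARD('n)"
    using powr_mono[of "real CARD('n) / 2" "real CARD('n)" t] t by (simp add: powr_realpow)
  show "1 \<le> t powr (real CARD('n) / 2)" using t by (intro ge_one_powr_ge_zero) auto
  show "t powr (real CARD('n) / 2) \<le> 2 ^ CARD('n)"
    by (rule order_trans[OF le power_mono]) (use t in auto)
  have "t powr (real CARD('n) / 2) - 1 \<le> t ^ CARD('n) - 1" using le by simp
  also have "\<dots> = (t - 1) * (\<Sum>i<CARD('n). t ^ i)" by (rule power_diff_1_eq)
  also have "\<dots> \<le> (t - 1) * (\<Sum>i<CARD('n). 2 ^ CARD('n))"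
  proof (intro mult_left_mono sum_mono)
    fix i assume "i \<in> {..<CARD('n)}"
    then show "t ^ i \<le> 2 ^ CARD('n)"
      by (intro order_trans[OF power_mono power_increasing]) (use t in auto)
  qed (use t in simp)
  finally show "t powr (real CARD('n) / 2) - 1 \<le> real CARD('n) * 2 ^ CARD('n) * (t - 1)" by (simp add: mult_ac)
qed

lemma scale_facts:
  assumes u: "u \<in> H1" and t: "0 < t"
  shows "scale t u \<in> H1" "gnrm (scale t u) = t * gnrm u" "nrm2 lebesgue (scale t u) = nrm2 lebesgue u" 
    "Nf (scale t u) = t powr p * Nf u"
proof -
  define a where "a = t powr (real CARD('n) / 2)"
  have a: "0 < a" "a\<^sup>2 = t ^ CARD('n)" 
    using t by (auto simp: a_def power2_eq_square powr_add[symmetric] powr_realpow)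
  have s: "scale t u = (\<lambda>x. a * u (t *\<^sub>R x))" by (simp add: scale_def[abs_def] a_def)
  note d = H1_dilate[OF u t]
  show "scale t u \<in> H1" unfolding s by (rule H1_cmult[OF d(1)])
  have "(gnrm (scale t u))\<^sup>2 = (t * gnrm u)\<^sup>2"
    unfolding s gnrm_cmult[OF d(1)] power_mult_distrib d(2) using a t by (simp add: power_mult_distrib)
  then show "gnrm (scale t u) = t * gnrm u" by (rule power2_eq_imp_eq) (use t in auto)
  have "(nrm2 lebesgue (scale t u))\<^sup>2 = (nrm2 lebesgue u)\<^sup>2"
    unfolding s nrm2_cmult power_mult_distrib d(3) using a t by simp
  then show "nrm2 lebesgue (scale t u) = nrm2 lebesgue u" by (rule power2_eq_imp_eq) auto
  \<comment> \<open>N p/2 = p + N at the critical exponent: after the Jacobian t^-N the critical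
    integral scales like t^p, the squared gradient like t^2.\<close>
  have ap: "a powr p = t powr p * t ^ CARD('n)"
  proof -
    have "real CARD('n) / 2 * p = p + real CARD('n)" using p_facts(6) by (simp add: algebra_simps)
    then show ?thesis unfolding a_def powr_powr using t by (simp only: powr_add powr_realpow)
  qed
  have "Nf (scale t u) = a powr p * (\<integral>x. \<bar>u (0 + t *\<^sub>R x)\<bar> powr p \<partial>lebesgue)"
    unfolding Nf_def s using a(1) by (simp add: abs_mult powr_mult)
  also have "\<dots> = t powr p * Nf u"
    using t by (subst integrable_lebesgue_affine(2)[OF _ H1_powr_integrable[OF u]]) (auto simp: ap Nf_def)
  finally show "Nf (scale t u) = t powr p * Nf u" .
qed

text \<open>The dilation quotient carries a factor 1/|x|; on a ball multiplying it back costs at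
  most |R|. This is why the rate t - 1 is available for the local norm.\<close>

lemma lnrm_scale_diff:
  assumes u: "u \<in> H1" and t: "1 \<le> t" "t \<le> 2"
  shows "lnrm R (\<lambda>x. scale t u x - u x) \<le> (t - 1) * (2 ^ CARD('n) * \<bar>R\<bar> * gnrm u + real CARD('n) * 2 ^ CARD('n) * nrm2 lebesgue u)"
proof -
  define a where "a = t powr (real CARD('n) / 2)"
  note a = scale_factor[OF t, folded a_def]
  define q where "q x = (u (t *\<^sub>R x) - u x) / norm x" for x
  note d = H1_dilation[OF has_weak_grad_weak_grad[OF u] H1_sq_int[OF u] t(1), folded q_def gnrm_def]
  define b where "b x = indicat_real (cball 0 R) x * norm x * a" for x :: "real^'n"
  have b: "\<bar>b x\<bar> \<le> \<bar>R\<bar> * a" for x using a by (auto simp: b_def indicator_def intro!: mult_right_mono)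
  have bm: "b \<in> borel_measurable lebesgue" unfolding b_def[abs_def] 
    by (intro borel_measurable_times borel_measurable_indicator borel_measurable_const continuous_borel_lebesgue continuous_on_norm continuous_on_id) auto
  have I: "sq_int lebesgue (\<lambda>x. (a - 1) * (indicat_real (cball 0 R) x * u x))"
    by (intro sq_int_cmult sq_int_indicator_mult H1_sq_int u)
  have "lnrm R (\<lambda>x. scale t u x - u x) = nrm2 lebesgue (\<lambda>x. b x *\<^sub>R q x + (a - 1) * (indicat_real (cball 0 R) x * u x))"
    unfolding lnrm_def
  proof (rule arg_cong[where f="nrm2 lebesgue"], rule ext)
    fix x :: "real^'n"
    have "norm x * q x = u (t *\<^sub>R x) - u x" by (cases "x = 0") (auto simp: q_def)
    then have "b x *\<^sub>R q x = indicat_real (cball 0 R) x * a * (u (t *\<^sub>R x) - u x)" by (simp add: b_def mult_ac)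
    then show "indicat_real (cball 0 R) x * (scale t u x - u x) = b x *\<^sub>R q x + (a - 1) * (indicat_real (cball 0 R) x * u x)"
      by (simp add: scale_def a_def algebra_simps)
  qed
  also have "\<dots> \<le> nrm2 lebesgue (\<lambda>x. b x *\<^sub>R q x) + (a - 1) * lnrm R u"
    using nrm2_triangle[OF sq_int_mult_bounded[OF d(1) bm b] I] a by (simp add: nrm2_cmult lnrm_def)
  also have "nrm2 lebesgue (\<lambda>x. b x *\<^sub>R q x) \<le> \<bar>R\<bar> * a * ((t - 1) * gnrm u)"
    using nrm2_mult_bounded[OF d(1) b] d(2) a by (meson abs_ge_zero mult_left_mono mult_nonneg_nonneg order_trans zero_le_one)
  also have "\<dots> \<le> \<bar>R\<bar> * 2 ^ CARD('n) * ((t - 1) * gnrm u)" 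
    using a t by (intro mult_right_mono mult_left_mono) auto
  also have "(a - 1) * lnrm R u \<le> (real CARD('n) * 2 ^ CARD('n) * (t - 1)) * nrm2 lebesgue u"
    using a t lnrm_le[OF H1_sq_int[OF u]] by (intro mult_mono) auto
  finally show ?thesis by (simp add: algebra_simps)
qed

text \<open>No rate in t - 1 is claimed for the full H1 norm of \<open>D\<close>, so its
  contribution must be absorbed with an arbitrarily small factor. The weight of \<open>rem\<close>
  is bounded by |u(x)|^(p-2) and |u(t x)|^(p-2), which are form-compact uniformly in
  \<open>t\<close>, so only a local norm is left.\<close>

lemma scale_diff_absorb:
  assumes u: "u \<in> H1" and m: "0 < m"
  shows "\<exists>C\<ge>0. \<exists>R. \<forall>t. 1 \<le> t \<longrightarrow> t \<le> 2 \<longrightarrow> (\<forall>D. D = (\<lambda>x. scale t u x - u x) \<longrightarrow> 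
    \<bar>Qf D\<bar> / 2 + (p - 1) * rem u D \<le> m * ((gnrm D)\<^sup>2 + (nrm2 lebesgue D)\<^sup>2) + C * (lnrm R D)\<^sup>2)"
proof -
  define N where "N = (2::real) ^ CARD('n)"
  have N: "1 \<le> N" unfolding N_def by simp
  define K where "K = (p - 1) * (3 * N) powr (p - 2)"
  have K: "0 < K" using N p_gt by (auto simp: K_def)
  have "0 < m / (4 * K)" using m K by simp
  from compact_pot_dilate[OF compact_pot_powr[OF u] this] obtain C1 R1 where C1: "0 \<le> C1" and
    CR: "\<And>D t. D \<in> H1 \<Longrightarrow> 1 \<le> t \<Longrightarrow> t \<le> 2 \<Longrightarrow> integrable lebesgue (\<lambda>x. \<bar>\<bar>u (t *\<^sub>R x)\<bar> powr (p - 2)\<bar> * (D x)\<^sup>2) \<and>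
      (\<integral>x. \<bar>\<bar>u (t *\<^sub>R x)\<bar> powr (p - 2)\<bar> * (D x)\<^sup>2 \<partial>lebesgue) \<le> m / (4 * K) * ((gnrm D)\<^sup>2 + (nrm2 lebesgue D)\<^sup>2) + C1 * (lnrm R1 D)\<^sup>2" by blast
  from compact_potD(3)[OF Vpot m] obtain C2 R2 where C2: "0 \<le> C2" and
    CV: "\<And>D. D \<in> H1 \<Longrightarrow> (\<integral>x. \<bar>V x\<bar> * (D x)\<^sup>2 \<partial>lebesgue) \<le> m * ((gnrm D)\<^sup>2 + (nrm2 lebesgue D)\<^sup>2) + C2 * (lnrm R2 D)\<^sup>2" by blast
  define R where "R = max R1 R2"
  have main: "\<bar>Qf D\<bar> / 2 + (p - 1) * rem u D \<le> m * ((gnrm D)\<^sup>2 + (nrm2 lebesgue D)\<^sup>2) + (C2 + 2 * K * C1) * (lnrm R D)\<^sup>2"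
    if t: "1 \<le> t" "t \<le> 2" and D: "D = (\<lambda>x. scale t u x - u x)" for t D
  proof -
    define X where "X = (gnrm D)\<^sup>2 + (nrm2 lebesgue D)\<^sup>2"
    define Y where "Y = (lnrm R D)\<^sup>2"
    have DH: "D \<in> H1" unfolding D using t by (intro H1_diff scale_facts u) auto
    have l: "(lnrm R1 D)\<^sup>2 \<le> Y" "(lnrm R2 D)\<^sup>2 \<le> Y" unfolding Y_def R_def
      by (intro power_mono lnrm_mono H1_sq_int[OF DH]; simp)+
    define A where "A s x = \<bar>u (s *\<^sub>R x)\<bar> powr (p - 2) * (D x)\<^sup>2" for s x
    have A: "integrable lebesgue (A s)" "(\<integral>x. A s x \<partial>lebesgue) \<le> m / (4 * K) * X + C1 * Y" if "1 \<le> s" "s \<le> 2" for s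
      using CR[OF DH that] mult_left_mono[OF l(1) C1] by (auto simp: A_def[abs_def] X_def)
    have "rem u D \<le> (\<integral>x. (3 * N) powr (p - 2) * (A 1 x + A t x) \<partial>lebesgue)"
      unfolding rem_def
    proof (rule integral_mono')
      show "integrable lebesgue (\<lambda>x. (3 * N) powr (p - 2) * (A 1 x + A t x))" using A(1)[of 1] A(1)[OF t] by auto
      fix x :: "real^'n"
      define M where "M = max \<bar>u x\<bar> \<bar>u (t *\<^sub>R x)\<bar>"
      have "\<bar>scale t u x\<bar> \<le> N * M" 
        unfolding scale_def abs_mult using scale_factor[OF t] N by (intro mult_mono) (auto simp: N_def M_def)
      moreover have "\<bar>u x\<bar> \<le> N * M" using mult_mono[OF N, of "\<bar>u x\<bar>" M] N by (auto simp: M_def)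
      \<comment> \<open>\<open>u\<close> occurs in |u| and again in |D|, the dilate once; each is at
        most N M, which gives the factor 3.\<close>
      ultimately have "\<bar>u x\<bar> + \<bar>D x\<bar> \<le> 3 * N * M" unfolding D by linarith
      then have "(\<bar>u x\<bar> + \<bar>D x\<bar>) powr (p - 2) \<le> (3 * N * M) powr (p - 2)" using p_gt by (intro powr_mono2) auto
      also have "\<dots> = (3 * N) powr (p - 2) * M powr (p - 2)" using N by (simp add: powr_mult M_def)
      also have "\<dots> \<le> (3 * N) powr (p - 2) * (\<bar>u x\<bar> powr (p - 2) + \<bar>u (t *\<^sub>R x)\<bar> powr (p - 2))"
        by (intro mult_left_mono) (auto simp: M_def max_def)
      finally show "(\<bar>u x\<bar> + \<bar>D x\<bar>) powr (p - 2) * (D x)\<^sup>2 \<le> (3 * N) powr (p - 2) * (A 1 x + A t x)"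
        unfolding A_def using mult_right_mono[OF _ zero_le_power2[of "D x"]] by (fastforce simp: algebra_simps)
    qed (auto simp: A_def)
    also have "\<dots> = (3 * N) powr (p - 2) * ((\<integral>x. A 1 x \<partial>lebesgue) + (\<integral>x. A t x \<partial>lebesgue))" 
      using A(1)[of 1] A(1)[OF t] by simp
    also have "\<dots> \<le> (3 * N) powr (p - 2) * ((m / (4 * K) * X + C1 * Y) + (m / (4 * K) * X + C1 * Y))"
      using A(2)[of 1] A(2)[OF t] by (intro mult_left_mono add_mono) auto
    finally have "(p - 1) * rem u D \<le> (p - 1) * ((3 * N) powr (p - 2) * ((m / (4 * K) * X + C1 * Y) + (m / (4 * K) * X + C1 * Y)))"
      using p_gt by (intro mult_left_mono) auto
    also have "\<dots> = K * (2 * (m / (4 * K) * X + C1 * Y))" by (simp add: K_def mult_ac)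
    also have "\<dots> = m / 2 * X + 2 * K * C1 * Y" using K by (simp add: field_simps)
    finally have r: "(p - 1) * rem u D \<le> m / 2 * X + 2 * K * C1 * Y" .
    have "\<bar>Qf D\<bar> \<le> m * X + C2 * Y" 
      using compact_pot_abs_le[OF Vpot DH] CV[OF DH] mult_left_mono[OF l(2) C2] unfolding Qf_def X_def by linarith
    moreover have "0 \<le> C2 * Y" using C2 by (simp add: Y_def)
    ultimately show ?thesis using r unfolding X_def[symmetric] Y_def[symmetric] by (simp add: distrib_right)
  qed
  show ?thesis using main C1 C2 K by (intro exI[of _ "C2 + 2 * K * C1"] conjI exI[of _ R]) auto
qed

text \<open>Expand the energy at W in the direction D = W_t - W. Criticality and equal masses make
  the linear term a positive multiple of the squared L2 norm of D; with half the squared gradient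
  this is a full H1 square. It absorbs potential and remainder up to the local norm, which is O(t -
  1).\<close>

lemma scale_energy_lower:
  assumes W: "weak_eq W \<mu>" and \<mu>: "\<mu> < 0"
  shows "\<exists>C\<ge>0. \<forall>t. 1 \<le> t \<longrightarrow> t \<le> 2 \<longrightarrow> energy V W - C * (t - 1)\<^sup>2 \<le> energy V (scale t W)"
proof -
  have WH: "W \<in> H1" and eq: "\<And>v. v \<in> H1 \<Longrightarrow> dE W v = \<mu> * (\<integral>x. W x * v x \<partial>lebesgue)" using W by (auto simp: weak_eq_def)
  \<comment> \<open>Small enough for both available terms: 1/2 from the gradient of
    \<open>D\<close>, -\<mu>/2 from the multiplier.\<close>
  define m where "m = min (1 / 2) (- \<mu> / 2)"
  have m: "0 < m" "m \<le> 1 / 2" "m \<le> - \<mu> / 2" using \<mu> by (auto simp: m_def)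
  from scale_diff_absorb[OF WH m(1)] obtain C R where C: "0 \<le> C" and
    CR: "\<And>t D. 1 \<le> t \<Longrightarrow> t \<le> 2 \<Longrightarrow> D = (\<lambda>x. scale t W x - W x) \<Longrightarrow> 
      \<bar>Qf D\<bar> / 2 + (p - 1) * rem W D \<le> m * ((gnrm D)\<^sup>2 + (nrm2 lebesgue D)\<^sup>2) + C * (lnrm R D)\<^sup>2" by blast
  define L where "L = 2 ^ CARD('n) * \<bar>R\<bar> * gnrm W + real CARD('n) * 2 ^ CARD('n) * nrm2 lebesgue W"
  have "energy V W - C * L\<^sup>2 * (t - 1)\<^sup>2 \<le> energy V (scale t W)" if t: "1 \<le> t" "t \<le> 2" for t
  proof -
    define D where "D x = scale t W x - W x" for x
    have SH: "scale t W \<in> H1" and Sn: "nrm2 lebesgue (scale t W) = nrm2 lebesgue W" using scale_facts[OF WH, of t] t by auto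
    have DH: "D \<in> H1" unfolding D_def[abs_def] by (intro H1_diff SH WH)
    have WD: "(\<lambda>x. W x + D x) = scale t W" by (simp add: D_def)
    have "(nrm2 lebesgue W)\<^sup>2 = (nrm2 lebesgue W)\<^sup>2 + 2 * (\<integral>x. W x * D x \<partial>lebesgue) + (nrm2 lebesgue D)\<^sup>2"
      using nrm2_add_power2[OF H1_sq_int[OF WH] H1_sq_int[OF DH]] unfolding WD Sn by (simp add: mult.commute)
    \<comment> \<open>Equal masses make the inner product quadratic in \<open>D\<close>; the
      negative multiplier then supplies the missing L2 coercivity.\<close>
    then have "(\<integral>x. W x * D x \<partial>lebesgue) = - (nrm2 lebesgue D)\<^sup>2 / 2" by simp
    then have d: "dE W D = - \<mu> / 2 * (nrm2 lebesgue D)\<^sup>2" unfolding eq[OF DH] by simp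
    have "\<bar>energy V (scale t W) - energy V W - dE W D - (gnrm D)\<^sup>2 / 2 - Qf D / 2\<bar> \<le> (p - 1) * rem W D"
      using energy_Taylor[OF WH DH] unfolding WD .
    moreover have "\<bar>Qf D\<bar> / 2 + (p - 1) * rem W D \<le> m * ((gnrm D)\<^sup>2 + (nrm2 lebesgue D)\<^sup>2) + C * (lnrm R D)\<^sup>2"
      by (rule CR[OF t]) (simp add: D_def[abs_def])
    moreover have "m * (gnrm D)\<^sup>2 \<le> 1 / 2 * (gnrm D)\<^sup>2" "m * (nrm2 lebesgue D)\<^sup>2 \<le> - \<mu> / 2 * (nrm2 lebesgue D)\<^sup>2"
      by (rule mult_right_mono[OF m(2) zero_le_power2], rule mult_right_mono[OF m(3) zero_le_power2])
    ultimately have "energy V W - C * (lnrm R D)\<^sup>2 \<le> energy V (scale t W)" 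
      using abs_ge_minus_self[of "Qf D"] unfolding d distrib_left abs_le_iff by linarith
    moreover have "(lnrm R D)\<^sup>2 \<le> ((t - 1) * L)\<^sup>2"
      using lnrm_scale_diff[OF WH t, of R] unfolding D_def[abs_def] L_def by (intro power_mono) auto
    from mult_left_mono[OF this C] have "C * (lnrm R D)\<^sup>2 \<le> C * L\<^sup>2 * (t - 1)\<^sup>2" by (simp add: power_mult_distrib mult_ac)
    ultimately show ?thesis by linarith
  qed
  then show ?thesis using C by (intro exI[of _ "C * L\<^sup>2"]) auto
qed

end

section \<open>From dilations to a gradient bound at critical points\<close>

context nls
begin

text \<open>Factor W_t^2 - W^2 as (W_t - W) u with u = W_t + W. Up to the amplitude factor, W_t - W
  is |x| times the dilation quotient, so \<open>V\<close> meets it only as V(x) |x|.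
  \<open>C\<close> does not depend on W, which makes the resulting bound uniform over all critical
  points.\<close>

lemma Qf_scale_diff:
  assumes H: "compact_pot (\<lambda>x. (V x * norm x)\<^sup>2)" and \<theta>: "0 < \<theta>"
  shows "\<exists>C\<ge>0. \<forall>W\<in>H1. \<forall>t. 1 \<le> t \<longrightarrow> t \<le> 2 \<longrightarrow> \<bar>Qf (scale t W) - Qf W\<bar> \<le> (t - 1) * (\<theta> * (gnrm W)\<^sup>2 + C * (nrm2 lebesgue W)\<^sup>2)"
proof -
  define N where "N = (2::real) ^ CARD('n)"
  have N: "1 \<le> N" unfolding N_def by simp
  define L where "L = real CARD('n) * N"
  have L: "0 < L" using N by (simp add: L_def)
  \<comment> \<open>The sum \<open>u\<close> has gradient norm at most 3 times that of W, hence the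
    factor 9; N^2 times this bound times 9 is \<theta>^2/2, which ends as 3/4 of \<theta>.\<close>
  have "0 < \<theta>\<^sup>2 / (18 * N\<^sup>2)" using \<theta> N by simp
  from compact_pot_form_bound[OF H this] obtain C1 where C1: "0 \<le> C1" and
    F1: "\<And>u. u \<in> H1 \<Longrightarrow> (\<integral>x. \<bar>(V x * norm x)\<^sup>2\<bar> * (u x)\<^sup>2 \<partial>lebesgue) \<le> \<theta>\<^sup>2 / (18 * N\<^sup>2) * (gnrm u)\<^sup>2 + C1 * (nrm2 lebesgue u)\<^sup>2"
    by blast
  \<comment> \<open>Averaging the forms of W and \<open>u\<close> gives the factor (1 + 9)/2 = 5,
    and 5 L times this bound is the remaining quarter of \<theta>.\<close>
  have "0 < \<theta> / (20 * L)" using \<theta> L by simp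
  from compact_pot_form_bound[OF Vpot this] obtain C2 where C2: "0 \<le> C2" and
    F2: "\<And>u. u \<in> H1 \<Longrightarrow> (\<integral>x. \<bar>V x\<bar> * (u x)\<^sup>2 \<partial>lebesgue) \<le> \<theta> / (20 * L) * (gnrm u)\<^sup>2 + C2 * (nrm2 lebesgue u)\<^sup>2"
    by blast
  define C where "C = 2 * N\<^sup>2 * C1 / \<theta> + 5 / 2 * L * C2"
  have "\<bar>Qf (scale t W) - Qf W\<bar> \<le> (t - 1) * (\<theta> * (gnrm W)\<^sup>2 + C * (nrm2 lebesgue W)\<^sup>2)" 
    if W: "W \<in> H1" and t: "1 \<le> t" "t \<le> 2" for W t
  proof -
    define a where "a = t powr (real CARD('n) / 2)"
    have a: "1 \<le> a" "a \<le> N" "a - 1 \<le> L * (t - 1)" using scale_factor[OF t] by (auto simp: a_def N_def L_def)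
    define G \<rho> where "G = gnrm W" and "\<rho> = nrm2 lebesgue W"
    have t0: "0 < t" using t by simp
    note S = scale_facts[OF W t0]
    define u where "u x = scale t W x + W x" for x
    have uH: "u \<in> H1" unfolding u_def[abs_def] by (intro H1_add S W)
    have "gnrm u \<le> t * G + G" using gnrm_add_le[OF S(1) W] unfolding S(2) G_def by (simp add: u_def[abs_def])
    also have "\<dots> \<le> 3 * G" using mult_right_mono[OF t(2), of G] by (simp add: G_def)
    finally have "(gnrm u)\<^sup>2 \<le> (3 * G)\<^sup>2" by (intro power_mono) auto
    then have ug: "(gnrm u)\<^sup>2 \<le> 9 * G\<^sup>2" by (simp add: power_mult_distrib)
    have "nrm2 lebesgue u \<le> 2 * \<rho>" 
      using nrm2_triangle[OF H1_sq_int[OF S(1)] H1_sq_int[OF W]] unfolding S(3) \<rho>_def by (simp add: u_def[abs_def])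
    then have "(nrm2 lebesgue u)\<^sup>2 \<le> (2 * \<rho>)\<^sup>2" by (intro power_mono) auto
    then have un: "(nrm2 lebesgue u)\<^sup>2 \<le> 4 * \<rho>\<^sup>2" by (simp add: power_mult_distrib)
    define q where "q x = (W (t *\<^sub>R x) - W x) / norm x" for x
    note q = H1_dilation[OF has_weak_grad_weak_grad[OF W] H1_sq_int[OF W] t(1), folded q_def gnrm_def]
    define w where "w x = V x * norm x * u x" for x
    have [measurable]: "V \<in> borel_measurable lebesgue" "u \<in> borel_measurable lebesgue" 
      using compact_potD(1)[OF Vpot] H1_sq_int[OF uH] by (auto simp: sq_int_def)
    have [measurable]: "(\<lambda>x::real^'n. norm x) \<in> borel_measurable lebesgue" 
      by (intro continuous_borel_lebesgue continuous_on_norm continuous_on_id)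
    have w2: "(norm (w x))\<^sup>2 = \<bar>(V x * norm x)\<^sup>2\<bar> * (u x)\<^sup>2" for x by (simp add: w_def power_mult_distrib)
    have w: "sq_int lebesgue w" 
      unfolding sq_int_def w2 using compact_potD(2)[OF H uH] by (auto simp: w_def[abs_def])
    have wn: "(nrm2 lebesgue w)\<^sup>2 \<le> \<theta>\<^sup>2 / (18 * N\<^sup>2) * (9 * G\<^sup>2) + C1 * (4 * \<rho>\<^sup>2)"
    proof -
      have "(nrm2 lebesgue w)\<^sup>2 \<le> \<theta>\<^sup>2 / (18 * N\<^sup>2) * (gnrm u)\<^sup>2 + C1 * (nrm2 lebesgue u)\<^sup>2" 
        using F1[OF uH] unfolding nrm2_power2 w2 .
      also have "\<dots> \<le> \<theta>\<^sup>2 / (18 * N\<^sup>2) * (9 * G\<^sup>2) + C1 * (4 * \<rho>\<^sup>2)"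
        using C1 ug un by (intro add_mono mult_left_mono) auto
      finally show ?thesis .
    qed
    define I1 I2 where "I1 = (\<integral>x. q x * w x \<partial>lebesgue)" and "I2 = (\<integral>x. V x * W x * u x \<partial>lebesgue)"
    have "Qf (scale t W) - Qf W = (\<integral>x. V x * (scale t W x)\<^sup>2 - V x * (W x)\<^sup>2 \<partial>lebesgue)"
      unfolding Qf_def by (intro Bochner_Integration.integral_diff[symmetric] compact_pot_integrable Vpot S W)
    also have "\<dots> = (\<integral>x. a * (q x * w x) + (a - 1) * (V x * W x * u x) \<partial>lebesgue)"
    proof (rule Bochner_Integration.integral_cong[OF refl])
      fix x :: "real^'n"
      have "norm x * q x = W (t *\<^sub>R x) - W x" by (cases "x = 0") (auto simp: q_def)
      then have "a * (q x * w x) = V x * u x * (a * (W (t *\<^sub>R x) - W x))" unfolding w_def by (metis (no_types, lifting) mult.assoc mult.commute)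
      then show "V x * (scale t W x)\<^sup>2 - V x * (W x)\<^sup>2 = a * (q x * w x) + (a - 1) * (V x * W x * u x)"
        by (simp add: u_def scale_def a_def power2_eq_square algebra_simps)
    qed
    also have "\<dots> = a * I1 + (a - 1) * I2"
      unfolding I1_def I2_def using sq_int_mult[OF q(1) w] compact_pot_bilinear(1)[OF Vpot W uH] by simp
    finally have E: "\<bar>Qf (scale t W) - Qf W\<bar> \<le> a * \<bar>I1\<bar> + (a - 1) * \<bar>I2\<bar>" 
      using a by (metis abs_mult abs_of_nonneg abs_triangle_ineq diff_ge_0_iff_ge order_trans zero_le_one)
    have b1: "a * \<bar>I1\<bar> \<le> (t - 1) * (3 / 4 * \<theta> * G\<^sup>2 + 2 * N\<^sup>2 * C1 / \<theta> * \<rho>\<^sup>2)"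
    proof -
      have "\<bar>I1\<bar> \<le> nrm2 lebesgue q * nrm2 lebesgue w" unfolding I1_def by (rule integral_mult_le[OF q(1) w])
      also have "\<dots> \<le> (t - 1) * G * nrm2 lebesgue w" using q(2) by (intro mult_right_mono) (auto simp: G_def)
      finally have "a * \<bar>I1\<bar> \<le> N * ((t - 1) * G * nrm2 lebesgue w)" using a by (intro mult_mono) auto
      also have "\<dots> = (t - 1) * (G * (N * nrm2 lebesgue w))" by simp
      also have "\<dots> \<le> (t - 1) * (3 / 4 * \<theta> * G\<^sup>2 + 2 * N\<^sup>2 * C1 / \<theta> * \<rho>\<^sup>2)"
      proof (rule mult_left_mono)
        define Y where "Y = N * nrm2 lebesgue w"
        have Y: "Y\<^sup>2 \<le> \<theta>\<^sup>2 / 2 * G\<^sup>2 + 4 * N\<^sup>2 * C1 * \<rho>\<^sup>2"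
        proof -
          have "N\<^sup>2 * (\<theta>\<^sup>2 / (18 * N\<^sup>2) * (9 * G\<^sup>2) + C1 * (4 * \<rho>\<^sup>2)) = \<theta>\<^sup>2 / 2 * G\<^sup>2 + 4 * N\<^sup>2 * C1 * \<rho>\<^sup>2"
            using N by (simp add: distrib_left)
          with mult_left_mono[OF wn, of "N\<^sup>2"] show ?thesis by (simp add: Y_def power_mult_distrib)
        qed
        have "2 * (\<theta> * G) * Y \<le> (\<theta> * G)\<^sup>2 + Y\<^sup>2" using sum_squares_bound[of "\<theta> * G" Y] by simp
        also have "\<dots> \<le> (\<theta> * G)\<^sup>2 + (\<theta>\<^sup>2 / 2 * G\<^sup>2 + 4 * N\<^sup>2 * C1 * \<rho>\<^sup>2)" using Y by simp
        also have "\<dots> = 2 * \<theta> * (3 / 4 * \<theta> * G\<^sup>2 + 2 * N\<^sup>2 * C1 / \<theta> * \<rho>\<^sup>2)" 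
          using \<theta> by (simp add: power_mult_distrib power2_eq_square field_simps)
        finally have "2 * \<theta> * (G * Y) \<le> 2 * \<theta> * (3 / 4 * \<theta> * G\<^sup>2 + 2 * N\<^sup>2 * C1 / \<theta> * \<rho>\<^sup>2)" by simp
        then have "G * Y \<le> 3 / 4 * \<theta> * G\<^sup>2 + 2 * N\<^sup>2 * C1 / \<theta> * \<rho>\<^sup>2" by (rule mult_left_le_imp_le) (use \<theta> in simp)
        then show "G * (N * nrm2 lebesgue w) \<le> 3 / 4 * \<theta> * G\<^sup>2 + 2 * N\<^sup>2 * C1 / \<theta> * \<rho>\<^sup>2" unfolding Y_def .
      qed (use t in simp)
      finally show ?thesis .
    qed
    have b2: "(a - 1) * \<bar>I2\<bar> \<le> (t - 1) * (1 / 4 * \<theta> * G\<^sup>2 + 5 / 2 * L * C2 * \<rho>\<^sup>2)"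
    proof -
      define X1 X2 where "X1 = (\<integral>x. \<bar>V x\<bar> * (W x)\<^sup>2 \<partial>lebesgue)" and "X2 = (\<integral>x. \<bar>V x\<bar> * (u x)\<^sup>2 \<partial>lebesgue)"
      have X: "0 \<le> X1" "0 \<le> X2" by (auto simp: X1_def X2_def intro!: Bochner_Integration.integral_nonneg)
      have "\<bar>I2\<bar> \<le> sqrt X1 * sqrt X2" unfolding I2_def X1_def X2_def by (rule compact_pot_bilinear(2)[OF Vpot W uH])
      also have "\<dots> \<le> (X1 + X2) / 2" using arith_geo_mean_sqrt[OF X] by (simp add: real_sqrt_mult)
      finally have "\<bar>I2\<bar> \<le> (X1 + X2) / 2" .
      moreover have "X1 \<le> \<theta> / (20 * L) * G\<^sup>2 + C2 * \<rho>\<^sup>2" unfolding X1_def G_def \<rho>_def by (rule F2[OF W])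
      moreover have "X2 \<le> \<theta> / (20 * L) * (9 * G\<^sup>2) + C2 * (4 * \<rho>\<^sup>2)"
      proof -
        have "X2 \<le> \<theta> / (20 * L) * (gnrm u)\<^sup>2 + C2 * (nrm2 lebesgue u)\<^sup>2" unfolding X2_def by (rule F2[OF uH])
        also have "\<dots> \<le> \<theta> / (20 * L) * (9 * G\<^sup>2) + C2 * (4 * \<rho>\<^sup>2)" 
          using C2 \<theta> L ug un by (intro add_mono mult_left_mono) auto
        finally show ?thesis .
      qed
      ultimately have "\<bar>I2\<bar> \<le> 5 * (\<theta> / (20 * L) * G\<^sup>2) + 5 / 2 * (C2 * \<rho>\<^sup>2)" by simp
      then have "(a - 1) * \<bar>I2\<bar> \<le> L * (t - 1) * (5 * (\<theta> / (20 * L) * G\<^sup>2) + 5 / 2 * (C2 * \<rho>\<^sup>2))"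
        using a t L by (intro mult_mono) auto
      also have "\<dots> = (t - 1) * (1 / 4 * \<theta> * G\<^sup>2 + 5 / 2 * L * C2 * \<rho>\<^sup>2)" using L by (simp add: field_simps)
      finally show ?thesis .
    qed
    have "(t - 1) * (3 / 4 * \<theta> * G\<^sup>2 + 2 * N\<^sup>2 * C1 / \<theta> * \<rho>\<^sup>2) + (t - 1) * (1 / 4 * \<theta> * G\<^sup>2 + 5 / 2 * L * C2 * \<rho>\<^sup>2) = (t - 1) * (\<theta> * G\<^sup>2 + C * \<rho>\<^sup>2)"
      unfolding C_def distrib_left[symmetric] by (rule arg_cong[where f="(*) (t - 1)"]) (simp add: algebra_simps)
    then show ?thesis using E b1 b2 unfolding G_def \<rho>_def by linarith
  qed
  moreover have "0 \<le> C" using C1 C2 L \<theta> by (simp add: C_def)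
  ultimately show ?thesis by blast
qed

text \<open>The lower half of the Taylor estimate at 1: dividing by h later leaves an error that
  vanishes with h.\<close>

lemma powr_second_order: 
  assumes "0 \<le> h" "h \<le> 1"
  shows "h - (p - 1) * 2 powr (p - 2) * h\<^sup>2 \<le> ((1 + h) powr p - 1) / p"
proof -
  have "(1 + h) powr (p - 2) * h\<^sup>2 \<le> 2 powr (p - 2) * h\<^sup>2" using assms p_gt by (intro mult_right_mono powr_mono2) auto
  then have "p * (p - 1) * ((1 + h) powr (p - 2) * h\<^sup>2) \<le> p * (p - 1) * (2 powr (p - 2) * h\<^sup>2)" 
    using p_gt by (intro mult_left_mono) auto
  then have "p * h - p * (p - 1) * (2 powr (p - 2) * h\<^sup>2) \<le> (1 + h) powr p - 1"
    using powr_Taylor[OF p_gt(1), of 1 h] assms by (simp add: abs_le_iff)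
  then have "p * (h - (p - 1) * 2 powr (p - 2) * h\<^sup>2) \<le> (1 + h) powr p - 1" by (simp add: algebra_simps)
  then show ?thesis using p_gt by (simp add: pos_le_divide_eq mult.commute)
qed

text \<open>Insert the scaling laws into the lower energy bound at t = 1 + h, divide by h and let h
  tend to 0. Since h > 0 this gives one inequality, an upper bound of the critical integral.\<close>

lemma Pohozaev_inequality:
  assumes H: "compact_pot (\<lambda>x. (V x * norm x)\<^sup>2)" and \<theta>: "0 < \<theta>"
  shows "\<exists>C\<ge>0. \<forall>W \<mu>. weak_eq W \<mu> \<longrightarrow> \<mu> < 0 \<longrightarrow> Nf W \<le> (1 + \<theta> / 2) * (gnrm W)\<^sup>2 + C * (nrm2 lebesgue W)\<^sup>2"
proof -
  from Qf_scale_diff[OF H \<theta>] obtain C where C: "0 \<le> C" and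
    Q: "\<And>W t. W \<in> H1 \<Longrightarrow> 1 \<le> t \<Longrightarrow> t \<le> 2 \<Longrightarrow> \<bar>Qf (scale t W) - Qf W\<bar> \<le> (t - 1) * (\<theta> * (gnrm W)\<^sup>2 + C * (nrm2 lebesgue W)\<^sup>2)"
    by blast
  have "Nf W \<le> (1 + \<theta> / 2) * (gnrm W)\<^sup>2 + C / 2 * (nrm2 lebesgue W)\<^sup>2" if W: "weak_eq W \<mu>" and \<mu>: "\<mu> < 0" for W \<mu>
  proof -
    have WH: "W \<in> H1" using W by (simp add: weak_eq_def)
    \<comment> \<open>\<open>D\<close> depends on W. It multiplies h^2 and disappears in the limit;
      only the uniform \<open>C\<close> survives.\<close>
    from scale_energy_lower[OF W \<mu>] obtain D where D: "0 \<le> D" and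
      E: "\<And>t. 1 \<le> t \<Longrightarrow> t \<le> 2 \<Longrightarrow> energy V W - D * (t - 1)\<^sup>2 \<le> energy V (scale t W)" by blast
    define Y where "Y = (1 + \<theta> / 2) * (gnrm W)\<^sup>2 + C / 2 * (nrm2 lebesgue W)\<^sup>2"
    define P where "P = (p - 1) * 2 powr (p - 2)"
    define K where "K = P * Nf W + (gnrm W)\<^sup>2 / 2 + D"
    have K: "0 \<le> K" using p_gt D Nf_nonneg[of W] by (simp add: K_def P_def)
    have h: "Nf W \<le> Y + K * h" if h: "0 < h" "h \<le> 1" for h
    proof -
      define t where "t = 1 + h"
      have t: "1 \<le> t" "t \<le> 2" "t - 1 = h" using h by (auto simp: t_def)
      note S = scale_facts[OF WH, of t]
      have "((1 + h) powr p - 1) / p * Nf W - h * (1 + h / 2) * (gnrm W)\<^sup>2 - (Qf (scale t W) - Qf W) / 2 = energy V W - energy V (scale t W)"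
        unfolding energy_eq using S t p_gt by (simp add: t_def power2_eq_square field_simps)
      also have "\<dots> \<le> D * h\<^sup>2" using E[OF t(1,2)] t(3) by simp
      finally have 1: "((1 + h) powr p - 1) / p * Nf W \<le> h * (1 + h / 2) * (gnrm W)\<^sup>2 + (Qf (scale t W) - Qf W) / 2 + D * h\<^sup>2" by linarith
      have 2: "(h - P * h\<^sup>2) * Nf W \<le> ((1 + h) powr p - 1) / p * Nf W"
        using powr_second_order[of h] h by (intro mult_right_mono Nf_nonneg) (auto simp: P_def)
      have "Qf (scale t W) - Qf W \<le> h * (\<theta> * (gnrm W)\<^sup>2 + C * (nrm2 lebesgue W)\<^sup>2)"
        using Q[OF WH t(1,2)] unfolding t(3) by (rule order_trans[OF abs_ge_self])
      then have "(Qf (scale t W) - Qf W) / 2 \<le> h * (\<theta> * (gnrm W)\<^sup>2 + C * (nrm2 lebesgue W)\<^sup>2) / 2"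
        by (rule divide_right_mono) simp
      then have "h * (1 + h / 2) * (gnrm W)\<^sup>2 + (Qf (scale t W) - Qf W) / 2 + D * h\<^sup>2
        \<le> h * (1 + h / 2) * (gnrm W)\<^sup>2 + h * (\<theta> * (gnrm W)\<^sup>2 + C * (nrm2 lebesgue W)\<^sup>2) / 2 + D * h\<^sup>2"
        by (intro add_mono order_refl)
      from order_trans[OF order_trans[OF 2 1] this]
      have "h * Nf W \<le> h * (Y + K * h)" by (simp add: Y_def K_def power2_eq_square algebra_simps add_divide_distrib)
      then show ?thesis using h(1) by simp
    qed
    have "Nf W \<le> Y"
    proof (rule field_le_epsilon)
      fix e :: real assume e: "0 < e"
      define s where "s = min 1 (e / (K + 1))"
      have s: "0 < s" "s \<le> 1" "s \<le> e / (K + 1)" using e K by (auto simp: s_def)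
      have "K * s \<le> (K + 1) * (e / (K + 1))" using K s by (intro mult_mono) auto
      then show "Nf W \<le> Y + e" using h[OF s(1,2)] K by simp
    qed
    then show ?thesis unfolding Y_def .
  qed
  then show ?thesis using C by (intro exI[of _ "C / 2"]) auto
qed

text \<open>Write \<kappa> = 1/2 - 1/p. Replacing the critical integral by its bound leaves \<kappa>
  times the squared gradient; half of it pays for the potential, a quarter for the error in the
  Pohozaev inequality, and \<kappa>/4 remains. Negative energy thus bounds the gradient by a
  multiple of the mass norm.\<close>

lemma critical_energy_bound:
  assumes H: "compact_pot (\<lambda>x. (V x * norm x)\<^sup>2)"
  shows "\<exists>c>0. \<exists>C\<ge>0. \<forall>W \<mu>. weak_eq W \<mu> \<longrightarrow> \<mu> < 0 \<longrightarrow> c * (gnrm W)\<^sup>2 - C * (nrm2 lebesgue W)\<^sup>2 \<le> energy V W"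
proof -
  define \<kappa> where "\<kappa> = 1 / 2 - 1 / p"
  have \<kappa>: "0 < \<kappa>" using p_gt by (simp add: \<kappa>_def field_simps)
  from Pohozaev_inequality[OF H \<kappa>] obtain C where C: "0 \<le> C" and
    P: "\<And>W \<mu>. weak_eq W \<mu> \<Longrightarrow> \<mu> < 0 \<Longrightarrow> Nf W \<le> (1 + \<kappa> / 2) * (gnrm W)\<^sup>2 + C * (nrm2 lebesgue W)\<^sup>2" by blast
  from compact_pot_form_bound[OF Vpot \<kappa>] obtain D where D: "0 \<le> D" and
    F: "\<And>u. u \<in> H1 \<Longrightarrow> (\<integral>x. \<bar>V x\<bar> * (u x)\<^sup>2 \<partial>lebesgue) \<le> \<kappa> * (gnrm u)\<^sup>2 + D * (nrm2 lebesgue u)\<^sup>2" by blast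
  have "\<kappa> / 4 * (gnrm W)\<^sup>2 - (C / p + D / 2) * (nrm2 lebesgue W)\<^sup>2 \<le> energy V W" if W: "weak_eq W \<mu>" and \<mu>: "\<mu> < 0" for W \<mu>
  proof -
    have WH: "W \<in> H1" using W by (simp add: weak_eq_def)
    have "Nf W / p \<le> (1 / p + (1 / p) * (\<kappa> / 2)) * (gnrm W)\<^sup>2 + C / p * (nrm2 lebesgue W)\<^sup>2"
      using P[OF W \<mu>] p_gt by (simp add: field_simps)
    \<comment> \<open>The leading 1/p is exactly 1/2 - \<kappa>; in the error term 1/p <= 1/2 is
      enough.\<close>
    also have "(1 / p + (1 / p) * (\<kappa> / 2)) * (gnrm W)\<^sup>2 \<le> (1 / 2 - \<kappa> + 1 / 2 * (\<kappa> / 2)) * (gnrm W)\<^sup>2"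
      using p_gt \<kappa> by (intro mult_right_mono add_mono) (auto simp: \<kappa>_def field_simps)
    finally have "Nf W / p \<le> (1 / 2 - \<kappa> + 1 / 2 * (\<kappa> / 2)) * (gnrm W)\<^sup>2 + C / p * (nrm2 lebesgue W)\<^sup>2" by simp
    moreover have "- Qf W \<le> \<kappa> * (gnrm W)\<^sup>2 + D * (nrm2 lebesgue W)\<^sup>2"
      using compact_pot_abs_le[OF Vpot WH] F[OF WH] unfolding Qf_def by linarith
    ultimately show ?thesis unfolding energy_eq by (simp add: algebra_simps)
  qed
  then show ?thesis using \<kappa> C D p_gt by (intro exI[of _ "\<kappa> / 4"] exI[of _ "C / p + D / 2"] conjI) auto
qed

end

section \<open>Ground states of small mass\<close>

lemma mass_sphere_iff: "0 \<le> \<rho> \<Longrightarrow> U \<in> mass_sphere \<rho> \<longleftrightarrow> U \<in> H1 \<and> nrm2 lebesgue U = \<rho>"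
  unfolding mass_sphere_def using nrm2_power2[of lebesgue U] by (auto intro: power2_eq_imp_eq)

lemma small_square_mult:
  fixes k s :: real
  assumes "0 \<le> k" "0 < s"
  shows "\<exists>\<rho>0>0. \<forall>\<rho>. 0 < \<rho> \<longrightarrow> \<rho> < \<rho>0 \<longrightarrow> k * \<rho>\<^sup>2 < s"
proof (intro exI[of _ "min 1 (s / (k + 1))"] conjI allI impI)
  show "0 < min 1 (s / (k + 1))" using assms by auto
  fix \<rho> :: real assume \<rho>: "0 < \<rho>" "\<rho> < min 1 (s / (k + 1))"
  have "k * \<rho>\<^sup>2 \<le> k * \<rho>" using assms \<rho> by (intro mult_left_mono) (auto simp: power2_eq_square mult_left_le)
  also have "\<dots> < (k + 1) * \<rho>" using \<rho> by simp
  also have "\<dots> \<le> (k + 1) * (s / (k + 1))" using assms \<rho> by (intro mult_left_mono) auto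
  also have "\<dots> = s" using assms by simp
  finally show "k * \<rho>\<^sup>2 < s" .
qed

context nls
begin

lemma critical_multiplier:
  assumes U: "U \<in> H1" and \<rho>: "0 < \<rho>" "nrm2 lebesgue U = \<rho>" and E: "energy V U < 0"
    and tangent: "\<And>v. v \<in> H1 \<Longrightarrow> (\<integral>x. U x * v x \<partial>lebesgue) = 0 \<Longrightarrow> dE U v = 0"
  shows "weak_eq U (dE U U / \<rho>\<^sup>2)" "dE U U / \<rho>\<^sup>2 < 0"
proof -
  show "weak_eq U (dE U U / \<rho>\<^sup>2)" unfolding weak_eq_def using U dE_Lagrange[OF U \<rho> tangent] by blast
  have "0 \<le> (1 - 2 / p) * Nf U" using p_gt by (intro mult_nonneg_nonneg Nf_nonneg) simp
  then have "dE U U < 0" using dE_self[OF U] E by linarith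
  then show "dE U U / \<rho>\<^sup>2 < 0" using \<rho>(1) by (simp add: divide_neg_pos)
qed

lemma weak_eq_weak_solution: "weak_eq U \<mu> \<Longrightarrow> weak_solution V U \<mu>"
  unfolding weak_eq_def weak_solution_def dE_def p_eq[symmetric] diff_eq_eq by blast

lemma energy_abs:
  assumes "u \<in> H1" shows "energy V (\<lambda>x. \<bar>u x\<bar>) \<le> energy V u"
  unfolding energy_eq using power_mono[OF H1_abs(2)[OF assms], of 2] by (simp add: Qf_def Nf_def)

text \<open>Uniqueness of the derivative replaces the quantified functional by the first variation,
  so criticality can be fed into the multiplier rule.\<close>

lemma constrained_critical_iff:
  assumes \<rho>: "0 \<le> \<rho>"
  shows "constrained_critical V \<rho> U \<longleftrightarrow> U \<in> H1 \<and> nrm2 lebesgue U = \<rho> \<and> (\<forall>v\<in>H1. (\<integral>x. U x * v x \<partial>lebesgue) = 0 \<longrightarrow> dE U v = 0)"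
  unfolding constrained_critical_def mass_sphere_iff[OF \<rho>]
proof (safe, goal_cases)
  case (1 L v)
  then show ?case using has_H1_derivative_unique[OF energy_has_H1_derivative 1(3), of v] by simp
next
  case 2
  then show ?case using energy_has_H1_derivative by blast
qed

theorem small_mass_ground_state:
  assumes H: "compact_pot (\<lambda>x. (V x * norm x)\<^sup>2)"
    and \<phi>: "\<phi> \<in> H1" "nrm2 lebesgue \<phi> = 1" "(gnrm \<phi>)\<^sup>2 + Qf \<phi> < 0"
  shows "\<exists>\<rho>1>0. \<exists>\<rho>2>0. \<rho>2 \<le> \<rho>1 \<and>
    (\<forall>\<rho>. 0 < \<rho> \<and> \<rho> < \<rho>1 \<longrightarrow>
      (\<exists>U \<mu>. weak_solution V U \<mu> \<and> (\<integral>x. (U x)\<^sup>2 \<partial>lebesgue) = \<rho>\<^sup>2 \<and> local_minimizer V \<rho> U \<and>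
         energy V U < 0 \<and> \<mu> < 0 \<and> (AE x in lebesgue. 0 < U x) \<and> (\<rho> < \<rho>2 \<longrightarrow> normalized_ground_state V \<rho> U)))"
proof -
  obtain r C where B: "barrier r C" using barrier_exists by blast
  then have r: "0 < r" and C: "0 < C" by (auto simp: barrier_def)
  from critical_energy_bound[OF H] obtain c D where c: "0 < c" and D: "0 \<le> D" and
    crit: "\<And>W \<mu>. weak_eq W \<mu> \<Longrightarrow> \<mu> < 0 \<Longrightarrow> c * (gnrm W)\<^sup>2 - D * (nrm2 lebesgue W)\<^sup>2 \<le> energy V W" by blast
  \<comment> \<open>Three smallness conditions on the mass: \<open>a1\<close> keeps functions of
    negative energy off the boundary of the ball, \<open>a2\<close> lets the scaled test function
    fit into it, and \<open>a3\<close> places critical points of negative energy inside it. Only the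
    last one concerns ground states.\<close>
  obtain a1 where a1: "0 < a1" "\<And>\<rho>. 0 < \<rho> \<Longrightarrow> \<rho> < a1 \<Longrightarrow> 4 * C * \<rho>\<^sup>2 < r\<^sup>2"
    using small_square_mult[of "4 * C" "r\<^sup>2"] r C by auto
  obtain a2 where a2: "0 < a2" "\<And>\<rho>. 0 < \<rho> \<Longrightarrow> \<rho> < a2 \<Longrightarrow> (gnrm \<phi>)\<^sup>2 * \<rho>\<^sup>2 < r\<^sup>2"
    using small_square_mult[of "(gnrm \<phi>)\<^sup>2" "r\<^sup>2"] r by auto
  obtain a3 where a3: "0 < a3" "\<And>\<rho>. 0 < \<rho> \<Longrightarrow> \<rho> < a3 \<Longrightarrow> D * \<rho>\<^sup>2 < c * r\<^sup>2"
    using small_square_mult[of D "c * r\<^sup>2"] r c D by auto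
  show ?thesis
  proof (rule exI[of _ "min a1 a2"], rule conjI, use a1 a2 in simp,
      rule exI[of _ "min a3 (min a1 a2)"], intro conjI allI impI)
    fix \<rho> assume "0 < \<rho> \<and> \<rho> < min a1 a2"
    then have \<rho>: "0 < \<rho>" "\<rho> < a1" "\<rho> < a2" by auto
    note \<rho>1 = a1(2)[OF \<rho>(1,2)]
    \<comment> \<open>A competitor of negative energy: the quadratic part is negative and scales
      with \<rho>^2, and the critical term only lowers the energy.\<close>
    define u0 where "u0 x = \<rho> * \<phi> x" for x
    have u0H: "u0 \<in> H1" unfolding u0_def[abs_def] by (rule H1_cmult[OF \<phi>(1)])
    have u0g: "gnrm u0 = \<rho> * gnrm \<phi>" using gnrm_cmult[OF \<phi>(1), of \<rho>] \<rho>(1) by (simp add: u0_def[abs_def])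
    have "gnrm u0 \<le> r" 
      by (rule power2_le_imp_le) (use a2(2)[OF \<rho>(1,3)] r in \<open>auto simp: u0g power_mult_distrib mult.commute\<close>)
    moreover have "nrm2 lebesgue u0 = \<rho>" using \<phi>(2) \<rho>(1) by (simp add: u0_def[abs_def] nrm2_cmult)
    ultimately have u0S: "u0 \<in> small_sphere r \<rho>" using u0H by (simp add: small_sphere_def)
    have "Qf u0 = \<rho>\<^sup>2 * Qf \<phi>" 
      unfolding Qf_def integral_mult_right_zero[symmetric] by (simp add: u0_def power_mult_distrib mult_ac)
    then have "energy V u0 = \<rho>\<^sup>2 * ((gnrm \<phi>)\<^sup>2 + Qf \<phi>) / 2 - Nf u0 / p"
      unfolding energy_eq u0g by (simp add: power_mult_distrib distrib_left add_divide_distrib)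
    moreover have "\<rho>\<^sup>2 * ((gnrm \<phi>)\<^sup>2 + Qf \<phi>) < 0" using \<phi>(3) \<rho>(1) by (intro mult_pos_neg) auto
    moreover have "0 \<le> Nf u0 / p" using Nf_nonneg p_gt by simp
    ultimately have "energy V u0 < 0" by linarith
    from small_sphere_minimizer[OF B \<rho>(1) \<rho>1 u0S this] obtain U0 where U0: "U0 \<in> small_sphere r \<rho>" "energy V U0 < 0" 
      and min0: "\<And>w. w \<in> small_sphere r \<rho> \<Longrightarrow> energy V U0 \<le> energy V w" by blast
    \<comment> \<open>Passing to the absolute value keeps the mass and raises neither gradient nor
      energy, so this is a nonnegative minimizer.\<close>
    define U where "U x = \<bar>U0 x\<bar>" for x
    have U0H: "U0 \<in> H1" "nrm2 lebesgue U0 = \<rho>" "gnrm U0 \<le> r" using U0(1) by (auto simp: small_sphere_def)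
    have UE: "energy V U \<le> energy V U0" using energy_abs[OF U0H(1)] by (simp add: U_def[abs_def])
    have UH: "U \<in> H1" "gnrm U \<le> r" using H1_abs[OF U0H(1)] U0H(3) by (auto simp: U_def[abs_def])
    have Un: "nrm2 lebesgue U = \<rho>" using U0H(2) by (simp add: U_def nrm2_def)
    have US: "U \<in> small_sphere r \<rho>" using UH Un by (simp add: small_sphere_def)
    have neg: "energy V U < 0" using UE U0(2) by simp
    have min: "energy V U \<le> energy V w" if "w \<in> small_sphere r \<rho>" for w using min0[OF that] UE by simp
    have Ur: "gnrm U < r" using negative_energy_interior[OF B \<rho>1 UH _ neg] Un by simp
    note tangent = minimizer_tangent[OF US \<rho>(1) Ur min]
    define \<mu> where "\<mu> = dE U U / \<rho>\<^sup>2"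
    note mult = critical_multiplier[OF UH(1) \<rho>(1) Un neg tangent, folded \<mu>_def]
    have nz: "\<not> (AE x in lebesgue. U x = 0)"
    proof
      assume "AE x in lebesgue. U x = 0"
      then have "AE x in lebesgue. norm (U x) \<le> norm (0::real)" by (rule eventually_mono) simp
      from nrm2_mono[OF sq_int_zero this] have "nrm2 lebesgue U \<le> nrm2 lebesgue (\<lambda>x::real^'n. 0::real)" .
      also have "\<dots> = 0" by (simp add: nrm2_def)
      finally show False using Un \<rho>(1) by simp
    qed
    have "0 \<le> U x" for x by (simp add: U_def)
    note pos = strong_maximum_principle[OF mult(1) this nz]
    have loc: "local_minimizer V \<rho> U"
      unfolding local_minimizer_def
    proof (intro conjI exI[of _ "r - gnrm U"] ballI impI)
      show "U \<in> mass_sphere \<rho>" using UH Un \<rho>(1) by (simp add: mass_sphere_iff)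
      fix W assume W: "W \<in> mass_sphere \<rho>" and d: "H1_norm (\<lambda>x. W x - U x) < r - gnrm U"
      have WH: "W \<in> H1" "nrm2 lebesgue W = \<rho>" using W \<rho>(1) by (auto simp: mass_sphere_iff)
      have "gnrm W \<le> gnrm (\<lambda>x. W x - U x) + gnrm U" using gnrm_add_le[OF H1_diff[OF WH(1) UH(1)] UH(1)] by simp
      also have "\<dots> \<le> r" using gnrm_le_H1_norm[of "\<lambda>x. W x - U x"] d by simp
      finally show "energy V U \<le> energy V W" using WH by (intro min) (simp add: small_sphere_def)
    qed (use Ur in simp)
    have ground: "normalized_ground_state V \<rho> U" if \<rho>2: "\<rho> < a3"
      unfolding normalized_ground_state_def
    proof (intro conjI antisym INF_greatest)
      show Uc: "constrained_critical V \<rho> U" using UH Un \<rho>(1) tangent by (simp add: constrained_critical_iff)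
      then show "(INF W\<in>{W. constrained_critical V \<rho> W}. ereal (energy V W)) \<le> ereal (energy V U)" 
        by (intro INF_lower) simp
      fix W assume "W \<in> {W. constrained_critical V \<rho> W}"
      then have W: "W \<in> H1" "nrm2 lebesgue W = \<rho>" "\<And>v. v \<in> H1 \<Longrightarrow> (\<integral>x. W x * v x \<partial>lebesgue) = 0 \<Longrightarrow> dE W v = 0" 
        using \<rho>(1) by (auto simp: constrained_critical_iff)
      show "ereal (energy V U) \<le> ereal (energy V W)"
      \<comment> \<open>Critical points of negative energy lie in the ball, where \<open>U\<close>
        is minimal; all others lie above \<open>U\<close> because its energy is negative.\<close>
      proof (cases "energy V W < 0")
        case True
        note m = critical_multiplier[OF W(1) \<rho>(1) W(2) True W(3)]
        have "c * (gnrm W)\<^sup>2 < c * r\<^sup>2" using crit[OF m] True a3(2)[OF \<rho>(1) \<rho>2] unfolding W(2) by linarith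
        then have "(gnrm W)\<^sup>2 < r\<^sup>2" using c by simp
        then have "gnrm W < r" by (rule power_less_imp_less_base) (use r in simp)
        then show ?thesis using W by (simp add: min small_sphere_def)
      next
        case False
        then show ?thesis using neg by simp
      qed
    qed
    have mass: "(\<integral>x. (U x)\<^sup>2 \<partial>lebesgue) = \<rho>\<^sup>2" using nrm2_power2[of lebesgue U] Un by simp
    have ground': "\<rho> < min a3 (min a1 a2) \<longrightarrow> normalized_ground_state V \<rho> U" using ground by auto
    show "\<exists>U \<mu>. weak_solution V U \<mu> \<and> (\<integral>x. (U x)\<^sup>2 \<partial>lebesgue) = \<rho>\<^sup>2 \<and> local_minimizer V \<rho> U \<and>
         energy V U < 0 \<and> \<mu> < 0 \<and> (AE x in lebesgue. 0 < U x) \<and> (\<rho> < min a3 (min a1 a2) \<longrightarrow> normalized_ground_state V \<rho> U)"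
      by (intro exI[of _ U] exI[of _ \<mu>] conjI weak_eq_weak_solution[OF mult(1)] mass loc neg mult(2) pos ground')
  qed (use a1 a2 a3 in auto)
qed

end

section \<open>Reduction of the integrability hypotheses to form-compactness\<close>

theorem corollary1p4:
  fixes V V1 V2 W1 W2 :: "real^'n::finite \<Rightarrow> real"
  assumes "CARD('n) \<ge> 3"
    and "AE x in lebesgue. V x = V1 x + V2 x"
    and "AE x in lebesgue. V x * norm x = W1 x + W2 x"
    and "V1 \<in> Lp (real CARD('n) / 2)"
    and "W1 \<in> Lp (real CARD('n))"
    and "V2 \<in> Linf"
    and "W2 \<in> Linf"
    and "((\<lambda>x. \<bar>V2 x\<bar> + \<bar>W2 x\<bar>) \<longlongrightarrow> 0) at_infinity"
    and "(INF \<phi>\<in>{\<phi> \<in> H1. (\<integral>x. (\<phi> x)\<^sup>2 \<partial>lebesgue) = 1}.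
            ereal (\<integral>x. (norm (weak_grad \<phi> x))\<^sup>2 + V x * (\<phi> x)\<^sup>2 \<partial>lebesgue)) < 0"
  shows "\<exists>\<rho>1>0. \<exists>\<rho>2>0. \<rho>2 \<le> \<rho>1 \<and>
    (\<forall>\<rho>. 0 < \<rho> \<and> \<rho> < \<rho>1 \<longrightarrow>
      (\<exists>U \<mu>.
         weak_solution V U \<mu> \<and>
         (\<integral>x. (U x)\<^sup>2 \<partial>lebesgue) = \<rho>\<^sup>2 \<and>
         local_minimizer V \<rho> U \<and>
         energy V U < 0 \<and>
         \<mu> < 0 \<and>
         (AE x in lebesgue. 0 < U x) \<and>
         (\<rho> < \<rho>2 \<longrightarrow> normalized_ground_state V \<rho> U)))"
proof -
  have AE1: "AE x in lebesgue. V1 x + V2 x = V x" and AE2: "AE x in lebesgue. V x * norm x = W1 x + W2 x"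
    using assms(2,3) by (auto elim: eventually_mono)
  have V1[measurable]: "V1 \<in> borel_measurable lebesgue" "integrable lebesgue (\<lambda>x. \<bar>V1 x\<bar> powr (real CARD('n) / 2))"
    and W1[measurable]: "W1 \<in> borel_measurable lebesgue" "integrable lebesgue (\<lambda>x. \<bar>W1 x\<bar> powr real CARD('n))"
    using assms(4,5) by (auto simp: Lp_def)
  obtain K1 K2 where V2[measurable]: "V2 \<in> borel_measurable lebesgue" and K1: "AE x in lebesgue. \<bar>V2 x\<bar> \<le> K1"
    and W2[measurable]: "W2 \<in> borel_measurable lebesgue" and K2: "AE x in lebesgue. \<bar>W2 x\<bar> \<le> K2"
    using assms(6,7) by (auto simp: Linf_def)
  have V2_lim: "(V2 \<longlongrightarrow> 0) at_infinity" and W2_lim: "(W2 \<longlongrightarrow> 0) at_infinity"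
    by (rule Lim_null_comparison[OF _ assms(8)], simp)+
  have [measurable]: "V \<in> borel_measurable lebesgue" 
    by (rule borel_measurable_AE[OF borel_measurable_add[OF V1(1) V2] AE1])
  have [measurable]: "(\<lambda>x::real^'n. norm x) \<in> borel_measurable lebesgue" 
    by (intro continuous_borel_lebesgue continuous_on_norm continuous_on_id)
  have V: "compact_pot V"
  proof (rule compact_pot_dominated[OF compact_pot_Lp[OF assms(1) V1] compact_pot_Linf[OF V2 K1 V2_lim]])
    show "AE x in lebesgue. \<bar>V x\<bar> \<le> 1 * (\<bar>V1 x\<bar> + \<bar>V2 x\<bar>)"
      using AE1 by eventually_elim auto
  qed simp_all
  have H: "compact_pot (\<lambda>x. (V x * norm x)\<^sup>2)"
  proof (rule compact_pot_dominated)
    \<comment> \<open>Squaring turns L^N into L^(N/2), the class covered by the form-compactness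
      lemma.\<close>
    show "compact_pot (\<lambda>x. (W1 x)\<^sup>2)"
    proof (rule compact_pot_Lp[OF assms(1)])
      have "\<bar>(W1 x)\<^sup>2\<bar> powr (real CARD('n) / 2) = \<bar>W1 x\<bar> powr real CARD('n)" for x
      proof (cases "W1 x = 0")
        case False
        then have "\<bar>(W1 x)\<^sup>2\<bar> = \<bar>W1 x\<bar> powr 2" by simp
        then show ?thesis by (simp only: powr_powr) simp
      qed (use assms(1) in simp)
      then show "integrable lebesgue (\<lambda>x. \<bar>(W1 x)\<^sup>2\<bar> powr (real CARD('n) / 2))" using W1(2) by simp
    qed simp
    show "compact_pot (\<lambda>x. (W2 x)\<^sup>2)"
    proof (rule compact_pot_Linf)
      show "AE x in lebesgue. \<bar>(W2 x)\<^sup>2\<bar> \<le> K2\<^sup>2" 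
        using K2 by eventually_elim (simp add: power2_le_iff_abs_le)
      show "((\<lambda>x. (W2 x)\<^sup>2) \<longlongrightarrow> 0) at_infinity" using tendsto_power[OF W2_lim, of 2] by simp
    qed simp
    show "AE x in lebesgue. \<bar>(V x * norm x)\<^sup>2\<bar> \<le> 2 * (\<bar>(W1 x)\<^sup>2\<bar> + \<bar>(W2 x)\<^sup>2\<bar>)"
      using AE2
    proof eventually_elim
      case (elim x)
      show ?case using norm_add_sq_le[of "W1 x" "W2 x"] unfolding elim by simp
    qed
  qed simp_all
  interpret nls V "crit_exp TYPE('n)" using assms(1) V by unfold_locales auto
  \<comment> \<open>A negative infimum is witnessed by one function; form-compactness of
    \<open>V\<close> makes both parts of its integrand integrable, so the integral splits.\<close>
  obtain \<phi> where \<phi>: "\<phi> \<in> H1" "(\<integral>x. (\<phi> x)\<^sup>2 \<partial>lebesgue) = 1" 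
    and neg: "(\<integral>x. (norm (weak_grad \<phi> x))\<^sup>2 + V x * (\<phi> x)\<^sup>2 \<partial>lebesgue) < 0"
    using assms(9) unfolding INF_less_iff by auto
  show ?thesis
  proof (rule small_mass_ground_state[OF H \<phi>(1)])
    show "nrm2 lebesgue \<phi> = 1" using \<phi>(2) by (simp add: nrm2_def)
    show "(gnrm \<phi>)\<^sup>2 + Qf \<phi> < 0"
      using neg sq_int_integrable[OF weak_grad_sq_int[OF \<phi>(1)]] compact_pot_integrable[OF V \<phi>(1)]
      by (simp add: gnrm_def nrm2_power2 Qf_def)
  qed
qed

end
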